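(* Let $n\ge2$, $1\le k\le n$, $\theta\in(0,\pi)$, $1<p<k+1$, and let $f$ be a positive smooth function on $\mathcal{C}_\theta$. Then the positive admissible solution of $$\sigma_k(\nabla^2h+h\sigma)=f\,h^{p-1}\ \text{ in }\mathcal{C}_\theta,\qquad \nabla_\mu h=\cot\theta\, h\ \text{ on }\partial\mathcal{C}_\theta$$ is unique.
   Context: Let $e=-E_{n+1}$, $E_1,\dots,E_{n+1}$ the standard basis of $\mathbb{R}^{n+1}$, $\overline{\mathbb{R}^{n+1}_+}=\{x_{n+1}\ge0\}$. $\mathcal{C}_\theta=\{\xi\in\overline{\mathbb{R}^{n+1}_+}:|\xi-\cos\theta\,e|=1\}$ with round metric $\sigma$, connection $\nabla$, unit outward conormal $\mu$ of $\partial\mathcal{C}_\theta$. $\sigma_k(W)$ is the $k$-th elementary symmetric function of the eigenvalues of $W$; $\Gamma_k=\{\lambda\in\mathbb{R}^n:\sigma_i(\lambda)>0,1\le i\le k\}$; $h\in C^2(\mathcal{C}_\theta)$ is admissible if the eigenvalues of $\nabla^2h+h\sigma$ lie in $\Gamma_k$ everywhere. *)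

theory Defs
  imports "HOL-Analysis.Analysis"
begin

fun Ck_on :: "nat \<Rightarrow> 'a::euclidean_space set \<Rightarrow> ('a \<Rightarrow> real) \<Rightarrow> bool" where
  "Ck_on 0 U f = continuous_on U f"
| "Ck_on (Suc k) U f =
     ((\<forall>x\<in>U. f differentiable (at x)) \<and>
      (\<forall>v. Ck_on k U (\<lambda>x. frechet_derivative f (at x) v)))"

definition smooth_on :: "'a::euclidean_space set \<Rightarrow> ('a \<Rightarrow> real) \<Rightarrow> bool" where
  "smooth_on U f \<longleftrightarrow> (\<forall>k. Ck_on k U f)"

definition Ck_set :: "nat \<Rightarrow> 'a::euclidean_space set \<Rightarrow> ('a \<Rightarrow> real) \<Rightarrow> bool" where
  "Ck_set k S f \<longleftrightarrow> (\<exists>U. open U \<and> S \<subseteq> U \<and> Ck_on k U f)"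

definition smooth_set :: "'a::euclidean_space set \<Rightarrow> ('a \<Rightarrow> real) \<Rightarrow> bool" where
  "smooth_set S f \<longleftrightarrow> (\<exists>U. open U \<and> S \<subseteq> U \<and> smooth_on U f)"

text \<open>The last coordinate x_{n+1} is represented by a distinguished index j;
  E_{n+1} = axis j 1 and e = - E_{n+1}.\<close>

definition e_vec :: "'m::finite \<Rightarrow> real^'m" where
  "e_vec j = - axis j 1"

definition cap_center :: "'m::finite \<Rightarrow> real \<Rightarrow> real^'m" where
  "cap_center j \<theta> = cos \<theta> *\<^sub>R e_vec j"

definition cap :: "'m::finite \<Rightarrow> real \<Rightarrow> (real^'m) set" where
  "cap j \<theta> = {\<xi>. \<xi> $ j \<ge> 0 \<and> norm (\<xi> - cap_center j \<theta>) = 1}"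

definition cap_boundary :: "'m::finite \<Rightarrow> real \<Rightarrow> (real^'m) set" where
  "cap_boundary j \<theta> = {\<xi> \<in> cap j \<theta>. \<xi> $ j = 0}"

definition sph_normal :: "'m::finite \<Rightarrow> real \<Rightarrow> real^'m \<Rightarrow> real^'m" where
  "sph_normal j \<theta> \<xi> = \<xi> - cap_center j \<theta>"

definition tangent_space :: "'m::finite \<Rightarrow> real \<Rightarrow> real^'m \<Rightarrow> (real^'m) set" where
  "tangent_space j \<theta> \<xi> = {X. X \<bullet> sph_normal j \<theta> \<xi> = 0}"

definition sph_exp :: "'m::finite \<Rightarrow> real \<Rightarrow> real^'m \<Rightarrow> real^'m \<Rightarrow> real^'m" where
  "sph_exp j \<theta> \<xi> X = cap_center j \<theta> + cos (norm X) *\<^sub>R sph_normal j \<theta> \<xi>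
       + (sin (norm X) / norm X) *\<^sub>R X"

text \<open>Unit outward conormal mu of the boundary of C_theta at xi in the boundary:
  the unit vector tangent to the sphere, orthogonal to the boundary, pointing
  towards x_{n+1} < 0.\<close>
definition conormal :: "'m::finite \<Rightarrow> real \<Rightarrow> real^'m \<Rightarrow> real^'m" where
  "conormal j \<theta> \<xi> =
     (let u = axis j 1 - (axis j 1 \<bullet> sph_normal j \<theta> \<xi>) *\<^sub>R sph_normal j \<theta> \<xi>
      in - (u /\<^sub>R norm u))"

definition sph_hess_quad :: "'m::finite \<Rightarrow> real \<Rightarrow> (real^'m \<Rightarrow> real) \<Rightarrow> real^'m \<Rightarrow> real^'m \<Rightarrow> real" where
  "sph_hess_quad j \<theta> h \<xi> X = deriv (deriv (\<lambda>t. h (sph_exp j \<theta> \<xi> (t *\<^sub>R X)))) 0"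

definition W_quad :: "'m::finite \<Rightarrow> real \<Rightarrow> (real^'m \<Rightarrow> real) \<Rightarrow> real^'m \<Rightarrow> real^'m \<Rightarrow> real" where
  "W_quad j \<theta> h \<xi> X = sph_hess_quad j \<theta> h \<xi> X + h \<xi> * (X \<bullet> X)"

definition eigenvalues_of :: "nat \<Rightarrow> (real^'m) set \<Rightarrow> (real^'m \<Rightarrow> real) \<Rightarrow> (nat \<Rightarrow> real) \<Rightarrow> bool" where
  "eigenvalues_of n T Q lam \<longleftrightarrow>
     (\<exists>v :: nat \<Rightarrow> real^'m.
        (\<forall>i<n. v i \<in> T) \<and>
        (\<forall>i<n. \<forall>i'<n. v i \<bullet> v i' = (if i = i' then 1 else 0)) \<and>
        span (v ` {..<n}) = T \<and>
        (\<forall>a :: nat \<Rightarrow> real. Q (\<Sum>i<n. a i *\<^sub>R v i) = (\<Sum>i<n. lam i * (a i)\<^sup>2)))"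

definition sigma :: "nat \<Rightarrow> nat \<Rightarrow> (nat \<Rightarrow> real) \<Rightarrow> real" where
  "sigma n k lam = (\<Sum>S\<in>{S. S \<subseteq> {..<n} \<and> card S = k}. \<Prod>i\<in>S. lam i)"

definition Gamma :: "nat \<Rightarrow> nat \<Rightarrow> (nat \<Rightarrow> real) set" where
  "Gamma n k = {lam. \<forall>i. 1 \<le> i \<and> i \<le> k \<longrightarrow> sigma n i lam > 0}"

definition admissible :: "nat \<Rightarrow> 'm::finite \<Rightarrow> real \<Rightarrow> (real^'m \<Rightarrow> real) \<Rightarrow> bool" where
  "admissible k j \<theta> h \<longleftrightarrow>
     Ck_set 2 (cap j \<theta>) h \<and>
     (\<forall>\<xi>\<in>cap j \<theta>. \<exists>lam.
        eigenvalues_of (CARD('m) - 1) (tangent_space j \<theta> \<xi>) (W_quad j \<theta> h \<xi>) lam \<and>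
        lam \<in> Gamma (CARD('m) - 1) k)"

definition solves :: "nat \<Rightarrow> real \<Rightarrow> 'm::finite \<Rightarrow> real \<Rightarrow> (real^'m \<Rightarrow> real) \<Rightarrow> (real^'m \<Rightarrow> real) \<Rightarrow> bool" where
  "solves k p j \<theta> f h \<longleftrightarrow>
     (\<forall>\<xi>\<in>cap j \<theta>. \<exists>lam.
        eigenvalues_of (CARD('m) - 1) (tangent_space j \<theta> \<xi>) (W_quad j \<theta> h \<xi>) lam \<and>
        sigma (CARD('m) - 1) k lam = f \<xi> * h \<xi> powr (p - 1)) \<and>
     (\<forall>\<xi>\<in>cap_boundary j \<theta>.
        frechet_derivative h (at \<xi>) (conormal j \<theta> \<xi>) = cot \<theta> * h \<xi>)"

end

theory Submission
 imports Defs "HOL-Combinatorics.Permutations" "HOL-Probability.Distributions"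
begin

text \<open>Let \<open>H(x) = |x| h(x/|x| + cos \<theta> e)\<close> be the one-homogeneous extension of \<open>h\<close> to the cone \<open>x\<^sub>j \<ge> cos \<theta> |x|\<close>. On the
tangent spaces of the cap, \<open>\<nabla>\<^sup>2h + h\<sigma>\<close> is the Hessian \<open>A\<close> of \<open>H\<close>, and the Robin condition becomes \<open>\<partial>\<^sub>j H = 0\<close> on the boundary of
the cone.

For \<open>k \<ge> 2\<close> test the divergence free Newton tensor of \<open>A\<^sub>2\<close> with \<open>H\<^sub>1 \<nabla>H\<^sub>2 - H\<^sub>2 \<nabla>H\<^sub>1\<close>; the boundary flux vanishes.
With Garding's inequality for \<open>tr (T\<^sub>k\<^sub>-\<^sub>1(A\<^sub>2) A\<^sub>1)\<close>, and with the roles of the solutions exchanged, the integral of a positive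
multiple of \<open>(1 - r powr (1 - \<alpha>)) (r powr (p - 1) - r powr \<alpha>)\<close> is nonnegative, where \<open>r = h\<^sub>1/h\<^sub>2\<close> and
\<open>\<alpha> = (p - 1)/k < min 1 (p - 1)\<close>. The integrand is nonpositive, so \<open>r = 1\<close>.

For \<open>k = 1\<close> this degenerates, and one needs that the quadratic form \<open>B(H, H) = \<integral> H \<Delta>H\<close> is Lorentzian. On a slice
\<open>x\<^sub>j = c |x'|\<close> the Poincare inequality for the Gaussian measure in the horizontal variables \<open>x'\<close> reduces this to the
horizontal means of \<open>H\<close>, that is, to a one-dimensional inequality in \<open>c \<ge> cot \<theta>\<close>. Then \<open>B(H\<^sub>1, H\<^sub>2)\<^sup>2 \<ge> B(H\<^sub>1, H\<^sub>1) B(H\<^sub>2, H\<^sub>2)\<close>,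
and for \<open>\<rho>\<^sup>2 = B(H\<^sub>1, H\<^sub>1)/B(H\<^sub>2, H\<^sub>2)\<close> and \<open>q = p - 1\<close> the integral of a positive multiple of
\<open>(h\<^sub>1 - \<rho> h\<^sub>2) (h\<^sub>1 powr q - (\<rho> h\<^sub>2) powr q)\<close> is nonpositive. Hence \<open>h\<^sub>1 = \<rho> h\<^sub>2\<close>, and the symmetry of \<open>B\<close> gives \<open>\<rho> = 1\<close>.\<close>

section \<open>Garding's inequality for elementary symmetric functions\<close>

text \<open>For k = 1 the exponent \<alpha> equals p - 1, so the second factor of the integrand
  vanishes identically, and Garding's inequality is an equality for the linear function tr A; the
  comparison then only restates the symmetry of B. Hence the separate argument. The cone replaces
  calculus on a manifold with boundary by Lebesgue integration on open sets: a radial cutoff selects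
  a shell, and an angular cutoff, whose slope concentrates at the boundary, turns the boundary flux
  into a volume integral. A solution is only twice continuously differentiable up to the boundary,
  so the Newton tensor is merely continuous and the flux vanishes at the boundary without a rate.
  For k = 1 the products H tr A are homogeneous of degree zero, so averages over the horizontal
  sphere are Gaussian integrals and no surface measure is needed. As \<theta> may be obtuse, the
  slopes c may start at a negative value, and the one-dimensional comparison has to pass c =
  0.\<close>

definition esym :: "'i set \<Rightarrow> nat \<Rightarrow> ('i \<Rightarrow> real) \<Rightarrow> real" where
 "esym I k x = (\<Sum>S | S \<subseteq> I \<and> card S = k. \<Prod>i\<in>S. x i)"

lemma esym_0 [simp]: "finite I \<Longrightarrow> esym I 0 x = 1"
proof -
 assume "finite I"
 then have "{S. S \<subseteq> I \<and> card S = 0} = {{}}" using finite_subset by fastforce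
 then show ?thesis by (simp add: esym_def)
qed

lemma esym_insert:
 assumes "finite I" "a \<notin> I"
 shows "esym (insert a I) (Suc k) x = esym I (Suc k) x + x a * esym I k x"
proof -
 let ?A = "{S. S \<subseteq> I \<and> card S = Suc k}" and ?B = "{S. S \<subseteq> I \<and> card S = k}"
 have fin: "finite ?A" "finite ?B" using assms by (auto intro: finite_subset[of _ "Pow I"])
 have eq: "{S. S \<subseteq> insert a I \<and> card S = Suc k} = ?A \<union> insert a ` ?B" (is "?L = ?R")
 proof
  show "?L \<subseteq> ?R"
  proof
   fix S assume S: "S \<in> ?L"
   then have fS: "finite S" using assms(1) by (auto intro: finite_subset)
   show "S \<in> ?R"
   proof (cases "a \<in> S")
    case True
    then have "S = insert a (S - {a})" "S - {a} \<subseteq> I" "card (S - {a}) = k" using S fS by auto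
    then show ?thesis by blast
   next
    case False then show ?thesis using S by auto
   qed
  qed
  show "?R \<subseteq> ?L"
  proof
   fix S assume "S \<in> ?R"
   then consider "S \<in> ?A" | T where "T \<in> ?B" "S = insert a T" by blast
   then show "S \<in> ?L"
   proof cases
    case 2
    then have "finite T" "a \<notin> T" using assms by (auto intro: finite_subset)
    then show ?thesis using 2 by auto
   qed auto
  qed
 qed
 have disj: "?A \<inter> insert a ` ?B = {}" using assms(2) by auto
 have inj: "inj_on (insert a) ?B" using assms(2) by (auto intro!: inj_onI)
 have "esym (insert a I) (Suc k) x = esym I (Suc k) x + (\<Sum>S\<in>insert a ` ?B. \<Prod>i\<in>S. x i)"
  unfolding esym_def eq using fin disj by (simp add: sum.union_disjoint)
 also have "(\<Sum>S\<in>insert a ` ?B. \<Prod>i\<in>S. x i) = (\<Sum>S\<in>?B. x a * (\<Prod>i\<in>S. x i))" unfolding sum.reindex[OF inj]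
 proof (rule sum.cong, simp, simp)
  fix S assume "S \<subseteq> I \<and> card S = k"
  then have "finite S" "a \<notin> S" using assms by (auto intro: finite_subset)
  then show "prod x (insert a S) = x a * prod x S" by simp
 qed
 finally show ?thesis by (simp add: esym_def sum_distrib_left)
qed

lemma esym_remove:
 assumes "finite I" "a \<in> I"
 shows "esym I (Suc k) x = esym (I - {a}) (Suc k) x + x a * esym (I - {a}) k x"
 using esym_insert[of "I - {a}" a k x] assms by (simp add: insert_absorb)

lemma esym_eq_0: "finite I \<Longrightarrow> card I < k \<Longrightarrow> esym I k x = 0"
proof -
 assume "finite I" "card I < k"
 then have "card S \<noteq> k" if "S \<subseteq> I" for S using card_mono[OF _ that] by auto
 then have "{S. S \<subseteq> I \<and> card S = k} = {}" by blast
 then show ?thesis unfolding esym_def by (simp only: sum.empty)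
qed

lemma esym_pos_card: "finite I \<Longrightarrow> 0 < esym I k x \<Longrightarrow> k \<le> card I" using esym_eq_0[of I k x] by (cases "card I < k") auto

lemma esym_scale: "esym I k (\<lambda>i. c * x i) = c ^ k * esym I k x"
 unfolding esym_def sum_distrib_left by (intro sum.cong) (auto simp: prod.distrib)

lemma esym_permutes:
 assumes "\<pi> permutes I"
 shows "esym I k (\<lambda>i. x (\<pi> i)) = esym I k x" unfolding esym_def
proof (rule sum.reindex_bij_witness[of _ "\<lambda>S. inv \<pi> ` S" "\<lambda>S. \<pi> ` S"], goal_cases)
 case (1 S) then show ?case using assms by (simp add: image_comp permutes_inv_o)
next
 case (2 S) then show ?case using permutes_image[OF assms] card_image[OF inj_on_subset[OF permutes_inj[OF assms] subset_UNIV]] by auto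
next
 case (3 S) then show ?case using assms by (simp add: image_comp permutes_inv_o)
next
 case (4 S) then show ?case using permutes_image[OF permutes_inv[OF assms]] card_image[OF inj_on_subset[OF permutes_inj[OF permutes_inv[OF assms]] subset_UNIV]] by auto
next
 case (5 S) then show ?case by (subst prod.reindex) (auto intro: inj_on_subset[OF permutes_inj[OF assms]])
qed

lemma esym_1: "finite I \<Longrightarrow> esym I (Suc 0) x = (\<Sum>i\<in>I. x i)"
proof (induction I rule: finite_induct)
 case empty then show ?case by (simp add: esym_eq_0)
next
 case (insert a I) then show ?case by (simp add: esym_insert)
qed

text \<open>\<open>esym (I - {i}) k x\<close> is the partial derivative of
  \<open>esym I (Suc k)\<close> in \<open>x i\<close>, so this is Euler's relation for a polynomial
  homogeneous of degree \<open>Suc k\<close>.\<close>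

lemma esym_euler:
 assumes "finite I"
 shows "(\<Sum>i\<in>I. x i * esym (I - {i}) k x) = real (Suc k) * esym I (Suc k) x" using assms
proof (induction I arbitrary: k rule: finite_induct)
 case empty then show ?case by (simp add: esym_eq_0)
next
 case (insert a I)
 have R: "insert a I - {i} = insert a (I - {i})" if "i \<in> I" for i using that insert by auto
 have *: "(\<Sum>i\<in>I. x i * esym (insert a I - {i}) k x) = real (Suc k) * esym I (Suc k) x + x a * (real k * esym I k x)"
 proof (cases k)
  case 0
  then show ?thesis using insert.hyps by (simp add: esym_1)
 next
  case (Suc l)
  have "(\<Sum>i\<in>I. x i * esym (insert a I - {i}) k x) = (\<Sum>i\<in>I. x i * esym (I - {i}) k x + x a * (x i * esym (I - {i}) l x))"
   by (rule sum.cong) (use insert.hyps in \<open>auto simp: R Suc esym_insert algebra_simps\<close>)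
  also have "\<dots> = real (Suc k) * esym I (Suc k) x + x a * (real (Suc l) * esym I (Suc l) x)"
   by (simp add: sum.distrib insert.IH flip: sum_distrib_left)
  finally show ?thesis by (simp add: Suc)
 qed
 have "insert a I - {a} = I" using insert by auto
 then show ?case using insert * by (simp add: esym_insert algebra_simps)
qed

text \<open>Each subset of size \<open>k\<close> is counted once for every index outside it. The sum
  is the derivative of \<open>esym I (Suc k)\<close> along the vector of ones, which drives the
  shift argument below.\<close>

lemma esym_sum_remove:
 assumes "finite I"
 shows "(\<Sum>i\<in>I. esym (I - {i}) k x) = (real (card I) - real k) * esym I k x"
proof (cases k)
 case 0 with assms show ?thesis by simp
next
 case (Suc l)
 have "(\<Sum>i\<in>I. esym I (Suc l) x) = (\<Sum>i\<in>I. esym (I - {i}) (Suc l) x + x i * esym (I - {i}) l x)"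
  by (rule sum.cong) (auto simp: assms intro: esym_remove)
 then show ?thesis using esym_euler[OF assms, of x l] by (simp add: Suc sum.distrib algebra_simps)
qed

lemma DERIV_esym:
 assumes "finite I"
 shows "DERIV (\<lambda>t. esym I (Suc k) (\<lambda>i. x i + t * y i)) t :> (\<Sum>i\<in>I. y i * esym (I - {i}) k (\<lambda>i. x i + t * y i))" using assms
proof (induction I arbitrary: k rule: finite_induct)
 case empty then show ?case by (simp add: esym_eq_0)
next
 case (insert a I)
 have R: "insert a I - {i} = insert a (I - {i})" if "i \<in> I" for i using that insert by auto
 have R2: "insert a I - {a} = I" using insert by auto
 show ?case
 proof (cases k)
  case 0
  then show ?thesis using insert.hyps by (auto simp: esym_1 intro!: derivative_eq_intros)
 next
  case (Suc l)
  have *: "(\<Sum>i\<in>I. y i * esym (insert a I - {i}) k z) = (\<Sum>i\<in>I. y i * esym (I - {i}) k z) + z a * (\<Sum>i\<in>I. y i * esym (I - {i}) l z)" for z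
   unfolding sum_distrib_left sum.distrib[symmetric]
   by (rule sum.cong) (use insert.hyps in \<open>auto simp: R Suc esym_insert algebra_simps\<close>)
  show ?thesis unfolding esym_insert[OF insert.hyps]
   by (rule derivative_eq_intros insert.IH[of k] insert.IH[of l, folded Suc] refl)+
     (use insert.hyps in \<open>simp add: R2 *\<close>)
 qed
qed

lemma continuous_esym: "continuous_on UNIV (\<lambda>t. esym I k (\<lambda>i. x i + t * y i))" unfolding esym_def by (intro continuous_intros)

text \<open>The Garding cone over an arbitrary index set: the inductions delete indices, so
  \<open>I - {i}\<close> must be treated on the same footing as \<open>I\<close>.\<close>

definition gam :: "'i set \<Rightarrow> nat \<Rightarrow> ('i \<Rightarrow> real) \<Rightarrow> bool" where
 "gam I k x \<longleftrightarrow> (\<forall>i\<le>k. 0 < esym I i x)"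

text \<open>By \<open>esym_sum_remove\<close>, the derivative of \<open>esym I (Suc k)\<close> in
  the shift is a positive multiple of \<open>esym I k\<close>, positive by induction. At the top
  index only nonnegativity is assumed, so that a point on the boundary of the cone is moved
  inside.\<close>

lemma esym_shift_pos:
 assumes "finite I" "\<And>i. i < k \<Longrightarrow> 0 < esym I i x" "0 \<le> esym I k x" "k \<le> card I" "0 < s"
 shows "0 < esym I k (\<lambda>i. x i + s)" using assms(2-)
proof (induction k arbitrary: s)
 case 0 then show ?case using assms(1) by simp
next
 case (Suc k)
 have pos: "0 < esym I k (\<lambda>i. x i + t)" if "0 \<le> t" for t
 proof (cases "t = 0")
  case True then show ?thesis using Suc.prems(1)[of k] by simp
 next
  case False then show ?thesis using Suc.IH[of t] Suc.prems that by (force intro: less_imp_le)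
 qed
 have "esym I (Suc k) (\<lambda>i. x i + 0 * 1) < esym I (Suc k) (\<lambda>i. x i + s * 1)"
 proof (rule DERIV_pos_imp_increasing[of 0 s])
  show "\<exists>y. DERIV (\<lambda>t. esym I (Suc k) (\<lambda>i. x i + t * 1)) t :> y \<and> 0 < y" if "0 \<le> t" "t \<le> s" for t
  proof (intro exI conjI)
   show "DERIV (\<lambda>t. esym I (Suc k) (\<lambda>i. x i + t * 1)) t :> (\<Sum>i\<in>I. 1 * esym (I - {i}) k (\<lambda>i. x i + t * 1))"
    by (rule DERIV_esym[OF assms(1)])
   show "0 < (\<Sum>i\<in>I. 1 * esym (I - {i}) k (\<lambda>i. x i + t * 1))"
    using pos[OF that(1)] Suc.prems(3) by (simp add: esym_sum_remove[OF assms(1)])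
  qed
 qed (use Suc.prems in auto)
 then show ?case using Suc.prems by simp
qed

lemma gam_shift:
 assumes "finite I" "gam I k x" "0 \<le> s"
 shows "gam I k (\<lambda>i. x i + s)"
proof (cases "s = 0")
 case False
 show ?thesis unfolding gam_def
 proof (intro allI impI)
  fix i assume "i \<le> k"
  show "0 < esym I i (\<lambda>i. x i + s)"
   by (rule esym_shift_pos) (use assms \<open>i \<le> k\<close> False esym_pos_card[OF assms(1)] in \<open>auto simp: gam_def intro: less_imp_le\<close>)
 qed
qed (use assms in simp)

lemma esym_pos: "finite I \<Longrightarrow> k \<le> card I \<Longrightarrow> (\<And>i. i \<in> I \<Longrightarrow> 0 < x i) \<Longrightarrow> 0 < esym I k x" unfolding esym_def
proof (rule sum_pos)
 assume "finite I" "k \<le> card I"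
 then show "{S. S \<subseteq> I \<and> card S = k} \<noteq> {}" using obtain_subset_with_card_n by (metis (mono_tags, lifting) empty_iff mem_Collect_eq)
qed (auto intro: prod_pos finite_subset[of _ "Pow I"])

text \<open>If some \<open>esym (I - {a}) (Suc j)\<close> were nonpositive, shifting \<open>x\<close> by a constant would make it vanish; at that
 point Euler's identity forces \<open>esym (I - {a}) (j + 2) \<le> 0\<close>, hence \<open>esym I (j + 2) \<le> 0\<close>.\<close>
lemma gam_remove:
 assumes "finite I" "gam I (Suc k) x" "a \<in> I"
 shows "gam (I - {a}) k x" using assms
proof (induction "card I" arbitrary: I k x a rule: less_induct)
 case less
 note fin = less.prems(1) and aI = less.prems(3)
 define J where "J = I - {a}"
 have finJ: "finite J" using fin by (simp add: J_def)
 have cardJ: "card J < card I" using fin aI unfolding J_def by (rule card_Diff1_less)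
 have "gam J k x" using less.prems(2)
 proof (induction k arbitrary: x)
  case 0 then show ?case using finJ by (simp add: gam_def)
 next
  case (Suc j)
  have gj: "gam I (Suc j) y" if "gam I (Suc (Suc j)) y" for y using that by (auto simp: gam_def)
  have cJ: "Suc j \<le> card J"
   using Suc.prems esym_pos_card[OF fin, of "Suc (Suc j)" x] card_Diff_singleton[OF aI] by (auto simp: gam_def J_def)
  have "0 < esym J (Suc j) x"
  proof (rule ccontr)
   assume neg: "\<not> ?thesis"
   let ?g = "\<lambda>s. esym J (Suc j) (\<lambda>i. x i + s * 1)"
   \<comment> \<open>All \<open>x i + M\<close> are positive, so \<open>?g\<close> is nonnegative at
     \<open>M\<close> and has a zero in \<open>{0..M}\<close>.\<close>
   define M where "M = (\<Sum>i\<in>J. \<bar>x i\<bar>) + 1"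
   have "0 < x i + M" if "i \<in> J" for i
   proof -
    have "\<bar>x i\<bar> \<le> (\<Sum>i\<in>J. \<bar>x i\<bar>)" using that finJ by (intro member_le_sum) auto
    then show ?thesis by (simp add: M_def)
   qed
   then have "0 \<le> ?g M" using esym_pos[OF finJ cJ] by (simp add: less_imp_le)
   moreover have "?g 0 \<le> 0" using neg by simp
   moreover have "0 \<le> M" by (simp add: M_def sum_nonneg)
   moreover have "continuous_on {0..M} ?g" by (rule continuous_on_subset[OF continuous_esym subset_UNIV])
   ultimately obtain s where s: "0 \<le> s" "?g s = 0" using IVT'[of ?g 0 0 M] by auto
   define m where "m = (\<lambda>i. x i + s)"
   have m0: "esym J (Suc j) m = 0" using s by (simp add: m_def)
   have gm: "gam I (Suc (Suc j)) m" unfolding m_def by (rule gam_shift[OF fin Suc.prems s(1)])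
   then have gJm: "gam J j m" using Suc.IH gj by blast
   have "0 < esym I (Suc (Suc j)) m" using gm by (simp add: gam_def)
   then have pos: "0 < esym J (Suc (Suc j)) m" using esym_remove[OF fin aI, of "Suc j" m] m0 by (simp add: J_def)
   \<comment> \<open>At \<open>m\<close> the function \<open>esym J (Suc j)\<close> is zero, so
     \<open>m\<close> lies only in the closure of the cone of order \<open>Suc j\<close> on
     \<open>J\<close>. After a further shift by \<open>t > 0\<close> the outer induction on the
     smaller set \<open>J\<close> applies; then \<open>t\<close> tends to 0.\<close>
   have nn: "0 \<le> esym (J - {i}) j m" if i: "i \<in> J" for i
   proof -
    have p: "0 < esym (J - {i}) j (\<lambda>i. m i + t * 1)" if t: "0 < t" for t
    proof -
     have "gam J (Suc j) (\<lambda>i. m i + t)" unfolding gam_def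
     proof (intro allI impI)
      fix l assume "l \<le> Suc j"
      then show "0 < esym J l (\<lambda>i. m i + t)"
       by (intro esym_shift_pos) (use finJ gJm m0 cJ t in \<open>auto simp: gam_def le_Suc_eq intro: less_imp_le\<close>)
     qed
     then have "gam (J - {i}) j (\<lambda>i. m i + t)" using less.hyps[OF cardJ finJ _ i] by blast
     then show ?thesis by (simp add: gam_def)
    qed
    have "((\<lambda>t. esym (J - {i}) j (\<lambda>i. m i + t * 1)) \<longlongrightarrow> esym (J - {i}) j (\<lambda>i. m i + 0 * 1)) (at_right 0)"
     using continuous_esym[of "J - {i}" j m "\<lambda>_. 1"] continuous_on_eq_continuous_within
     by (metis UNIV_I continuous_within filterlim_at_split isCont_def open_UNIV continuous_on_eq_continuous_at)
    then have "0 \<le> esym (J - {i}) j (\<lambda>i. m i + 0 * 1)"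
     by (rule tendsto_lowerbound) (auto simp: eventually_at_right_field intro!: exI[of _ 1] less_imp_le p[simplified])
    then show ?thesis by simp
   qed
   have "real (Suc (Suc j)) * esym J (Suc (Suc j)) m = (\<Sum>i\<in>J. m i * esym (J - {i}) (Suc j) m)"
    by (rule esym_euler[OF finJ, symmetric])
   also have "\<dots> = (\<Sum>i\<in>J. - ((m i)\<^sup>2 * esym (J - {i}) j m))"
   proof (rule sum.cong[OF refl])
    fix i assume "i \<in> J"
    then have "esym (J - {i}) (Suc j) m = - (m i * esym (J - {i}) j m)" using esym_remove[OF finJ, of i j m] m0 by simp
    then show "m i * esym (J - {i}) (Suc j) m = - ((m i)\<^sup>2 * esym (J - {i}) j m)" by (simp add: power2_eq_square)
   qed
   also have "\<dots> \<le> 0" by (rule sum_nonpos) (simp add: nn)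
   finally show False using pos by (simp add: mult_le_0_iff)
  qed
  then show ?case using Suc.IH[OF gj[OF Suc.prems]] by (auto simp: gam_def le_Suc_eq)
 qed
 then show ?case by (simp add: J_def)
qed

text \<open>Homogeneous of degree one, so superadditivity is the same as concavity, and a product of
  consecutive quotients telescopes to \<open>esym\<close>. Garding's inequality is derived from
  these quotients rather than from a root of \<open>esym\<close>.\<close>

definition qsym :: "'i set \<Rightarrow> nat \<Rightarrow> ('i \<Rightarrow> real) \<Rightarrow> real" where
 "qsym I k x = esym I (Suc k) x / esym I k x"

text \<open>The function a^2 / c is convex and homogeneous of degree one, hence subadditive, and it
  decreases in c; subadditivity itself is (a d - b c)^2 \<ge> 0.\<close>

lemma square_div_subadd:
 fixes a b c d e :: real
 assumes "0 < c" "0 < d" "c + d \<le> e"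
 shows "(a + b)\<^sup>2 / e \<le> a\<^sup>2 / c + b\<^sup>2 / d"
proof -
 have "(a + b)\<^sup>2 / e \<le> (a + b)\<^sup>2 / (c + d)" using assms by (intro divide_left_mono) auto
 also have "\<dots> \<le> a\<^sup>2 / c + b\<^sup>2 / d"
 proof -
  have "0 \<le> (a * d - b * c)\<^sup>2" by simp
  then have "(a + b)\<^sup>2 * (c * d) \<le> (a\<^sup>2 * d + b\<^sup>2 * c) * (c + d)" by (simp add: power2_eq_square algebra_simps)
  then show ?thesis using assms by (simp add: field_simps power2_eq_square)
 qed
 finally show ?thesis .
qed

text \<open>The argument of Marcus and Lopes.\<close>
lemma qsym_superadd:
 assumes "finite I" "gam I k x" "gam I k y"
 shows "gam I k (\<lambda>i. x i + y i) \<and> qsym I k x + qsym I k y \<le> qsym I k (\<lambda>i. x i + y i)" using assms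
proof (induction k arbitrary: I)
 case 0
 then show ?case by (simp add: gam_def qsym_def esym_1 sum.distrib)
next
 case (Suc k)
 let ?z = "\<lambda>i. x i + y i"
 have "gam I k x" "gam I k y" using Suc.prems by (auto simp: gam_def)
 note IH1 = Suc.IH[OF Suc.prems(1) this]
 have "0 < qsym I k x" "0 < qsym I k y" using Suc.prems by (auto simp: gam_def qsym_def)
 then have "0 < qsym I k ?z" using IH1 by linarith
 moreover have "0 < esym I k ?z" using IH1 by (auto simp: gam_def)
 ultimately have "0 < esym I (Suc k) ?z" by (simp add: qsym_def zero_less_divide_iff)
 then have gz: "gam I (Suc k) ?z" using IH1 by (auto simp: gam_def le_Suc_eq)
 define D where "D w i = w i + qsym (I - {i}) k w" for w i
 have posr: "0 < esym (I - {i}) k w" if "gam I (Suc k) w" "i \<in> I" for w i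
  using gam_remove[OF Suc.prems(1) that] by (simp add: gam_def)
 have Deq: "D w i = esym I (Suc k) w / esym (I - {i}) k w" if "gam I (Suc k) w" "i \<in> I" for w i
  using posr[OF that] esym_remove[OF Suc.prems(1) that(2), of k w] by (simp add: D_def qsym_def field_simps)
 have Dpos: "0 < D w i" if "gam I (Suc k) w" "i \<in> I" for w i using Deq[OF that] posr[OF that] that(1) by (simp add: gam_def)
 \<comment> \<open>Euler's identity together with \<open>esym_remove\<close> makes the quotient a
   linear function minus a sum of squares over \<open>D\<close>. By induction \<open>D\<close> is
   superadditive, and then \<open>square_div_subadd\<close> makes the subtracted sum
   subadditive.\<close>
 have form: "real (Suc (Suc k)) * qsym I (Suc k) w = (\<Sum>i\<in>I. w i) - (\<Sum>i\<in>I. (w i)\<^sup>2 / D w i)" if g: "gam I (Suc k) w" for w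
 proof -
  have e: "0 < esym I (Suc k) w" using g by (simp add: gam_def)
  have "real (Suc (Suc k)) * esym I (Suc (Suc k)) w = (\<Sum>i\<in>I. w i * esym (I - {i}) (Suc k) w)"
   by (rule esym_euler[OF Suc.prems(1), symmetric])
  also have "\<dots> = (\<Sum>i\<in>I. esym I (Suc k) w * (w i - (w i)\<^sup>2 / D w i))"
  proof (rule sum.cong[OF refl])
   fix i assume i: "i \<in> I"
   have "(w i)\<^sup>2 / D w i * esym I (Suc k) w = (w i)\<^sup>2 * esym (I - {i}) k w" using Deq[OF g i] posr[OF g i] e by simp
   then show "w i * esym (I - {i}) (Suc k) w = esym I (Suc k) w * (w i - (w i)\<^sup>2 / D w i)"
    using esym_remove[OF Suc.prems(1) i, of k w] by (simp add: algebra_simps power2_eq_square)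
  qed
  also have "\<dots> = esym I (Suc k) w * ((\<Sum>i\<in>I. w i) - (\<Sum>i\<in>I. (w i)\<^sup>2 / D w i))" by (simp add: sum_subtractf flip: sum_distrib_left)
  finally show ?thesis using e by (simp add: qsym_def field_simps)
 qed
 have "(\<Sum>i\<in>I. (?z i)\<^sup>2 / D ?z i) \<le> (\<Sum>i\<in>I. (x i)\<^sup>2 / D x i + (y i)\<^sup>2 / D y i)"
 proof (rule sum_mono, rule square_div_subadd)
  fix i assume i: "i \<in> I"
  show "0 < D x i" "0 < D y i" using Dpos i Suc.prems by auto
  show "D x i + D y i \<le> D ?z i" using Suc.IH[of "I - {i}"] gam_remove[OF Suc.prems(1) _ i] Suc.prems by (auto simp: D_def)
 qed
 then have "real (Suc (Suc k)) * (qsym I (Suc k) x + qsym I (Suc k) y) \<le> real (Suc (Suc k)) * qsym I (Suc k) ?z"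
  unfolding distrib_left form[OF gz] form[OF Suc.prems(2)] form[OF Suc.prems(3)] by (simp add: sum.distrib)
 then show ?case using gz by simp
qed

lemma esym_prod_qsym:
 assumes "finite I" "gam I k x" "l \<le> k"
 shows "esym I l x = (\<Prod>j<l. qsym I j x)" using assms(3)
proof (induction l)
 case 0 then show ?case using assms by simp
next
 case (Suc l)
 then have "esym I l x \<noteq> 0" using assms(2) unfolding gam_def by (metis Suc_leD less_irrefl)
 then have "esym I (Suc l) x = esym I l x * qsym I l x" by (simp add: qsym_def)
 then show ?case using Suc by simp
qed

section \<open>Garding's inequality for vectors and for doubly stochastic couplings\<close>

lemma one_add_sum_le_prod:
 fixes a :: "'i \<Rightarrow> real"
 assumes "finite I" "\<And>i. i \<in> I \<Longrightarrow> 0 \<le> a i"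
 shows "1 + (\<Sum>i\<in>I. a i) \<le> (\<Prod>i\<in>I. 1 + a i)" using assms
proof (induction I rule: finite_induct)
 case (insert i I)
 have "0 \<le> a i * (\<Sum>i\<in>I. a i)" using insert by (auto intro!: mult_nonneg_nonneg sum_nonneg)
 then have "1 + (\<Sum>i\<in>insert i I. a i) \<le> (1 + a i) * (1 + (\<Sum>i\<in>I. a i))" using insert by (simp add: algebra_simps)
 also have "\<dots> \<le> (1 + a i) * (\<Prod>i\<in>I. 1 + a i)" using insert by (intro mult_left_mono) auto
 finally show ?case using insert by simp
qed simp

text \<open>Apply ln t \<le> t - 1 to \<open>a i / y\<close>, with \<open>y\<close> the geometric
  mean: the logarithms cancel in the sum.\<close>

lemma arith_geo_mean_card:
 fixes a :: "'i \<Rightarrow> real"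
 assumes "finite I" "I \<noteq> {}" "\<And>i. i \<in> I \<Longrightarrow> 0 < a i"
 shows "real (card I) * (\<Prod>i\<in>I. a i) powr (1 / real (card I)) \<le> (\<Sum>i\<in>I. a i)"
proof -
 define y where "y = (\<Prod>i\<in>I. a i) powr (1 / real (card I))"
 have P: "0 < (\<Prod>i\<in>I. a i)" using assms by (auto intro: prod_pos)
 then have y: "0 < y" by (simp add: y_def)
 have c: "0 < card I" using assms by (simp add: card_gt_0_iff)
 have "ln y = (\<Sum>i\<in>I. ln (a i)) / real (card I)"
  unfolding y_def using P assms(3) by (simp add: ln_powr ln_prod[OF assms(1)] less_imp_neq[symmetric])
 then have "0 = (\<Sum>i\<in>I. ln (a i) - ln y)" using c by (simp add: sum_subtractf)
 also have "\<dots> \<le> (\<Sum>i\<in>I. a i / y - 1)"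
 proof (rule sum_mono)
  fix i assume "i \<in> I"
  then show "ln (a i) - ln y \<le> a i / y - 1" using assms(3)[of i] y ln_le_minus_one[of "a i / y"] by (simp add: ln_div)
 qed
 finally have "real (card I) \<le> (\<Sum>i\<in>I. a i) / y" by (simp add: sum_subtractf sum_divide_distrib)
 then show ?thesis using y by (simp add: y_def[symmetric] field_simps)
qed

lemma gam_scale: "0 < t \<Longrightarrow> gam I k x \<Longrightarrow> gam I k (\<lambda>i. t * x i)" by (simp add: gam_def esym_scale)

text \<open>The right side is the derivative at t = 0 of \<open>esym I k\<close> at x + t y.
  Superadditivity of the quotients bounds this function below by
  \<open>esym I k x * (1 + t * A)\<close>, with \<open>A\<close> the sum of the ratios of quotients;
  the arithmetic-geometric mean inequality bounds \<open>A\<close> below by a root of a product that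
  telescopes.\<close>

lemma garding_vector:
 assumes "finite I" "gam I k x" "gam I k y" "1 \<le> k"
 shows "real k * esym I k x * (esym I k y / esym I k x) powr (1 / real k) \<le> (\<Sum>i\<in>I. y i * esym (I - {i}) (k - 1) x)"
proof -
 have pos: "0 < esym I j x" "0 < esym I j y" if "j \<le> k" for j using assms that by (auto simp: gam_def)
 have qpos: "0 < qsym I j x" "0 < qsym I j y" if "j < k" for j using pos[of j] pos[of "Suc j"] that by (auto simp: qsym_def)
 have gl: "gam I j w" if "gam I k w" "j \<le> k" for j w using that by (auto simp: gam_def)
 define A where "A = (\<Sum>j<k. qsym I j y / qsym I j x)"
 let ?f = "\<lambda>t. esym I k (\<lambda>i. x i + t * y i)"
 have lower: "esym I k x * (1 + t * A) \<le> ?f t" if t: "0 < t" for t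
 proof -
  have gty: "gam I k (\<lambda>i. t * y i)" using assms t by (simp add: gam_scale)
  have qty: "qsym I j (\<lambda>i. t * y i) = t * qsym I j y" for j using t by (simp add: qsym_def esym_scale)
  have "gam I k (\<lambda>i. x i + t * y i)" using qsym_superadd[OF assms(1,2) gty] by simp
  then have "?f t = (\<Prod>j<k. qsym I j (\<lambda>i. x i + t * y i))" using esym_prod_qsym[OF assms(1)] by blast
  also have "\<dots> \<ge> (\<Prod>j<k. qsym I j x * (1 + t * (qsym I j y / qsym I j x)))"
  proof (rule prod_mono, rule conjI)
   fix j assume "j \<in> {..<k}"
   then have j: "j < k" by simp
   show "0 \<le> qsym I j x * (1 + t * (qsym I j y / qsym I j x))" using qpos[OF j] t by (simp add: less_imp_le)
   show "qsym I j x * (1 + t * (qsym I j y / qsym I j x)) \<le> qsym I j (\<lambda>i. x i + t * y i)"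
    using qsym_superadd[OF assms(1) gl[OF assms(2)] gl[OF gty], of j] j qpos(1)[OF j] by (simp add: qty algebra_simps)
  qed
  also have "(\<Prod>j<k. qsym I j x * (1 + t * (qsym I j y / qsym I j x))) = esym I k x * (\<Prod>j<k. 1 + t * (qsym I j y / qsym I j x))"
   using esym_prod_qsym[OF assms(1,2), of k] by (simp add: prod.distrib)
  also have "\<dots> \<ge> esym I k x * (1 + t * A)"
   using one_add_sum_le_prod[of "{..<k}" "\<lambda>j. t * (qsym I j y / qsym I j x)"] qpos t pos(1)[of k]
   by (intro mult_left_mono) (auto simp: A_def sum_distrib_left less_imp_le)
  finally show ?thesis by simp
 qed
 obtain l where l: "k = Suc l" using assms(4) by (cases k) auto
 define D where "D = (\<Sum>i\<in>I. y i * esym (I - {i}) l x)"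
 have der: "DERIV ?f 0 :> D" using DERIV_esym[OF assms(1), of l x y 0] by (simp add: D_def l)
 have "((\<lambda>t. (?f t - ?f 0) / (t - 0)) \<longlongrightarrow> D) (at_right 0)"
  using der by (simp add: DERIV_def has_field_derivative_iff filterlim_at_split)
 then have "esym I k x * A \<le> D"
 proof (rule tendsto_lowerbound)
  show "\<forall>\<^sub>F t in at_right 0. esym I k x * A \<le> (?f t - ?f 0) / (t - 0)"
   using lower by (auto simp: eventually_at_right_field field_simps intro!: exI[of _ 1])
 qed simp
 moreover have "real k * (\<Prod>j<k. qsym I j y / qsym I j x) powr (1 / real k) \<le> A"
  using arith_geo_mean_card[of "{..<k}" "\<lambda>j. qsym I j y / qsym I j x"] qpos assms(4) by (auto simp: A_def lessThan_empty_iff)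
 moreover have "(\<Prod>j<k. qsym I j y / qsym I j x) = esym I k y / esym I k x"
  using esym_prod_qsym[OF assms(1,2), of k] esym_prod_qsym[OF assms(1,3), of k] by (simp add: prod_dividef)
 ultimately have "real k * (esym I k y / esym I k x) powr (1 / real k) \<le> A" "esym I k x * A \<le> D" by simp_all
 then have "esym I k x * (real k * (esym I k y / esym I k x) powr (1 / real k)) \<le> D"
  using mult_left_mono[of "real k * (esym I k y / esym I k x) powr (1 / real k)" A "esym I k x"] pos(1)[of k] by linarith
 then show ?thesis by (simp add: D_def l mult_ac)
qed

text \<open>When \<open>a\<close> and \<open>m\<close> are oppositely ordered, the identity
  minimises the sum of \<open>a i * m (\<pi> i)\<close> over permutations; \<open>u\<close> is the
  dual potential that certifies this. Elements are added in increasing order of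
  \<open>a i - m i\<close>, so the new element has the largest \<open>a\<close> and the smallest
  \<open>m\<close>.\<close>

lemma opposite_potential:
 fixes a m :: "'i \<Rightarrow> real"
 assumes "finite I" "\<And>i j. i \<in> I \<Longrightarrow> j \<in> I \<Longrightarrow> (a i - a j) * (m i - m j) \<le> 0"
 shows "\<exists>u :: 'i \<Rightarrow> real. \<forall>i\<in>I. \<forall>j\<in>I. u i - u j \<le> (a i - a j) * m j" using assms
proof (induction I rule: finite_ranking_induct[where f = "\<lambda>i. a i - m i"])
 case empty then show ?case by simp
next
 case (insert x S)
 then obtain u where u: "\<And>i j. i \<in> S \<Longrightarrow> j \<in> S \<Longrightarrow> u i - u j \<le> (a i - a j) * m j" by blast
 show ?case
 proof (cases "S = {} \<or> x \<in> S")
  case True then show ?thesis using u by (auto simp: insert_absorb)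
 next
  case False
  have ax: "a j \<le> a x" and mx: "m x \<le> m j" if "j \<in> S" for j
  proof -
   have *: "a j - m j \<le> a x - m x" using insert.hyps(2)[OF that] .
   have "(a x - a j) * (m x - m j) \<le> 0" using insert.prems that by auto
   then show "a j \<le> a x" "m x \<le> m j" using * by (auto simp: mult_le_0_iff)
  qed
  let ?c = "\<lambda>j. u j + (a x - a j) * m j"
  \<comment> \<open>The largest value permitted by the constraints that have the new index on the
    left.\<close>
  define ux where "ux = Min (?c ` S)"
  have "ux \<in> ?c ` S" unfolding ux_def using False insert.hyps(1) by (intro Min_in) auto
  then obtain j0 where j0: "j0 \<in> S" "ux = ?c j0" by blast
  have le: "ux \<le> ?c j" if "j \<in> S" for j unfolding ux_def using that insert.hyps(1) by simp
  have ge: "u i - ux \<le> (a i - a x) * m x" if i: "i \<in> S" for i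
  proof -
   have "u i - ux \<le> (a i - a j0) * m j0 - (a x - a j0) * m j0" using u[OF i j0(1)] j0(2) by simp
   also have "\<dots> = (a i - a x) * m j0" by (simp add: algebra_simps)
   also have "\<dots> \<le> (a i - a x) * m x" using ax[OF i] mx[OF j0(1)] by (intro mult_left_mono_neg) auto
   finally show ?thesis .
  qed
  show ?thesis by (rule exI[of _ "u(x := ux)"]) (use False u le ge in \<open>auto simp: algebra_simps\<close>)
 qed
qed

text \<open>Linear programming duality takes the place of a decomposition of \<open>S\<close> into
  permutations. For an optimal \<pi> no transposition lowers the cost, so \<open>a\<close> and
  \<open>m\<close> after \<pi> are oppositely ordered and \<open>opposite_potential\<close> supplies
  a certificate.\<close>

lemma doubly_stochastic_bound:
 fixes a m :: "'i \<Rightarrow> real" and S :: "'i \<Rightarrow> 'i \<Rightarrow> real"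
 assumes "finite I" "\<And>i j. i \<in> I \<Longrightarrow> j \<in> I \<Longrightarrow> 0 \<le> S i j"
  and row: "\<And>i. i \<in> I \<Longrightarrow> (\<Sum>j\<in>I. S i j) = 1"
  and col: "\<And>j. j \<in> I \<Longrightarrow> (\<Sum>i\<in>I. S i j) = 1"
  and perm: "\<And>\<pi>. \<pi> permutes I \<Longrightarrow> B \<le> (\<Sum>i\<in>I. a i * m (\<pi> i))"
 shows "B \<le> (\<Sum>i\<in>I. a i * (\<Sum>j\<in>I. S i j * m j))"
proof -
 let ?c = "\<lambda>\<pi>. \<Sum>i\<in>I. a i * m (\<pi> i)"
 have "finite {\<pi>. \<pi> permutes I}" "{\<pi>. \<pi> permutes I} \<noteq> {}"
  using assms(1) by (auto intro: finite_permutations exI[of _ id] permutes_id)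
 then obtain \<pi> where \<pi>: "\<pi> permutes I" and min: "\<And>\<rho>. \<rho> permutes I \<Longrightarrow> ?c \<pi> \<le> ?c \<rho>"
  using arg_min_if_finite[of "{\<pi>. \<pi> permutes I}" ?c] that[of "arg_min_on ?c {\<pi>. \<pi> permutes I}"] by (auto simp: not_less)
 have opp: "(a i - a j) * (m (\<pi> i) - m (\<pi> j)) \<le> 0" if ij: "i \<in> I" "j \<in> I" for i j
 proof (cases "i = j")
  case False
  let ?\<rho> = "\<pi> \<circ> Transposition.transpose i j"
  have "?\<rho> permutes I" using \<pi> ij by (intro permutes_compose permutes_swap_id)
  then have "?c \<pi> \<le> ?c ?\<rho>" by (rule min)
  moreover have "?c \<rho> = a i * m (\<rho> i) + a j * m (\<rho> j) + (\<Sum>l\<in>I - {i} - {j}. a l * m (\<rho> l))" for \<rho>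
   using assms(1) ij False by (simp add: sum.remove[of I i] sum.remove[of "I - {i}" j])
  moreover have "(\<Sum>l\<in>I - {i} - {j}. a l * m (?\<rho> l)) = (\<Sum>l\<in>I - {i} - {j}. a l * m (\<pi> l))"
   by (rule sum.cong) (auto simp: transpose_def)
  ultimately show ?thesis by (simp add: algebra_simps)
 qed simp
 obtain u where u: "\<And>i j. i \<in> I \<Longrightarrow> j \<in> I \<Longrightarrow> u i - u j \<le> (a i - a j) * m (\<pi> j)"
  using opposite_potential[OF assms(1), of a "\<lambda>i. m (\<pi> i)"] opp by blast
 have bij: "bij_betw \<pi> I I" using \<pi> by (rule permutes_imp_bij)
 have inI: "\<pi> j \<in> I" if "j \<in> I" for j using that \<pi> by (simp add: permutes_in_image)
 \<comment> \<open>The unit row sums spread \<open>u i\<close> over row \<open>i\<close>, the unit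
   column sums spread \<open>a j * m (\<pi> j) - u j\<close> over column \<open>\<pi> j\<close>. The
   inequality for \<open>u\<close> then applies entry by entry.\<close>
 have "B \<le> (\<Sum>i\<in>I. u i) + (\<Sum>j\<in>I. a j * m (\<pi> j) - u j)" using perm[OF \<pi>] by (simp add: sum_subtractf)
 also have "(\<Sum>i\<in>I. u i) = (\<Sum>i\<in>I. \<Sum>j\<in>I. S i (\<pi> j) * u i)"
 proof (rule sum.cong[OF refl])
  fix i assume "i \<in> I"
  then have "(\<Sum>j\<in>I. S i (\<pi> j)) = 1" using row sum.reindex_bij_betw[OF bij, of "S i"] by simp
  then show "u i = (\<Sum>j\<in>I. S i (\<pi> j) * u i)" by (simp flip: sum_distrib_right)
 qed
 also have "(\<Sum>j\<in>I. a j * m (\<pi> j) - u j) = (\<Sum>j\<in>I. \<Sum>i\<in>I. S i (\<pi> j) * (a j * m (\<pi> j) - u j))"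
  by (rule sum.cong) (use col inI in \<open>simp_all flip: sum_distrib_right\<close>)
 also have "\<dots> = (\<Sum>i\<in>I. \<Sum>j\<in>I. S i (\<pi> j) * (a j * m (\<pi> j) - u j))" by (rule sum.swap)
 also have "(\<Sum>i\<in>I. \<Sum>j\<in>I. S i (\<pi> j) * u i) + \<dots> = (\<Sum>i\<in>I. \<Sum>j\<in>I. S i (\<pi> j) * (u i - u j + a j * m (\<pi> j)))"
  by (simp add: sum.distrib[symmetric] algebra_simps)
 also have "\<dots> \<le> (\<Sum>i\<in>I. \<Sum>j\<in>I. S i (\<pi> j) * (a i * m (\<pi> j)))"
 proof (intro sum_mono mult_left_mono)
  fix i j assume "i \<in> I" "j \<in> I"
  then show "u i - u j + a j * m (\<pi> j) \<le> a i * m (\<pi> j)" using u[of i j] by (simp add: algebra_simps)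
 qed (use assms(2) inI in auto)
 also have "\<dots> = (\<Sum>i\<in>I. a i * (\<Sum>j\<in>I. S i (\<pi> j) * m (\<pi> j)))" by (simp add: sum_distrib_left mult_ac)
 also have "\<dots> = (\<Sum>i\<in>I. a i * (\<Sum>j\<in>I. S i j * m j))" by (simp add: sum.reindex_bij_betw[OF bij, of "\<lambda>j. S _ j * m j"])
 finally show ?thesis .
qed

text \<open>Permuting \<open>y\<close> changes neither its cone nor its symmetric functions, so
  \<open>garding_vector\<close> holds for every matching of the entries of \<open>x\<close> and
  \<open>y\<close>, and therefore for averages of matchings.\<close>

lemma garding_doubly_stochastic:
 assumes "finite I" "gam I k x" "gam I k y" "1 \<le> k"
  and "\<And>i j. i \<in> I \<Longrightarrow> j \<in> I \<Longrightarrow> 0 \<le> S i j"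
  and "\<And>i. i \<in> I \<Longrightarrow> (\<Sum>j\<in>I. S i j) = 1"
  and "\<And>j. j \<in> I \<Longrightarrow> (\<Sum>i\<in>I. S i j) = 1"
 shows "real k * esym I k x * (esym I k y / esym I k x) powr (1 / real k)
  \<le> (\<Sum>i\<in>I. esym (I - {i}) (k - 1) x * (\<Sum>j\<in>I. S i j * y j))"
proof (rule doubly_stochastic_bound[OF assms(1,5,6,7)])
 fix \<pi> assume \<pi>: "\<pi> permutes I"
 have "gam I k (\<lambda>i. y (\<pi> i))" using assms(3) by (simp add: gam_def esym_permutes[OF \<pi>])
 from garding_vector[OF assms(1,2) this assms(4)]
 show "real k * esym I k x * (esym I k y / esym I k x) powr (1 / real k) \<le> (\<Sum>i\<in>I. esym (I - {i}) (k - 1) x * y (\<pi> i))"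
  by (simp add: esym_permutes[OF \<pi>] mult.commute)
qed

section \<open>Newton tensors\<close>

text \<open>The Newton tensors T_0 = I and T_(k+1) = \<sigma>_(k+1) I - T_k A, with \<sigma>_(k+1)
  written as tr (T_k A) / (k + 1). No eigenvalues enter, so the entries are polynomials in those of
  \<open>A\<close> and can be differentiated.\<close>

fun newton :: "real^'m^'m \<Rightarrow> nat \<Rightarrow> real^'m^'m" where
 "newton A 0 = mat 1"
| "newton A (Suc k) = (trace (newton A k ** A) / real (Suc k)) *\<^sub>R mat 1 - newton A k ** A"

definition msig :: "real^'m^'m \<Rightarrow> nat \<Rightarrow> real" where
 "msig A k = (if k = 0 then 1 else trace (newton A (k - 1) ** A) / real k)"

lemma newton_Suc: "newton A (Suc k) = msig A (Suc k) *\<^sub>R mat 1 - newton A k ** A" by (simp add: msig_def)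

declare newton.simps(2) [simp del]

fun mpow :: "real^'m^'m \<Rightarrow> nat \<Rightarrow> real^'m^'m" where
 "mpow A 0 = mat 1"
| "mpow A (Suc k) = mpow A k ** A"

lemma scaleR_matrix_mult_left: "(c *\<^sub>R A) ** (B :: real^'n^'m) = c *\<^sub>R (A ** B)"
 by (simp add: matrix_matrix_mult_def vec_eq_iff sum_distrib_left mult_ac)

lemma scaleR_matrix_mult_right: "A ** (c *\<^sub>R (B :: real^'n^'m)) = c *\<^sub>R (A ** B)"
 by (simp add: matrix_matrix_mult_def vec_eq_iff sum_distrib_left mult_ac)

lemma matrix_mult_diff_left: "(A - B) ** (C :: real^'n^'m) = A ** C - B ** C"
 by (simp add: matrix_matrix_mult_def vec_eq_iff sum_subtractf algebra_simps)

lemma matrix_mult_diff_right: "A ** (B - C) = A ** B - A ** (C :: real^'n^'m)"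
 by (simp add: matrix_matrix_mult_def vec_eq_iff sum_subtractf algebra_simps)

lemma matrix_mult_add_left: "(A + B) ** (C :: real^'n^'m) = A ** C + B ** C"
 by (simp add: matrix_matrix_mult_def vec_eq_iff sum.distrib algebra_simps)

lemma trace_scaleR: "trace (c *\<^sub>R A) = c * trace (A :: real^'m^'m)" by (simp add: trace_def sum_distrib_left)

lemma mpow_comm: "mpow A k ** A = A ** mpow A k"
proof (induction k)
 case (Suc k)
 then show ?case by (metis matrix_mul_assoc mpow.simps(2))
qed simp

lemma mpow_add: "mpow A i ** mpow A j = mpow A (i + j)" by (induction j) (simp_all add: matrix_mul_assoc)

lemma newton_comm: "newton A k ** A = A ** newton A k"
proof (induction k)
 case (Suc k)
 then have "newton A k ** A ** A = A ** (newton A k ** A)" by (metis matrix_mul_assoc)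
 then show ?case by (simp add: newton_Suc matrix_mult_diff_left matrix_mult_diff_right scaleR_matrix_mult_left
    scaleR_matrix_mult_right)
qed simp

lemma transpose_newton:
 assumes "transpose A = A"
 shows "transpose (newton A k) = newton A k"
proof (induction k)
 case (Suc k)
 have "transpose (x *\<^sub>R mat 1 - B) = x *\<^sub>R mat 1 - transpose (B :: real^'a^'a)" for x B
  by (simp add: transpose_def vec_eq_iff mat_def)
 then show ?case using Suc assms by (simp add: newton_Suc matrix_transpose_mul newton_comm)
qed simp

lemma newton_scaleR: "newton (c *\<^sub>R A) k = c ^ k *\<^sub>R newton A k"
proof (induction k)
 case (Suc k)
 then show ?case by (simp add: newton.simps(2) scaleR_matrix_mult_left scaleR_matrix_mult_right trace_scaleR algebra_simps)
qed simp

lemma newton_expand: "newton A k = (\<Sum>j\<le>k. ((-1) ^ j * msig A (k - j)) *\<^sub>R mpow A j)"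
proof (induction k)
 case 0 then show ?case by (simp add: msig_def)
next
 case (Suc k)
 have sm: "(\<Sum>j\<in>S. f j) ** (B :: real^'a^'a) = (\<Sum>j\<in>S. f j ** B)" for S :: "nat set" and f B
  by (induction S rule: infinite_finite_induct) (simp_all add: matrix_mult_add_left)
 show ?case unfolding sum.atMost_Suc_shift newton_Suc Suc sm by (simp add: scaleR_matrix_mult_left sum_negf)
qed

lemma trace_newton_mult: "trace (newton A k ** B) = (\<Sum>j\<le>k. (-1) ^ j * msig A (k - j) * trace (mpow A j ** B))"
proof -
 have sm: "trace ((\<Sum>j\<in>S. f j) ** (B :: real^'a^'a)) = (\<Sum>j\<in>S. trace (f j ** B))" for S :: "nat set" and f B
  by (induction S rule: infinite_finite_induct) (simp_all add: matrix_mult_add_left trace_add, simp_all add: trace_def)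
 show ?thesis unfolding newton_expand sm by (simp add: scaleR_matrix_mult_left trace_scaleR)
qed

text \<open>Newton's identities between elementary symmetric functions and power sums, which are
  here the traces of powers of \<open>A\<close>.\<close>

lemma msig_recursion: "real k * msig A k = (\<Sum>j<k. (-1) ^ j * msig A (k - 1 - j) * trace (mpow A (Suc j)))"
proof (cases k)
 case (Suc l)
 then show ?thesis using trace_newton_mult[of A l A] by (simp add: msig_def lessThan_Suc_atMost)
qed simp

section \<open>Derivatives of the symmetric functions and of the Newton tensors\<close>

definition mderiv :: "(real \<Rightarrow> real^'m^'m) \<Rightarrow> real^'m^'m \<Rightarrow> real \<Rightarrow> bool" where
 "mderiv A B t \<longleftrightarrow> (\<forall>i l. DERIV (\<lambda>s. A s $ i $ l) t :> B $ i $ l)"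

lemma mderiv_mult:
 assumes "mderiv A A' t" "mderiv B B' t"
 shows "mderiv (\<lambda>s. A s ** B s) (A' ** B t + A t ** B') t" using assms unfolding mderiv_def matrix_matrix_mult_def
 by (auto intro!: derivative_eq_intros simp: sum.distrib mult_ac)

lemma mderiv_trace: "mderiv A A' t \<Longrightarrow> DERIV (\<lambda>s. trace (A s)) t :> trace A'"
 unfolding mderiv_def trace_def by (auto intro!: derivative_eq_intros)

lemma mderiv_scaleR_mat_diff:
 assumes "DERIV f t :> f'" "mderiv B B' t"
 shows "mderiv (\<lambda>s. f s *\<^sub>R mat 1 - B s) (f' *\<^sub>R mat 1 - B') t"
 using assms unfolding mderiv_def by (auto intro!: derivative_eq_intros)

text \<open>\<open>A t\<close> and \<open>B\<close> need not commute, so \<open>D\<close> has no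
  short formula in terms of them. Only its traces against powers of \<open>A t\<close> are used, and
  there cyclicity of the trace gives k equal terms.\<close>

lemma mderiv_mpow:
 assumes "mderiv A B t"
 shows "\<exists>D. mderiv (\<lambda>s. mpow (A s) k) D t \<and> (\<forall>m. trace (D ** mpow (A t) m) = real k * trace (mpow (A t) (k - 1 + m) ** B))"
proof (induction k)
 case 0
 show ?case by (intro exI[of _ 0]) (auto simp: mderiv_def trace_def matrix_matrix_mult_def)
next
 case (Suc k)
 then obtain D where D: "mderiv (\<lambda>s. mpow (A s) k) D t"
  "\<And>m. trace (D ** mpow (A t) m) = real k * trace (mpow (A t) (k - 1 + m) ** B)" by blast
 have "trace ((D ** A t + mpow (A t) k ** B) ** mpow (A t) m) = real (Suc k) * trace (mpow (A t) (k + m) ** B)" for m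
 proof -
  have "D ** A t ** mpow (A t) m = D ** mpow (A t) (Suc m)" by (simp add: mpow_comm matrix_mul_assoc)
  moreover have "trace (mpow (A t) k ** B ** mpow (A t) m) = trace (mpow (A t) (k + m) ** B)"
   by (metis add.commute matrix_mul_assoc mpow_add trace_mul_sym)
  moreover have "trace (D ** mpow (A t) (Suc m)) = real k * trace (mpow (A t) (k + m) ** B)"
   using D(2)[of "Suc m"] by (cases k) (simp_all del: mpow.simps)
  ultimately show ?thesis by (simp add: matrix_mult_add_left trace_add distrib_right del: mpow.simps)
 qed
 then show ?case using mderiv_mult[OF D(1) assms] by auto
qed

text \<open>The formula is d\<sigma>_k = tr (T_(k-1) dA), written out with
  \<open>newton_expand\<close>. It follows by differentiating Newton's identities, with strong
  induction for the derivatives of the lower symmetric functions.\<close>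

lemma DERIV_msig:
 assumes "mderiv A B t"
 shows "DERIV (\<lambda>s. msig (A s) k) t :> (\<Sum>j<k. (-1) ^ j * msig (A t) (k - 1 - j) * trace (mpow (A t) j ** B))"
proof (induction k rule: less_induct)
 case (less k)
 define s where "s i = msig (A t) i" for i
 define p where "p i = trace (mpow (A t) (Suc i))" for i
 define q where "q i = trace (mpow (A t) i ** B)" for i
 define r where "r i = (\<Sum>j<i. (-1) ^ j * s (i - 1 - j) * q j)" for i
 have dp: "DERIV (\<lambda>s. trace (mpow (A s) (Suc i))) t :> real (Suc i) * q i" for i
 proof -
  obtain D where D: "mderiv (\<lambda>s. mpow (A s) (Suc i)) D t"
   "\<And>m. trace (D ** mpow (A t) m) = real (Suc i) * trace (mpow (A t) (Suc i - 1 + m) ** B)"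
   using mderiv_mpow[OF assms, of "Suc i"] by blast
  show ?thesis using mderiv_trace[OF D(1)] D(2)[of 0] by (simp add: q_def)
 qed
 have IH: "DERIV (\<lambda>s. msig (A s) i) t :> r i" if "i < k" for i using less[OF that] by (simp add: r_def s_def q_def)
 show ?case
 proof (cases "k = 0")
  case True then show ?thesis by (simp add: msig_def)
 next
  case False
  let ?D = "\<Sum>j<k. (-1) ^ j * (r (k - 1 - j) * p j + real (Suc j) * q j * s (k - 1 - j))"
  have "DERIV (\<lambda>u. \<Sum>j<k. (-1) ^ j * msig (A u) (k - 1 - j) * trace (mpow (A u) (Suc j))) t :> ?D"
  proof (rule DERIV_sum)
   fix j assume "j \<in> {..<k}"
   then have "k - 1 - j < k" by auto
   show "DERIV (\<lambda>u. (-1) ^ j * msig (A u) (k - 1 - j) * trace (mpow (A u) (Suc j))) t :> (-1) ^ j * (r (k - 1 - j) * p j + real (Suc j) * q j * s (k - 1 - j))"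
    unfolding mult.assoc
    by (rule DERIV_cmult) (use DERIV_mult[OF IH[OF \<open>k - 1 - j < k\<close>] dp[of j]] in \<open>simp add: p_def s_def algebra_simps\<close>)
  qed
  then have "DERIV (\<lambda>u. real k * msig (A u) k) t :> ?D" by (simp only: msig_recursion)
  from DERIV_cdivide[OF this, of "real k"] False
  have 1: "DERIV (\<lambda>u. msig (A u) k) t :> ?D / real k" by simp
  \<comment> \<open>Over this triangle the indices \<open>j\<close> and \<open>i\<close> may be
    exchanged; the inner sum is then again the right side of Newton's identities.\<close>
  let ?T = "SIGMA j:{..<k}. {..<k - 1 - j}"
  have "(\<Sum>j<k. (-1) ^ j * (r (k - 1 - j) * p j)) = (\<Sum>(j, i)\<in>?T. (-1) ^ j * (-1) ^ i * s (k - 1 - j - 1 - i) * q i * p j)"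
   by (subst sum.Sigma[symmetric]) (auto simp: r_def sum_distrib_left sum_distrib_right mult_ac intro!: sum.cong)
  also have "\<dots> = (\<Sum>(j, i)\<in>?T. (-1) ^ j * (-1) ^ i * s (k - 1 - j - 1 - i) * p i * q j)"
   by (rule sum.reindex_bij_witness[of _ "\<lambda>(a, b). (b, a)" "\<lambda>(a, b). (b, a)"]) (auto simp: mult_ac diff_right_commute add_ac)
  also have "\<dots> = (\<Sum>j<k. (-1) ^ j * q j * (\<Sum>i<k - 1 - j. (-1) ^ i * s (k - 1 - j - 1 - i) * p i))"
   by (subst sum.Sigma[symmetric]) (auto simp: sum_distrib_left mult_ac intro!: sum.cong)
  also have "\<dots> = (\<Sum>j<k. (-1) ^ j * q j * (real (k - 1 - j) * s (k - 1 - j)))" by (simp only: s_def p_def msig_recursion)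
  finally have "?D = (\<Sum>j<k. (-1) ^ j * q j * (real (k - 1 - j) * s (k - 1 - j)) + (-1) ^ j * (real (Suc j) * q j * s (k - 1 - j)))"
   by (simp add: distrib_left sum.distrib)
  \<comment> \<open>The weights \<open>k - 1 - j\<close> and \<open>Suc j\<close> add up to
    \<open>k\<close>, which cancels the division by \<open>real k\<close>.\<close>
  also have "\<dots> = (\<Sum>j<k. real k * ((-1) ^ j * s (k - 1 - j) * q j))"
  proof (rule sum.cong[OF refl])
   fix j assume "j \<in> {..<k}"
   then have "real (k - 1 - j) = real k - 1 - real j" by auto
   then show "(-1) ^ j * q j * (real (k - 1 - j) * s (k - 1 - j)) + (-1) ^ j * (real (Suc j) * q j * s (k - 1 - j)) =
     real k * ((-1) ^ j * s (k - 1 - j) * q j)" by (simp add: algebra_simps)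
  qed
  also have "\<dots> = real k * (\<Sum>j<k. (-1) ^ j * s (k - 1 - j) * q j)" by (simp only: sum_distrib_left)
  finally have "?D / real k = (\<Sum>j<k. (-1) ^ j * s (k - 1 - j) * q j)" using False by simp
  then show ?thesis using 1 by (simp add: s_def q_def)
 qed
qed

lemma DERIV_msig_Suc:
 assumes "mderiv A B t"
 shows "DERIV (\<lambda>s. msig (A s) (Suc k)) t :> trace (newton (A t) k ** B)"
 using DERIV_msig[OF assms, of "Suc k"] by (simp add: trace_newton_mult lessThan_Suc_atMost)

fun dnewton :: "real^'m^'m \<Rightarrow> real^'m^'m \<Rightarrow> nat \<Rightarrow> real^'m^'m" where
 "dnewton A B 0 = 0"
| "dnewton A B (Suc k) = trace (newton A k ** B) *\<^sub>R mat 1 - (dnewton A B k ** A + newton A k ** B)"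

lemma mderiv_newton:
 assumes "mderiv A B t"
 shows "mderiv (\<lambda>s. newton (A s) k) (dnewton (A t) B k) t"
proof (induction k)
 case 0 then show ?case by (simp add: mderiv_def)
next
 case (Suc k)
 show ?case unfolding newton_Suc dnewton.simps by (intro mderiv_scaleR_mat_diff DERIV_msig_Suc mderiv_mult Suc assms)
qed

text \<open>\<open>C i\<close> stands for the i-th partial derivative of a Hessian, symmetric in all
  three indices. In the induction step the two terms tr (T_k C_l) cancel, and what remains is the
  divergence of the previous tensor multiplied by \<open>A\<close>.\<close>

lemma dnewton_div_free:
 fixes A :: "real^'m^'m" and C :: "'m \<Rightarrow> real^'m^'m"
 assumes "\<And>i m l. C i $ m $ l = C m $ i $ l" "\<And>i m l. C i $ m $ l = C i $ l $ m"
 shows "(\<Sum>i\<in>UNIV. dnewton A (C i) k $ i $ l) = 0"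
proof (induction k arbitrary: l)
 case (Suc k)
 have "(\<Sum>i\<in>UNIV. (dnewton A (C i) k ** A) $ i $ l) = (\<Sum>m\<in>UNIV. (\<Sum>i\<in>UNIV. dnewton A (C i) k $ i $ m) * A $ m $ l)"
  unfolding matrix_matrix_mult_def sum_distrib_right vec_lambda_beta by (rule sum.swap)
 then have 1: "(\<Sum>i\<in>UNIV. (dnewton A (C i) k ** A) $ i $ l) = 0" by (simp add: Suc)
 have sym: "C i $ m $ l = C l $ m $ i" for i m using assms by metis
 have "(\<Sum>i\<in>UNIV. (newton A k ** C i) $ i $ l) = trace (newton A k ** C l)"
  unfolding trace_def matrix_matrix_mult_def vec_lambda_beta by (intro sum.cong refl) (simp add: sym)
 moreover have "(\<Sum>i\<in>UNIV. (trace (newton A k ** C i) *\<^sub>R mat 1 :: real^'m^'m) $ i $ l) = trace (newton A k ** C l)"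
  by (simp add: mat_def if_distrib[of "\<lambda>x. _ * x"] cong: if_cong)
 ultimately show ?case using 1 by (simp add: sum_subtractf sum.distrib)
qed simp

text \<open>In the application \<nu> is the radial direction, on which the Hessian of a
  one-homogeneous function vanishes, and \<open>lam\<close> lists the tangential eigenvalues only.
  Orthonormality is recorded through the expansion formula, from which traces and the sums of
  squares in \<open>garding_matrix\<close> are read off.\<close>

definition eigframe :: "nat \<Rightarrow> real^'m \<Rightarrow> (nat \<Rightarrow> real^'m) \<Rightarrow> (nat \<Rightarrow> real) \<Rightarrow> real^'m^'m \<Rightarrow> bool" where
 "eigframe n \<nu> v lam A \<longleftrightarrow>
   (\<forall>x. x = (x \<bullet> \<nu>) *\<^sub>R \<nu> + (\<Sum>i<n. (x \<bullet> v i) *\<^sub>R v i)) \<and> \<nu> \<bullet> \<nu> = 1 \<and>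
   (\<forall>i<n. v i \<bullet> \<nu> = 0 \<and> v i \<bullet> v i = 1) \<and> A *v \<nu> = 0 \<and> (\<forall>i<n. A *v v i = lam i *\<^sub>R v i)"

section \<open>Newton tensors in an eigenframe\<close>

lemma trace_inner: "trace (M :: real^'m^'m) = (\<Sum>m\<in>UNIV. axis m 1 \<bullet> (M *v axis m 1))"
 by (simp add: trace_def inner_axis' matrix_vector_mult_basis column_def)

lemma trace_frame:
 fixes M :: "real^'m^'m"
 assumes fr: "\<And>x. x = (x \<bullet> \<nu>) *\<^sub>R \<nu> + (\<Sum>i<n. (x \<bullet> v i) *\<^sub>R v i)"
 shows "trace M = \<nu> \<bullet> (M *v \<nu>) + (\<Sum>i<n. v i \<bullet> (M *v v i))"
proof -
 have par: "(\<Sum>m\<in>UNIV. (axis m 1 \<bullet> a) * (axis m 1 \<bullet> b)) = a \<bullet> b" for a b :: "real^'m"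
 proof -
  have "axis m 1 \<bullet> w = w $ m" for m :: 'm and w :: "real^'m" by (simp add: inner_axis')
  then show ?thesis by (simp add: inner_vec_def)
 qed
 have adj: "(M *v x) \<bullet> y = x \<bullet> (transpose M *v y)" for x y by (metis dot_lmul_matrix inner_commute transpose_matrix_vector)
 have "trace M = (\<Sum>m\<in>UNIV. (axis m 1 \<bullet> \<nu>) * (axis m 1 \<bullet> (transpose M *v \<nu>)) + (\<Sum>i<n. (axis m 1 \<bullet> v i) * (axis m 1 \<bullet> (transpose M *v v i))))"
  unfolding trace_inner
 proof (rule sum.cong[OF refl])
  fix m :: 'm
  show "axis m 1 \<bullet> (M *v axis m 1) = (axis m 1 \<bullet> \<nu>) * (axis m 1 \<bullet> (transpose M *v \<nu>)) + (\<Sum>i<n. (axis m 1 \<bullet> v i) * (axis m 1 \<bullet> (transpose M *v v i)))"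
   by (subst (2) fr) (simp only: inner_add_right inner_scaleR_right inner_sum_right adj mult.commute)
 qed
 also have "\<dots> = \<nu> \<bullet> (transpose M *v \<nu>) + (\<Sum>i<n. v i \<bullet> (transpose M *v v i))"
  unfolding sum.distrib par by (subst sum.swap) (simp add: par)
 also have "\<dots> = \<nu> \<bullet> (M *v \<nu>) + (\<Sum>i<n. v i \<bullet> (M *v v i))" by (simp only: adj[symmetric] inner_commute)
 finally show ?thesis .
qed

text \<open>On the eigenvector \<open>v i\<close> the recursion removes from
  \<open>esym {..<n}\<close> the terms containing \<open>lam i\<close>; on the kernel vector \<nu>
  it removes nothing. The trace of \<open>newton A k ** A\<close> is then evaluated by Euler's
  identity for \<open>esym\<close>.\<close>

lemma newton_eigframe:
 assumes "eigframe n \<nu> v lam A"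
 shows "msig A k = esym {..<n} k lam" (is ?t1)
  and "i < n \<Longrightarrow> newton A k *v v i = esym ({..<n} - {i}) k lam *\<^sub>R v i"
  and "newton A k *v \<nu> = esym {..<n} k lam *\<^sub>R \<nu>"
proof -
 have fr: "\<And>x. x = (x \<bullet> \<nu>) *\<^sub>R \<nu> + (\<Sum>i<n. (x \<bullet> v i) *\<^sub>R v i)"
  and n1: "\<nu> \<bullet> \<nu> = 1" and v1: "\<And>i. i < n \<Longrightarrow> v i \<bullet> v i = 1" and A0: "A *v \<nu> = 0"
  and Av: "\<And>i. i < n \<Longrightarrow> A *v v i = lam i *\<^sub>R v i" using assms unfolding eigframe_def by blast+
 have "(\<forall>i<n. newton A k *v v i = esym ({..<n} - {i}) k lam *\<^sub>R v i) \<and> newton A k *v \<nu> = esym {..<n} k lam *\<^sub>R \<nu>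
   \<and> msig A (Suc k) = esym {..<n} (Suc k) lam" for k
 proof (induction k)
  case 0
  have "trace A = (\<Sum>i<n. lam i)" by (subst trace_frame[OF fr]) (simp add: A0 Av v1)
  then show ?case by (simp add: msig_def esym_1)
 next
  case (Suc k)
  have s1: "msig A (Suc k) = esym {..<n} (Suc k) lam" using Suc by simp
  have a: "\<forall>i<n. newton A (Suc k) *v v i = esym ({..<n} - {i}) (Suc k) lam *\<^sub>R v i"
  proof (intro allI impI)
   fix i assume i: "i < n"
   have "newton A (Suc k) *v v i = msig A (Suc k) *\<^sub>R v i - newton A k *v (A *v v i)"
    by (simp add: newton_Suc matrix_vector_mult_diff_rdistrib scaleR_matrix_vector_assoc[symmetric] matrix_vector_mul_assoc)
   also have "\<dots> = (esym {..<n} (Suc k) lam - lam i * esym ({..<n} - {i}) k lam) *\<^sub>R v i"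
    using Suc i by (simp add: Av s1 matrix_vector_mult_scaleR scaleR_diff_left)
   also have "\<dots> = esym ({..<n} - {i}) (Suc k) lam *\<^sub>R v i" using esym_remove[of "{..<n}" i k lam] i by simp
   finally show "newton A (Suc k) *v v i = esym ({..<n} - {i}) (Suc k) lam *\<^sub>R v i" .
  qed
  have b: "newton A (Suc k) *v \<nu> = esym {..<n} (Suc k) lam *\<^sub>R \<nu>"
   by (simp add: newton_Suc matrix_vector_mult_diff_rdistrib scaleR_matrix_vector_assoc[symmetric]
     matrix_vector_mul_assoc[symmetric] A0 s1)
  have "trace (newton A (Suc k) ** A) = (\<Sum>i<n. lam i * esym ({..<n} - {i}) (Suc k) lam)" by (subst trace_frame[OF fr])
    (simp add: matrix_vector_mul_assoc[symmetric] A0 Av matrix_vector_mult_scaleR a v1)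
  then have "msig A (Suc (Suc k)) = esym {..<n} (Suc (Suc k)) lam"
   using esym_euler[of "{..<n}" lam "Suc k"] by (simp add: msig_def)
  with a b show ?case by simp
 qed
 note all = this
 show ?t1 by (cases k) (use all in \<open>auto simp: msig_def\<close>)
 show "i < n \<Longrightarrow> newton A k *v v i = esym ({..<n} - {i}) k lam *\<^sub>R v i" using all by blast
 show "newton A k *v \<nu> = esym {..<n} k lam *\<^sub>R \<nu>" using all by blast
qed

text \<open>Both frames are orthonormal bases of the complement of the same \<nu>, so the squared
  inner products of their vectors form a doubly stochastic matrix. In the frame of \<open>A\<close>,
  the diagonal entries of \<open>B\<close> are averages of \<open>mu\<close> with these
  weights.\<close>

lemma garding_matrix:
 assumes A: "eigframe n \<nu> v lam A" and B: "eigframe n \<nu> u mu B"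
  and "gam {..<n} k lam" "gam {..<n} k mu" "1 \<le> k"
 shows "real k * esym {..<n} k lam * (esym {..<n} k mu / esym {..<n} k lam) powr (1 / real k) \<le> trace (newton A (k - 1) ** B)"
proof -
 have frA: "\<And>x. x = (x \<bullet> \<nu>) *\<^sub>R \<nu> + (\<Sum>i<n. (x \<bullet> v i) *\<^sub>R v i)"
  and v1: "\<And>i. i < n \<Longrightarrow> v i \<bullet> v i = 1" and vn: "\<And>i. i < n \<Longrightarrow> v i \<bullet> \<nu> = 0" using A unfolding eigframe_def by blast+
 have frB: "\<And>x. x = (x \<bullet> \<nu>) *\<^sub>R \<nu> + (\<Sum>i<n. (x \<bullet> u i) *\<^sub>R u i)"
  and u1: "\<And>i. i < n \<Longrightarrow> u i \<bullet> u i = 1" and un: "\<And>i. i < n \<Longrightarrow> u i \<bullet> \<nu> = 0" and B0: "B *v \<nu> = 0"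
  and Bu: "\<And>i. i < n \<Longrightarrow> B *v u i = mu i *\<^sub>R u i" using B unfolding eigframe_def by blast+
 have Ve: "v i = (\<Sum>j<n. (v i \<bullet> u j) *\<^sub>R u j)" if "i < n" for i using frB[of "v i"] vn[OF that] by simp
 have Ue: "u j = (\<Sum>i<n. (u j \<bullet> v i) *\<^sub>R v i)" if "j < n" for j using frA[of "u j"] un[OF that] by simp
 have row: "(\<Sum>j<n. (v i \<bullet> u j)\<^sup>2) = 1" if "i < n" for i
 proof -
  have "v i \<bullet> v i = (\<Sum>j<n. (v i \<bullet> u j)\<^sup>2)" by (subst (2) Ve[OF that]) (simp add: inner_sum_right power2_eq_square)
  then show ?thesis using v1[OF that] by simp
 qed
 have col: "(\<Sum>i<n. (v i \<bullet> u j)\<^sup>2) = 1" if "j < n" for j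
 proof -
  have "u j \<bullet> u j = (\<Sum>i<n. (v i \<bullet> u j)\<^sup>2)" by (subst (2) Ue[OF that]) (simp add: inner_sum_right power2_eq_square inner_commute)
  then show ?thesis using u1[OF that] by simp
 qed
 have quad: "v i \<bullet> (B *v v i) = (\<Sum>j<n. (v i \<bullet> u j)\<^sup>2 * mu j)" if "i < n" for i
 proof -
  have "B *v v i = (\<Sum>j<n. (v i \<bullet> u j) *\<^sub>R (B *v u j))"
   by (subst Ve[OF that]) (simp add: linear_sum[OF matrix_vector_mul_linear] matrix_vector_mult_scaleR)
  also have "\<dots> = (\<Sum>j<n. ((v i \<bullet> u j) * mu j) *\<^sub>R u j)" by (simp add: Bu)
  finally show ?thesis by (simp add: inner_sum_right power2_eq_square mult_ac)
 qed
 have "trace (newton A (k - 1) ** B) = trace (B ** newton A (k - 1))" by (rule trace_mul_sym)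
 also have "\<dots> = (\<Sum>i<n. esym ({..<n} - {i}) (k - 1) lam * (\<Sum>j<n. (v i \<bullet> u j)\<^sup>2 * mu j))" by (subst trace_frame[OF frA])
   (simp add: matrix_vector_mul_assoc[symmetric] newton_eigframe[OF A] matrix_vector_mult_scaleR B0 quad)
 finally show ?thesis using garding_doubly_stochastic[OF _ assms(3,4,5), of "\<lambda>i j. (v i \<bullet> u j)\<^sup>2"] row col by simp
qed

lemma trace_newton_self:
 assumes "eigframe n \<nu> v lam A" "1 \<le> k"
 shows "trace (newton A (k - 1) ** A) = real k * esym {..<n} k lam"
 using newton_eigframe(1)[OF assms(1), of k] assms(2) by (simp add: msig_def field_simps)

lemma eigframe_esym_unique:
 assumes "eigframe n \<nu> v lam A" "eigframe n \<nu> u mu A"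
 shows "esym {..<n} k lam = esym {..<n} k mu" using newton_eigframe(1)[OF assms(1)] newton_eigframe(1)[OF assms(2)] by metis

section \<open>Integration by parts\<close>

lemma has_derivative_mult_imp_DERIV:
 "(f has_derivative (\<lambda>u. u * c)) (at x) \<Longrightarrow> DERIV f x :> c" by (simp add: has_field_derivative_def mult_commute_abs)

lemma DERIV_along_line:
 fixes f :: "'a::real_normed_vector \<Rightarrow> real"
 assumes "(f has_derivative f') (at x)"
 shows "DERIV (\<lambda>s. f (x + s *\<^sub>R e)) 0 :> f' e"
proof -
 have "((\<lambda>s. x + s *\<^sub>R e) has_derivative (\<lambda>s. s *\<^sub>R e)) (at 0)" by (auto intro!: derivative_eq_intros)
 from has_derivative_compose[OF this, of f f'] assms show ?thesis
  by (intro has_derivative_mult_imp_DERIV) (simp add: linear_scale[OF has_derivative_linear])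
qed

lemma compact_image_bound:
 fixes f :: "'a::topological_space \<Rightarrow> 'b::real_normed_vector"
 assumes "compact S" "continuous_on S f"
 obtains B where "0 \<le> B" "\<And>x. x \<in> S \<Longrightarrow> norm (f x) \<le> B"
 using compact_imp_bounded[OF compact_continuous_image[OF assms(2,1)]] unfolding bounded_pos by (auto intro: less_imp_le)

lemma DERIV_integral:
 fixes f f' :: "real \<Rightarrow> 'a \<Rightarrow> real"
 assumes "0 < d"
  and int: "\<And>t. \<bar>t - t0\<bar> < d \<Longrightarrow> integrable M (f t)"
  and der: "AE x in M. \<forall>t. \<bar>t - t0\<bar> < d \<longrightarrow> DERIV (\<lambda>s. f s x) t :> f' t x"
  and bnd: "AE x in M. \<forall>t. \<bar>t - t0\<bar> < d \<longrightarrow> \<bar>f' t x\<bar> \<le> w x"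
  and w: "integrable M w"
  and meas: "f' t0 \<in> borel_measurable M"
 shows "DERIV (\<lambda>t. \<integral>x. f t x \<partial>M) t0 :> (\<integral>x. f' t0 x \<partial>M)"
proof -
 have t0B: "t0 \<in> ball t0 d" using assms(1) by simp
 have "((\<lambda>t. ((\<integral>x. f t x \<partial>M) - (\<integral>x. f t0 x \<partial>M)) / (t - t0)) \<longlongrightarrow> (\<integral>x. f' t0 x \<partial>M)) (at t0 within ball t0 d)"
  unfolding tendsto_at_iff_sequentially
 proof (intro allI impI)
  fix X :: "nat \<Rightarrow> real" assume X: "\<forall>i. X i \<in> ball t0 d - {t0}" "X \<longlonglongrightarrow> t0"
  have Xd: "\<bar>X i - t0\<bar> < d" "X i \<noteq> t0" for i using X(1) by (auto simp: dist_real_def abs_minus_commute)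
  have i0: "integrable M (f t0)" using int[of t0] assms(1) by simp
  have ii: "integrable M (f (X i))" for i using int[OF Xd(1)] .
  have "(\<lambda>i. \<integral>x. (f (X i) x - f t0 x) / (X i - t0) \<partial>M) \<longlonglongrightarrow> (\<integral>x. f' t0 x \<partial>M)"
  proof (rule integral_dominated_convergence[where w = w])
   show "f' t0 \<in> borel_measurable M" by (rule meas)
   show "(\<lambda>x. (f (X i) x - f t0 x) / (X i - t0)) \<in> borel_measurable M" for i
    using i0 ii[of i] by (auto intro!: borel_measurable_divide borel_measurable_diff dest: borel_measurable_integrable)
   show "integrable M w" by (rule w)
   show "AE x in M. (\<lambda>i. (f (X i) x - f t0 x) / (X i - t0)) \<longlonglongrightarrow> f' t0 x" using der
   proof eventually_elim
    case (elim x)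
    then have "DERIV (\<lambda>s. f s x) t0 :> f' t0 x" using assms(1) by simp
    then have "((\<lambda>s. (f s x - f t0 x) / (s - t0)) \<longlongrightarrow> f' t0 x) (at t0)" by (simp add: has_field_derivative_iff)
    then show ?case using X(2) Xd(2) unfolding tendsto_at_iff_sequentially comp_def by auto
   qed
   show "AE x in M. norm ((f (X i) x - f t0 x) / (X i - t0)) \<le> w x" for i using der bnd
   proof eventually_elim
    case (elim x)
    have "\<bar>f (X i) x - f t0 x\<bar> \<le> w x * \<bar>X i - t0\<bar>"
    proof (rule field_differentiable_bound[of "ball t0 d" "\<lambda>s. f s x" "\<lambda>s. f' s x", simplified])
     show "((\<lambda>s. f s x) has_real_derivative f' z x) (at z within ball t0 d)" if "dist t0 z < d" for z
      using elim(1) that by (auto simp: dist_real_def abs_minus_commute intro: has_field_derivative_at_within)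
     show "\<bar>f' z x\<bar> \<le> w x" if "dist t0 z < d" for z using elim(2) that by (auto simp: dist_real_def abs_minus_commute)
     show "dist t0 (X i) < d" using Xd(1)[of i] by (simp add: dist_real_def abs_minus_commute)
    qed (use assms(1) in auto)
    then show ?case using Xd(2)[of i] by (simp add: divide_le_eq)
   qed
  qed
  moreover have "(\<integral>x. (f (X i) x - f t0 x) / (X i - t0) \<partial>M) = ((\<integral>x. f (X i) x \<partial>M) - (\<integral>x. f t0 x \<partial>M)) / (X i - t0)" for i
   using i0 ii[of i] by simp
  ultimately show "((\<lambda>t. ((\<integral>x. f t x \<partial>M) - (\<integral>x. f t0 x \<partial>M)) / (t - t0)) \<circ> X) \<longlonglongrightarrow> (\<integral>x. f' t0 x \<partial>M)" by (simp only: comp_def)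
 qed
 then show ?thesis unfolding has_field_derivative_iff using at_within_open[OF t0B open_ball] by simp
qed

lemma integrable_lborel_translate:
 fixes F :: "'a::euclidean_space \<Rightarrow> real"
 assumes "integrable lborel F"
 shows "integrable lborel (\<lambda>x. F (x + c))" "(LBINT x. F (x + c)) = (LBINT x. F x)"
proof -
 have "integrable (distr lborel borel ((+) c)) F" using assms by (simp add: lborel_distr_plus)
 then have "integrable lborel (\<lambda>x. F (c + x))"
  using borel_measurable_integrable[OF assms] by (subst (asm) integrable_distr_eq) auto
 then show "integrable lborel (\<lambda>x. F (x + c))" by (simp add: add.commute)
 have "(LBINT x. F x) = (\<integral>x. F x \<partial>distr lborel borel ((+) c))" by (simp add: lborel_distr_plus)
 also have "\<dots> = (LBINT x. F (c + x))" using borel_measurable_integrable[OF assms] by (subst integral_distr) auto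
 finally show "(LBINT x. F (x + c)) = (LBINT x. F x)" by (simp add: add.commute)
qed

lemma integral_lborel_reflect:
 fixes F :: "'a::euclidean_space \<Rightarrow> real"
 assumes [measurable]: "F \<in> borel_measurable borel"
 shows "(LBINT y. F (x - y)) = (LBINT y. F y)"
proof -
 have "(LBINT y. F y) = (\<integral>y. F y \<partial>(density (distr lborel borel (\<lambda>y::'a. x + (-1) *\<^sub>R y)) (\<lambda>_. \<bar>-1::real\<bar>^DIM('a))))"
  by (subst lborel_affine[of "-1" x, symmetric]) auto
 also have "\<dots> = (LBINT y. F (x - y))" by (simp add: density_1 one_ennreal_def[symmetric] integral_distr)
 finally show ?thesis ..
qed

text \<open>By translation invariance, the integral of a translate has zero derivative.\<close>
lemma integral_directional_deriv_eq_0: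
 fixes F F' :: "'a::euclidean_space \<Rightarrow> real"
 assumes "integrable lborel F"
  and "AE x in lborel. \<forall>t. \<bar>t\<bar> < 1 \<longrightarrow> DERIV (\<lambda>s. F (x + s *\<^sub>R e)) t :> F' (x + t *\<^sub>R e)"
  and "AE x in lborel. \<forall>t. \<bar>t\<bar> < 1 \<longrightarrow> \<bar>F' (x + t *\<^sub>R e)\<bar> \<le> w x"
  and "integrable lborel w" and "F' \<in> borel_measurable borel"
 shows "(LBINT x. F' x) = 0"
proof -
 have "DERIV (\<lambda>t. LBINT x. F (x + t *\<^sub>R e)) 0 :> (LBINT x. F' (x + 0 *\<^sub>R e))"
  by (rule DERIV_integral[where d = 1 and w = w]) (use assms in \<open>simp_all add: integrable_lborel_translate(1)\<close>)
 moreover have "DERIV (\<lambda>t. LBINT x. F (x + t *\<^sub>R e)) 0 :> 0" by (simp add: integrable_lborel_translate(2)[OF assms(1)])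
 ultimately show ?thesis using DERIV_unique by fastforce
qed

lemma DERIV_shift_line:
 assumes "\<And>x. DERIV (\<lambda>s. F (x + s *\<^sub>R e)) 0 :> F' x"
 shows "DERIV (\<lambda>s. F (x + s *\<^sub>R (e::'a::real_vector))) t :> F' (x + t *\<^sub>R e)"
proof -
 have "DERIV (\<lambda>s. F ((x + t *\<^sub>R e) + (s + - t) *\<^sub>R e)) t :> F' (x + t *\<^sub>R e)"
  using assms[of "x + t *\<^sub>R e"] DERIV_shift[of "\<lambda>s. F ((x + t *\<^sub>R e) + s *\<^sub>R e)" "F' (x + t *\<^sub>R e)" t "- t"] by simp
 then show ?thesis by (simp add: algebra_simps)
qed

lemma integrable_compact_support:
 fixes F :: "'a::euclidean_space \<Rightarrow> real"
 assumes "compact S" "\<And>x. x \<notin> S \<Longrightarrow> F x = 0" "\<And>x. \<bar>F x\<bar> \<le> B" "F \<in> borel_measurable borel"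
 shows "integrable lborel F"
proof (rule Bochner_Integration.integrable_bound)
 have "integrable lborel (\<lambda>x. indicator S x *\<^sub>R B)" by (rule borel_integrable_compact[OF assms(1)]) simp
 then show "integrable lborel (\<lambda>x. indicator S x *\<^sub>R B)" .
 show "AE x in lborel. norm (F x) \<le> norm (indicator S x *\<^sub>R B)"
 proof (rule AE_I2)
  fix x show "norm (F x) \<le> norm (indicator S x *\<^sub>R B)" using assms(2)[of x] assms(3)[of x] by (cases "x \<in> S") auto
 qed
qed (use assms in simp)

lemma integral_directional_deriv_compact:
 fixes F F' :: "'a::euclidean_space \<Rightarrow> real"
 assumes "compact S" "\<And>x. x \<notin> S \<Longrightarrow> F x = 0" "\<And>x. x \<notin> S \<Longrightarrow> F' x = 0"
  and "continuous_on UNIV F"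
  and der: "\<And>x. DERIV (\<lambda>s. F (x + s *\<^sub>R e)) 0 :> F' x"
  and B: "\<And>x. \<bar>F' x\<bar> \<le> B" and meas: "F' \<in> borel_measurable borel"
 shows "(LBINT x. F' x) = 0"
proof -
 \<comment> \<open>If \<open>x + t *\<^sub>R e\<close> lies in \<open>S\<close> for some
   \<open>\<bar>t\<bar> < 1\<close>, then \<open>x\<close> lies in \<open>?T\<close>; one majorant
   supported there serves all these translates.\<close>
 let ?T = "{x + y |x y. x \<in> S \<and> y \<in> cball 0 (norm e)}"
 have T: "compact ?T" by (rule compact_sums[OF assms(1) compact_cball])
 obtain C where C: "\<And>x. x \<in> S \<Longrightarrow> \<bar>F x\<bar> \<le> C"
  using compact_imp_bounded[OF compact_continuous_image[OF continuous_on_subset[OF assms(4) subset_UNIV] assms(1)]]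
  unfolding bounded_iff by auto
 have B0: "0 \<le> B" using B[of 0] by linarith
 show ?thesis
 proof (rule integral_directional_deriv_eq_0[where w = "\<lambda>x. indicator ?T x *\<^sub>R B" and e = e])
  have "\<bar>F x\<bar> \<le> max C 0" for x using C[of x] assms(2)[of x] by (cases "x \<in> S") auto
  then show "integrable lborel F"
   using integrable_compact_support[of S F "max C 0", OF assms(1,2)] borel_measurable_continuous_onI[OF assms(4)] by blast
  show "integrable lborel (\<lambda>x. indicator ?T x *\<^sub>R B)" by (rule borel_integrable_compact[OF T]) simp
  show "AE x in lborel. \<forall>t. \<bar>t\<bar> < 1 \<longrightarrow> DERIV (\<lambda>s. F (x + s *\<^sub>R e)) t :> F' (x + t *\<^sub>R e)"
   using DERIV_shift_line[of F e F', OF der] by blast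
  have "\<bar>F' (x + t *\<^sub>R e)\<bar> \<le> indicator ?T x *\<^sub>R B" if t: "\<bar>t\<bar> < 1" for x t
  proof (cases "x + t *\<^sub>R e \<in> S")
   case True
   have "norm (- t *\<^sub>R e) \<le> norm e" using t by (simp add: mult_left_le_one_le)
   then have "x \<in> ?T" using True by (intro CollectI exI[of _ "x + t *\<^sub>R e"] exI[of _ "- t *\<^sub>R e"]) auto
   then show ?thesis using B by simp
  next
   case False then show ?thesis using assms(3) B0 by (simp add: indicator_def)
  qed
  then show "AE x in lborel. \<forall>t. \<bar>t\<bar> < 1 \<longrightarrow> \<bar>F' (x + t *\<^sub>R e)\<bar> \<le> indicator ?T x *\<^sub>R B" by blast
 qed (rule meas)
qed

lemma AE_zero_continuous:
 fixes f :: "'a::euclidean_space \<Rightarrow> real"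
 assumes "open V" "continuous_on V f" "AE x in lborel. x \<in> V \<longrightarrow> f x = 0" "x \<in> V"
 shows "f x = 0"
proof (rule ccontr)
 assume "f x \<noteq> 0"
 let ?S = "V \<inter> f -` (- {0})"
 have op: "open ?S" by (rule continuous_open_preimage[OF assms(2,1)]) auto
 have "AE x in lborel. x \<notin> ?S" using assms(3) by eventually_elim auto
 moreover have "?S \<in> sets lborel" using op by simp
 ultimately have "?S \<in> null_sets lborel" by (subst AE_iff_null_sets) auto
 then have "negligible ?S" by (simp add: negligible_iff_null_sets null_sets_completionI)
 then show False using open_not_negligible[OF op] \<open>f x \<noteq> 0\<close> assms(4) by auto
qed

lemma DERIV_pos_part_power:
 "DERIV (\<lambda>s::real. (max 0 s) ^ (k + 2)) s :> real (k + 2) * (max 0 s) ^ (k + 1)"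
proof -
 consider "s > 0" | "s < 0" | "s = 0" by linarith
 then show ?thesis
 proof cases
  case 1
  have "DERIV (\<lambda>s::real. s ^ (k + 2)) s :> real (k + 2) * (max 0 s) ^ (k + 1)" using 1 DERIV_pow[of "k + 2" s UNIV] by simp
  then show ?thesis by (rule has_field_derivative_transform_within_open[of _ _ _ "{0<..}"]) (use 1 in auto)
 next
  case 2
  have "DERIV (\<lambda>s::real. 0) s :> real (k + 2) * (max 0 s) ^ (k + 1)" using 2 by simp
  then show ?thesis by (rule has_field_derivative_transform_within_open[of _ _ _ "{..<0}"]) (use 2 in auto)
 next
  case 3
  have "((\<lambda>h::real. (max 0 h) ^ (k + 2) / h) \<longlongrightarrow> 0) (at 0)"
  proof (rule Lim_null_comparison)
   show "\<forall>\<^sub>F h in at 0. norm ((max 0 h) ^ (k + 2) / h) \<le> \<bar>h\<bar> ^ (k + 1)"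
   proof (rule always_eventually, rule allI)
    fix h :: real show "norm ((max 0 h) ^ (k + 2) / h) \<le> \<bar>h\<bar> ^ (k + 1)"
     by (cases "0 \<le> h") (simp_all add: max_def abs_mult mult_nonpos_nonneg)
   qed
   have "((\<lambda>h::real. \<bar>h\<bar> ^ (k + 1)) \<longlongrightarrow> \<bar>0\<bar> ^ (k + 1)) (at 0)" by (intro tendsto_intros)
   then show "((\<lambda>h::real. \<bar>h\<bar> ^ (k + 1)) \<longlongrightarrow> 0) (at 0)" by simp
  qed
  then show ?thesis using 3 by (simp add: has_field_derivative_iff)
 qed
qed

lemma integral_directional_deriv_continuous:
 fixes F F' :: "'a::euclidean_space \<Rightarrow> real"
 assumes S: "compact S" "\<And>x. x \<notin> S \<Longrightarrow> F x = 0"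
  and cont: "continuous_on UNIV F" "continuous_on UNIV F'"
  and der: "\<And>x. DERIV (\<lambda>s. F (x + s *\<^sub>R e)) 0 :> F' x"
 shows "(LBINT x. F' x) = 0" and "integrable lborel F'" and "x \<notin> S \<Longrightarrow> F' x = 0"
proof -
 have z: "F' x = 0" if x: "x \<notin> S" for x
 proof -
  have "open (- S)" using S(1) by (simp add: compact_imp_closed open_Compl)
  then have op: "open ((\<lambda>s::real. x + s *\<^sub>R e) -` (- S))" by (rule open_vimage) (intro continuous_intros)
  have "DERIV (\<lambda>s::real. 0::real) 0 :> 0" by simp
  then have "DERIV (\<lambda>s. F (x + s *\<^sub>R e)) 0 :> 0"
   by (rule has_field_derivative_transform_within_open[OF _ op]) (use x S(2) in \<open>auto simp: vimage_def\<close>)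
  then show ?thesis using der DERIV_unique by blast
 qed
 obtain C where C: "\<And>x. x \<in> S \<Longrightarrow> \<bar>F' x\<bar> \<le> C"
  using compact_imp_bounded[OF compact_continuous_image[OF continuous_on_subset[OF cont(2) subset_UNIV] S(1)]]
  unfolding bounded_iff by auto
 have B: "\<bar>F' x\<bar> \<le> max C 0" for x using C[of x] z[of x] by (cases "x \<in> S") auto
 have m: "F' \<in> borel_measurable borel" by (rule borel_measurable_continuous_onI[OF cont(2)])
 show "(LBINT x. F' x) = 0" by (rule integral_directional_deriv_compact[OF S z cont(1) der B m])
 show "integrable lborel F'" by (rule integrable_compact_support[OF S(1) z B m])
 show "x \<notin> S \<Longrightarrow> F' x = 0" by (rule z)
qed

lemma continuous_on_newton:
 assumes "\<And>i l. continuous_on S (\<lambda>x. A x $ i $ l)"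
 shows "continuous_on S (\<lambda>x. newton (A x) k $ i $ l)"
proof (induction k arbitrary: i l)
 case (Suc k)
 show ?case unfolding newton.simps trace_def matrix_matrix_mult_def vector_minus_component vector_scaleR_component
  by (simp only: vec_lambda_beta) (intro continuous_intros Suc assms, simp)
qed (simp add: mat_def)

lemma continuous_on_dnewton:
 assumes "\<And>i l. continuous_on S (\<lambda>x. A x $ i $ l)" "\<And>i l. continuous_on S (\<lambda>x. B x $ i $ l)"
 shows "continuous_on S (\<lambda>x. dnewton (A x) (B x) k $ i $ l)"
proof (induction k arbitrary: i l)
 case (Suc k)
 show ?case unfolding dnewton.simps trace_def matrix_matrix_mult_def vector_minus_component vector_scaleR_component vector_add_component
  by (simp only: vec_lambda_beta) (intro continuous_intros Suc assms continuous_on_newton)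
qed simp

lemma newton_bounded:
 obtains B' where "\<And>A :: real^'m^'m. (\<And>i l. \<bar>A $ i $ l\<bar> \<le> B) \<Longrightarrow> \<bar>newton A k $ i $ l\<bar> \<le> B'"
proof -
 let ?R = "\<Sum>i\<in>(UNIV::'m set). \<Sum>l\<in>(UNIV::'m set). B"
 have "continuous_on (cball 0 ?R) (\<lambda>A::real^'m^'m. newton A k $ i $ l)" by (rule continuous_on_newton) (intro continuous_intros)
 then obtain B' where B': "\<And>A::real^'m^'m. A \<in> cball 0 ?R \<Longrightarrow> norm (newton A k $ i $ l) \<le> B'"
  by (rule compact_image_bound[rotated]) auto
 then have B': "\<bar>newton A k $ i $ l\<bar> \<le> B'" if "norm A \<le> ?R" for A :: "real^'m^'m" using that by auto
 show thesis
 proof (rule that, rule B')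
  fix A :: "real^'m^'m" assume A: "\<And>i l. \<bar>A $ i $ l\<bar> \<le> B"
  have "norm A \<le> (\<Sum>i\<in>UNIV. norm (A $ i))" unfolding norm_vec_def by (rule L2_set_le_sum) simp
  also have "\<dots> \<le> (\<Sum>i\<in>UNIV. \<Sum>l\<in>UNIV. \<bar>A $ i $ l\<bar>)" by (intro sum_mono norm_le_l1_cart)
  also have "\<dots> \<le> ?R" by (intro sum_mono A)
  finally show "norm A \<le> ?R" .
 qed
qed

section \<open>Mollification with a compactly supported kernel\<close>

definition conv :: "('a::euclidean_space \<Rightarrow> real) \<Rightarrow> ('a \<Rightarrow> real) \<Rightarrow> 'a \<Rightarrow> real" where
 "conv K G x = (LBINT y. K (x - y) * G y)"

lemma integrable_conv:
 fixes K G :: "'a::euclidean_space \<Rightarrow> real"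
 assumes "continuous_on UNIV K" "\<And>x. \<bar>K x\<bar> \<le> B" "integrable lborel G"
 shows "integrable lborel (\<lambda>y. K (x - y) * G y)"
proof (rule Bochner_Integration.integrable_bound)
 show "integrable lborel (\<lambda>y. B * G y)" using assms(3) by simp
 have "0 \<le> B" using assms(2)[of 0] by linarith
 then show "AE y in lborel. norm (K (x - y) * G y) \<le> norm (B * G y)"
  using assms(2) by (intro AE_I2) (simp add: abs_mult mult_right_mono)
 have "continuous_on UNIV (\<lambda>y. K (x - y))" by (rule continuous_on_compose2[OF assms(1)]) (auto intro!: continuous_intros)
 then show "(\<lambda>y. K (x - y) * G y) \<in> borel_measurable lborel"
  using borel_measurable_integrable[OF assms(3)] by (auto intro!: borel_measurable_times dest: borel_measurable_continuous_onI)
qed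

lemma DERIV_conv:
 fixes K K' G :: "'a::euclidean_space \<Rightarrow> real"
 assumes K: "continuous_on UNIV K" "\<And>x. \<bar>K x\<bar> \<le> B"
  and K': "continuous_on UNIV K'" "\<And>x. \<bar>K' x\<bar> \<le> B'"
  and der: "\<And>x. DERIV (\<lambda>s. K (x + s *\<^sub>R e)) 0 :> K' x"
  and G: "integrable lborel G"
 shows "DERIV (\<lambda>s. conv K G (x + s *\<^sub>R e)) 0 :> conv K' G x"
proof -
 have "DERIV (\<lambda>s. LBINT y. K (x + s *\<^sub>R e - y) * G y) 0 :> (LBINT y. K' (x + 0 *\<^sub>R e - y) * G y)"
 proof (rule DERIV_integral[where d = 1 and w = "\<lambda>y. B' * \<bar>G y\<bar>"])
  show "integrable lborel (\<lambda>y. K (x + t *\<^sub>R e - y) * G y)" for t by (rule integrable_conv[OF K G])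
  show "AE y in lborel. \<forall>t. \<bar>t - 0\<bar> < 1 \<longrightarrow> DERIV (\<lambda>s. K (x + s *\<^sub>R e - y) * G y) t :> K' (x + t *\<^sub>R e - y) * G y"
  proof (intro AE_I2 allI impI)
   fix y t
   have "DERIV (\<lambda>s. K ((x - y) + s *\<^sub>R e)) t :> K' ((x - y) + t *\<^sub>R e)" by (rule DERIV_shift_line[OF der])
   then show "DERIV (\<lambda>s. K (x + s *\<^sub>R e - y) * G y) t :> K' (x + t *\<^sub>R e - y) * G y"
    by (intro DERIV_cmult_right) (simp add: algebra_simps)
  qed
  show "AE y in lborel. \<forall>t. \<bar>t - 0\<bar> < 1 \<longrightarrow> \<bar>K' (x + t *\<^sub>R e - y) * G y\<bar> \<le> B' * \<bar>G y\<bar>"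
   using K'(2) by (intro AE_I2) (simp add: abs_mult mult_right_mono)
  show "integrable lborel (\<lambda>y. B' * \<bar>G y\<bar>)" using G by simp
  show "(\<lambda>y. K' (x + 0 *\<^sub>R e - y) * G y) \<in> borel_measurable lborel"
   by (rule borel_measurable_integrable[OF integrable_conv[OF K' G]])
 qed simp
 then show ?thesis by (simp add: conv_def)
qed

lemma continuous_on_conv:
 fixes K G :: "'a::euclidean_space \<Rightarrow> real"
 assumes K: "continuous_on UNIV K" "\<And>x. \<bar>K x\<bar> \<le> B" and G: "integrable lborel G"
 shows "continuous_on UNIV (conv K G)" unfolding continuous_on_sequentially
proof (intro ballI allI impI, elim conjE)
 fix u :: "nat \<Rightarrow> 'a" and x :: 'a assume u: "u \<longlonglongrightarrow> x"
 show "(conv K G \<circ> u) \<longlonglongrightarrow> conv K G x" unfolding comp_def conv_def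
 proof (rule integral_dominated_convergence[where w = "\<lambda>y. B * \<bar>G y\<bar>"])
  show "AE y in lborel. (\<lambda>i. K (u i - y) * G y) \<longlonglongrightarrow> K (x - y) * G y"
  proof (rule AE_I2)
   fix y
   have "(\<lambda>i. K (u i - y)) \<longlonglongrightarrow> K (x - y)" by (rule continuous_on_tendsto_compose[OF K(1)]) (auto intro!: tendsto_intros u)
   then show "(\<lambda>i. K (u i - y) * G y) \<longlonglongrightarrow> K (x - y) * G y" by (intro tendsto_intros)
  qed
  show "AE y in lborel. norm (K (u i - y) * G y) \<le> B * \<bar>G y\<bar>" for i
   using K(2) by (intro AE_I2) (simp add: abs_mult mult_right_mono)
 qed (use G borel_measurable_integrable[OF integrable_conv[OF K G]] in auto)
qed

text \<open>The fourth power leaves two continuous derivatives, with the closed forms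
  \<open>bump'\<close> and \<open>bump''\<close>: the first moves the gradient onto the kernel, the
  second differentiates the mollified Hessian.\<close>

definition bump :: "real \<Rightarrow> real^'m \<Rightarrow> real" where
 "bump r y = (max 0 (r\<^sup>2 - y \<bullet> y)) ^ 4"

definition bump' :: "real \<Rightarrow> 'm \<Rightarrow> real^'m \<Rightarrow> real" where
 "bump' r m y = - 8 * y $ m * (max 0 (r\<^sup>2 - y \<bullet> y)) ^ 3"

definition bump'' :: "real \<Rightarrow> 'm \<Rightarrow> 'm \<Rightarrow> real^'m \<Rightarrow> real" where
 "bump'' r i m y = (if i = m then - 8 * (max 0 (r\<^sup>2 - y \<bullet> y)) ^ 3 else 0) + 48 * y $ i * y $ m * (max 0 (r\<^sup>2 - y \<bullet> y)) ^ 2"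

lemma DERIV_inner_line:
 "DERIV (\<lambda>s. (y + s *\<^sub>R axis m 1) \<bullet> (y + s *\<^sub>R axis m 1)) 0 :> 2 * (y :: real^'m) $ m"
proof -
 have eq: "(y + s *\<^sub>R axis m 1) \<bullet> (y + s *\<^sub>R axis m 1) = y \<bullet> y + 2 * s * y $ m + s\<^sup>2" for s
  by (simp add: inner_add_left inner_add_right inner_axis inner_axis' power2_eq_square algebra_simps)
 show ?thesis unfolding eq by (auto intro!: derivative_eq_intros)
qed

lemma DERIV_bump:
 "DERIV (\<lambda>s. bump r (y + s *\<^sub>R axis m 1)) 0 :> bump' r m y"
proof -
 have "DERIV (\<lambda>s. r\<^sup>2 - (y + s *\<^sub>R axis m 1) \<bullet> (y + s *\<^sub>R axis m 1)) 0 :> - (2 * y $ m)"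
  using DERIV_diff[OF DERIV_const[of "r\<^sup>2"] DERIV_inner_line[of y m]] by simp
 from DERIV_chain2[OF DERIV_pos_part_power[of 2] this]
 show ?thesis by (simp add: bump_def bump'_def mult_ac)
qed

lemma DERIV_bump':
 "DERIV (\<lambda>s. bump' r m (y + s *\<^sub>R axis i 1)) 0 :> bump'' r i m y"
proof -
 have "DERIV (\<lambda>s. r\<^sup>2 - (y + s *\<^sub>R axis i 1) \<bullet> (y + s *\<^sub>R axis i 1)) 0 :> - (2 * y $ i)"
  using DERIV_diff[OF DERIV_const[of "r\<^sup>2"] DERIV_inner_line[of y i]] by simp
 from DERIV_chain2[OF DERIV_pos_part_power[of 1] this]
 have 1: "DERIV (\<lambda>s. (max 0 (r\<^sup>2 - (y + s *\<^sub>R axis i 1) \<bullet> (y + s *\<^sub>R axis i 1))) ^ 3) 0 :> - 6 * y $ i * (max 0 (r\<^sup>2 - y \<bullet> y)) ^ 2" by (simp add: mult_ac numeral_3_eq_3 numeral_2_eq_2)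
 have 2: "DERIV (\<lambda>s. - 8 * (y + s *\<^sub>R axis i 1) $ m) 0 :> (if i = m then - 8 else 0)"
  by (auto simp: axis_def intro!: derivative_eq_intros)
 show ?thesis unfolding bump'_def by (rule DERIV_cong[OF DERIV_mult[OF 2 1]]) (simp add: bump''_def)
qed

lemma bump_zero: "r \<le> norm y \<Longrightarrow> 0 \<le> r \<Longrightarrow> bump r y = 0 \<and> bump' r m y = 0 \<and> bump'' r i m y = 0"
proof -
 assume "r \<le> norm y" "0 \<le> r"
 then have "r\<^sup>2 \<le> y \<bullet> y" by (simp add: power2_norm_eq_inner[symmetric] power_mono)
 then show ?thesis by (simp add: bump_def bump'_def bump''_def max_def)
qed

lemma continuous_bump: "continuous_on S (bump r)" "continuous_on S (bump' r m)" "continuous_on S (bump'' r i m)"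
proof -
 show "continuous_on S (bump r)" unfolding bump_def[abs_def] by (intro continuous_intros)
 show "continuous_on S (bump' r m)" unfolding bump'_def[abs_def] by (intro continuous_intros)
 show "continuous_on S (bump'' r i m)" unfolding bump''_def[abs_def] by (cases "i = m"; simp; intro continuous_intros)
qed

lemma bounded_compact_support:
 fixes K :: "'a::euclidean_space \<Rightarrow> real"
 assumes "continuous_on UNIV K" "\<And>y. r \<le> norm y \<Longrightarrow> K y = 0"
 obtains B where "\<And>y. \<bar>K y\<bar> \<le> B"
proof -
 obtain B where "\<And>y. y \<in> cball 0 r \<Longrightarrow> norm (K y) \<le> B"
  using compact_image_bound[OF compact_cball continuous_on_subset[OF assms(1) subset_UNIV], of 0 r] by metis
 then have B: "\<bar>K y\<bar> \<le> B" if "norm y \<le> r" for y using that by auto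
 have "\<bar>K y\<bar> \<le> max B 0" for y using B[of y] assms(2)[of y] by (cases "norm y \<le> r") auto
 then show thesis by (rule that)
qed

lemma integral_bump:
 assumes "0 < r"
 shows "integrable lborel (bump r :: real^'m \<Rightarrow> real)" and "0 < (LBINT y. bump r (y :: real^'m))"
proof -
 obtain B where B: "\<And>y::real^'m. \<bar>bump r y\<bar> \<le> B"
  using bounded_compact_support[OF continuous_bump(1), of r] bump_zero assms by (metis less_imp_le)
 have z: "bump r y = 0" if "y \<notin> cball 0 r" for y :: "real^'m" using that bump_zero[of r y] assms by auto
 show int: "integrable lborel (bump r :: real^'m \<Rightarrow> real)" by (rule integrable_compact_support[OF compact_cball[of 0 r] z B])
    (auto intro!: borel_measurable_continuous_onI continuous_bump)
 have nn: "0 \<le> bump r y" for y :: "real^'m" by (simp add: bump_def)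
 have "(LBINT y. bump r (y :: real^'m)) \<noteq> 0"
 proof
  assume "(LBINT y. bump r (y :: real^'m)) = 0"
  then have "AE y::real^'m in lborel. bump r y = 0" using integral_nonneg_eq_0_iff_AE[OF int] nn by simp
  then have "bump r (0::real^'m) = 0" by (intro AE_zero_continuous[of UNIV "bump r" 0]) (auto intro: continuous_bump)
  then show False using assms by (simp add: bump_def)
 qed
 moreover have "0 \<le> (LBINT y. bump r (y :: real^'m))" using nn by simp
 ultimately show "0 < (LBINT y. bump r (y :: real^'m))" by simp
qed

text \<open>The entries of \<open>A\<close> need not be differentiable, so \<open>A\<close> is mollified first.\<close>
lemma newton_weak_div_free:
 fixes g :: "real^'m \<Rightarrow> real^'m" and A :: "real^'m \<Rightarrow> real^'m^'m" and \<phi> :: "real^'m \<Rightarrow> real"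
 assumes V: "open V" and S: "compact S" "S \<subseteq> V"
  and g: "\<And>x. x \<in> V \<Longrightarrow> (g has_derivative (\<lambda>v. A x *v v)) (at x)"
  and A: "continuous_on V A" and sym: "\<And>x. x \<in> V \<Longrightarrow> transpose (A x) = A x"
  and \<phi>0: "\<And>x. x \<notin> S \<Longrightarrow> \<phi> x = 0" and \<phi>c: "continuous_on UNIV \<phi>"
  and \<phi>': "\<And>x i. DERIV (\<lambda>s. \<phi> (x + s *\<^sub>R axis i 1)) 0 :> \<phi>' i x"
  and \<phi>'c: "\<And>i. continuous_on UNIV (\<phi>' i)"
 shows "(LBINT x. (\<Sum>i\<in>UNIV. newton (A x) k $ i $ l * \<phi>' i x)) = 0"
proof -
 have "S \<inter> - V = {}" using S by auto
 then obtain d where d: "0 < d" "\<And>x y. x \<in> S \<Longrightarrow> y \<notin> V \<Longrightarrow> d \<le> dist x y"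
  using separate_compact_closed[OF S(1), of "- V"] V by (metis ComplI closed_Compl)
 \<comment> \<open>A compact neighbourhood of \<open>S\<close> inside \<open>V\<close>: balls of
   radius at most d/2 about points of \<open>S\<close> stay where \<open>g\<close> and
   \<open>A\<close> are controlled.\<close>
 define S1 where "S1 = {x + y |x y. x \<in> S \<and> y \<in> cball 0 (d / 2)}"
 have S1c: "compact S1" unfolding S1_def by (rule compact_sums[OF S(1) compact_cball])
 have S1V: "S1 \<subseteq> V"
 proof
  fix z assume "z \<in> S1"
  then obtain x y where "z = x + y" "x \<in> S" "norm y \<le> d / 2" by (auto simp: S1_def)
  then show "z \<in> V" using d(2)[of x z] d(1) by (force simp: dist_norm)
 qed
 have inS1: "y \<in> S1" if "x \<in> S" "dist x y \<le> d / 2" for x y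
  unfolding S1_def using that by (intro CollectI exI[of _ x] exI[of _ "y - x"]) (auto simp: dist_norm norm_minus_commute)
 have gc: "continuous_on V g" by (rule has_derivative_continuous_on) (use g has_derivative_at_withinI in blast)
 define G where "G l y = indicator S1 y *\<^sub>R (g y $ l)" for l y
 have Gi: "integrable lborel (G l)" for l unfolding G_def[abs_def]
  by (rule borel_integrable_compact[OF S1c]) (intro continuous_intros continuous_on_subset[OF gc S1V])
 define c where "c r = (LBINT y. bump r (y :: real^'m))" for r
 \<comment> \<open>\<open>Aq r\<close> is the derivative of the mollified field with the
   differentiation put on the kernel, hence continuously differentiable although \<open>A\<close> is
   only continuous; \<open>C r i\<close> is its i-th partial derivative.\<close>
 define Aq where "Aq r x = (\<chi> m l. conv (bump' r m) (G l) x / c r)" for r x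
 define C where "C r i x = (\<chi> m l. conv (bump'' r i m) (G l) x / c r)" for r i x
 have Aent: "continuous_on V (\<lambda>x. A x $ i $ l)" for i l by (intro continuous_intros A)
 obtain BA where BA: "\<And>x i l. x \<in> S1 \<Longrightarrow> \<bar>A x $ i $ l\<bar> \<le> BA"
 proof -
  have "\<exists>B. \<forall>x\<in>S1. \<bar>A x $ i $ l\<bar> \<le> B" for i l
   using compact_imp_bounded[OF compact_continuous_image[OF continuous_on_subset[OF Aent S1V] S1c]]
   unfolding bounded_iff by auto
  then obtain B where B: "\<And>i l x. x \<in> S1 \<Longrightarrow> \<bar>A x $ i $ l\<bar> \<le> B i l" by metis
  have "B i l \<le> Max (range (\<lambda>(i, l). B i l))" for i l by (rule Max_ge) auto
  then show thesis using that B by (meson order_trans)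
 qed
 have bounds: "\<exists>B. \<forall>y::real^'m. \<bar>bump r y\<bar> \<le> B" "\<exists>B. \<forall>y. \<bar>bump' r m y\<bar> \<le> B" "\<exists>B. \<forall>y. \<bar>bump'' r i m y\<bar> \<le> B"
  if "0 < r" for r and i m :: 'm
  using bounded_compact_support[OF continuous_bump(1), of r r] bounded_compact_support[OF continuous_bump(2), of r r m]
   bounded_compact_support[OF continuous_bump(3), of r r i m] bump_zero[of r] that by (meson less_imp_le)+
 have cnz: "c r \<noteq> 0" if "0 < r" for r using integral_bump(2)[OF that, where 'm = 'm] unfolding c_def by linarith
 have Aq_cont: "continuous_on UNIV (\<lambda>x. Aq r x $ m $ l)" if "0 < r" for r m l using bounds(2)[OF that, of m] unfolding Aq_def
  by (auto intro!: continuous_intros continuous_on_conv continuous_bump Gi simp: cnz that)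
 have C_cont: "continuous_on UNIV (\<lambda>x. C r i x $ m $ l)" if "0 < r" for r i m l using bounds(3)[OF that, of i m] unfolding C_def
  by (auto intro!: continuous_intros continuous_on_conv continuous_bump Gi simp: cnz that)
 have Aq_der: "DERIV (\<lambda>s. Aq r (x + s *\<^sub>R axis i 1) $ m $ l) 0 :> C r i x $ m $ l" if r: "0 < r" for r x i m l
 proof -
  obtain B B' where "\<And>y. \<bar>bump' r m y\<bar> \<le> B" "\<And>y. \<bar>bump'' r i m y\<bar> \<le> B'"
   using bounds(2)[OF r, of m] bounds(3)[OF r, of i m] by blast
  from DERIV_conv[OF continuous_bump(2) this(1) continuous_bump(3) this(2) DERIV_bump' Gi]
  show ?thesis unfolding Aq_def C_def by (auto intro: DERIV_cdivide)
 qed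
 \<comment> \<open>Close to \<open>S\<close>, integration by parts moves the derivative back to
   \<open>g\<close>: there \<open>Aq r\<close> is a weighted average of \<open>A\<close>, hence
   symmetric and close to \<open>A\<close>. The ball of radius 2 r about x stays in
   \<open>S1\<close> because d/8 + 2 d/8 < d/2.\<close>
 have Aq_eq: "Aq r x $ m $ l = (LBINT y. bump r (x - y) * (indicator S1 y *\<^sub>R A y $ m $ l)) / c r"
  if r: "0 < r" "r < d / 8" and x: "infdist x S \<le> d / 8" "S \<noteq> {}" for r x m l
 proof -
  obtain x0 where x0: "x0 \<in> S" "dist x x0 \<le> d / 8"
   using infdist_attains_inf[OF compact_imp_closed[OF S(1)] x(2), of x] x(1) by metis
  have near: "y \<in> S1" if "dist y x < 2 * r" for y
  proof (rule inS1[OF x0(1)])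
   have "dist x0 y \<le> dist x x0 + dist y x" by (metis dist_commute dist_triangle2)
   then show "dist x0 y \<le> d / 2" using that r x0 by linarith
  qed
  let ?F = "\<lambda>y. bump r (x - y) * G l y"
  let ?F' = "\<lambda>y. - bump' r m (x - y) * G l y + bump r (x - y) * (indicator S1 y *\<^sub>R A y $ m $ l)"
  have fz: "bump r (x - y) = 0 \<and> bump' r m (x - y) = 0" if "r < dist y x" for y
   using bump_zero[of r "x - y"] that r by (simp add: dist_norm norm_minus_commute)
  have opB: "open (ball x (2 * r))" "open (- cball x r)" by (auto simp: open_Compl)
  have cover: "ball x (2 * r) \<union> - cball x r = UNIV" using r by (auto simp: subset_eq)
  have glue: "continuous_on UNIV H" if "continuous_on (ball x (2 * r)) H" "\<And>y. r < dist y x \<Longrightarrow> H y = 0" for H :: "real^'m \<Rightarrow> real"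
  proof -
   have "continuous_on (- cball x r) H" by (rule continuous_on_eq[of _ "\<lambda>_. 0"]) (use that(2) in \<open>auto simp: dist_commute\<close>)
   then show ?thesis using continuous_on_open_Un[OF opB that(1)] cover by simp
  qed
  have gb: "G l y = g y $ l" if "y \<in> ball x (2 * r)" for y l using near[of y] that by (simp add: G_def dist_commute)
  have bV: "ball x (2 * r) \<subseteq> V" using near S1V by (auto simp: dist_commute)
  have bc: "continuous_on T (\<lambda>y. bump r (x - y))" "continuous_on T (\<lambda>y. bump' r m (x - y))" for T
   by (rule continuous_on_compose2[OF continuous_bump(1)[of UNIV]] continuous_on_compose2[OF continuous_bump(2)[of UNIV]]; auto intro!: continuous_intros)+
  have F: "continuous_on UNIV ?F"
  proof (rule glue)
   have "continuous_on (ball x (2 * r)) (\<lambda>y. bump r (x - y) * g y $ l)"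
    by (intro continuous_intros bc continuous_on_subset[OF gc bV])
   then show "continuous_on (ball x (2 * r)) ?F" by (rule continuous_on_eq) (simp add: gb)
  qed (simp add: fz)
  have F': "continuous_on UNIV ?F'"
  proof (rule glue)
   have "continuous_on (ball x (2 * r)) (\<lambda>y. - bump' r m (x - y) * g y $ l + bump r (x - y) * A y $ m $ l)"
    by (intro continuous_intros bc continuous_on_subset[OF gc bV] continuous_on_subset[OF A bV])
   then show "continuous_on (ball x (2 * r)) ?F'" by (rule continuous_on_eq) (use near in \<open>simp add: gb dist_commute\<close>)
  qed (simp add: fz)
  have der: "DERIV (\<lambda>s. ?F (y + s *\<^sub>R axis m 1)) 0 :> ?F' y" for y
  proof -
   have line: "open ((\<lambda>s. y + s *\<^sub>R axis m (1::real)) -` T)" if "open T" for T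
    by (rule open_vimage[OF that]) (intro continuous_intros)
   consider "y \<in> ball x (2 * r)" | "y \<in> - cball x r" using cover by blast
   then show ?thesis
   proof cases
    case 1
    then have yV: "y \<in> V" using bV by blast
    have "((\<lambda>s. y + s *\<^sub>R axis m (1::real)) has_derivative (\<lambda>s. s *\<^sub>R axis m 1)) (at 0)"
     by (auto intro!: derivative_eq_intros)
    from has_derivative_compose[OF this, of g "\<lambda>v. A y *v v"] g[OF yV]
    have "((\<lambda>s. g (y + s *\<^sub>R axis m 1)) has_derivative (\<lambda>s. A y *v (s *\<^sub>R axis m 1))) (at 0)" by simp
    then have "((\<lambda>s. g (y + s *\<^sub>R axis m 1) $ l) has_derivative (\<lambda>s. (A y *v (s *\<^sub>R axis m 1)) $ l)) (at 0)"
     by (rule bounded_linear.has_derivative[OF bounded_linear_vec_nth])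
    moreover have "(A y *v (s *\<^sub>R axis m 1)) $ l = A y $ m $ l * s" for s using arg_cong[OF sym[OF yV], of "\<lambda>M. M $ m $ l"]
     by (simp add: matrix_vector_mult_scaleR matrix_vector_mult_basis column_def transpose_def)
    ultimately have dg: "DERIV (\<lambda>s. g (y + s *\<^sub>R axis m 1) $ l) 0 :> A y $ m $ l" by (simp add: has_field_derivative_def)
    have db: "DERIV (\<lambda>s. bump r (x - (y + s *\<^sub>R axis m 1))) 0 :> - bump' r m (x - y)"
    proof -
     have "DERIV (\<lambda>s. bump r ((x - y) + s *\<^sub>R axis m 1)) (- 0) :> bump' r m (x - y)" using DERIV_bump[of r "x - y" m] by simp
     from DERIV_mirror[THEN iffD1, OF this] show ?thesis by (simp add: algebra_simps)
    qed
    have "DERIV (\<lambda>s. bump r (x - (y + s *\<^sub>R axis m 1)) * g (y + s *\<^sub>R axis m 1) $ l) 0 :> ?F' y"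
     by (rule DERIV_cong[OF DERIV_mult[OF db dg]]) (use near[of y] 1 in \<open>simp add: gb dist_commute\<close>)
    then show ?thesis by (rule has_field_derivative_transform_within_open[OF _ line[OF opB(1)]]) (use 1 in \<open>auto simp: gb\<close>)
   next
    case 2
    have "DERIV (\<lambda>s. 0) 0 :> ?F' y" using 2 fz[of y] by (simp add: dist_commute)
    then show ?thesis
     by (rule has_field_derivative_transform_within_open[OF _ line[OF opB(2)]]) (use 2 fz in \<open>auto simp: dist_commute\<close>)
   qed
  qed
  have I: "(LBINT y. ?F' y) = 0"
   by (rule integral_directional_deriv_continuous(1)[OF compact_cball[of x r] _ F F' der]) (use fz in \<open>auto simp: dist_commute\<close>)
  obtain B B' where BB: "\<And>y::real^'m. \<bar>bump r y\<bar> \<le> B" "\<And>y. \<bar>bump' r m y\<bar> \<le> B'" using bounds(1)[OF r(1)] bounds(2)[OF r(1), of m] by blast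
  have Ai: "integrable lborel (\<lambda>y. indicator S1 y *\<^sub>R A y $ m $ l)"
   using borel_integrable_compact[OF S1c continuous_on_subset[OF Aent[of m l] S1V]] by simp
  note i1 = integrable_conv[OF continuous_bump(2) BB(2) Gi, of x l] and i2 = integrable_conv[OF continuous_bump(1) BB(1) Ai, of x]
  have "(LBINT y. bump r (x - y) * (indicator S1 y *\<^sub>R A y $ m $ l)) - (LBINT y. bump' r m (x - y) * G l y) = (LBINT y. ?F' y)"
   using Bochner_Integration.integral_diff[OF i2 i1] by (simp add: algebra_simps)
  then show ?thesis using I by (simp add: Aq_def conv_def)
 qed
 show ?thesis
 proof (cases "S = {}")
  case True
  then have "\<phi>' i x = 0" for i x using integral_directional_deriv_continuous(3)[OF S(1) \<phi>0 \<phi>c \<phi>'c \<phi>', of x i] by simp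
  then show ?thesis by simp
 next
  case False
  have \<phi>'0: "\<phi>' i x = 0" if "x \<notin> S" for i x
   using integral_directional_deriv_continuous(3)[OF S(1) \<phi>0 \<phi>c \<phi>'c \<phi>', of x i] that by simp
  \<comment> \<open>For the mollified tensor the product rule holds classically, and its divergence
    vanishes on \<open>S\<close> by \<open>dnewton_div_free\<close>.\<close>
  have sm: "(LBINT x. (\<Sum>i\<in>UNIV. newton (Aq r x) k $ i $ l * \<phi>' i x)) = 0" if r: "0 < r" "r < d / 8" for r
  proof -
   let ?D = "\<lambda>i x. dnewton (Aq r x) (C r i x) k $ i $ l * \<phi> x + newton (Aq r x) k $ i $ l * \<phi>' i x"
   have der: "DERIV (\<lambda>s. newton (Aq r (x + s *\<^sub>R axis i 1)) k $ i $ l * \<phi> (x + s *\<^sub>R axis i 1)) 0 :> ?D i x" for x i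
   proof -
    have "mderiv (\<lambda>s. Aq r (x + s *\<^sub>R axis i 1)) (C r i x) 0" unfolding mderiv_def using Aq_der[OF r(1)] by blast
    from mderiv_newton[OF this, of k]
    have "DERIV (\<lambda>s. newton (Aq r (x + s *\<^sub>R axis i 1)) k $ i $ l) 0 :> dnewton (Aq r x) (C r i x) k $ i $ l"
     unfolding mderiv_def by simp
    from DERIV_mult[OF this \<phi>'[of x i]] show ?thesis by (simp add: mult_ac add_ac)
   qed
   have c1: "continuous_on UNIV (\<lambda>x. newton (Aq r x) k $ i $ l)" for i by (rule continuous_on_newton[OF Aq_cont[OF r(1)]])
   have c2: "continuous_on UNIV (\<lambda>x. dnewton (Aq r x) (C r i x) k $ i $ l)" for i
    by (rule continuous_on_dnewton[OF Aq_cont[OF r(1)] C_cont[OF r(1)]])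
   have I: "(LBINT x. ?D i x) = 0" "integrable lborel (?D i)" for i
    by (rule integral_directional_deriv_continuous[OF S(1), of "\<lambda>x. newton (Aq r x) k $ i $ l * \<phi> x" _ "axis i 1"],
      use \<phi>0 in simp, intro continuous_intros c1 \<phi>c, intro continuous_intros c1 c2 \<phi>c \<phi>'c, rule der)+
   \<comment> \<open>Symmetry of \<open>Aq r\<close> holds on a whole neighbourhood of
     \<open>x\<close>, so it passes to the partial derivative.\<close>
   have Csym: "C r i x $ m $ l' = C r i x $ l' $ m" if x: "x \<in> S" for i x m l'
   proof -
    have Asym: "Aq r z $ m $ l' = Aq r z $ l' $ m" if z: "infdist z S \<le> d / 8" for z
    proof -
     have e: "indicator S1 y *\<^sub>R A y $ m $ l' = indicator S1 y *\<^sub>R A y $ l' $ m" for y :: "real^'m"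
     proof (cases "y \<in> S1")
      case True
      then have "transpose (A y) = A y" using sym S1V by blast
      then have "transpose (A y) $ m $ l' = A y $ m $ l'" by simp
      then show ?thesis by (simp add: transpose_def)
     qed simp
     show ?thesis unfolding Aq_eq[OF r z False] e ..
    qed
    let ?U = "(\<lambda>s. x + s *\<^sub>R axis i (1::real)) -` {z. infdist z S < d / 8}"
    have "open {z. infdist z S < d / 8}" by (intro open_Collect_less continuous_intros)
    then have op: "open ?U" by (rule open_vimage) (intro continuous_intros)
    have "DERIV (\<lambda>s. Aq r (x + s *\<^sub>R axis i 1) $ l' $ m) 0 :> C r i x $ m $ l'"
     by (rule has_field_derivative_transform_within_open[OF Aq_der[OF r(1)] op]) (use x d(1) Asym in auto)
    then show ?thesis using Aq_der[OF r(1)] DERIV_unique by blast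
   qed
   have C1: "C r i x $ m $ l' = C r m x $ i $ l'" for i x m l'
   proof -
    have "bump'' r i m = (bump'' r m i :: real^'m \<Rightarrow> real)" by (rule ext) (simp add: bump''_def mult_ac)
    then show ?thesis by (simp add: C_def)
   qed
   have zero: "(\<Sum>i\<in>UNIV. dnewton (Aq r x) (C r i x) k $ i $ l) * \<phi> x = 0" for x
   proof (cases "x \<in> S")
    case True
    then show ?thesis using dnewton_div_free[of "\<lambda>i. C r i x", OF C1 Csym[OF True]] by simp
   qed (simp add: \<phi>0)
   have "(\<Sum>i\<in>UNIV. ?D i x) = (\<Sum>i\<in>UNIV. newton (Aq r x) k $ i $ l * \<phi>' i x)" for x
    using zero[of x] by (simp add: sum.distrib sum_distrib_right)
   then show ?thesis using Bochner_Integration.integral_sum[of UNIV lborel ?D] I by simp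
  qed
  \<comment> \<open>Radii tending to 0; the factor 9 keeps them below the d/8 that
    \<open>Aq_eq\<close> asks for.\<close>
  define R where "R q = d / (9 * (real q + 1))" for q
  have R: "0 < R q" "R q < d / 8" for q
  proof -
   show "0 < R q" using d(1) by (simp add: R_def)
   have "d / (9 * (real q + 1)) \<le> d / 9" using d(1) by (intro divide_left_mono) auto
   then show "R q < d / 8" using d(1) by (simp add: R_def)
  qed
  have R0: "R \<longlonglongrightarrow> 0" unfolding R_def[abs_def] by real_asymp
  have c_pos: "0 < c (R q)" for q using integral_bump(2)[OF R(1)] by (simp add: c_def)
  have cint: "(LBINT y. bump (R q) (x - y)) = c (R q)" "integrable lborel (\<lambda>y. bump (R q) (x - y))" for q and x :: "real^'m"
  proof -
   show "(LBINT y. bump (R q) (x - y)) = c (R q)" unfolding c_def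
    by (rule integral_lborel_reflect) (intro borel_measurable_continuous_onI continuous_bump)
   then show "integrable lborel (\<lambda>y. bump (R q) (x - y))" using c_pos[of q] not_integrable_integral_eq by force
  qed
  \<comment> \<open>Used twice: with \<open>a = 0\<close> it gives a bound uniform in
    \<open>q\<close>, with \<open>a = A x $ m $ l\<close> it gives convergence.\<close>
  have conv_est: "\<bar>Aq (R q) x $ m $ l - a\<bar> \<le> e"
   if x: "x \<in> S" and e: "\<And>y. y \<in> S1 \<Longrightarrow> dist y x < R q \<Longrightarrow> \<bar>A y $ m $ l - a\<bar> \<le> e" for q x m l a e
  proof -
   have infd: "infdist x S \<le> d / 8" using x d(1) by simp
   have Ai: "integrable lborel (\<lambda>y. indicator S1 y *\<^sub>R A y $ m $ l)"
    using borel_integrable_compact[OF S1c continuous_on_subset[OF Aent[of m l] S1V]] by simp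
   obtain B where BB: "\<And>y::real^'m. \<bar>bump (R q) y\<bar> \<le> B" using bounds(1)[OF R(1)[of q]] by blast
   note i2 = integrable_conv[OF continuous_bump(1) BB Ai, of x]
   have i3: "integrable lborel (\<lambda>y. bump (R q) (x - y) * a)" using cint(2) by simp
   have "(Aq (R q) x $ m $ l - a) * c (R q) = (LBINT y. bump (R q) (x - y) * (indicator S1 y *\<^sub>R A y $ m $ l) - bump (R q) (x - y) * a)"
    unfolding Bochner_Integration.integral_diff[OF i2 i3]
    using c_pos[of q] by (simp add: Aq_eq[OF R infd False] cint left_diff_distrib)
   moreover have "\<bar>\<dots>\<bar> \<le> (LBINT y. bump (R q) (x - y) * e)"
   proof (rule order_trans[OF integral_abs_bound], rule integral_mono)
    show "integrable lborel (\<lambda>y. \<bar>bump (R q) (x - y) * (indicator S1 y *\<^sub>R A y $ m $ l) - bump (R q) (x - y) * a\<bar>)"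
     using Bochner_Integration.integrable_diff[OF i2 i3] by (rule integrable_abs)
    show "integrable lborel (\<lambda>y. bump (R q) (x - y) * e)" using cint(2) by simp
    fix y
    show "\<bar>bump (R q) (x - y) * (indicator S1 y *\<^sub>R A y $ m $ l) - bump (R q) (x - y) * a\<bar> \<le> bump (R q) (x - y) * e"
    proof (cases "dist y x < R q")
     case True
     then have y: "y \<in> S1" using inS1[OF x, of y] R(2)[of q] d(1) by (simp add: dist_commute)
     have "0 \<le> bump (R q) (x - y)" by (simp add: bump_def)
     then show ?thesis using e[OF y True] y by (simp add: abs_mult mult_left_mono flip: right_diff_distrib)
    next
     case False
     then show ?thesis using bump_zero[of "R q" "x - y"] R(1)[of q] by (simp add: dist_norm norm_minus_commute)
    qed
   qed
   ultimately have "\<bar>(Aq (R q) x $ m $ l - a) * c (R q)\<bar> \<le> (LBINT y. bump (R q) (x - y) * e)" by (simp only:)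
   then have "\<bar>Aq (R q) x $ m $ l - a\<bar> * c (R q) \<le> e * c (R q)" using c_pos[of q] by (simp add: cint abs_mult mult.commute)
   then show ?thesis using c_pos[of q] by simp
  qed
  have lim: "(\<lambda>q. Aq (R q) x $ m $ l) \<longlonglongrightarrow> A x $ m $ l" if x: "x \<in> S" for x m l
  proof (rule LIMSEQ_I)
   fix e :: real assume e: "0 < e"
   have "x \<in> V" using x S by blast
   then have "isCont (\<lambda>x. A x $ m $ l) x" using Aent V by (simp add: continuous_on_eq_continuous_at)
   then obtain \<delta> where \<delta>: "0 < \<delta>" "\<And>y. dist y x < \<delta> \<Longrightarrow> \<bar>A y $ m $ l - A x $ m $ l\<bar> < e / 2"
    using e unfolding continuous_at_eps_delta dist_real_def by (metis half_gt_zero)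
   obtain N where N: "\<And>q. N \<le> q \<Longrightarrow> R q < \<delta>" using order_tendstoD(2)[OF R0 \<delta>(1)] by (auto simp: eventually_sequentially)
   have "norm (Aq (R q) x $ m $ l - A x $ m $ l) < e" if "N \<le> q" for q
   proof -
    have "\<bar>Aq (R q) x $ m $ l - A x $ m $ l\<bar> \<le> e / 2"
    proof (rule conv_est[OF x])
     fix y assume "dist y x < R q"
     then show "\<bar>A y $ m $ l - A x $ m $ l\<bar> \<le> e / 2" using \<delta>(2)[of y] N[OF that] by simp
    qed
    then show ?thesis using e by simp
   qed
   then show "\<exists>N. \<forall>q\<ge>N. norm (Aq (R q) x $ m $ l - A x $ m $ l) < e" by blast
  qed
  have bd: "\<bar>Aq (R q) x $ m $ l\<bar> \<le> BA" if x: "x \<in> S" for q x m l using conv_est[OF x, of q m l 0 BA] BA by simp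
  obtain B' where B': "\<And>i M :: real^'m^'m. (\<And>i l. \<bar>M $ i $ l\<bar> \<le> BA) \<Longrightarrow> \<bar>newton M k $ i $ l\<bar> \<le> B' i"
  proof -
   have "\<exists>B'. \<forall>M :: real^'m^'m. (\<forall>i l. \<bar>M $ i $ l\<bar> \<le> BA) \<longrightarrow> \<bar>newton M k $ i $ l\<bar> \<le> B'" for i
    using newton_bounded[of BA k i l] by metis
   then show thesis using that by metis
  qed
  have \<phi>'i: "integrable lborel (\<phi>' i)" for i using integral_directional_deriv_continuous(2)[OF S(1) \<phi>0 \<phi>c \<phi>'c \<phi>'] by blast
  have B'0: "0 \<le> B' i" for i
  proof -
   obtain x where "x \<in> S" using False by blast
   then have "\<bar>newton (Aq (R 0) x) k $ i $ l\<bar> \<le> B' i" using B' bd by blast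
   then show ?thesis by linarith
  qed
  have "(\<lambda>q. LBINT x. (\<Sum>i\<in>UNIV. newton (Aq (R q) x) k $ i $ l * \<phi>' i x)) \<longlonglongrightarrow>
   (LBINT x. (\<Sum>i\<in>UNIV. newton (A x) k $ i $ l * \<phi>' i x))"
  proof (rule integral_dominated_convergence[where w = "\<lambda>x. \<Sum>i\<in>UNIV. B' i * \<bar>\<phi>' i x\<bar>"])
   have mS: "(\<lambda>x. indicator S x *\<^sub>R (\<Sum>i\<in>UNIV. newton (A x) k $ i $ l * \<phi>' i x)) \<in> borel_measurable lborel"
    by (rule borel_measurable_integrable, rule borel_integrable_compact[OF S(1)])
      (intro continuous_intros continuous_on_newton continuous_on_subset[OF Aent S(2)] continuous_on_subset[OF \<phi>'c subset_UNIV])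
   have "(\<lambda>x. indicator S x *\<^sub>R (\<Sum>i\<in>UNIV. newton (A x) k $ i $ l * \<phi>' i x)) = (\<lambda>x. \<Sum>i\<in>UNIV. newton (A x) k $ i $ l * \<phi>' i x)"
   proof (rule ext)
    fix x show "indicator S x *\<^sub>R (\<Sum>i\<in>UNIV. newton (A x) k $ i $ l * \<phi>' i x) = (\<Sum>i\<in>UNIV. newton (A x) k $ i $ l * \<phi>' i x)"
     by (cases "x \<in> S") (simp_all add: \<phi>'0)
   qed
   then show "(\<lambda>x. \<Sum>i\<in>UNIV. newton (A x) k $ i $ l * \<phi>' i x) \<in> borel_measurable lborel" using mS by simp
   have "continuous_on UNIV (\<lambda>x. \<Sum>i\<in>UNIV. newton (Aq (R q) x) k $ i $ l * \<phi>' i x)" for q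
    by (intro continuous_intros continuous_on_newton Aq_cont R \<phi>'c)
   then show "(\<lambda>x. \<Sum>i\<in>UNIV. newton (Aq (R q) x) k $ i $ l * \<phi>' i x) \<in> borel_measurable lborel" for q
    using borel_measurable_continuous_onI by fastforce
   show "integrable lborel (\<lambda>x. \<Sum>i\<in>UNIV. B' i * \<bar>\<phi>' i x\<bar>)" using \<phi>'i by simp
   show "AE x in lborel. (\<lambda>q. \<Sum>i\<in>UNIV. newton (Aq (R q) x) k $ i $ l * \<phi>' i x) \<longlonglongrightarrow> (\<Sum>i\<in>UNIV. newton (A x) k $ i $ l * \<phi>' i x)"
   proof (intro AE_I2 tendsto_sum)
    fix x i
    show "(\<lambda>q. newton (Aq (R q) x) k $ i $ l * \<phi>' i x) \<longlonglongrightarrow> newton (A x) k $ i $ l * \<phi>' i x"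
    proof (cases "x \<in> S")
     case True
     have "(\<lambda>q. Aq (R q) x) \<longlonglongrightarrow> A x" using lim[OF True] by (intro vec_tendstoI)
     moreover have "continuous_on UNIV (\<lambda>M::real^'m^'m. newton M k $ i $ l)"
      by (rule continuous_on_newton) (intro continuous_intros)
     ultimately have "(\<lambda>q. newton (Aq (R q) x) k $ i $ l) \<longlonglongrightarrow> newton (A x) k $ i $ l"
      by (intro continuous_on_tendsto_compose[of UNIV "\<lambda>M::real^'m^'m. newton M k $ i $ l"]) auto
     then show ?thesis by (rule tendsto_mult[OF _ tendsto_const])
    qed (simp add: \<phi>'0)
   qed
   show "AE x in lborel. norm (\<Sum>i\<in>UNIV. newton (Aq (R q) x) k $ i $ l * \<phi>' i x) \<le> (\<Sum>i\<in>UNIV. B' i * \<bar>\<phi>' i x\<bar>)" for q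
   proof (intro AE_I2 sum_norm_le)
    fix x i
    show "norm (newton (Aq (R q) x) k $ i $ l * \<phi>' i x) \<le> B' i * \<bar>\<phi>' i x\<bar>"
    proof (cases "x \<in> S")
     case True
     have "\<bar>newton (Aq (R q) x) k $ i $ l\<bar> \<le> B' i" by (rule B') (rule bd[OF True])
     then show ?thesis by (simp add: abs_mult mult_right_mono)
    qed (simp add: \<phi>'0)
   qed
  qed
  moreover have "(LBINT x. (\<Sum>i\<in>UNIV. newton (Aq (R q) x) k $ i $ l * \<phi>' i x)) = 0" for q by (rule sm[OF R])
  ultimately show ?thesis by (simp add: LIMSEQ_const_iff)
 qed
qed

section \<open>The one-homogeneous extension of a function on the cap\<close>

text \<open>The second difference of \<open>h\<close> over a parallelogram with sides s a and s b is
  symmetric in \<open>a\<close> and \<open>b\<close>, and two mean value steps express it, in either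
  order, by \<open>B\<close> at a nearby point. Continuity of \<open>B\<close> at \<open>x\<close>
  identifies the two values.\<close>

lemma symmetric_hessian:
 fixes h :: "real^'m \<Rightarrow> real" and g :: "real^'m \<Rightarrow> real^'m" and B :: "real^'m \<Rightarrow> real^'m^'m"
 assumes V: "open V" "x \<in> V"
  and h: "\<And>x. x \<in> V \<Longrightarrow> (h has_derivative (\<lambda>v. g x \<bullet> v)) (at x)"
  and g: "\<And>x. x \<in> V \<Longrightarrow> (g has_derivative (\<lambda>v. B x *v v)) (at x)"
  and B: "continuous_on V B"
 shows "transpose (B x) = B x"
proof -
 have key: "\<exists>y. norm (y - x) \<le> s * (norm a + norm b) \<and>
   h (x + s *\<^sub>R a + s *\<^sub>R b) - h (x + s *\<^sub>R a) - h (x + s *\<^sub>R b) + h x = s\<^sup>2 * ((B y *v b) \<bullet> a)"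
  if s: "0 < s" and sub: "\<And>y. norm (y - x) \<le> s * (norm a + norm b) \<Longrightarrow> y \<in> V" for s a b
 proof -
  have nrm: "norm (p *\<^sub>R a + q *\<^sub>R b) \<le> s * (norm a + norm b)" if "0 \<le> p" "p \<le> s" "0 \<le> q" "q \<le> s" for p q
  proof -
   have "norm (p *\<^sub>R a + q *\<^sub>R b) \<le> p * norm a + q * norm b" using that by (intro order_trans[OF norm_triangle_ineq]) simp
   also have "\<dots> \<le> s * norm a + s * norm b" using that by (intro add_mono mult_right_mono) auto
   finally show ?thesis by (simp add: distrib_left)
  qed
  have inV: "x + p *\<^sub>R a + q *\<^sub>R b \<in> V" if "0 \<le> p" "p \<le> s" "0 \<le> q" "q \<le> s" for p q
   using sub[of "x + p *\<^sub>R a + q *\<^sub>R b"] nrm[OF that] by (simp add: add.assoc)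
  have dh: "DERIV (\<lambda>p. h (x + p *\<^sub>R a + q *\<^sub>R b)) p :> g (x + p *\<^sub>R a + q *\<^sub>R b) \<bullet> a"
   if "0 \<le> p" "p \<le> s" "0 \<le> q" "q \<le> s" for p q
  proof -
   have "((\<lambda>p. x + p *\<^sub>R a + q *\<^sub>R b) has_derivative (\<lambda>u. u *\<^sub>R a)) (at p)" by (auto intro!: derivative_eq_intros)
   from has_derivative_compose[OF this h[OF inV[OF that]]] show ?thesis by (intro has_derivative_mult_imp_DERIV) simp
  qed
  have "\<exists>p. 0 < p \<and> p < s \<and> (h (x + s *\<^sub>R a + s *\<^sub>R b) - h (x + s *\<^sub>R a + 0 *\<^sub>R b)) - (h (x + 0 *\<^sub>R a + s *\<^sub>R b) - h (x + 0 *\<^sub>R a + 0 *\<^sub>R b)) =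
    (s - 0) * (g (x + p *\<^sub>R a + s *\<^sub>R b) \<bullet> a - g (x + p *\<^sub>R a + 0 *\<^sub>R b) \<bullet> a)"
   by (rule MVT2[OF s]) (intro DERIV_diff dh; use s in simp)
  then obtain p where p: "0 < p" "p < s"
   "h (x + s *\<^sub>R a + s *\<^sub>R b) - h (x + s *\<^sub>R a) - h (x + s *\<^sub>R b) + h x = s * (g (x + p *\<^sub>R a + s *\<^sub>R b) \<bullet> a - g (x + p *\<^sub>R a + 0 *\<^sub>R b) \<bullet> a)"
   by auto
  have dg: "DERIV (\<lambda>q. g (x + p *\<^sub>R a + q *\<^sub>R b) \<bullet> a) q :> (B (x + p *\<^sub>R a + q *\<^sub>R b) *v b) \<bullet> a"
   if "0 \<le> q" "q \<le> s" for q
  proof -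
   have 1: "((\<lambda>q. x + p *\<^sub>R a + q *\<^sub>R b) has_derivative (\<lambda>u. u *\<^sub>R b)) (at q)" by (auto intro!: derivative_eq_intros)
   have "x + p *\<^sub>R a + q *\<^sub>R b \<in> V" using inV[of p q] p that by simp
   from has_derivative_inner_left[OF has_derivative_compose[OF 1 g[OF this]], of a] show ?thesis
    by (intro has_derivative_mult_imp_DERIV) (simp add: matrix_vector_mult_scaleR)
  qed
  obtain q where q: "0 < q" "q < s" "g (x + p *\<^sub>R a + s *\<^sub>R b) \<bullet> a - g (x + p *\<^sub>R a + 0 *\<^sub>R b) \<bullet> a = (s - 0) * ((B (x + p *\<^sub>R a + q *\<^sub>R b) *v b) \<bullet> a)"
   using MVT2[OF s, of "\<lambda>q. g (x + p *\<^sub>R a + q *\<^sub>R b) \<bullet> a" "\<lambda>q. (B (x + p *\<^sub>R a + q *\<^sub>R b) *v b) \<bullet> a"] dg by auto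
  show ?thesis using p q nrm[of p q] by (intro exI[of _ "x + p *\<^sub>R a + q *\<^sub>R b"]) (simp add: add.assoc power2_eq_square)
 qed
 have "(B x *v b) \<bullet> a = (B x *v a) \<bullet> b" for a b
 proof (rule ccontr)
  assume ne: "\<not> ?thesis"
  define e where "e = \<bar>(B x *v b) \<bullet> a - (B x *v a) \<bullet> b\<bar> / 3"
  have e: "0 < e" using ne by (simp add: e_def)
  have c: "continuous_on V (\<lambda>y. (B y *v u) \<bullet> w)" for u w unfolding matrix_vector_mult_def by (intro continuous_intros B)
  have "\<exists>d>0. \<forall>y. dist y x < d \<longrightarrow> \<bar>(B y *v u) \<bullet> w - (B x *v u) \<bullet> w\<bar> < e" for u w
   using c[of u w] V e by (simp add: continuous_on_eq_continuous_at continuous_at_eps_delta dist_real_def)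
  then obtain d1 d2 where d: "0 < d1" "0 < d2" "\<And>y. dist y x < d1 \<Longrightarrow> \<bar>(B y *v b) \<bullet> a - (B x *v b) \<bullet> a\<bar> < e"
   "\<And>y. dist y x < d2 \<Longrightarrow> \<bar>(B y *v a) \<bullet> b - (B x *v a) \<bullet> b\<bar> < e" by metis
  obtain d3 where d3: "0 < d3" "ball x d3 \<subseteq> V" using V openE by blast
  define D where "D = min d1 (min d2 d3)"
  have D: "0 < D" using d d3 by (simp add: D_def)
  define s where "s = D / (2 * (norm a + norm b + 1))"
  have L: "0 < norm a + norm b + 1" by (simp add: add_nonneg_pos)
  have s: "0 < s" using D L by (simp add: s_def)
  have sD: "s * (norm a + norm b) < D"
  proof -
   have "s * (norm a + norm b) \<le> s * (norm a + norm b + 1)" using s by simp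
   also have "\<dots> = D / 2" using L by (simp add: s_def field_simps)
   finally show ?thesis using D by simp
  qed
  have sub: "y \<in> V" if "norm (y - x) \<le> s * (norm a + norm b)" for y
   using d3(2) that sD by (auto simp: D_def dist_norm norm_minus_commute subset_eq)
  obtain y where y: "norm (y - x) \<le> s * (norm a + norm b)"
    "h (x + s *\<^sub>R a + s *\<^sub>R b) - h (x + s *\<^sub>R a) - h (x + s *\<^sub>R b) + h x = s\<^sup>2 * ((B y *v b) \<bullet> a)" using key[OF s sub] by blast
  obtain z where z: "norm (z - x) \<le> s * (norm b + norm a)"
    "h (x + s *\<^sub>R b + s *\<^sub>R a) - h (x + s *\<^sub>R b) - h (x + s *\<^sub>R a) + h x = s\<^sup>2 * ((B z *v a) \<bullet> b)"
   using key[OF s, of b a] sub by (auto simp: add.commute)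
  have "h (x + s *\<^sub>R b + s *\<^sub>R a) = h (x + s *\<^sub>R a + s *\<^sub>R b)" by (simp add: add_ac)
  then have "s\<^sup>2 * ((B y *v b) \<bullet> a) = s\<^sup>2 * ((B z *v a) \<bullet> b)" using y(2) z(2) by linarith
  then have "(B y *v b) \<bullet> a = (B z *v a) \<bullet> b" using s by simp
  moreover have "\<bar>(B y *v b) \<bullet> a - (B x *v b) \<bullet> a\<bar> < e" using d(3)[of y] y(1) sD by (simp add: dist_norm D_def)
  moreover have "\<bar>(B z *v a) \<bullet> b - (B x *v a) \<bullet> b\<bar> < e" using d(4)[of z] z(1) sD by (simp add: dist_norm D_def add.commute)
  ultimately show False using e unfolding e_def by argo
 qed
 then have "(B x *v axis i 1) \<bullet> axis l 1 = (B x *v axis l 1) \<bullet> axis i 1" for i l by blast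
 then have "B x $ l $ i = B x $ i $ l" for i l by (simp add: inner_axis matrix_vector_mult_basis column_def)
 then show ?thesis by (simp add: transpose_def vec_eq_iff)
qed

lemma Ck_on_2_hessian:
 fixes h :: "real^'m \<Rightarrow> real"
 assumes "open U" "Ck_on 2 U h"
 obtains dh B where "\<And>x. x \<in> U \<Longrightarrow> (h has_derivative (\<lambda>v. dh x \<bullet> v)) (at x)"
  "\<And>x. x \<in> U \<Longrightarrow> (dh has_derivative (\<lambda>v. B x *v v)) (at x)"
  "continuous_on U (B :: real^'m \<Rightarrow> real^'m^'m)" "\<And>x. x \<in> U \<Longrightarrow> transpose (B x) = B x"
proof -
 have C: "h differentiable (at x)" "(\<lambda>x. frechet_derivative h (at x) v) differentiable (at x)"
  "continuous_on U (\<lambda>x. frechet_derivative (\<lambda>x. frechet_derivative h (at x) v) (at x) w)" if "x \<in> U" for x v w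
  using assms(2) that by (auto simp: numeral_2_eq_2)
 have lin: "f v = (\<chi> i. f (axis i 1)) \<bullet> v" if "linear f" for f :: "real^'m \<Rightarrow> real" and v
 proof -
  have "f v = f (\<Sum>i\<in>UNIV. v $ i *\<^sub>R axis i 1)" by (simp add: basis_expansion flip: scalar_mult_eq_scaleR)
  also have "\<dots> = (\<Sum>i\<in>UNIV. v $ i * f (axis i 1))" using that by (simp add: linear_sum linear_scale)
  finally show ?thesis by (simp add: inner_vec_def mult.commute)
 qed
 define dh where "dh x = (\<chi> i. frechet_derivative h (at x) (axis i 1))" for x
 define B where "B x = (\<chi> l i. frechet_derivative (\<lambda>x. frechet_derivative h (at x) (axis l 1)) (at x) (axis i 1))" for x
 have 1: "(h has_derivative (\<lambda>v. dh x \<bullet> v)) (at x)" if "x \<in> U" for x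
 proof -
  have hd: "(h has_derivative frechet_derivative h (at x)) (at x)" using C(1)[OF that] by (simp only: frechet_derivative_works)
  have "frechet_derivative h (at x) = (\<lambda>v. dh x \<bullet> v)"
   by (rule ext) (simp add: dh_def lin[OF has_derivative_linear[OF hd], symmetric])
  then show ?thesis using hd by simp
 qed
 have 2: "(dh has_derivative (\<lambda>v. B x *v v)) (at x)" if "x \<in> U" for x unfolding has_derivative_componentwise_within[of dh]
 proof
  fix b :: "real^'m" assume "b \<in> Basis"
  then obtain l where b: "b = axis l 1" by (auto simp: Basis_vec_def)
  let ?f = "\<lambda>x. frechet_derivative h (at x) (axis l 1)"
  have hd: "(?f has_derivative frechet_derivative ?f (at x)) (at x)" using C(2)[OF that] by (simp only: frechet_derivative_works)
  have "frechet_derivative ?f (at x) = (\<lambda>v. (B x *v v) \<bullet> b)"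
  proof
   fix v show "frechet_derivative ?f (at x) v = (B x *v v) \<bullet> b"
    using lin[OF has_derivative_linear[OF hd], of v] by (simp add: B_def b inner_axis matrix_vector_mult_def inner_vec_def[of "vec_lambda _"])
  qed
  moreover have "(\<lambda>x. dh x \<bullet> b) = ?f" by (simp add: b dh_def inner_axis)
  ultimately show "((\<lambda>x. dh x \<bullet> b) has_derivative (\<lambda>v. (B x *v v) \<bullet> b)) (at x)" using hd by simp
 qed
 have 3: "continuous_on U B" unfolding B_def[abs_def] by (rule continuous_on_vec_lambda)+ (cases "U = {}"; use C(3) in auto)
 show thesis by (rule that[OF 1 2 3 symmetric_hessian[OF assms(1) _ 1 2 3]])
qed

text \<open>The cone over the cap with the centre moved to the origin: a unit vector \<nu>
  corresponds to \<open>\<nu> + cap_center j \<theta>\<close>, whose last coordinate is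
  \<open>\<nu> $ j - cos \<theta>\<close>.\<close>

definition cone :: "'m::finite \<Rightarrow> real \<Rightarrow> (real^'m) set" where
 "cone j \<theta> = {x. x \<noteq> 0 \<and> cos \<theta> * norm x \<le> x $ j}"

text \<open>The interface between the cap and all later analysis: a one-homogeneous function with
  continuous Hessian on an open, dilation invariant neighbourhood \<open>V\<close> of the cone, so
  that derivatives at boundary points are full derivatives. The assumption \<open>bdry\<close> is
  the Robin condition.\<close>

locale cap_ext =
 fixes j :: "'m::finite" and \<theta> :: real and V :: "(real^'m) set" and H :: "real^'m \<Rightarrow> real"
  and g :: "real^'m \<Rightarrow> real^'m" and A :: "real^'m \<Rightarrow> real^'m^'m"
 assumes \<theta>: "0 < \<theta>" "\<theta> < pi"
  and openV: "open V" and coneV: "cone j \<theta> \<subseteq> V" and V0: "0 \<notin> V"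
  and H: "x \<in> V \<Longrightarrow> (H has_derivative (\<lambda>v. g x \<bullet> v)) (at x)"
  and g: "x \<in> V \<Longrightarrow> (g has_derivative (\<lambda>v. A x *v v)) (at x)"
  and A: "continuous_on V A"
  and sym: "x \<in> V \<Longrightarrow> transpose (A x) = A x"
  and euler: "x \<in> V \<Longrightarrow> g x \<bullet> x = H x" "x \<in> V \<Longrightarrow> A x *v x = 0"
  and homV: "x \<in> V \<Longrightarrow> 0 < t \<Longrightarrow> t *\<^sub>R x \<in> V"
  and homH: "x \<in> V \<Longrightarrow> 0 < t \<Longrightarrow> H (t *\<^sub>R x) = t * H x"
  and homg: "x \<in> V \<Longrightarrow> 0 < t \<Longrightarrow> g (t *\<^sub>R x) = g x"
  and homA: "x \<in> V \<Longrightarrow> 0 < t \<Longrightarrow> A (t *\<^sub>R x) = (1 / t) *\<^sub>R A x"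
  and bdry: "x \<in> cone j \<theta> \<Longrightarrow> x $ j = cos \<theta> * norm x \<Longrightarrow> g x $ j = 0"

lemma cap_center_nth: "cap_center j \<theta> $ j = - cos \<theta>" by (simp add: cap_center_def e_vec_def)

lemma cap_normal:
 assumes "\<xi> \<in> cap j \<theta>"
 shows "norm (sph_normal j \<theta> \<xi>) = 1" "sph_normal j \<theta> \<xi> \<in> cone j \<theta>" "sgn (sph_normal j \<theta> \<xi>) = sph_normal j \<theta> \<xi>"
  "sph_normal j \<theta> \<xi> $ j = \<xi> $ j + cos \<theta>"
proof -
 show 1: "norm (sph_normal j \<theta> \<xi>) = 1" using assms by (simp add: cap_def sph_normal_def)
 show 2: "sph_normal j \<theta> \<xi> $ j = \<xi> $ j + cos \<theta>" by (simp add: sph_normal_def cap_center_nth)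
 show "sph_normal j \<theta> \<xi> \<in> cone j \<theta>" using assms 1 2 by (auto simp: cone_def cap_def)
 show "sgn (sph_normal j \<theta> \<xi>) = sph_normal j \<theta> \<xi>" using 1 by (simp add: sgn_div_norm)
qed

lemma cone_cap: "x \<in> cone j \<theta> \<Longrightarrow> sgn x + cap_center j \<theta> \<in> cap j \<theta>"
 by (auto simp: cone_def cap_def cap_center_nth sgn_div_norm field_simps)

lemma has_derivative_sgn:
 fixes x :: "real^'m"
 assumes "x \<noteq> 0"
 shows "(sgn has_derivative (\<lambda>v. (1 / norm x) *\<^sub>R (v - (sgn x \<bullet> v) *\<^sub>R sgn x))) (at x)"
proof -
 have "((\<lambda>x. inverse (norm x) *\<^sub>R x) has_derivative
   (\<lambda>v. inverse (norm x) *\<^sub>R v + (- (inverse (norm x) * (sgn x \<bullet> v) * inverse (norm x))) *\<^sub>R x)) (at x)"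
 proof -
  have n: "(norm has_derivative (\<lambda>v. sgn x \<bullet> v)) (at x)" using has_derivative_norm[OF assms] by (simp add: inner_commute)
  have "((\<lambda>x. inverse (norm x)) has_derivative (\<lambda>v. - (inverse (norm x) * (sgn x \<bullet> v) * inverse (norm x)))) (at x)"
   by (rule Deriv.has_derivative_inverse[OF _ n]) (use assms in simp)
  from has_derivative_scaleR[OF this has_derivative_ident] show ?thesis .
 qed
 moreover have "inverse (norm x) *\<^sub>R v + (- (inverse (norm x) * (sgn x \<bullet> v) * inverse (norm x))) *\<^sub>R x =
   (1 / norm x) *\<^sub>R (v - (sgn x \<bullet> v) *\<^sub>R sgn x)" for v
 proof -
  have "(- (inverse (norm x) * (sgn x \<bullet> v) * inverse (norm x))) *\<^sub>R x =
    - ((inverse (norm x) * (sgn x \<bullet> v)) *\<^sub>R (inverse (norm x) *\<^sub>R x))" by (simp only: scaleR_scaleR scaleR_minus_left)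
  also have "inverse (norm x) *\<^sub>R x = sgn x" by (simp add: sgn_div_norm)
  finally show ?thesis by (simp only: scaleR_diff_right divide_inverse mult_1 scaleR_scaleR diff_conv_add_uminus scaleR_minus_right scaleR_add_right)
 qed
 ultimately have "((\<lambda>x. inverse (norm x) *\<^sub>R x) has_derivative (\<lambda>v. (1 / norm x) *\<^sub>R (v - (sgn x \<bullet> v) *\<^sub>R sgn x))) (at x)"
  by simp
 then show ?thesis by (simp add: sgn_div_norm[abs_def])
qed

lemma has_derivative_sph_exp:
 fixes \<nu> X c :: "real^'m"
 shows "((\<lambda>t. c + cos (t * a) *\<^sub>R \<nu> + (sin (t * a) / a) *\<^sub>R X) has_derivative
   (\<lambda>s. s *\<^sub>R (- (a * sin (t * a)) *\<^sub>R \<nu> + (if a = 0 then 0 else cos (t * a)) *\<^sub>R X))) (at t)"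
 by (auto intro!: derivative_eq_intros simp: algebra_simps)

text \<open>The great circle in \<open>sph_exp\<close> has at time 0 an acceleration of
  \<open>- (X \<bullet> X)\<close> times the normal, which adds the gradient term to the Euclidean
  Hessian.\<close>

lemma sph_hess_quad_eq:
 fixes h :: "real^'m \<Rightarrow> real"
 assumes U: "open U" "\<xi> \<in> U"
  and h: "\<And>x. x \<in> U \<Longrightarrow> (h has_derivative (\<lambda>v. dh x \<bullet> v)) (at x)"
  and dh: "\<And>x. x \<in> U \<Longrightarrow> (dh has_derivative (\<lambda>v. B x *v v)) (at x)"
 shows "sph_hess_quad j \<theta> h \<xi> X = X \<bullet> (B \<xi> *v X) - (X \<bullet> X) * (dh \<xi> \<bullet> sph_normal j \<theta> \<xi>)"
proof (cases "X = 0")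
 case True
 then show ?thesis by (simp add: sph_hess_quad_def)
next
 case False
 define a where "a = norm X"
 have a: "a \<noteq> 0" using False by (simp add: a_def)
 define \<nu> where "\<nu> = sph_normal j \<theta> \<xi>"
 define \<gamma> where "\<gamma> t = cap_center j \<theta> + cos (t * a) *\<^sub>R \<nu> + (sin (t * a) / a) *\<^sub>R X" for t
 define \<gamma>' where "\<gamma>' t = - (a * sin (t * a)) *\<^sub>R \<nu> + cos (t * a) *\<^sub>R X" for t
 \<comment> \<open>At \<open>t = 0\<close> the quotient in \<open>sph_exp\<close> is a division by
   zero and multiplies the zero vector; for \<open>t < 0\<close> the oddness of the sine removes the
   sign.\<close>
 have eq: "sph_exp j \<theta> \<xi> (t *\<^sub>R X) = \<gamma> t" for t
  by (cases t "0::real" rule: linorder_cases) (simp_all add: sph_exp_def \<gamma>_def a_def \<nu>_def)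
 have \<gamma>d: "(\<gamma> has_derivative (\<lambda>s. s *\<^sub>R \<gamma>' t)) (at t)" for t
  using has_derivative_sph_exp[of "cap_center j \<theta>" a \<nu> X t] a unfolding \<gamma>_def[abs_def] \<gamma>'_def by simp
 have \<gamma>'d: "(\<gamma>' has_derivative (\<lambda>s. s *\<^sub>R (- (a\<^sup>2 * cos (t * a)) *\<^sub>R \<nu> - (a * sin (t * a)) *\<^sub>R X))) (at t)" for t
  unfolding \<gamma>'_def[abs_def] by (auto intro!: derivative_eq_intros simp: algebra_simps power2_eq_square)
 have \<gamma>0: "\<gamma> 0 = \<xi>" by (simp add: \<gamma>_def \<nu>_def sph_normal_def)
 have \<gamma>'0: "\<gamma>' 0 = X" by (simp add: \<gamma>'_def)
 have d1: "DERIV (\<lambda>t. h (\<gamma> t)) t :> dh (\<gamma> t) \<bullet> \<gamma>' t" if "\<gamma> t \<in> U" for t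
  using has_derivative_compose[OF \<gamma>d h[OF that]] by (intro has_derivative_mult_imp_DERIV) simp
 have "isCont \<gamma> 0" by (rule has_derivative_continuous[OF \<gamma>d])
 then have ev: "\<forall>\<^sub>F t in nhds 0. \<gamma> t \<in> U"
  using topological_tendstoD[of \<gamma> "\<gamma> 0" "at 0" U] U \<gamma>0 by (simp add: isCont_def eventually_nhds_conv_at)
 have e2: "\<forall>\<^sub>F t in nhds 0. deriv (\<lambda>t. h (\<gamma> t)) t = dh (\<gamma> t) \<bullet> \<gamma>' t" using ev by eventually_elim (rule DERIV_imp_deriv[OF d1])
 have "((\<lambda>t. dh (\<gamma> t) \<bullet> \<gamma>' t) has_derivative
   (\<lambda>s. dh (\<gamma> 0) \<bullet> (s *\<^sub>R (- (a\<^sup>2 * cos (0 * a)) *\<^sub>R \<nu> - (a * sin (0 * a)) *\<^sub>R X)) + (B (\<gamma> 0) *v (s *\<^sub>R \<gamma>' 0)) \<bullet> \<gamma>' 0)) (at 0)"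
  using U by (intro has_derivative_inner has_derivative_compose[OF \<gamma>d dh] \<gamma>'d) (simp add: \<gamma>0)
 then have "DERIV (\<lambda>t. dh (\<gamma> t) \<bullet> \<gamma>' t) 0 :> (X \<bullet> (B \<xi> *v X) - a\<^sup>2 * (dh \<xi> \<bullet> \<nu>))"
  by (intro has_derivative_mult_imp_DERIV) (simp add: \<gamma>0 \<gamma>'0 matrix_vector_mult_scaleR algebra_simps inner_commute)
 then have "deriv (\<lambda>t. dh (\<gamma> t) \<bullet> \<gamma>' t) 0 = X \<bullet> (B \<xi> *v X) - a\<^sup>2 * (dh \<xi> \<bullet> \<nu>)" by (rule DERIV_imp_deriv)
 then show ?thesis unfolding sph_hess_quad_def eq deriv_cong_ev[OF e2 refl] by (simp add: a_def \<nu>_def power2_norm_eq_inner)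
qed

text \<open>Homogeneity forces the radial component of the gradient to be \<open>h\<close> itself,
  so the radial part of \<open>dh\<close> is replaced. The Hessian becomes the tangential
  compression of s I + B divided by the norm, where s = h - dh \<bullet> \<nu>; by
  \<open>sph_hess_quad_eq\<close> this is the matrix of \<open>W_quad\<close> at unit
  vectors.\<close>

lemma cap_ext_exists:
 fixes h :: "real^'m \<Rightarrow> real"
 assumes \<theta>: "0 < \<theta>" "\<theta> < pi" and h: "Ck_set 2 (cap j \<theta>) h"
  and robin: "\<forall>\<xi>\<in>cap_boundary j \<theta>. frechet_derivative h (at \<xi>) (conormal j \<theta> \<xi>) = cot \<theta> * h \<xi>"
 obtains V g A where "cap_ext j \<theta> V (\<lambda>x. norm x * h (sgn x + cap_center j \<theta>)) g A"
  "\<And>\<xi> X. \<xi> \<in> cap j \<theta> \<Longrightarrow> X \<bullet> sph_normal j \<theta> \<xi> = 0 \<Longrightarrow> W_quad j \<theta> h \<xi> X = X \<bullet> (A (sph_normal j \<theta> \<xi>) *v X)"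
proof -
 obtain U where U: "open U" "cap j \<theta> \<subseteq> U" "Ck_on 2 U h" using h by (auto simp: Ck_set_def)
 obtain dh B where dh: "\<And>x. x \<in> U \<Longrightarrow> (h has_derivative (\<lambda>v. dh x \<bullet> v)) (at x)"
  and B: "\<And>x. x \<in> U \<Longrightarrow> (dh has_derivative (\<lambda>v. B x *v v)) (at x)"
  and Bc: "continuous_on U B" and Bs: "\<And>x. x \<in> U \<Longrightarrow> transpose (B x) = B x" using Ck_on_2_hessian[OF U(1,3)] by blast
 let ?c = "cap_center j \<theta>"
 let ?\<pi> = "\<lambda>x. sgn x + ?c"
 define V where "V = {x. x \<noteq> 0 \<and> ?\<pi> x \<in> U}"
 define s where "s x = h (?\<pi> x) - sgn x \<bullet> dh (?\<pi> x)" for x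
 define g where "g x = s x *\<^sub>R sgn x + dh (?\<pi> x)" for x
 define P where "P x = (\<chi> i l. (if i = l then 1 else 0) - sgn x $ i * sgn x $ l)" for x :: "real^'m"
 define A where "A x = (1 / norm x) *\<^sub>R (s x *\<^sub>R P x + P x ** B (?\<pi> x) ** P x)" for x
 let ?H = "\<lambda>x. norm x * h (?\<pi> x)"
 have Pv: "P x *v v = v - (sgn x \<bullet> v) *\<^sub>R sgn x" for x v
 proof -
  have "(\<Sum>l\<in>UNIV. ((if i = l then 1 else 0) - sgn x $ i * sgn x $ l) * v $ l) =
    (\<Sum>l\<in>UNIV. if i = l then v $ l else 0) - sgn x $ i * (\<Sum>l\<in>UNIV. sgn x $ l * v $ l)" for i
   unfolding sum_distrib_left sum_subtractf[symmetric] by (intro sum.cong) (auto simp: algebra_simps)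
  then show ?thesis by (simp add: P_def vec_eq_iff matrix_vector_mult_def inner_vec_def mult.commute)
 qed
 have PT: "transpose (P x) = P x" for x by (simp add: P_def transpose_def vec_eq_iff mult.commute eq_commute)
 have Av: "A x *v v = (1 / norm x) *\<^sub>R (s x *\<^sub>R (P x *v v) + P x *v (B (?\<pi> x) *v (P x *v v)))" for x v
  by (simp add: A_def matrix_vector_mult_add_rdistrib scaleR_matrix_vector_assoc[symmetric] matrix_vector_mul_assoc matrix_mul_assoc)
 have cs: "continuous_on (- {0}) (sgn :: real^'m \<Rightarrow> real^'m)" unfolding sgn_div_norm[abs_def] by (intro continuous_intros) auto
 have oV: "open V"
 proof -
  have "open (- {0} \<inter> ?\<pi> -` U)" by (rule continuous_open_preimage) (use U in \<open>auto intro!: continuous_intros cs\<close>)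
  moreover have "V = - {0} \<inter> ?\<pi> -` U" by (auto simp: V_def)
  ultimately show ?thesis by simp
 qed
 have dpi: "(?\<pi> has_derivative (\<lambda>v. (1 / norm x) *\<^sub>R (P x *v v))) (at x)" if "x \<in> V" for x
  unfolding Pv using has_derivative_add_const[OF has_derivative_sgn[of x], of ?c] that by (simp add: V_def)
 have inU: "?\<pi> x \<in> U" "x \<noteq> 0" if "x \<in> V" for x using that by (auto simp: V_def)
 have unit: "sgn x \<bullet> sgn x = 1" if "x \<noteq> 0" for x :: "real^'m" using that by (simp add: norm_sgn flip: power2_norm_eq_inner)
 have nx: "norm x *\<^sub>R sgn x = x" for x :: "real^'m" by (cases "x = 0") (simp_all add: sgn_div_norm)
 have xs: "sgn x \<bullet> x = norm x" for x :: "real^'m"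
  by (cases "x = 0") (simp_all add: sgn_div_norm dot_square_norm power2_eq_square)
 have dhpi: "((\<lambda>x. h (?\<pi> x)) has_derivative (\<lambda>v. dh (?\<pi> x) \<bullet> ((1 / norm x) *\<^sub>R (P x *v v)))) (at x)" if "x \<in> V" for x
  by (rule has_derivative_compose[OF dpi[OF that] dh[OF inU(1)[OF that]]])
 have dBpi: "((\<lambda>x. dh (?\<pi> x)) has_derivative (\<lambda>v. B (?\<pi> x) *v ((1 / norm x) *\<^sub>R (P x *v v)))) (at x)" if "x \<in> V" for x
  by (rule has_derivative_compose[OF dpi[OF that] B[OF inU(1)[OF that]]])
 have dsgn: "(sgn has_derivative (\<lambda>v. (1 / norm x) *\<^sub>R (P x *v v))) (at x)" if "x \<in> V" for x
  unfolding Pv using has_derivative_sgn[OF inU(2)[OF that]] .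
 have HD: "(?H has_derivative (\<lambda>v. g x \<bullet> v)) (at x)" if x: "x \<in> V" for x
 proof -
  have "(?H has_derivative (\<lambda>v. norm x * (dh (?\<pi> x) \<bullet> ((1 / norm x) *\<^sub>R (P x *v v))) + (sgn x \<bullet> v) * h (?\<pi> x))) (at x)"
   using has_derivative_mult[OF has_derivative_norm[OF inU(2)[OF x]] dhpi[OF x]] by (simp add: inner_commute)
  moreover have "norm x * (dh (?\<pi> x) \<bullet> ((1 / norm x) *\<^sub>R (P x *v v))) + (sgn x \<bullet> v) * h (?\<pi> x) = g x \<bullet> v" for v
   using inU(2)[OF x] by (simp add: Pv g_def s_def inner_diff_right inner_add_left inner_diff_left algebra_simps inner_commute)
  ultimately show ?thesis by simp
 qed
 have gD: "(g has_derivative (\<lambda>v. A x *v v)) (at x)" if x: "x \<in> V" for x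
 proof -
  let ?w = "\<lambda>v. (1 / norm x) *\<^sub>R (P x *v v)"
  have "(s has_derivative (\<lambda>v. dh (?\<pi> x) \<bullet> ?w v - (sgn x \<bullet> (B (?\<pi> x) *v ?w v) + ?w v \<bullet> dh (?\<pi> x)))) (at x)"
   unfolding s_def[abs_def] by (intro has_derivative_diff has_derivative_inner dhpi dBpi dsgn x)
  then have sD: "(s has_derivative (\<lambda>v. - (sgn x \<bullet> (B (?\<pi> x) *v ?w v)))) (at x)" by (simp add: inner_commute)
  have "(g has_derivative (\<lambda>v. (s x *\<^sub>R ?w v + (- (sgn x \<bullet> (B (?\<pi> x) *v ?w v))) *\<^sub>R sgn x) + B (?\<pi> x) *v ?w v)) (at x)"
   unfolding g_def[abs_def] by (intro has_derivative_add has_derivative_scaleR sD dBpi dsgn x)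
  moreover have "(s x *\<^sub>R ?w v + (- (sgn x \<bullet> (B (?\<pi> x) *v ?w v))) *\<^sub>R sgn x) + B (?\<pi> x) *v ?w v = A x *v v" for v
   unfolding Av Pv[of x "B (?\<pi> x) *v (P x *v v)"] by (simp add: matrix_vector_mult_scaleR algebra_simps)
  ultimately show ?thesis by simp
 qed
 have VU: "V \<subseteq> - {0}" "?\<pi> ` V \<subseteq> U" by (auto simp: V_def)
 have cV: "continuous_on V sgn" using continuous_on_subset[OF cs VU(1)] .
 have hc: "continuous_on U h" by (rule has_derivative_continuous_on) (use dh has_derivative_at_withinI in blast)
 have dhc: "continuous_on U dh" by (rule has_derivative_continuous_on) (use B has_derivative_at_withinI in blast)
 have c\<pi>: "continuous_on V (\<lambda>x. f (?\<pi> x))" if "continuous_on U f" for f :: "real^'m \<Rightarrow> 'b::topological_space"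
  by (rule continuous_on_compose2[OF that _ VU(2)]) (intro continuous_intros cV)
 have Ac: "continuous_on V A" unfolding A_def[abs_def] s_def P_def matrix_matrix_mult_def vec_lambda_beta
  by (intro continuous_intros continuous_on_vec_lambda cV c\<pi> hc dhc Bc) (use VU in auto)
 have As: "transpose (A x) = A x" if x: "x \<in> V" for x
 proof -
  have "transpose (P x ** B (?\<pi> x) ** P x) = P x ** B (?\<pi> x) ** P x"
   by (simp add: matrix_transpose_mul PT Bs[OF inU(1)[OF x]] matrix_mul_assoc)
  moreover have "transpose (a *\<^sub>R (b *\<^sub>R M + N)) = a *\<^sub>R (b *\<^sub>R transpose M + transpose N)" for a b :: real and M N :: "real^'m^'m"
   by (simp add: transpose_def vec_eq_iff)
  ultimately show ?thesis by (simp add: A_def PT)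
 qed
 have Ps: "P x *v x = 0" for x by (simp add: Pv xs nx)
 have coV: "cone j \<theta> \<subseteq> V" using cone_cap U(2) by (force simp: V_def cone_def)
 have bd: "g x $ j = 0" if x: "x \<in> cone j \<theta>" and xj: "x $ j = cos \<theta> * norm x" for x
 proof -
  have x0: "x \<noteq> 0" using x by (simp add: cone_def)
  define \<xi> where "\<xi> = ?\<pi> x"
  have \<xi>: "\<xi> \<in> cap j \<theta>" unfolding \<xi>_def by (rule cone_cap[OF x])
  have \<nu>: "sph_normal j \<theta> \<xi> = sgn x" by (simp add: \<xi>_def sph_normal_def)
  have sj: "sgn x $ j = cos \<theta>" using x0 xj by (simp add: sgn_div_norm)
  then have "\<xi> \<in> cap_boundary j \<theta>" using \<xi> by (simp add: cap_boundary_def \<xi>_def cap_center_nth)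
  then have R: "frechet_derivative h (at \<xi>) (conormal j \<theta> \<xi>) = cot \<theta> * h \<xi>" using robin by blast
  have "\<xi> \<in> U" using \<xi> U(2) by blast
  then have F: "frechet_derivative h (at \<xi>) = (\<lambda>v. dh \<xi> \<bullet> v)" using dh frechet_derivative_at by metis
  \<comment> \<open>\<open>u\<close> is the tangential part of the last basis vector. On the
    boundary its length is sin \<theta>, so \<open>conormal\<close> is minus \<open>u\<close>
    divided by sin \<theta>, and the Robin condition turns into \<open>g x $ j = 0\<close>.\<close>
  define u where "u = axis j 1 - cos \<theta> *\<^sub>R sgn x"
  have "u \<bullet> u = 1 - (cos \<theta>)\<^sup>2"
   using unit[OF x0] sj by (simp add: u_def inner_diff_left inner_diff_right inner_axis inner_axis' power2_eq_square)
  then have "(norm u)\<^sup>2 = (sin \<theta>)\<^sup>2" by (simp add: power2_norm_eq_inner sin_squared_eq)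
  then have nu: "norm u = sin \<theta>" using sin_gt_zero[OF \<theta>] by (metis abs_norm_cancel abs_of_pos real_sqrt_abs)
  have cn: "conormal j \<theta> \<xi> = - (u /\<^sub>R sin \<theta>)" using nu sj by (simp add: conormal_def \<nu> Let_def inner_axis' u_def)
  have "- (dh \<xi> \<bullet> u) / sin \<theta> = cos \<theta> / sin \<theta> * h \<xi>" using R unfolding F cn by (simp add: cot_def divide_inverse mult.commute)
  then have "- (dh \<xi> \<bullet> u) = cos \<theta> * h \<xi>" using sin_gt_zero[OF \<theta>] by (simp add: field_simps)
  then have "dh \<xi> $ j = cos \<theta> * (sgn x \<bullet> dh \<xi>) - cos \<theta> * h \<xi>" by (simp add: u_def inner_diff_right inner_axis inner_commute)
  then show ?thesis by (simp add: g_def s_def sj \<xi>_def[symmetric] algebra_simps)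
 qed
 have "cap_ext j \<theta> V ?H g A"
 proof
  show "0 \<notin> V" by (simp add: V_def)
  show "g x \<bullet> x = ?H x" if "x \<in> V" for x
  proof -
   have "dh (?\<pi> x) \<bullet> x = norm x * (dh (?\<pi> x) \<bullet> sgn x)" by (subst (1) nx[of x, symmetric]) simp
   then show ?thesis using xs[of x] by (simp add: g_def s_def inner_add_left algebra_simps inner_commute)
  qed
  show "A x *v x = 0" if "x \<in> V" for x by (simp add: Av Ps)
  fix x :: "real^'m" and t :: real assume "x \<in> V" "0 < t"
  then have sg: "sgn (t *\<^sub>R x) = sgn x" by (simp add: sgn_scaleR)
  show "t *\<^sub>R x \<in> V" using \<open>x \<in> V\<close> \<open>0 < t\<close> by (simp add: V_def sg)
  show "?H (t *\<^sub>R x) = t * ?H x" using \<open>0 < t\<close> by (simp add: sg)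
  show "g (t *\<^sub>R x) = g x" by (simp add: g_def s_def sg)
  show "A (t *\<^sub>R x) = (1 / t) *\<^sub>R A x" using \<open>0 < t\<close> by (simp add: A_def s_def P_def sg)
 qed (use \<theta> oV coV HD gD Ac As bd in auto)
 moreover have "W_quad j \<theta> h \<xi> X = X \<bullet> (A (sph_normal j \<theta> \<xi>) *v X)"
  if \<xi>: "\<xi> \<in> cap j \<theta>" and X: "X \<bullet> sph_normal j \<theta> \<xi> = 0" for \<xi> X
 proof -
  define \<nu> where "\<nu> = sph_normal j \<theta> \<xi>"
  have \<nu>: "norm \<nu> = 1" "sgn \<nu> = \<nu>" "\<nu> + ?c = \<xi>" using cap_normal[OF \<xi>] by (auto simp: \<nu>_def sph_normal_def)
  have PX: "P \<nu> *v X = X" using X by (simp add: Pv \<nu> \<nu>_def[symmetric] inner_commute)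
  have "X \<bullet> (P \<nu> *v Y) = X \<bullet> Y" for Y using X by (simp add: Pv \<nu> \<nu>_def[symmetric] inner_diff_right)
  then have "X \<bullet> (A \<nu> *v X) = s \<nu> * (X \<bullet> X) + X \<bullet> (B \<xi> *v X)" by (simp add: Av PX \<nu> inner_add_right)
  moreover have "s \<nu> = h \<xi> - dh \<xi> \<bullet> \<nu>" by (simp add: s_def \<nu> inner_commute)
  moreover have "sph_hess_quad j \<theta> h \<xi> X = X \<bullet> (B \<xi> *v X) - (X \<bullet> X) * (dh \<xi> \<bullet> \<nu>)"
   unfolding \<nu>_def by (rule sph_hess_quad_eq[OF U(1) _ dh B]) (use \<xi> U(2) in auto)
  ultimately show ?thesis by (simp add: W_quad_def \<nu>_def[symmetric] algebra_simps)
 qed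
 ultimately show thesis by (rule that)
qed

text \<open>\<open>eigenvalues_of\<close> only diagonalises a quadratic form. Testing it on
  \<open>v i\<close> and on \<open>v i + v l\<close> recovers the diagonal and, by polarisation, the
  vanishing off-diagonal entries of the symmetric matrix.\<close>

lemma eigenvalues_of_eigframe:
 fixes A :: "real^'m^'m"
 assumes ev: "eigenvalues_of n {X. X \<bullet> \<nu> = 0} Q lam" and \<nu>: "norm \<nu> = 1"
  and sym: "transpose A = A" and A0: "A *v \<nu> = 0"
  and Q: "\<And>X. X \<bullet> \<nu> = 0 \<Longrightarrow> Q X = X \<bullet> (A *v X)"
 obtains v where "eigframe n \<nu> v lam A"
proof -
 obtain v where vT: "\<And>i. i < n \<Longrightarrow> v i \<bullet> \<nu> = 0"
  and on: "\<And>i i'. i < n \<Longrightarrow> i' < n \<Longrightarrow> v i \<bullet> v i' = (if i = i' then 1 else 0)"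
  and sp: "span (v ` {..<n}) = {X. X \<bullet> \<nu> = 0}"
  and Qv: "\<And>a. Q (\<Sum>i<n. a i *\<^sub>R v i) = (\<Sum>i<n. lam i * (a i)\<^sup>2)" using ev unfolding eigenvalues_of_def by auto
 have \<nu>1: "\<nu> \<bullet> \<nu> = 1" using \<nu> by (simp flip: power2_norm_eq_inner)
 have adj: "x \<bullet> (A *v y) = (A *v x) \<bullet> y" for x y using dot_lmul_matrix[of x A y] sym by (metis transpose_matrix_vector)
 have fr: "x = (x \<bullet> \<nu>) *\<^sub>R \<nu> + (\<Sum>i<n. (x \<bullet> v i) *\<^sub>R v i)" for x
 proof -
  define y where "y = x - (x \<bullet> \<nu>) *\<^sub>R \<nu>"
  have "y \<bullet> \<nu> = 0" using \<nu>1 by (simp add: y_def inner_diff_left)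
  then have "y \<in> span (v ` {..<n})" using sp by simp
  then obtain u where u: "y = (\<Sum>b\<in>v ` {..<n}. u b *\<^sub>R b)" by (auto simp: span_finite)
  have inj: "inj_on v {..<n}"
  proof (rule inj_onI)
   fix a b assume "a \<in> {..<n}" "b \<in> {..<n}" "v a = v b"
   then show "a = b" using on[of a b] on[of a a] by (auto split: if_splits)
  qed
  have y: "y = (\<Sum>i<n. u (v i) *\<^sub>R v i)" unfolding u by (simp add: sum.reindex[OF inj])
  have "y \<bullet> v i = u (v i)" if "i < n" for i
  proof -
   have "y \<bullet> v i = (\<Sum>l<n. u (v l) * (v l \<bullet> v i))" by (subst y) (simp add: inner_sum_left)
   also have "\<dots> = (\<Sum>l<n. if l = i then u (v l) else 0)" by (rule sum.cong) (use on that in auto)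
   finally show ?thesis using that by simp
  qed
  moreover have "y \<bullet> v i = x \<bullet> v i" if "i < n" for i
   using vT[OF that] inner_commute[of \<nu> "v i"] by (simp add: y_def inner_diff_left)
  ultimately have "y = (\<Sum>i<n. (x \<bullet> v i) *\<^sub>R v i)" by (subst y) (auto intro!: sum.cong)
  then show ?thesis by (simp add: y_def algebra_simps)
 qed
 have quad: "X \<bullet> (A *v X) = (\<Sum>i<n. lam i * (a i)\<^sup>2)" if "X = (\<Sum>i<n. a i *\<^sub>R v i)" for X a
 proof -
  have "X \<bullet> \<nu> = 0" unfolding that using vT by (simp add: inner_sum_left)
  then show ?thesis using Q[of X] Qv[of a] that by simp
 qed
 have d: "v i \<bullet> (A *v v i) = lam i" if "i < n" for i
 proof -
  have "v i = (\<Sum>l<n. (if l = i then 1 else 0) *\<^sub>R v l)" using that by (simp add: if_distrib[of "\<lambda>u. u *\<^sub>R _"] cong: if_cong)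
  from quad[OF this] show ?thesis using that by (simp add: if_distrib[of "\<lambda>u. u\<^sup>2"] if_distrib[of "\<lambda>u. _ * u"] cong: if_cong)
 qed
 have o: "v i \<bullet> (A *v v l) = 0" if "i < n" "l < n" "i \<noteq> l" for i l
 proof -
  have "v i + v l = (\<Sum>m<n. ((if m = i then 1 else 0) + (if m = l then 1 else 0)) *\<^sub>R v m)"
   using that by (simp add: scaleR_add_left sum.distrib if_distrib[of "\<lambda>u. u *\<^sub>R _"] cong: if_cong)
  from quad[OF this] have "(v i + v l) \<bullet> (A *v (v i + v l)) = (\<Sum>m<n. lam m * ((if m = i then 1 else 0) + (if m = l then 1 else 0))\<^sup>2)" .
  also have "\<dots> = (\<Sum>m<n. (if m = i then lam m else 0) + (if m = l then lam m else 0))" by (rule sum.cong) (use that in auto)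
  also have "\<dots> = lam i + lam l" using that by (simp add: sum.distrib)
  finally show ?thesis using d[OF that(1)] d[OF that(2)] adj[of "v i" "v l"]
   by (simp add: matrix_vector_right_distrib inner_add_left inner_add_right inner_commute)
 qed
 have Av: "A *v v i = lam i *\<^sub>R v i" if i: "i < n" for i
 proof -
  have z: "(A *v v i) \<bullet> \<nu> = 0" using adj[of "v i" \<nu>] A0 by simp
  have "A *v v i = (\<Sum>l<n. ((A *v v i) \<bullet> v l) *\<^sub>R v l)" using fr[of "A *v v i"] z by simp
  also have "\<dots> = (\<Sum>l<n. if l = i then lam i *\<^sub>R v i else 0)" by (rule sum.cong) (use i d o in \<open>auto simp: inner_commute\<close>)
  finally show ?thesis using i by simp
 qed
 have "eigframe n \<nu> v lam A" unfolding eigframe_def using fr \<nu>1 vT on A0 Av by auto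
 then show thesis by (rule that)
qed

lemma sigma_eq_esym: "sigma n k lam = esym {..<n} k lam" by (simp add: sigma_def esym_def)

lemma Gamma_eq_gam: "lam \<in> Gamma n k \<longleftrightarrow> gam {..<n} k lam"
proof -
 have "0 < esym {..<n} 0 lam" by simp
 then show ?thesis unfolding Gamma_def gam_def sigma_eq_esym mem_Collect_eq by (metis One_nat_def Suc_leI gr0I)
qed

section \<open>Cutoff functions on the cone\<close>

lemma newton_eigvec:
 assumes "A *v m = a *\<^sub>R m"
 shows "\<exists>b. newton A k *v m = b *\<^sub>R m"
proof (induction k)
 case 0 show ?case by (intro exI[of _ 1]) simp
next
 case (Suc k)
 then obtain b where "newton A k *v m = b *\<^sub>R m" by blast
 then have "newton A (Suc k) *v m = (msig A (Suc k) - a * b) *\<^sub>R m"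
  using assms by (simp add: newton_Suc matrix_vector_mult_diff_rdistrib scaleR_matrix_vector_assoc[symmetric]
    matrix_vector_mul_assoc[symmetric] matrix_vector_mult_scaleR scaleR_diff_left)
 then show ?case by blast
qed

context cap_ext
begin

lemma coneD: "x \<in> cone j \<theta> \<Longrightarrow> x \<in> V \<and> x \<noteq> 0" using coneV by (auto simp: cone_def)

lemma contH: "continuous_on V H" by (rule has_derivative_continuous_on) (use H has_derivative_at_withinI in blast)

lemma contg: "continuous_on V g" by (rule has_derivative_continuous_on) (use g has_derivative_at_withinI in blast)

lemma DERIV_H_line: "x \<in> V \<Longrightarrow> DERIV (\<lambda>s. H (x + s *\<^sub>R axis i 1)) 0 :> g x $ i"
 using DERIV_along_line[OF H, of x "axis i 1"] by (simp add: inner_axis)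

lemma DERIV_g_line: "x \<in> V \<Longrightarrow> DERIV (\<lambda>s. g (x + s *\<^sub>R axis i 1) $ l) 0 :> A x $ i $ l"
proof -
 assume x: "x \<in> V"
 have "DERIV (\<lambda>s. g (x + s *\<^sub>R axis i 1) $ l) 0 :> A x $ l $ i"
  using DERIV_along_line[OF bounded_linear.has_derivative[OF bounded_linear_vec_nth g[OF x], of l], of "axis i 1"]
  by (simp add: matrix_vector_mult_basis column_def)
 then show ?thesis using arg_cong[OF sym[OF x], of "\<lambda>M. M $ i $ l"] by (simp add: transpose_def)
qed

text \<open>Differentiating \<open>g x $ j = 0\<close> along the boundary shows that
  \<open>A x *v axis j 1\<close> is orthogonal to every \<tau> that is orthogonal to both
  \<open>x\<close> and the last basis vector. It is also orthogonal to \<open>x\<close>, so only a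
  multiple of the conormal direction \<open>m\<close> remains.\<close>

lemma boundary_eigenvector:
 assumes x: "x \<in> cone j \<theta>" and xj: "x $ j = cos \<theta> * norm x"
 shows "\<exists>a. A x *v (axis j 1 - (cos \<theta> / norm x) *\<^sub>R x) = a *\<^sub>R (axis j 1 - (cos \<theta> / norm x) *\<^sub>R x)"
proof -
 let ?E = "axis j (1::real)"
 have xV: "x \<in> V" and x0: "x \<noteq> 0" using coneD[OF x] by auto
 have adj: "a \<bullet> (A x *v b) = (A x *v a) \<bullet> b" for a b
  using dot_lmul_matrix[of a "A x" b] sym[OF xV] by (metis transpose_matrix_vector)
 define x' where "x' = x - (x $ j) *\<^sub>R ?E"
 have x'E: "x' \<bullet> ?E = 0" by (simp add: x'_def inner_diff_left inner_axis)
 have nx': "x' \<bullet> x' = (norm x * sin \<theta>)\<^sup>2"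
 proof -
  have "x' \<bullet> x' = x \<bullet> x - (x $ j)\<^sup>2"
   by (simp add: x'_def inner_diff_left inner_diff_right inner_axis inner_axis' power2_eq_square)
  also have "\<dots> = (norm x)\<^sup>2 * (1 - (cos \<theta>)\<^sup>2)" by (simp add: xj power_mult_distrib power2_norm_eq_inner algebra_simps)
  finally show ?thesis by (simp add: sin_squared_eq power_mult_distrib)
 qed
 have tang: "\<tau> \<bullet> (A x *v ?E) = 0" if \<tau>: "\<tau> \<bullet> x = 0" "\<tau> \<bullet> ?E = 0" for \<tau>
 proof (cases "\<tau> = 0")
  case False
  \<comment> \<open>This scaling gives \<tau> the length of \<open>x'\<close>, so \<gamma> is a
    circle of constant height and constant norm and never leaves the boundary of the cone.\<close>
  define b where "b = norm x * sin \<theta> / norm \<tau>"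
  have b: "b \<noteq> 0" using False x0 sin_gt_zero[OF \<theta>] by (simp add: b_def)
  have \<tau>x': "\<tau> \<bullet> x' = 0" using \<tau> by (simp add: x'_def inner_diff_right)
  define \<gamma> where "\<gamma> t = x $ j *\<^sub>R ?E + cos t *\<^sub>R x' + (sin t * b) *\<^sub>R \<tau>" for t
  have \<gamma>j: "\<gamma> t $ j = x $ j" for t using x'E \<tau>(2) by (simp add: \<gamma>_def inner_axis)
  have "x' $ j = 0" "\<tau> $ j = 0" using \<tau>(2) by (simp_all add: x'_def inner_axis)
  then have "\<gamma> t \<bullet> \<gamma> t = (x $ j)\<^sup>2 + (cos t)\<^sup>2 * (x' \<bullet> x') + (sin t * b)\<^sup>2 * (\<tau> \<bullet> \<tau>)" for t using x'E \<tau>x' \<tau>(2)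
   by (simp add: \<gamma>_def inner_add_left inner_add_right inner_commute[of ?E] inner_commute[of x' \<tau>] power2_eq_square inner_axis')
  moreover have "b\<^sup>2 * (\<tau> \<bullet> \<tau>) = x' \<bullet> x'" using False by (simp add: b_def nx' power_divide power2_norm_eq_inner)
  moreover have "(sin t * b)\<^sup>2 * (\<tau> \<bullet> \<tau>) = (sin t)\<^sup>2 * (b\<^sup>2 * (\<tau> \<bullet> \<tau>))" for t by (simp add: power_mult_distrib)
  ultimately have "\<gamma> t \<bullet> \<gamma> t = (x $ j)\<^sup>2 + ((sin t)\<^sup>2 + (cos t)\<^sup>2) * (x' \<bullet> x')" for t by (simp only: distrib_right add_ac)
  then have "\<gamma> t \<bullet> \<gamma> t = (cos \<theta> * norm x)\<^sup>2 + (norm x * sin \<theta>)\<^sup>2" for t by (simp add: nx' xj)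
  also have "(cos \<theta> * norm x)\<^sup>2 + (norm x * sin \<theta>)\<^sup>2 = (norm x)\<^sup>2 * ((sin \<theta>)\<^sup>2 + (cos \<theta>)\<^sup>2)"
   unfolding power_mult_distrib distrib_left by (simp add: mult.commute)
  finally have "\<gamma> t \<bullet> \<gamma> t = (norm x)\<^sup>2" for t by simp
  then have \<gamma>n: "norm (\<gamma> t) = norm x" for t by (simp add: norm_eq_sqrt_inner)
  have \<gamma>c: "\<gamma> t \<in> cone j \<theta>" for t using \<gamma>n[of t] \<gamma>j[of t] xj x0 by (auto simp: cone_def)
  have z: "g (\<gamma> t) $ j = 0" for t using bdry[OF \<gamma>c] \<gamma>n \<gamma>j xj by simp
  have "\<gamma> 0 = x" by (simp add: \<gamma>_def x'_def)
  moreover have "(\<gamma> has_derivative (\<lambda>s. s *\<^sub>R (b *\<^sub>R \<tau>))) (at 0)"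
   unfolding \<gamma>_def[abs_def] by (auto intro!: derivative_eq_intros)
  ultimately have "((\<lambda>t. g (\<gamma> t)) has_derivative (\<lambda>s. A x *v (s *\<^sub>R (b *\<^sub>R \<tau>)))) (at 0)"
   using has_derivative_compose[of \<gamma> _ 0 UNIV g] g[OF xV] by metis
  from bounded_linear.has_derivative[OF bounded_linear_vec_nth this, of j]
  have "DERIV (\<lambda>t. g (\<gamma> t) $ j) 0 :> b * (A x *v \<tau>) $ j"
   by (intro has_derivative_mult_imp_DERIV) (simp add: matrix_vector_mult_scaleR mult.assoc)
  moreover have "DERIV (\<lambda>t. g (\<gamma> t) $ j) 0 :> 0" by (simp add: z)
  ultimately have "b * (A x *v \<tau>) $ j = 0" by (rule DERIV_unique)
  then show ?thesis using b adj[of \<tau> ?E] by (simp add: inner_axis)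
 qed simp
 define m where "m = ?E - (cos \<theta> / norm x) *\<^sub>R x"
 define v where "v = A x *v m"
 have vE: "v = A x *v ?E" using euler(2)[OF xV] by (simp add: v_def m_def matrix_vector_mult_diff_distrib matrix_vector_mult_scaleR)
 have mx: "m \<bullet> x = 0" using x0 xj by (simp add: m_def inner_diff_left inner_axis' power2_norm_eq_inner[symmetric] power2_eq_square)
 have vx: "v \<bullet> x = 0" using adj[of m x] euler(2)[OF xV] by (simp add: v_def)
 have mE: "m \<bullet> ?E = 1 - (cos \<theta>)\<^sup>2" using x0 xj by (simp add: m_def inner_diff_left inner_axis power2_eq_square)
 have mm: "m \<bullet> m = m \<bullet> ?E" using mx by (subst (2) m_def) (simp add: inner_diff_right)
 have mm0: "m \<bullet> m \<noteq> 0" unfolding mm mE using sin_gt_zero[OF \<theta>] by (simp flip: sin_squared_eq)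
 define a where "a = (v \<bullet> m) / (m \<bullet> m)"
 define \<tau> where "\<tau> = v - a *\<^sub>R m"
 have t1: "\<tau> \<bullet> x = 0" using mx vx by (simp add: \<tau>_def inner_diff_left)
 have t2: "\<tau> \<bullet> m = 0" using mm0 by (simp add: \<tau>_def a_def inner_diff_left)
 have t3: "\<tau> \<bullet> ?E = 0" using t1 t2 by (simp add: m_def inner_diff_right)
 have "\<tau> \<bullet> v = 0" using tang[OF t1 t3] vE by simp
 then have "\<tau> \<bullet> \<tau> = 0" using t2 by (subst (2) \<tau>_def) (simp add: inner_diff_right)
 then have "v = a *\<^sub>R m" by (simp add: \<tau>_def)
 then show ?thesis unfolding v_def m_def by blast
qed

end

text \<open>A radial cutoff for 1 < x \<bullet> x < 2; squaring the positive part makes it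
  continuously differentiable. Its gradient is \<open>shell' x *\<^sub>R x\<close>.\<close>

definition shell :: "real^'m \<Rightarrow> real" where
 "shell x = (max 0 ((x \<bullet> x - 1) * (2 - x \<bullet> x)))\<^sup>2"

definition shell' :: "real^'m \<Rightarrow> real" where
 "shell' x = 4 * max 0 ((x \<bullet> x - 1) * (2 - x \<bullet> x)) * (3 - 2 * (x \<bullet> x))"

text \<open>An angular cutoff: as \<epsilon> decreases to 0 it increases to the indicator of s > 0,
  and \<open>ramp'\<close> concentrates at the boundary of the cone.\<close>

definition ramp :: "real \<Rightarrow> real \<Rightarrow> real" where
 "ramp \<epsilon> s = (max 0 s)\<^sup>2 / ((max 0 s)\<^sup>2 + \<epsilon>)"

definition ramp' :: "real \<Rightarrow> real \<Rightarrow> real" where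
 "ramp' \<epsilon> s = 2 * max 0 s * \<epsilon> / ((max 0 s)\<^sup>2 + \<epsilon>)\<^sup>2"

lemma DERIV_pos_part_square: "DERIV (\<lambda>s::real. (max 0 s)\<^sup>2) s :> 2 * max 0 s"
 using DERIV_pos_part_power[of 0 s] by (simp add: numeral_2_eq_2)

lemma DERIV_ramp: "0 < \<epsilon> \<Longrightarrow> DERIV (ramp \<epsilon>) s :> ramp' \<epsilon> s"
proof -
 assume e: "0 < \<epsilon>"
 note d = DERIV_pos_part_square[of s]
 have ne: "(max 0 s)\<^sup>2 + \<epsilon> \<noteq> 0" by (metis add_nonneg_pos e less_irrefl zero_le_power2)
 show ?thesis unfolding ramp_def[abs_def] by (rule DERIV_cong[OF DERIV_divide[OF d DERIV_add[OF d DERIV_const] ne]])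
    (simp add: ramp'_def power2_eq_square algebra_simps)
qed

lemma ramp_bounds: "0 < \<epsilon> \<Longrightarrow> 0 \<le> ramp \<epsilon> s \<and> ramp \<epsilon> s \<le> 1 \<and> 0 \<le> ramp' \<epsilon> s"
proof -
 assume e: "0 < \<epsilon>"
 have "0 < (max 0 s)\<^sup>2 + \<epsilon>" by (metis add_nonneg_pos e zero_le_power2)
 then show ?thesis using e by (simp add: ramp_def ramp'_def)
qed

lemma ramp_neg: "s \<le> 0 \<Longrightarrow> ramp \<epsilon> s = 0 \<and> ramp' \<epsilon> s = 0" by (simp add: ramp_def ramp'_def max_def)

text \<open>The product is 2 \<epsilon> (s^2 / (s^2 + \<epsilon>))^2. Any part of the boundary flux
  that is bounded by the cube of the angular distance therefore disappears as \<epsilon> tends to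
  0.\<close>

lemma ramp'_cubed: "0 < \<epsilon> \<Longrightarrow> 0 \<le> s \<Longrightarrow> ramp' \<epsilon> s * s ^ 3 \<le> 2 * \<epsilon>"
proof -
 assume e: "0 < \<epsilon>" "0 \<le> s"
 have p: "0 < s\<^sup>2 + \<epsilon>" by (metis add_nonneg_pos e(1) zero_le_power2)
 have "ramp' \<epsilon> s * s ^ 3 = 2 * \<epsilon> * ((s\<^sup>2)\<^sup>2 / (s\<^sup>2 + \<epsilon>)\<^sup>2)" using e by (simp add: ramp'_def max_def power2_eq_square power3_eq_cube)
 also have "\<dots> \<le> 2 * \<epsilon> * 1"
 proof (rule mult_left_mono)
  have "(s\<^sup>2)\<^sup>2 \<le> (s\<^sup>2 + \<epsilon>)\<^sup>2" using e by (intro power_mono) auto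
  then show "(s\<^sup>2)\<^sup>2 / (s\<^sup>2 + \<epsilon>)\<^sup>2 \<le> 1" using p by simp
 qed (use e in simp)
 finally show ?thesis by simp
qed

lemma continuous_ramp: "0 < \<epsilon> \<Longrightarrow> continuous_on S f \<Longrightarrow> continuous_on S (\<lambda>x. ramp \<epsilon> (f x))"
 "0 < \<epsilon> \<Longrightarrow> continuous_on S f \<Longrightarrow> continuous_on S (\<lambda>x. ramp' \<epsilon> (f x))" unfolding ramp_def ramp'_def
 by (intro continuous_intros; (assumption | metis add_nonneg_pos less_irrefl zero_le_power2 power_eq_0_iff))+

definition cutoff :: "'m::finite \<Rightarrow> real \<Rightarrow> real \<Rightarrow> real^'m \<Rightarrow> real" where
 "cutoff j \<theta> \<epsilon> x = shell x * ramp \<epsilon> (x $ j / norm x - cos \<theta>)"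

definition cutoff' :: "'m::finite \<Rightarrow> real \<Rightarrow> real \<Rightarrow> 'm \<Rightarrow> real^'m \<Rightarrow> real" where
 "cutoff' j \<theta> \<epsilon> i x = shell' x * x $ i * ramp \<epsilon> (x $ j / norm x - cos \<theta>) +
   shell x * ramp' \<epsilon> (x $ j / norm x - cos \<theta>) * ((if i = j then 1 / norm x else 0) - x $ j * x $ i / norm x ^ 3)"

definition csupp :: "'m::finite \<Rightarrow> real \<Rightarrow> (real^'m) set" where
 "csupp j \<theta> = {x. 1 \<le> x \<bullet> x \<and> x \<bullet> x \<le> 2 \<and> cos \<theta> * norm x \<le> x $ j}"

lemma csupp: "compact (csupp j \<theta>)" "csupp j \<theta> \<subseteq> cone j \<theta>"
proof -
 have "closed (csupp j \<theta>)" unfolding csupp_def by (intro closed_Collect_conj closed_Collect_le continuous_intros)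
 moreover have "bounded (csupp j \<theta>)"
 proof (rule boundedI[of _ 2])
  fix x assume "x \<in> csupp j \<theta>"
  then have "(norm x)\<^sup>2 \<le> 2\<^sup>2" by (simp add: csupp_def power2_norm_eq_inner)
  then show "norm x \<le> 2" by (rule power2_le_imp_le) simp
 qed
 ultimately show "compact (csupp j \<theta>)" by (simp add: compact_eq_bounded_closed)
 show "csupp j \<theta> \<subseteq> cone j \<theta>" by (auto simp: csupp_def cone_def)
qed

lemma shell_zero: "x \<bullet> x < 1 \<or> 2 < x \<bullet> x \<Longrightarrow> shell x = 0 \<and> shell' x = 0"
proof -
 assume "x \<bullet> x < 1 \<or> 2 < x \<bullet> x"
 then have "(x \<bullet> x - 1) * (2 - x \<bullet> x) \<le> 0" by (auto simp: mult_le_0_iff)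
 then show ?thesis by (simp add: shell_def shell'_def max_def)
qed

lemma shell_nonneg: "0 \<le> shell x" by (simp add: shell_def)

lemma cutoff_zero: "x \<notin> csupp j \<theta> \<Longrightarrow> cutoff j \<theta> \<epsilon> x = 0 \<and> shell x * ramp' \<epsilon> (x $ j / norm x - cos \<theta>) = 0"
proof (cases "x \<bullet> x < 1 \<or> 2 < x \<bullet> x")
 case True then show ?thesis by (simp add: cutoff_def shell_zero)
next
 case False
 assume "x \<notin> csupp j \<theta>"
 then have "x $ j < cos \<theta> * norm x" "x \<noteq> 0" using False by (auto simp: csupp_def)
 then have "x $ j / norm x - cos \<theta> \<le> 0" by (simp add: divide_le_eq)
 then show ?thesis using ramp_neg by (simp add: cutoff_def)
qed

lemma continuous_on_zero_off:
 fixes f :: "real^'m \<Rightarrow> real"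
 assumes "open V" "compact S" "S \<subseteq> V" "continuous_on V f" "\<And>x. x \<notin> S \<Longrightarrow> f x = 0"
 shows "continuous_on UNIV f"
proof -
 have "continuous_on (- S) f" by (rule continuous_on_eq[of _ "\<lambda>_. 0"]) (use assms(5) in auto)
 then have "continuous_on (V \<union> - S) f" using assms by (intro continuous_on_open_Un) (auto simp: compact_imp_closed)
 moreover have "V \<union> - S = UNIV" using assms(3) by auto
 ultimately show ?thesis by simp
qed

lemma continuous_shell: "continuous_on T shell" "continuous_on T shell'"
 unfolding shell_def[abs_def] shell'_def[abs_def] by (intro continuous_intros)+

lemma DERIV_cutoff:
 assumes e: "0 < \<epsilon>"
 shows "DERIV (\<lambda>s. cutoff j \<theta> \<epsilon> (x + s *\<^sub>R axis i 1)) 0 :> cutoff' j \<theta> \<epsilon> i x"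
\<comment> \<open>The norm is not differentiable at the origin, but \<open>shell\<close> vanishes on
  the open unit ball.\<close>
proof (cases "x \<bullet> x < 1")
 case True
 have "open {x::real^'a. x \<bullet> x < 1}" by (intro open_Collect_less continuous_intros)
 then have op: "open ((\<lambda>s. x + s *\<^sub>R axis i (1::real)) -` {x. x \<bullet> x < 1})" by (rule open_vimage) (intro continuous_intros)
 have "DERIV (\<lambda>s. 0) 0 :> cutoff' j \<theta> \<epsilon> i x" using True shell_zero[of x] by (simp add: cutoff'_def)
 then show ?thesis by (rule has_field_derivative_transform_within_open[OF _ op]) (use True in \<open>auto simp: cutoff_def shell_zero\<close>)
next
 case False
 then have x0: "x \<noteq> 0" by auto
 let ?l = "\<lambda>s. x + s *\<^sub>R axis i (1::real)"
 have q: "DERIV (\<lambda>s. (?l s \<bullet> ?l s - 1) * (2 - ?l s \<bullet> ?l s)) 0 :> (3 - 2 * (x \<bullet> x)) * (2 * x $ i)"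
  by (rule DERIV_cong, rule DERIV_mult[OF DERIV_diff[OF DERIV_inner_line DERIV_const] DERIV_diff[OF DERIV_const DERIV_inner_line]])
    (simp add: algebra_simps)
 have sh: "DERIV (\<lambda>s. shell (?l s)) 0 :> shell' x * x $ i"
  unfolding shell_def by (rule DERIV_cong[OF DERIV_chain2[OF DERIV_pos_part_square q]])
   (simp add: shell'_def)
 have n: "DERIV (\<lambda>s. norm (?l s)) 0 :> x $ i / norm x"
 proof -
  have "((\<lambda>s. ?l s) has_derivative (\<lambda>s. s *\<^sub>R axis i 1)) (at 0)" by (auto intro!: derivative_eq_intros)
  from has_derivative_compose[OF this, of norm "\<lambda>v. v \<bullet> sgn x"] has_derivative_norm[OF x0] show ?thesis
   by (intro has_derivative_mult_imp_DERIV) (simp add: inner_axis' sgn_div_norm divide_inverse mult_ac)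
 qed
 have xj: "DERIV (\<lambda>s. ?l s $ j) 0 :> (if i = j then 1 else 0)" by (auto simp: axis_def intro!: derivative_eq_intros)
 have c: "DERIV (\<lambda>s. ?l s $ j / norm (?l s) - cos \<theta>) 0 :> ((if i = j then 1 / norm x else 0) - x $ j * x $ i / norm x ^ 3)"
  by (rule DERIV_cong[OF DERIV_diff[OF DERIV_divide[OF xj n] DERIV_const]])
    (use x0 in \<open>auto simp: field_simps power3_eq_cube\<close>)
 have "DERIV (\<lambda>s. ramp \<epsilon> (?l s $ j / norm (?l s) - cos \<theta>)) 0 :> ramp' \<epsilon> (x $ j / norm x - cos \<theta>) * ((if i = j then 1 / norm x else 0) - x $ j * x $ i / norm x ^ 3)"
  using DERIV_chain2[OF DERIV_ramp[OF e] c] by simp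
 from DERIV_mult[OF sh this] show ?thesis unfolding cutoff_def by (rule DERIV_cong) (simp add: cutoff'_def algebra_simps)
qed

lemma continuous_cutoff:
 assumes e: "0 < \<epsilon>"
 shows "continuous_on UNIV (cutoff j \<theta> \<epsilon>)" "continuous_on UNIV (cutoff' j \<theta> \<epsilon> i)"
proof -
 let ?S = "{x::real^'a. 1 \<le> x \<bullet> x \<and> x \<bullet> x \<le> 2}"
 have "closed ?S" by (intro closed_Collect_conj closed_Collect_le continuous_intros)
 moreover have "bounded ?S"
 proof (rule boundedI[of _ 2])
  fix x :: "real^'a" assume "x \<in> ?S"
  then have "(norm x)\<^sup>2 \<le> 2\<^sup>2" by (simp add: power2_norm_eq_inner)
  then show "norm x \<le> 2" by (rule power2_le_imp_le) simp
 qed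
 ultimately have S: "compact ?S" by (simp add: compact_eq_bounded_closed)
 have op: "open (- {0::real^'a})" by (simp add: open_Compl)
 have sub: "?S \<subseteq> - {0}" by auto
 have "continuous_on (- {0}) (cutoff j \<theta> \<epsilon>)"
  unfolding cutoff_def[abs_def] by (intro continuous_intros continuous_shell continuous_ramp e) auto
 then show "continuous_on UNIV (cutoff j \<theta> \<epsilon>)"
  by (rule continuous_on_zero_off[OF op S sub]) (auto simp: cutoff_def shell_zero not_le)
 have "continuous_on (- {0}) (cutoff' j \<theta> \<epsilon> i)"
  unfolding cutoff'_def[abs_def] by (cases "i = j"; simp; intro continuous_intros continuous_shell continuous_ramp e; auto)
 then show "continuous_on UNIV (cutoff' j \<theta> \<epsilon> i)"
  by (rule continuous_on_zero_off[OF op S sub]) (auto simp: cutoff'_def shell_zero not_le)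
qed

lemma cutoff'_zero:
 assumes "0 < \<epsilon>" "x \<notin> csupp j \<theta>"
 shows "cutoff' j \<theta> \<epsilon> i x = 0"
 using integral_directional_deriv_continuous(3)[OF csupp(1) _ continuous_cutoff[OF assms(1)] DERIV_cutoff[OF assms(1)] assms(2)] cutoff_zero by blast

lemma sum_nth_axis: "(\<Sum>i\<in>UNIV. (if i = j then c else 0) * f i) = c * (f (j::'m::finite) :: real)"
 by (simp add: if_distrib[of "\<lambda>u. u * _"] cong: if_cong)

lemma shell_integrable: "integrable lborel (shell :: real^'m \<Rightarrow> real)"
proof -
 let ?S = "{x::real^'m. 1 \<le> x \<bullet> x \<and> x \<bullet> x \<le> 2}"
 have "closed ?S" by (intro closed_Collect_conj closed_Collect_le continuous_intros)
 moreover have "bounded ?S"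
 proof (rule boundedI[of _ 2])
  fix x :: "real^'m" assume "x \<in> ?S"
  then have "(norm x)\<^sup>2 \<le> 2\<^sup>2" by (simp add: power2_norm_eq_inner)
  then show "norm x \<le> 2" by (rule power2_le_imp_le) simp
 qed
 ultimately have S: "compact ?S" by (simp add: compact_eq_bounded_closed)
 have "(\<lambda>x. indicator ?S x *\<^sub>R shell x) = (shell :: real^'m \<Rightarrow> real)"
 proof (rule ext)
  fix x :: "real^'m" show "indicator ?S x *\<^sub>R shell x = shell x"
   by (cases "x \<bullet> x < 1 \<or> 2 < x \<bullet> x") (auto simp: shell_zero not_less)
 qed
 then show ?thesis using borel_integrable_compact[OF S continuous_shell(1)] by simp
qed

text \<open>Integrate the divergence of the cutoff times the tangential part of the last basis vector.\<close>
lemma cutoff_mass: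
 fixes j :: "'m::finite"
 assumes e: "0 < \<epsilon>"
 defines "c \<equiv> \<lambda>x::real^'m. x $ j / norm x"
 shows "integrable lborel (\<lambda>x. shell x * ramp' \<epsilon> (c x - cos \<theta>) * (1 - (c x)\<^sup>2) / norm x)" (is ?int)
  and "(LBINT x. shell x * ramp' \<epsilon> (c x - cos \<theta>) * (1 - (c x)\<^sup>2) / norm x) \<le> real (CARD('m)) * (LBINT x. shell (x::real^'m))" (is ?le)
proof -
 \<comment> \<open>\<open>?Y\<close> is orthogonal to \<open>x\<close>, so the derivative of
   \<open>shell\<close> drops out, and its component along the last basis vector is 1 - c^2. Its
   divergence is - (N - 1) x_j / |x|^2 with N = \<open>CARD('m)\<close>, so the mass of
   \<open>ramp'\<close> is bounded independently of \<epsilon>.\<close>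
 let ?Y = "\<lambda>i x::real^'m. (if i = j then 1 else 0) - x $ j * x $ i / (x \<bullet> x)"
 let ?Y' = "\<lambda>i x::real^'m. - ((if i = j then x $ i else 0) + x $ j) / (x \<bullet> x) + 2 * x $ j * (x $ i)\<^sup>2 / (x \<bullet> x)\<^sup>2"
 let ?D = "\<lambda>i x. cutoff' j \<theta> \<epsilon> i x * ?Y i x + cutoff j \<theta> \<epsilon> x * ?Y' i x"
 have op: "open (- {0::real^'m})" by (simp add: open_Compl)
 have sub: "csupp j \<theta> \<subseteq> - {0}" using csupp(2) by (auto simp: cone_def)
 have Yc: "continuous_on (- {0}) (?Y i)" "continuous_on (- {0}) (?Y' i)" for i
  by (cases "i = j"; simp; intro continuous_intros; simp)+
 have cc: "continuous_on T (cutoff j \<theta> \<epsilon>)" "continuous_on T (cutoff' j \<theta> \<epsilon> i)" for T i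
  using continuous_cutoff[OF e] continuous_on_subset by blast+
 have F: "continuous_on UNIV (\<lambda>x. cutoff j \<theta> \<epsilon> x * ?Y i x)" for i
  by (rule continuous_on_zero_off[OF op csupp(1) sub]) (intro continuous_on_mult cc Yc, simp add: cutoff_zero)
 have F': "continuous_on UNIV (?D i)" for i
  by (rule continuous_on_zero_off[OF op csupp(1) sub]) (intro continuous_on_mult continuous_on_add cc Yc, simp add: cutoff_zero cutoff'_zero[OF e])
 have der: "DERIV (\<lambda>s. cutoff j \<theta> \<epsilon> (x + s *\<^sub>R axis i 1) * ?Y i (x + s *\<^sub>R axis i 1)) 0 :> ?D i x" for i x
 proof (cases "x = 0")
  case False
  let ?l = "\<lambda>s. x + s *\<^sub>R axis i (1::real)"
  have xj: "DERIV (\<lambda>s. ?l s $ l) 0 :> (if i = l then 1 else 0)" for l by (auto simp: axis_def intro!: derivative_eq_intros)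
  have "DERIV (\<lambda>s. ?l s $ j * ?l s $ i / (?l s \<bullet> ?l s)) 0 :> - ?Y' i x"
   by (rule DERIV_cong[OF DERIV_divide[OF DERIV_mult[OF xj xj] DERIV_inner_line]])
     (use False in \<open>auto simp: field_simps power2_eq_square\<close>)
  from DERIV_diff[OF DERIV_const this, of "if i = j then 1 else 0"]
  have "DERIV (\<lambda>s. ?Y i (?l s)) 0 :> ?Y' i x" by (rule DERIV_cong) simp
  from DERIV_mult[OF DERIV_cutoff[OF e] this] show ?thesis by (rule DERIV_cong) simp
 next
  case True
  have "open {x::real^'m. x \<bullet> x < 1}" by (intro open_Collect_less continuous_intros)
  then have op: "open ((\<lambda>s. x + s *\<^sub>R axis i (1::real)) -` {x. x \<bullet> x < 1})" by (rule open_vimage) (intro continuous_intros)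
  have "DERIV (\<lambda>s. 0) 0 :> ?D i x" using True by (simp add: cutoff'_def cutoff_def shell_zero)
  then show ?thesis
   by (rule has_field_derivative_transform_within_open[OF _ op]) (use True in \<open>auto simp: cutoff_def shell_zero\<close>)
 qed
 have I: "(LBINT x. ?D i x) = 0" "integrable lborel (?D i)" for i
  by (rule integral_directional_deriv_continuous[OF csupp(1)[of j \<theta>] _ F F' der], simp add: cutoff_zero)+
 let ?M = "\<lambda>x. shell x * ramp' \<epsilon> (c x - cos \<theta>) * (1 - (c x)\<^sup>2) / norm x"
 let ?R = "\<lambda>x. (real (CARD('m)) - 1) * (cutoff j \<theta> \<epsilon> x * (x $ j / (x \<bullet> x)))"
 have eq: "(\<Sum>i\<in>UNIV. ?D i x) = ?M x - ?R x" for x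
 proof (cases "x = 0")
  case True
  then show ?thesis using shell_zero[of x] by (simp add: cutoff'_def cutoff_def)
 next
  case False
  have n2: "x \<bullet> x = (norm x)\<^sup>2" by (simp add: power2_norm_eq_inner)
  have sx: "(\<Sum>i\<in>UNIV. x $ i * x $ i) = x \<bullet> x" by (simp add: inner_vec_def)
  have s1: "(\<Sum>i\<in>UNIV. x $ i * ?Y i x) = 0"
  proof -
   have "(\<Sum>i\<in>UNIV. x $ i * ?Y i x) = (\<Sum>i\<in>UNIV. (if i = j then 1 else 0) * x $ i) - x $ j / (x \<bullet> x) * (\<Sum>i\<in>UNIV. x $ i * x $ i)"
    unfolding sum_distrib_left sum_subtractf[symmetric] by (intro sum.cong refl) (simp add: algebra_simps)
   then show ?thesis using False by (simp add: sum_nth_axis sx)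
  qed
  have s2: "(\<Sum>i\<in>UNIV. (if i = j then 1 else 0) * ?Y i x) = 1 - (c x)\<^sup>2"
   unfolding sum_nth_axis by (simp add: c_def n2 power_divide power2_eq_square)
  have "(\<Sum>i\<in>UNIV. cutoff' j \<theta> \<epsilon> i x * ?Y i x) =
    (shell' x * ramp \<epsilon> (c x - cos \<theta>) - shell x * ramp' \<epsilon> (c x - cos \<theta>) * x $ j / norm x ^ 3) * (\<Sum>i\<in>UNIV. x $ i * ?Y i x) +
    shell x * ramp' \<epsilon> (c x - cos \<theta>) / norm x * (\<Sum>i\<in>UNIV. (if i = j then 1 else 0) * ?Y i x)"
   unfolding sum_distrib_left sum.distrib[symmetric]
  proof (intro sum.cong refl)
   fix i show "cutoff' j \<theta> \<epsilon> i x * ?Y i x =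
    (shell' x * ramp \<epsilon> (c x - cos \<theta>) - shell x * ramp' \<epsilon> (c x - cos \<theta>) * x $ j / norm x ^ 3) * (x $ i * ?Y i x) +
    shell x * ramp' \<epsilon> (c x - cos \<theta>) / norm x * ((if i = j then 1 else 0) * ?Y i x)"
    by (cases "i = j"; simp add: cutoff'_def c_def algebra_simps divide_inverse)
  qed
  then have 1: "(\<Sum>i\<in>UNIV. cutoff' j \<theta> \<epsilon> i x * ?Y i x) = ?M x" unfolding s1 s2 by simp
  have "(\<Sum>i\<in>UNIV. ?Y' i x) = - ((\<Sum>i\<in>UNIV. (if i = j then 1 else 0) * x $ i) / (x \<bullet> x)) - real (CARD('m)) * (x $ j / (x \<bullet> x)) + 2 * x $ j / (x \<bullet> x)\<^sup>2 * (\<Sum>i\<in>UNIV. x $ i * x $ i)"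
  proof -
   have "real (CARD('m)) * (x $ j / (x \<bullet> x)) = (\<Sum>i\<in>(UNIV::'m set). x $ j / (x \<bullet> x))" by simp
   then show ?thesis unfolding sum_distrib_left sum_divide_distrib
    by (simp only: sum_negf[symmetric] sum_subtractf[symmetric] sum.distrib[symmetric])
      (intro sum.cong refl; simp add: power2_eq_square add_divide_distrib)
  qed
  also have "\<dots> = - (real (CARD('m)) - 1) * (x $ j / (x \<bullet> x))"
   unfolding sum_nth_axis sx using False by (simp add: power2_eq_square field_simps)
  finally have Y': "(\<Sum>i\<in>UNIV. ?Y' i x) = - (real (CARD('m)) - 1) * (x $ j / (x \<bullet> x))" .
  have 2: "(\<Sum>i\<in>UNIV. cutoff j \<theta> \<epsilon> x * ?Y' i x) = - ?R x"
   unfolding sum_distrib_left[symmetric] Y' by (simp only: mult.left_commute mult_minus_left mult_minus_right)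
  show ?thesis unfolding sum.distrib 1 2 by simp
 qed
 have Rc: "continuous_on UNIV ?R"
  by (rule continuous_on_zero_off[OF op csupp(1) sub]) (intro continuous_intros cc, simp, simp add: cutoff_zero)
 have Rle: "?R x \<le> real (CARD('m)) * shell x" "\<bar>?R x\<bar> \<le> real (CARD('m)) * shell x" for x
 proof -
  show "\<bar>?R x\<bar> \<le> real (CARD('m)) * shell x"
  proof (cases "x \<bullet> x < 1")
   case True then show ?thesis using shell_zero[of x] by (simp add: cutoff_def)
  next
   case False
   have n2: "x \<bullet> x = (norm x)\<^sup>2" by (simp add: power2_norm_eq_inner)
   have "1 \<le> norm x" using False unfolding n2 by (metis abs_norm_cancel abs_square_less_1 not_le)
   then have "norm x \<le> x \<bullet> x" unfolding n2 using mult_right_mono[of 1 "norm x" "norm x"] by (simp add: power2_eq_square)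
   moreover have "\<bar>x $ j\<bar> \<le> norm x" by (rule component_le_norm_cart)
   ultimately have a: "\<bar>x $ j / (x \<bullet> x)\<bar> \<le> 1" using False by (simp add: divide_le_eq)
   have b: "\<bar>cutoff j \<theta> \<epsilon> x\<bar> \<le> shell x"
    using ramp_bounds[OF e] shell_nonneg[of x] by (simp add: cutoff_def abs_mult mult_left_le)
   have "\<bar>?R x\<bar> = \<bar>real (CARD('m)) - 1\<bar> * (\<bar>cutoff j \<theta> \<epsilon> x\<bar> * \<bar>x $ j / (x \<bullet> x)\<bar>)" by (simp add: abs_mult)
   also have "\<dots> \<le> real (CARD('m)) * (shell x * 1)" using a b shell_nonneg[of x] by (intro mult_mono) auto
   finally show ?thesis by simp
  qed
  then show "?R x \<le> real (CARD('m)) * shell x" by linarith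
 qed
 have Ri: "integrable lborel ?R"
 proof (rule Bochner_Integration.integrable_bound)
  show "integrable lborel (\<lambda>x::real^'m. real (CARD('m)) * shell x)" using shell_integrable by simp
  show "AE x in lborel. norm (?R x) \<le> norm (real (CARD('m)) * shell x)"
  proof (rule AE_I2)
   fix x :: "real^'m"
   have "norm (real (CARD('m)) * shell x) = real (CARD('m)) * shell x" using shell_nonneg[of x] by simp
   then show "norm (?R x) \<le> norm (real (CARD('m)) * shell x)" using Rle(2)[of x] by (simp only: real_norm_def)
  qed
 qed (use borel_measurable_continuous_onI[OF Rc] in simp)
 have Si: "integrable lborel (\<lambda>x. \<Sum>i\<in>UNIV. ?D i x)" using I(2) by simp
 have MS: "?M = (\<lambda>x. (\<Sum>i\<in>UNIV. ?D i x) + ?R x)" using eq by auto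
 show ?int unfolding MS using Si Ri by (rule Bochner_Integration.integrable_add)
 have "(LBINT x. ?M x) = (LBINT x. (\<Sum>i\<in>UNIV. ?D i x)) + (LBINT x. ?R x)"
  unfolding MS using Si Ri by (rule Bochner_Integration.integral_add)
 also have "(LBINT x. (\<Sum>i\<in>UNIV. ?D i x)) = 0" using I Bochner_Integration.integral_sum[of UNIV lborel ?D] by simp
 also have "(LBINT x. ?R x) \<le> (LBINT x. real (CARD('m)) * shell (x::real^'m))"
  using Ri shell_integrable Rle(1) by (intro integral_mono) auto
 finally show ?le by simp
qed

section \<open>The flux inequality and the case of k at least 2\<close>

lemma newton_kernel: "A *v x = 0 \<Longrightarrow> newton A k *v x = msig A k *\<^sub>R (x::real^'m)"
proof (induction k)
 case 0 then show ?case by (simp add: msig_def)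
next
 case (Suc k)
 then show ?case by (simp add: newton_Suc matrix_vector_mult_diff_rdistrib scaleR_matrix_vector_assoc[symmetric]
    matrix_vector_mul_assoc[symmetric])
qed

lemma trace_mult_sum: "trace (T ** (A::real^'m^'m)) = (\<Sum>l\<in>UNIV. \<Sum>i\<in>UNIV. T $ i $ l * A $ l $ i)"
 unfolding trace_def matrix_matrix_mult_def vec_lambda_beta by (rule sum.swap)

locale two_cap_ext = one: cap_ext j \<theta> V1 H1 g1 A1 + two: cap_ext j \<theta> V2 H2 g2 A2
 for j :: "'m::finite" and \<theta> V1 H1 g1 A1 V2 H2 g2 A2
begin

text \<open>The divergence of T (H1 g2 - H2 g1), with T the Newton tensor of \<open>A2\<close>; the
  products of the two gradients cancel because T is symmetric.\<close>

definition flux_density :: "nat \<Rightarrow> real^'m \<Rightarrow> real" where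
 "flux_density k x = H1 x * trace (newton (A2 x) k ** A2 x) - H2 x * trace (newton (A2 x) k ** A1 x)"

text \<open>The component along the last basis vector of the field whose divergence is
  \<open>flux_density\<close>. Since that field is orthogonal to \<open>x\<close>, this component
  carries its whole flux through the cones on which \<open>x $ j / norm x\<close> is
  constant.\<close>

definition bdry_flux :: "nat \<Rightarrow> real^'m \<Rightarrow> real" where
 "bdry_flux k x = (newton (A2 x) k *v axis j 1) \<bullet> (H1 x *\<^sub>R g2 x - H2 x *\<^sub>R g1 x)"

lemma cont_newton: "continuous_on V2 (\<lambda>x. newton (A2 x) k $ i $ l)" by (rule continuous_on_newton) (intro continuous_intros two.A)

lemma cont_flux_density: "continuous_on (V1 \<inter> V2) (flux_density k)" unfolding flux_density_def[abs_def] trace_mult_sum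
 by (intro continuous_intros continuous_on_subset[OF cont_newton] continuous_on_subset[OF one.contH]
   continuous_on_subset[OF two.contH] continuous_on_subset[OF one.A] continuous_on_subset[OF two.A]) auto

lemma cont_bdry_flux: "continuous_on (V1 \<inter> V2) (bdry_flux k)"
 unfolding bdry_flux_def[abs_def] matrix_vector_mult_def inner_vec_def vec_lambda_beta
 by (intro continuous_intros continuous_on_subset[OF cont_newton] continuous_on_subset[OF one.contH]
   continuous_on_subset[OF two.contH] continuous_on_subset[OF one.contg] continuous_on_subset[OF two.contg]) auto

text \<open>Split the last basis vector into the conormal direction and a multiple of
  \<open>x\<close>; both are eigenvectors of the Newton tensor. The tested vector H1 g2 - H2 g1 is
  orthogonal to \<open>x\<close> by Euler's relation and has vanishing last component by the
  boundary condition.\<close>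

lemma bdry_flux_zero:
 assumes x: "x \<in> cone j \<theta>" and xj: "x $ j = cos \<theta> * norm x"
 shows "bdry_flux k x = 0"
proof -
 have xV: "x \<in> V1" "x \<in> V2" "x \<noteq> 0" using one.coneD[OF x] two.coneD[OF x] by auto
 let ?u = "H1 x *\<^sub>R g2 x - H2 x *\<^sub>R g1 x"
 let ?m = "axis j 1 - (cos \<theta> / norm x) *\<^sub>R x"
 have uj: "?u $ j = 0" using one.bdry[OF x xj] two.bdry[OF x xj] by simp
 have ux: "x \<bullet> ?u = 0" using one.euler(1)[OF xV(1)] two.euler(1)[OF xV(2)] by (simp add: inner_diff_right inner_commute)
 obtain b where b: "newton (A2 x) k *v ?m = b *\<^sub>R ?m" using two.boundary_eigenvector[OF x xj] newton_eigvec by blast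
 have "newton (A2 x) k *v axis j 1 = newton (A2 x) k *v ?m + (cos \<theta> / norm x) *\<^sub>R (newton (A2 x) k *v x)"
  by (simp add: matrix_vector_mult_diff_distrib matrix_vector_mult_scaleR)
 then have "bdry_flux k x = b * (?m \<bullet> ?u) + cos \<theta> / norm x * (msig (A2 x) k * (x \<bullet> ?u))"
  unfolding bdry_flux_def b newton_kernel[OF two.euler(2)[OF xV(2)]] by (simp only: inner_add_left inner_scaleR_left)
 also have "?m \<bullet> ?u = ?u $ j - cos \<theta> / norm x * (x \<bullet> ?u)" by (simp add: inner_diff_left inner_axis')
 finally show ?thesis unfolding ux uj by simp
qed

text \<open>Test the columns of the Newton tensor with the components of the cutoff times H1 g2 - H2
  g1 and add up. The part of the cutoff's gradient along \<open>x\<close> contributes nothing,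
  because \<open>x\<close> is an eigenvector of the tensor and the field is orthogonal to
  it.\<close>

lemma flux_identity:
 assumes e: "0 < \<epsilon>"
 shows "integrable lborel (\<lambda>x. cutoff j \<theta> \<epsilon> x * flux_density k x)"
  and "integrable lborel (\<lambda>x. shell x * ramp' \<epsilon> (x $ j / norm x - cos \<theta>) / norm x * bdry_flux k x)"
  and "(LBINT x. cutoff j \<theta> \<epsilon> x * flux_density k x) = - (LBINT x. shell x * ramp' \<epsilon> (x $ j / norm x - cos \<theta>) / norm x * bdry_flux k x)"
proof -
 let ?S = "csupp j \<theta>"
 let ?V = "V1 \<inter> V2"
 have SV: "?S \<subseteq> ?V" using csupp(2) one.coneV two.coneV by blast
 have oV: "open ?V" using one.openV two.openV by blast
 define u where "u x = H1 x *\<^sub>R g2 x - H2 x *\<^sub>R g1 x" for x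
 define u' where "u' i l x = (g1 x $ i * g2 x $ l + H1 x * A2 x $ i $ l) - (g2 x $ i * g1 x $ l + H2 x * A1 x $ i $ l)" for i l x
 have uc: "continuous_on ?V (\<lambda>x. u x $ l)" for l unfolding u_def
  by (intro continuous_intros continuous_on_subset[OF one.contH] continuous_on_subset[OF two.contH]
    continuous_on_subset[OF one.contg] continuous_on_subset[OF two.contg]) auto
 have u'c: "continuous_on ?V (u' i l)" for i l unfolding u'_def[abs_def]
  by (intro continuous_intros continuous_on_subset[OF one.contH] continuous_on_subset[OF two.contH]
    continuous_on_subset[OF one.contg] continuous_on_subset[OF two.contg] continuous_on_subset[OF one.A] continuous_on_subset[OF two.A]) auto
 have u_der: "DERIV (\<lambda>s. u (x + s *\<^sub>R axis i 1) $ l) 0 :> u' i l x" if "x \<in> ?V" for x i l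
  unfolding u_def u'_def vector_minus_component vector_scaleR_component real_scaleR_def
  by (rule DERIV_cong[OF DERIV_diff[OF DERIV_mult[OF one.DERIV_H_line two.DERIV_g_line] DERIV_mult[OF two.DERIV_H_line one.DERIV_g_line]]])
    (use that in \<open>auto simp: algebra_simps\<close>)
 have cc: "continuous_on T (cutoff j \<theta> \<epsilon>)" "continuous_on T (cutoff' j \<theta> \<epsilon> i)" for T i
  using continuous_cutoff[OF e] continuous_on_subset by blast+
 let ?\<phi> = "\<lambda>l x. cutoff j \<theta> \<epsilon> x * u x $ l"
 let ?\<phi>' = "\<lambda>l i x. cutoff' j \<theta> \<epsilon> i x * u x $ l + cutoff j \<theta> \<epsilon> x * u' i l x"
 have \<phi>0: "?\<phi> l x = 0" if "x \<notin> ?S" for l x using cutoff_zero[OF that] by simp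
 have \<phi>'0: "?\<phi>' l i x = 0" if "x \<notin> ?S" for l i x using cutoff_zero[OF that] cutoff'_zero[OF e that] by simp
 have \<phi>c: "continuous_on UNIV (?\<phi> l)" for l
  by (rule continuous_on_zero_off[OF oV csupp(1) SV _ \<phi>0]) (intro continuous_on_mult cc uc)
 have \<phi>'c: "continuous_on UNIV (?\<phi>' l i)" for l i
  by (rule continuous_on_zero_off[OF oV csupp(1) SV _ \<phi>'0]) (intro continuous_on_mult continuous_on_add cc uc u'c)
 have \<phi>': "DERIV (\<lambda>s. ?\<phi> l (x + s *\<^sub>R axis i 1)) 0 :> ?\<phi>' l i x" for l i x
 proof (cases "x \<in> ?V")
  case True
  show ?thesis by (rule DERIV_cong[OF DERIV_mult[OF DERIV_cutoff[OF e] u_der[OF True]]]) simp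
 next
  case False
  then have xS: "x \<in> - ?S" using SV by blast
  have "open (- ?S)" using csupp(1)[of j \<theta>] by (simp add: compact_imp_closed open_Compl)
  then have op: "open ((\<lambda>s. x + s *\<^sub>R axis i (1::real)) -` (- ?S))" by (rule open_vimage) (intro continuous_intros)
  have "?\<phi>' l i x = 0" by (rule \<phi>'0) (use xS in simp)
  then have "DERIV (\<lambda>s. 0) 0 :> ?\<phi>' l i x" by simp
  then show ?thesis by (rule has_field_derivative_transform_within_open[OF _ op]) (use xS \<phi>0 in auto)
 qed
 have W: "(LBINT x. (\<Sum>i\<in>UNIV. newton (A2 x) k $ i $ l * ?\<phi>' l i x)) = 0" for l
  by (rule newton_weak_div_free[OF two.openV csupp(1)[of j \<theta>] _ two.g two.A two.sym \<phi>0 \<phi>c \<phi>' \<phi>'c]) (use SV in auto)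
 have int: "integrable lborel (\<lambda>x. P x)" if "continuous_on ?V P" "\<And>x. x \<notin> ?S \<Longrightarrow> P x = 0" for P :: "real^'m \<Rightarrow> real"
 proof -
  have "(\<lambda>x. indicator ?S x *\<^sub>R P x) = P" using that(2) by (auto simp: fun_eq_iff indicator_def)
  then show ?thesis using borel_integrable_compact[OF csupp(1) continuous_on_subset[OF that(1) SV]] by simp
 qed
 have nc: "continuous_on ?V (\<lambda>x. newton (A2 x) k $ i $ l)" for i l by (rule continuous_on_subset[OF cont_newton]) auto
 have Wi: "integrable lborel (\<lambda>x. \<Sum>i\<in>UNIV. newton (A2 x) k $ i $ l * ?\<phi>' l i x)" for l
  by (rule int) (intro continuous_intros nc cc uc u'c, simp add: \<phi>'0)
 have z: "(LBINT x. (\<Sum>l\<in>UNIV. \<Sum>i\<in>UNIV. newton (A2 x) k $ i $ l * ?\<phi>' l i x)) = 0"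
  by (subst Bochner_Integration.integral_sum) (use W Wi in auto)
 show i1: "integrable lborel (\<lambda>x. cutoff j \<theta> \<epsilon> x * flux_density k x)"
  by (rule int) (intro continuous_intros cc cont_flux_density, simp add: cutoff_zero)
 have V0: "x \<noteq> 0" if "x \<in> ?V" for x using that one.V0 by auto
 show i2: "integrable lborel (\<lambda>x. shell x * ramp' \<epsilon> (x $ j / norm x - cos \<theta>) / norm x * bdry_flux k x)"
 proof (rule int)
  have "continuous_on ?V (\<lambda>x. x $ j / norm x - cos \<theta>)" by (intro continuous_intros) (use V0 in auto)
  from continuous_ramp(2)[OF e this]
  show "continuous_on ?V (\<lambda>x. shell x * ramp' \<epsilon> (x $ j / norm x - cos \<theta>) / norm x * bdry_flux k x)"
   by (intro continuous_intros continuous_shell cont_bdry_flux) (use V0 in auto)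
  fix x assume "x \<notin> ?S"
  then have "shell x * ramp' \<epsilon> (x $ j / norm x - cos \<theta>) = 0" using cutoff_zero by blast
  then show "shell x * ramp' \<epsilon> (x $ j / norm x - cos \<theta>) / norm x * bdry_flux k x = 0" by (simp only: div_0 mult_zero_left)
 qed
 have eq: "(\<Sum>l\<in>UNIV. \<Sum>i\<in>UNIV. newton (A2 x) k $ i $ l * ?\<phi>' l i x) =
   cutoff j \<theta> \<epsilon> x * flux_density k x + shell x * ramp' \<epsilon> (x $ j / norm x - cos \<theta>) / norm x * bdry_flux k x" for x
 proof (cases "x \<in> ?S")
  case False
  then have z: "shell x * ramp' \<epsilon> (x $ j / norm x - cos \<theta>) = 0" "cutoff j \<theta> \<epsilon> x = 0" using cutoff_zero by blast+
  have "(\<Sum>l\<in>UNIV. \<Sum>i\<in>UNIV. newton (A2 x) k $ i $ l * ?\<phi>' l i x) = 0"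
   by (intro sum.neutral ballI) (simp only: \<phi>'0[OF False] mult_zero_right)
  then show ?thesis by (simp only: z mult_zero_left div_0 add_0)
 next
  case True
  then have xV: "x \<in> V1" "x \<in> V2" using SV by auto
  define T where "T = newton (A2 x) k"
  have T: "T $ i $ l = T $ l $ i" for i l
   using arg_cong[OF transpose_newton[OF two.sym[OF xV(2)], of k], of "\<lambda>M. M $ l $ i"] by (simp add: T_def transpose_def)
  have As: "A1 x $ i $ l = A1 x $ l $ i" "A2 x $ i $ l = A2 x $ l $ i" for i l
   using arg_cong[OF one.sym[OF xV(1)], of "\<lambda>M. M $ l $ i"] arg_cong[OF two.sym[OF xV(2)], of "\<lambda>M. M $ l $ i"]
   by (simp_all add: transpose_def)
  have mv: "(\<Sum>l\<in>UNIV. \<Sum>i\<in>UNIV. T $ i $ l * (a $ i * b $ l)) = (T *v a) \<bullet> b" for a b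
   by (simp add: matrix_vector_mult_def inner_vec_def sum_distrib_right sum_distrib_left T mult_ac)
  have sw: "(T *v a) \<bullet> b = (T *v b) \<bullet> a" for a b
  proof -
   have "transpose T = T" unfolding T_def by (rule transpose_newton[OF two.sym[OF xV(2)]])
   then show ?thesis using dot_lmul_matrix[of b T a] by (metis inner_commute transpose_matrix_vector)
  qed
  have tr: "(\<Sum>l\<in>UNIV. \<Sum>i\<in>UNIV. T $ i $ l * M $ i $ l) = trace (T ** M)" if "\<And>i l. M $ i $ l = M $ l $ i" for M
   unfolding trace_mult_sum by (intro sum.cong refl) (simp add: that)
  have Tx: "(T *v x) \<bullet> u x = 0" unfolding T_def newton_kernel[OF two.euler(2)[OF xV(2)]]
   using one.euler(1)[OF xV(1)] two.euler(1)[OF xV(2)] by (simp add: u_def inner_diff_right inner_commute)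
  have 1: "(\<Sum>l\<in>UNIV. \<Sum>i\<in>UNIV. T $ i $ l * u' i l x) = flux_density k x"
  proof -
   have "(\<Sum>l\<in>UNIV. \<Sum>i\<in>UNIV. T $ i $ l * u' i l x) =
    ((\<Sum>l\<in>UNIV. \<Sum>i\<in>UNIV. T $ i $ l * (g1 x $ i * g2 x $ l)) + H1 x * (\<Sum>l\<in>UNIV. \<Sum>i\<in>UNIV. T $ i $ l * A2 x $ i $ l)) -
    ((\<Sum>l\<in>UNIV. \<Sum>i\<in>UNIV. T $ i $ l * (g2 x $ i * g1 x $ l)) + H2 x * (\<Sum>l\<in>UNIV. \<Sum>i\<in>UNIV. T $ i $ l * A1 x $ i $ l))"
    unfolding sum_distrib_left sum.distrib[symmetric] sum_subtractf[symmetric]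
    by (intro sum.cong refl) (simp add: u'_def algebra_simps)
   then show ?thesis unfolding mv tr[OF As(1)] tr[OF As(2)] sw[of "g2 x"] by (simp add: flux_density_def T_def)
  qed
  define a where "a = shell' x * ramp \<epsilon> (x $ j / norm x - cos \<theta>) - shell x * ramp' \<epsilon> (x $ j / norm x - cos \<theta>) * x $ j / norm x ^ 3"
  define b where "b = shell x * ramp' \<epsilon> (x $ j / norm x - cos \<theta>) / norm x"
  have c': "cutoff' j \<theta> \<epsilon> i x = a * x $ i + b * axis j 1 $ i" for i
   by (cases "i = j"; simp add: cutoff'_def a_def b_def axis_def algebra_simps divide_inverse)
  have 2: "(\<Sum>l\<in>UNIV. \<Sum>i\<in>UNIV. T $ i $ l * (cutoff' j \<theta> \<epsilon> i x * u x $ l)) = b * bdry_flux k x"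
  proof -
   have "(\<Sum>l\<in>UNIV. \<Sum>i\<in>UNIV. T $ i $ l * (cutoff' j \<theta> \<epsilon> i x * u x $ l)) =
    a * (\<Sum>l\<in>UNIV. \<Sum>i\<in>UNIV. T $ i $ l * (x $ i * u x $ l)) + b * (\<Sum>l\<in>UNIV. \<Sum>i\<in>UNIV. T $ i $ l * (axis j 1 $ i * u x $ l))"
    unfolding sum_distrib_left sum.distrib[symmetric] c' by (intro sum.cong refl) (simp add: algebra_simps)
   then show ?thesis unfolding mv Tx by (simp add: bdry_flux_def T_def u_def)
  qed
  have "(\<Sum>l\<in>UNIV. \<Sum>i\<in>UNIV. T $ i $ l * ?\<phi>' l i x) =
    (\<Sum>l\<in>UNIV. \<Sum>i\<in>UNIV. T $ i $ l * (cutoff' j \<theta> \<epsilon> i x * u x $ l)) + cutoff j \<theta> \<epsilon> x * (\<Sum>l\<in>UNIV. \<Sum>i\<in>UNIV. T $ i $ l * u' i l x)"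
   unfolding sum_distrib_left sum.distrib[symmetric] by (intro sum.cong refl) (simp add: algebra_simps)
  then show ?thesis unfolding 1 2 by (simp add: T_def b_def)
 qed
 have "(LBINT x. cutoff j \<theta> \<epsilon> x * flux_density k x + shell x * ramp' \<epsilon> (x $ j / norm x - cos \<theta>) / norm x * bdry_flux k x) = 0"
  using z unfolding eq .
 then show "(LBINT x. cutoff j \<theta> \<epsilon> x * flux_density k x) = - (LBINT x. shell x * ramp' \<epsilon> (x $ j / norm x - cos \<theta>) / norm x * bdry_flux k x)"
  unfolding Bochner_Integration.integral_add[OF i1 i2] by simp
qed

text \<open>The flux vanishes on the boundary of the cone, but mere continuity gives no rate. On the
  compact set where it reaches the \<delta> term, the angular distance to the boundary is at least
  some m > 0, so B / m^3 times the cube of the distance dominates.\<close>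

lemma bdry_flux_bound:
 assumes d: "0 < \<delta>"
 obtains C where "0 \<le> C" "\<And>x. x \<in> csupp j \<theta> \<Longrightarrow>
  \<bar>bdry_flux k x\<bar> \<le> \<delta> * (1 - (x $ j / norm x)\<^sup>2) + C * (x $ j / norm x - cos \<theta>) ^ 3"
proof -
 let ?S = "csupp j \<theta>"
 let ?c = "\<lambda>x::real^'m. x $ j / norm x"
 have Sc: "x \<in> cone j \<theta>" "x \<noteq> 0" if "x \<in> ?S" for x using that csupp(2) by (auto simp: cone_def)
 have SV: "?S \<subseteq> V1 \<inter> V2" using csupp(2) one.coneV two.coneV by blast
 have wc: "continuous_on ?S (bdry_flux k)" using continuous_on_subset[OF cont_bdry_flux SV] .
 have cc: "continuous_on ?S ?c" by (intro continuous_intros) (use Sc in auto)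
 have c0: "0 \<le> ?c x - cos \<theta>" if "x \<in> ?S" for x using Sc[OF that] by (auto simp: cone_def le_divide_eq)
 have c1: "0 \<le> 1 - (?c x)\<^sup>2" for x
 proof -
  have "\<bar>?c x\<bar> \<le> 1" using component_le_norm_cart[of x j] by (cases "x = 0") (simp_all add: divide_le_eq)
  then show ?thesis by (simp add: abs_square_le_1)
 qed
 let ?T = "{x \<in> ?S. \<delta> * (1 - (?c x)\<^sup>2) \<le> \<bar>bdry_flux k x\<bar>}"
 have "closed ?T" by (rule continuous_on_closed_Collect_le) (intro continuous_intros wc cc compact_imp_closed csupp(1))+
 then have "compact (?S \<inter> ?T)" by (rule compact_Int_closed[OF csupp(1)])
 moreover have "?S \<inter> ?T = ?T" by auto
 ultimately have T: "compact ?T" by (simp only:)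
 obtain B where B: "\<And>x. x \<in> ?S \<Longrightarrow> \<bar>bdry_flux k x\<bar> \<le> B"
  using compact_imp_bounded[OF compact_continuous_image[OF wc csupp(1)]] unfolding bounded_iff by auto
 show thesis
 proof (cases "?T = {}")
  case True
  show thesis
  proof (rule that[of 0])
   fix x assume x: "x \<in> ?S"
   then have "\<bar>bdry_flux k x\<bar> < \<delta> * (1 - (?c x)\<^sup>2)" using True by (auto simp: not_le)
   then show "\<bar>bdry_flux k x\<bar> \<le> \<delta> * (1 - (?c x)\<^sup>2) + 0 * (?c x - cos \<theta>) ^ 3" by simp
  qed simp
 next
  case False
  have "continuous_on ?T (\<lambda>x. ?c x - cos \<theta>)" by (intro continuous_intros continuous_on_subset[OF cc]) (use Sc in auto)
  then obtain y where y: "y \<in> ?T" "\<And>x. x \<in> ?T \<Longrightarrow> ?c y - cos \<theta> \<le> ?c x - cos \<theta>" using continuous_attains_inf[OF T False] by blast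
  define m where "m = ?c y - cos \<theta>"
  have "m \<noteq> 0"
  proof
   assume "m = 0"
   then have e: "?c y = cos \<theta>" by (simp add: m_def)
   have yS: "y \<in> ?S" using y by simp
   have "y $ j = cos \<theta> * norm y" using e Sc(2)[OF yS] by (simp add: field_simps)
   then have "bdry_flux k y = 0" by (rule bdry_flux_zero[OF Sc(1)[OF yS]])
   moreover have "0 < \<delta> * (1 - (?c y)\<^sup>2)" unfolding e using d sin_gt_zero[OF one.\<theta>] by (simp flip: sin_squared_eq)
   ultimately show False using y(1) by auto
  qed
  then have m: "0 < m" using c0[of y] y(1) by (auto simp: m_def)
  have B0: "0 \<le> B" using B[of y] y(1) abs_ge_zero[of "bdry_flux k y"] by auto
  show thesis
  proof (rule that[of "B / m ^ 3"])
   show "0 \<le> B / m ^ 3" using B0 m by simp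
   fix x assume x: "x \<in> ?S"
   show "\<bar>bdry_flux k x\<bar> \<le> \<delta> * (1 - (?c x)\<^sup>2) + B / m ^ 3 * (?c x - cos \<theta>) ^ 3"
   proof (cases "x \<in> ?T")
    case True
    then have "m ^ 3 \<le> (?c x - cos \<theta>) ^ 3" using y(2) m by (intro power_mono) (auto simp: m_def)
    then have "B / m ^ 3 * m ^ 3 \<le> B / m ^ 3 * (?c x - cos \<theta>) ^ 3" using B0 m by (intro mult_left_mono) auto
    then have "B \<le> B / m ^ 3 * (?c x - cos \<theta>) ^ 3" using m by simp
    then show ?thesis using B[OF x] mult_nonneg_nonneg[OF less_imp_le[OF d] c1[of x]] by linarith
   next
    case False
    then have "\<bar>bdry_flux k x\<bar> < \<delta> * (1 - (?c x)\<^sup>2)" using x by (auto simp: not_le)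
    moreover have "0 \<le> B / m ^ 3 * (?c x - cos \<theta>) ^ 3" using B0 m c0[OF x] by simp
    ultimately show ?thesis by linarith
   qed
  qed
 qed
qed

text \<open>In \<open>flux_identity\<close> the boundary term is at most \<delta> times the mass
  from \<open>cutoff_mass\<close> plus a multiple of \<epsilon> that depends on \<delta>: let
  \<epsilon> tend to 0 for fixed \<delta>, and only then choose \<delta> small. Passing to an upper
  bound \<open>Q\<close> lets a pointwise Garding estimate enter under the integral.\<close>

lemma flux_nonneg:
 assumes Q: "continuous_on (cone j \<theta>) Q" and le: "\<And>x. x \<in> cone j \<theta> \<Longrightarrow> flux_density k x \<le> Q x"
 shows "integrable lborel (\<lambda>x. indicator {x. cos \<theta> * norm x < x $ j} x * shell x * Q x)"
  and "0 \<le> (LBINT x. indicator {x. cos \<theta> * norm x < x $ j} x * shell x * Q x)"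
proof -
 let ?S = "csupp j \<theta>"
 let ?c = "\<lambda>x::real^'m. x $ j / norm x"
 let ?I = "indicator {x. cos \<theta> * norm x < x $ j} :: real^'m \<Rightarrow> real"
 have Sc: "x \<in> cone j \<theta>" "x \<noteq> 0" if "x \<in> ?S" for x using that csupp(2) by (auto simp: cone_def)
 have QS: "continuous_on ?S Q" using continuous_on_subset[OF Q csupp(2)] .
 have Qi: "integrable lborel (\<lambda>x. indicator ?S x *\<^sub>R (shell x * Q x))"
  by (rule borel_integrable_compact[OF csupp(1)]) (intro continuous_intros continuous_shell QS)
 have Im: "?I \<in> borel_measurable lborel"
 proof (rule borel_measurable_indicator)
  have "open {x::real^'m. cos \<theta> * norm x < x $ j}" by (intro open_Collect_less continuous_intros)
  then show "{x::real^'m. cos \<theta> * norm x < x $ j} \<in> sets lborel" by simp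
 qed
 have lim_eq: "?I x * shell x * Q x = ?I x * (indicator ?S x *\<^sub>R (shell x * Q x))" for x
 proof (cases "x \<in> ?S")
  case False
  show ?thesis
  proof (cases "x \<bullet> x < 1 \<or> 2 < x \<bullet> x")
   case True then show ?thesis using shell_zero[OF True] by simp
  next
   case False
   then have "\<not> cos \<theta> * norm x < x $ j" using \<open>x \<notin> ?S\<close> by (auto simp: csupp_def)
   then show ?thesis by simp
  qed
 qed simp
 have meas: "(\<lambda>x. ?I x * shell x * Q x) \<in> borel_measurable lborel"
  unfolding lim_eq using Im borel_measurable_integrable[OF Qi] by (rule borel_measurable_times)
 show int: "integrable lborel (\<lambda>x. ?I x * shell x * Q x)"
  by (rule Bochner_Integration.integrable_bound[OF Qi meas]) (rule AE_I2, unfold lim_eq, auto simp: indicator_def)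
 define e where "e n = 1 / (real n + 1)" for n
 have e: "0 < e n" for n by (simp add: e_def)
 have e0: "e \<longlonglongrightarrow> 0" unfolding e_def[abs_def] by real_asymp
 have cutQ: "cutoff j \<theta> (e n) x * Q x = ramp (e n) (?c x - cos \<theta>) * (indicator ?S x *\<^sub>R (shell x * Q x))" for n x
  using cutoff_zero[of x j \<theta> "e n"] by (cases "x \<in> ?S") (auto simp: cutoff_def)
 have cQm: "(\<lambda>x. cutoff j \<theta> (e n) x * Q x) \<in> borel_measurable lborel" for n
 proof -
  have eq: "cutoff j \<theta> (e n) x * Q x = cutoff j \<theta> (e n) x * (indicator ?S x *\<^sub>R Q x)" for x
   using cutoff_zero[of x j \<theta> "e n"] by (cases "x \<in> ?S") auto
  show ?thesis unfolding eq
   using borel_measurable_integrable[OF borel_integrable_compact[OF csupp(1) QS]] borel_measurable_continuous_onI[OF continuous_cutoff(1)[OF e]]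
   by (intro borel_measurable_times) auto
 qed
 have bd: "norm (cutoff j \<theta> (e n) x * Q x) \<le> norm (indicator ?S x *\<^sub>R (shell x * Q x))" for n x
  unfolding cutQ using ramp_bounds[OF e[of n], of "?c x - cos \<theta>"] by (simp add: abs_mult mult_left_le_one_le)
 have cQi: "integrable lborel (\<lambda>x. cutoff j \<theta> (e n) x * Q x)" for n
  by (rule Bochner_Integration.integrable_bound[OF Qi cQm]) (rule AE_I2, rule bd)
 have lim: "(\<lambda>n. LBINT x. cutoff j \<theta> (e n) x * Q x) \<longlonglongrightarrow> (LBINT x. ?I x * shell x * Q x)"
 proof (rule integral_dominated_convergence[where w = "\<lambda>x. norm (indicator ?S x *\<^sub>R (shell x * Q x))"])
  show "AE x in lborel. (\<lambda>n. cutoff j \<theta> (e n) x * Q x) \<longlonglongrightarrow> ?I x * shell x * Q x"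
  proof (rule AE_I2)
   fix x
   show "(\<lambda>n. cutoff j \<theta> (e n) x * Q x) \<longlonglongrightarrow> ?I x * shell x * Q x"
   proof (cases "x \<in> ?S")
    case False
    then show ?thesis unfolding lim_eq using cutoff_zero[OF False] by simp
   next
    case True
    have "(\<lambda>n. ramp (e n) (?c x - cos \<theta>)) \<longlonglongrightarrow> ?I x"
    proof (cases "cos \<theta> * norm x < x $ j")
     case c: True
     then have s: "0 < ?c x - cos \<theta>" using Sc(2)[OF True] by (simp add: less_divide_eq)
     have "(\<lambda>n. (?c x - cos \<theta>)\<^sup>2 / ((?c x - cos \<theta>)\<^sup>2 + e n)) \<longlonglongrightarrow> (?c x - cos \<theta>)\<^sup>2 / ((?c x - cos \<theta>)\<^sup>2 + 0)"
      by (intro tendsto_intros e0) (use s in simp)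
     then show ?thesis using c s by (simp add: ramp_def max_def)
    next
     case c: False
     then have "?c x - cos \<theta> \<le> 0" using Sc(2)[OF True] by (simp add: divide_le_eq)
     then show ?thesis using c ramp_neg by simp
    qed
    then have "(\<lambda>n. shell x * ramp (e n) (?c x - cos \<theta>) * Q x) \<longlonglongrightarrow> shell x * ?I x * Q x" by (intro tendsto_intros)
    then show ?thesis by (simp add: cutoff_def mult_ac)
   qed
  qed
  show "integrable lborel (\<lambda>x. norm (indicator ?S x *\<^sub>R (shell x * Q x)))" using Qi by (rule integrable_norm)
  show "AE x in lborel. norm (cutoff j \<theta> (e n) x * Q x) \<le> norm (indicator ?S x *\<^sub>R (shell x * Q x))" for n
   by (rule AE_I2) (rule bd)
 qed (rule meas cQm)+
 let ?M0 = "real (CARD('m)) * (LBINT x. shell (x::real^'m))" and ?M1 = "LBINT x. shell (x::real^'m)"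
 have lower: "- (\<delta> * ?M0) \<le> (LBINT x. ?I x * shell x * Q x)" if d: "0 < \<delta>" for \<delta>
 proof -
  obtain C where C: "0 \<le> C" "\<And>x. x \<in> ?S \<Longrightarrow> \<bar>bdry_flux k x\<bar> \<le> \<delta> * (1 - (?c x)\<^sup>2) + C * (?c x - cos \<theta>) ^ 3"
   using bdry_flux_bound[OF d] by blast
  have est: "- (\<delta> * ?M0 + 2 * C * e n * ?M1) \<le> (LBINT x. cutoff j \<theta> (e n) x * Q x)" for n
  proof -
   let ?w = "\<lambda>x. shell x * ramp' (e n) (?c x - cos \<theta>) / norm x * bdry_flux k x"
   let ?m = "\<lambda>x. shell x * ramp' (e n) (?c x - cos \<theta>) * (1 - (?c x)\<^sup>2) / norm x"
   have pw: "?w x \<le> \<delta> * ?m x + 2 * C * e n * shell x" for x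
   proof (cases "x \<in> ?S")
    case False
    then have z: "shell x * ramp' (e n) (?c x - cos \<theta>) = 0" using cutoff_zero by blast
    have "0 \<le> 2 * C * e n * shell x" using C(1) e[of n] shell_nonneg[of x] by simp
    then show ?thesis by (simp only: z mult_zero_left div_0 mult_zero_right add_0)
   next
    case True
    have n1: "1 \<le> norm x"
    proof -
     have "1 \<le> (norm x)\<^sup>2" using True by (simp add: csupp_def power2_norm_eq_inner)
     then show ?thesis by (metis abs_norm_cancel abs_square_less_1 not_le)
    qed
    have s: "0 \<le> ?c x - cos \<theta>" using Sc[OF True] by (auto simp: cone_def le_divide_eq)
    define a where "a = shell x * ramp' (e n) (?c x - cos \<theta>) / norm x"
    have a: "0 \<le> a" using ramp_bounds[OF e[of n]] shell_nonneg[of x] by (simp add: a_def)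
    have "?w x \<le> a * \<bar>bdry_flux k x\<bar>" unfolding a_def[symmetric] using a by (intro mult_left_mono) auto
    also have "\<dots> \<le> a * (\<delta> * (1 - (?c x)\<^sup>2) + C * (?c x - cos \<theta>) ^ 3)" using a C(2)[OF True] by (rule mult_left_mono[rotated])
    also have "\<dots> = \<delta> * ?m x + C * (shell x / norm x) * (ramp' (e n) (?c x - cos \<theta>) * (?c x - cos \<theta>) ^ 3)"
     by (simp add: a_def algebra_simps divide_inverse)
    also have "\<dots> \<le> \<delta> * ?m x + C * (shell x / norm x) * (2 * e n)"
     using ramp'_cubed[OF e[of n] s] C(1) shell_nonneg[of x] by (intro add_left_mono mult_left_mono) auto
    also have "\<dots> \<le> \<delta> * ?m x + C * shell x * (2 * e n)"
    proof -
     have "shell x / norm x \<le> shell x" using n1 shell_nonneg[of x] by (simp add: divide_le_eq mult_left_mono) (metis mult.right_neutral mult_left_mono)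
     then show ?thesis using C(1) e[of n] by (intro add_left_mono mult_right_mono mult_left_mono) auto
    qed
    finally show ?thesis by (simp add: mult_ac)
   qed
   have "(LBINT x. ?w x) \<le> (LBINT x. \<delta> * ?m x + 2 * C * e n * shell x)"
    by (rule integral_mono[OF flux_identity(2)[OF e] _ pw]) (intro Bochner_Integration.integrable_add integrable_mult_right cutoff_mass(1) e shell_integrable)
   also have "\<dots> = \<delta> * (LBINT x. ?m x) + 2 * C * e n * ?M1"
   proof -
    have i1: "integrable lborel (\<lambda>x. \<delta> * ?m x)" by (intro integrable_mult_right cutoff_mass(1) e)
    have i2: "integrable lborel (\<lambda>x::real^'m. 2 * C * e n * shell x)" by (intro integrable_mult_right shell_integrable)
    show ?thesis by (simp only: Bochner_Integration.integral_add[OF i1 i2] integral_mult_right_zero)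
   qed
   also have "\<dots> \<le> \<delta> * ?M0 + 2 * C * e n * ?M1" using cutoff_mass(2)[OF e[of n], of j \<theta>] d by simp
   finally have "- (\<delta> * ?M0 + 2 * C * e n * ?M1) \<le> (LBINT x. cutoff j \<theta> (e n) x * flux_density k x)"
    unfolding flux_identity(3)[OF e] by simp
   also have "\<dots> \<le> (LBINT x. cutoff j \<theta> (e n) x * Q x)"
   proof (rule integral_mono[OF flux_identity(1)[OF e] cQi])
    fix x show "cutoff j \<theta> (e n) x * flux_density k x \<le> cutoff j \<theta> (e n) x * Q x"
    proof (cases "x \<in> ?S")
     case True
     have "0 \<le> cutoff j \<theta> (e n) x" using ramp_bounds[OF e[of n]] shell_nonneg[of x] by (simp add: cutoff_def)
     then show ?thesis using le[OF Sc(1)[OF True]] by (rule mult_left_mono[rotated])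
    qed (simp add: cutoff_zero)
   qed
   finally show ?thesis .
  qed
  have "(\<lambda>n. - (\<delta> * ?M0 + 2 * C * e n * ?M1)) \<longlonglongrightarrow> - (\<delta> * ?M0 + 2 * C * 0 * ?M1)" by (intro tendsto_intros e0)
  from tendsto_le[OF _ lim this] est show ?thesis by simp
 qed
 have M0: "0 \<le> ?M0" by (simp add: shell_nonneg)
 show "0 \<le> (LBINT x. ?I x * shell x * Q x)"
 proof (rule ccontr)
  assume neg: "\<not> ?thesis"
  let ?J = "LBINT x. ?I x * shell x * Q x"
  have "0 < - ?J" using neg by linarith
  moreover have "0 < 2 * (M + 1)" if "0 \<le> M" for M :: real using that by simp
  note this[OF M0]
  \<comment> \<open>With this \<delta> the lower bound is at least J / 2, which exceeds J when J <
    0; adding 1 keeps the denominator positive.\<close>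
  ultimately have "0 < - ?J / (2 * (?M0 + 1))" by (rule divide_pos_pos)
  from lower[OF this] have "- (- ?J / (2 * (?M0 + 1)) * ?M0) \<le> ?J" .
  moreover have frac: "a / (2 * (M + 1)) * M \<le> a / 2" if "0 \<le> a" "0 \<le> M" for a M :: real using that by (simp add: field_simps)
  have "0 \<le> - ?J" using neg by linarith
  note frac[OF this M0]
  ultimately show False using neg by linarith
 qed
qed
end

section \<open>Pointwise comparison and uniqueness for k at least 2\<close>

lemma (in cap_ext) swap_two:
 assumes "cap_ext j \<theta> V2 H2 g2 A2"
 shows "two_cap_ext j \<theta> V H g A V2 H2 g2 A2" "two_cap_ext j \<theta> V2 H2 g2 A2 V H g A"
proof -
 interpret b: cap_ext j \<theta> V2 H2 g2 A2 by (rule assms)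
 show "two_cap_ext j \<theta> V H g A V2 H2 g2 A2" "two_cap_ext j \<theta> V2 H2 g2 A2 V H g A" by unfold_locales
qed

text \<open>Both integrals given by \<open>flux_nonneg\<close> are nonnegative while the integrand
  of their sum is nonpositive. So it vanishes almost everywhere, and by continuity wherever
  \<open>shell\<close> is positive inside the cone.\<close>

lemma flux_pair_zero:
 assumes c1: "cap_ext j \<theta> V1 H1 g1 A1" and c2: "cap_ext j \<theta> V2 H2 g2 A2"
  and Q: "continuous_on (cone j \<theta>) Q1" "continuous_on (cone j \<theta>) Q2"
  and le1: "\<And>x. x \<in> cone j \<theta> \<Longrightarrow> two_cap_ext.flux_density H1 A1 H2 A2 k x \<le> Q1 x"
  and le2: "\<And>x. x \<in> cone j \<theta> \<Longrightarrow> two_cap_ext.flux_density H2 A2 H1 A1 k x \<le> Q2 x"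
  and le: "\<And>x. x \<in> cone j \<theta> \<Longrightarrow> Q1 x + Q2 x \<le> 0"
  and x: "cos \<theta> * norm x < x $ j" "1 < x \<bullet> x" "x \<bullet> x < 2"
 shows "Q1 x + Q2 x = 0"
proof -
 interpret a: two_cap_ext j \<theta> V1 H1 g1 A1 V2 H2 g2 A2 by (rule cap_ext.swap_two[OF c1 c2])
 interpret b: two_cap_ext j \<theta> V2 H2 g2 A2 V1 H1 g1 A1 by (rule cap_ext.swap_two[OF c2 c1])
 let ?I = "indicator {x. cos \<theta> * norm x < x $ j} :: real^'a \<Rightarrow> real"
 let ?P = "\<lambda>x. - (?I x * shell x * Q1 x + ?I x * shell x * Q2 x)"
 note n1 = a.flux_nonneg[OF Q(1) le1] and n2 = b.flux_nonneg[OF Q(2) le2]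
 have int: "integrable lborel ?P" by (intro integrable_minus Bochner_Integration.integrable_add n1(1) n2(1))
 have coneI: "y \<in> cone j \<theta>" if "cos \<theta> * norm y < y $ j" for y using that by (auto simp: cone_def)
 have nn: "0 \<le> ?P y" for y
 proof (cases "cos \<theta> * norm y < y $ j")
  case True
  have "shell y * (Q1 y + Q2 y) \<le> 0" using shell_nonneg[of y] le[OF coneI[OF True]] by (rule mult_nonneg_nonpos)
  then show ?thesis using True by (simp add: distrib_left)
 qed simp
 have "(LBINT y. ?P y) = - ((LBINT y. ?I y * shell y * Q1 y) + (LBINT y. ?I y * shell y * Q2 y))"
  by (simp only: Bochner_Integration.integral_minus Bochner_Integration.integral_add[OF n1(1) n2(1)])
 then have "(LBINT y. ?P y) \<le> 0" using n1(2) n2(2) by linarith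
 moreover have "0 \<le> (LBINT y. ?P y)" by (rule Bochner_Integration.integral_nonneg) (rule nn)
 ultimately have "(LBINT y. ?P y) = 0" by linarith
 then have AE: "AE y in lborel. ?P y = 0" using integral_nonneg_eq_0_iff_AE[OF int] nn by simp
 let ?U = "{y. cos \<theta> * norm y < y $ j \<and> 1 < y \<bullet> y \<and> y \<bullet> y < 2}"
 have op: "open ?U" by (intro open_Collect_conj open_Collect_less continuous_intros)
 have sub: "?U \<subseteq> cone j \<theta>" using coneI by auto
 show ?thesis
 proof (rule AE_zero_continuous[OF op, of "\<lambda>x. Q1 x + Q2 x"])
  show "continuous_on ?U (\<lambda>x. Q1 x + Q2 x)" by (intro continuous_intros continuous_on_subset[OF Q(1) sub] continuous_on_subset[OF Q(2) sub])
  show "AE y in lborel. y \<in> ?U \<longrightarrow> Q1 y + Q2 y = 0" using AE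
  proof eventually_elim
   case (elim y)
   show ?case
   proof
    assume y: "y \<in> ?U"
    then have "shell y * (Q1 y + Q2 y) = 0" using elim by (simp add: distrib_left)
    moreover have "0 < shell y" using y by (simp add: shell_def max_def zero_less_mult_iff)
    ultimately show "Q1 y + Q2 y = 0" by simp
   qed
  qed
 qed (use x in simp)
qed

text \<open>Moving up by t changes the norm by at most t, and \<bar>cos \<theta>\<bar> < 1. Every
  point of the closed cone is thus a limit of interior points.\<close>

lemma cone_interior:
 assumes \<theta>: "0 < \<theta>" "\<theta> < pi" and x: "x \<in> cone j \<theta>" and t: "0 < t"
 shows "cos \<theta> * norm (x + t *\<^sub>R axis j 1) < (x + t *\<^sub>R axis j 1) $ j"
proof -
 have c: "\<bar>cos \<theta>\<bar> < 1"
 proof -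
  have "0 < (sin \<theta>)\<^sup>2" using sin_gt_zero[OF \<theta>] by simp
  then have "(cos \<theta>)\<^sup>2 < 1" by (simp add: sin_squared_eq)
  then show ?thesis by (simp add: abs_square_less_1)
 qed
 have "\<bar>norm (x + t *\<^sub>R axis j 1) - norm x\<bar> \<le> t" using norm_triangle_ineq3[of "x + t *\<^sub>R axis j 1" x] t by simp
 then have "\<bar>cos \<theta> * (norm (x + t *\<^sub>R axis j 1) - norm x)\<bar> \<le> \<bar>cos \<theta>\<bar> * t" unfolding abs_mult by (rule mult_left_mono) simp
 also have "\<dots> < t" using c t by simp
 finally have "cos \<theta> * norm (x + t *\<^sub>R axis j 1) < cos \<theta> * norm x + t" by (simp add: algebra_simps abs_less_iff)
 then show ?thesis using x by (simp add: cone_def)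
qed

lemma cone_eqI:
 assumes c1: "cap_ext j \<theta> V1 H1 g1 A1" and c2: "cap_ext j \<theta> V2 H2 g2 A2"
  and eq: "\<And>x. cos \<theta> * norm x < x $ j \<Longrightarrow> H1 x = H2 x" and x: "x \<in> cone j \<theta>"
 shows "H1 x = H2 x"
proof -
 interpret a: cap_ext j \<theta> V1 H1 g1 A1 by (rule c1)
 interpret b: cap_ext j \<theta> V2 H2 g2 A2 by (rule c2)
 let ?u = "\<lambda>m. x + (1 / real (Suc m)) *\<^sub>R axis j 1"
 have u: "?u \<longlonglongrightarrow> x + 0 *\<^sub>R axis j 1" by (intro tendsto_intros lim_inverse_n'[THEN LIMSEQ_Suc])
 have i1: "isCont H1 x" "isCont H2 x"
  using a.contH a.openV a.coneD[OF x] b.contH b.openV b.coneD[OF x] by (auto simp: continuous_on_eq_continuous_at)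
 have "(\<lambda>m. H1 (?u m) - H2 (?u m)) \<longlonglongrightarrow> H1 x - H2 x"
  using i1 u by (intro tendsto_diff isCont_tendsto_compose[where g = H1] isCont_tendsto_compose[where g = H2]) auto
 moreover have "H1 (?u m) - H2 (?u m) = 0" for m using eq[OF cone_interior[OF a.\<theta> x, of "1 / real (Suc m)"]] by simp
 ultimately show ?thesis by (simp add: LIMSEQ_const_iff)
qed

lemma sgn_cone: "x \<in> cone j \<theta> \<Longrightarrow> sgn x \<in> cone j \<theta>" "x \<in> cone j \<theta> \<Longrightarrow> norm (sgn x) = 1"
 by (auto simp: cone_def norm_sgn sgn_div_norm field_simps)

text \<open>Degrees add up: 1 for the function, -k for the Newton tensor and -1 for the Hessian it
  is paired with.\<close>

lemma (in two_cap_ext) flux_density_hom: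
 assumes x: "x \<in> cone j \<theta>"
 shows "flux_density k x = (1 / norm x) ^ k * flux_density k (sgn x)"
proof -
 have x0: "x \<noteq> 0" using one.coneD[OF x] by simp
 then have r: "0 < norm x" by simp
 have s: "sgn x \<in> cone j \<theta>" by (rule sgn_cone(1)[OF x])
 have sV: "sgn x \<in> V1" "sgn x \<in> V2" using one.coneD[OF s] two.coneD[OF s] by auto
 have xs: "norm x *\<^sub>R sgn x = x" using x0 by (simp add: sgn_div_norm)
 have H: "H1 x = norm x * H1 (sgn x)" "H2 x = norm x * H2 (sgn x)" using one.homH[OF sV(1) r] two.homH[OF sV(2) r] xs by simp_all
 have A: "A1 x = (1 / norm x) *\<^sub>R A1 (sgn x)" "A2 x = (1 / norm x) *\<^sub>R A2 (sgn x)"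
  using one.homA[OF sV(1) r] two.homA[OF sV(2) r] xs by simp_all
 show ?thesis unfolding flux_density_def H A newton_scaleR scaleR_matrix_mult_left scaleR_matrix_mult_right trace_scaleR
  using r by (simp add: field_simps)
qed

definition curvature_eq :: "nat \<Rightarrow> real \<Rightarrow> (real^'m \<Rightarrow> real) \<Rightarrow> (real^'m \<Rightarrow> real) \<Rightarrow> (real^'m \<Rightarrow> real^'m^'m) \<Rightarrow> real^'m \<Rightarrow> bool" where
 "curvature_eq k p F H A \<nu> \<longleftrightarrow> (\<exists>v lam. eigframe (CARD('m) - 1) \<nu> v lam (A \<nu>) \<and>
   gam {..<CARD('m) - 1} k lam \<and> esym {..<CARD('m) - 1} k lam = F \<nu> * H \<nu> powr (p - 1))"

text \<open>The trace against \<open>A2\<close> is exactly k \<sigma>_k, while the trace against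
  \<open>A1\<close> enters with a negative sign and is bounded below by
  \<open>garding_matrix\<close>.\<close>

lemma (in two_cap_ext) flux_density_le:
 assumes \<nu>: "\<nu> \<in> cone j \<theta>" "norm \<nu> = 1" and k: "1 \<le> k"
  and pos: "0 < F \<nu>" "0 < H1 \<nu>" "0 < H2 \<nu>"
  and e1: "curvature_eq k p F H1 A1 \<nu>" and e2: "curvature_eq k p F H2 A2 \<nu>"
 shows "flux_density (k - 1) \<nu> \<le> real k * F \<nu> * (H1 \<nu> * H2 \<nu> powr (p - 1) - H2 \<nu> powr p * (H1 \<nu> / H2 \<nu>) powr ((p - 1) / real k))"
proof -
 let ?n = "CARD('m) - 1"
 obtain v lam where 2: "eigframe ?n \<nu> v lam (A2 \<nu>)" "gam {..<?n} k lam" "esym {..<?n} k lam = F \<nu> * H2 \<nu> powr (p - 1)"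
  using e2 by (auto simp: curvature_eq_def)
 obtain u mu where 1: "eigframe ?n \<nu> u mu (A1 \<nu>)" "gam {..<?n} k mu" "esym {..<?n} k mu = F \<nu> * H1 \<nu> powr (p - 1)"
  using e1 by (auto simp: curvature_eq_def)
 have t2: "trace (newton (A2 \<nu>) (k - 1) ** A2 \<nu>) = real k * (F \<nu> * H2 \<nu> powr (p - 1))"
  using trace_newton_self[OF 2(1) k] 2(3) by simp
 have "real k * (F \<nu> * H2 \<nu> powr (p - 1)) * ((F \<nu> * H1 \<nu> powr (p - 1)) / (F \<nu> * H2 \<nu> powr (p - 1))) powr (1 / real k) \<le> trace (newton (A2 \<nu>) (k - 1) ** A1 \<nu>)"
  using garding_matrix[OF 2(1) 1(1) 2(2) 1(2) k] 1(3) 2(3) by simp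
 moreover have "((F \<nu> * H1 \<nu> powr (p - 1)) / (F \<nu> * H2 \<nu> powr (p - 1))) powr (1 / real k) = (H1 \<nu> / H2 \<nu>) powr ((p - 1) / real k)"
 proof -
  have "(F \<nu> * H1 \<nu> powr (p - 1)) / (F \<nu> * H2 \<nu> powr (p - 1)) = (H1 \<nu> / H2 \<nu>) powr (p - 1)" using pos by (simp add: powr_divide)
  then show ?thesis by (simp add: powr_powr)
 qed
 ultimately have t1: "real k * (F \<nu> * H2 \<nu> powr (p - 1)) * (H1 \<nu> / H2 \<nu>) powr ((p - 1) / real k) \<le> trace (newton (A2 \<nu>) (k - 1) ** A1 \<nu>)" by simp
 have "H2 \<nu> * (real k * (F \<nu> * H2 \<nu> powr (p - 1)) * (H1 \<nu> / H2 \<nu>) powr ((p - 1) / real k)) \<le> H2 \<nu> * trace (newton (A2 \<nu>) (k - 1) ** A1 \<nu>)"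
  using t1 pos by (intro mult_left_mono) auto
 moreover have h2p: "H2 \<nu> * H2 \<nu> powr (p - 1) = H2 \<nu> powr p" using pos by (simp add: powr_diff)
 have "h * (c * (d * q) * w) = c * d * ((h * q) * w)" for h c d q w :: real by simp
 from this[of "H2 \<nu>" "real k" "F \<nu>" "H2 \<nu> powr (p - 1)"]
 have "H2 \<nu> * (real k * (F \<nu> * H2 \<nu> powr (p - 1)) * (H1 \<nu> / H2 \<nu>) powr ((p - 1) / real k)) =
   real k * F \<nu> * (H2 \<nu> powr p * (H1 \<nu> / H2 \<nu>) powr ((p - 1) / real k))" unfolding h2p .
 moreover have "H1 \<nu> * (real k * (F \<nu> * H2 \<nu> powr (p - 1))) = real k * F \<nu> * (H1 \<nu> * H2 \<nu> powr (p - 1))" by simp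
 ultimately show ?thesis unfolding flux_density_def t2 right_diff_distrib by linarith
qed

text \<open>Dividing by F b^p leaves a function of r = a / b that factors; away from r = 1 the two
  factors have opposite signs because al < 1 and al < p - 1.\<close>

lemma comparison_factor:
 fixes a b p al F R :: real
 assumes a: "0 < a" and b: "0 < b" and al: "al < 1" "al < p - 1" "0 < F"
 defines "S \<equiv> F * (a * b powr (p - 1) - b powr p * (a / b) powr al) + F * (b * a powr (p - 1) - a powr p * (b / a) powr al)"
 shows "S \<le> 0" "S = 0 \<Longrightarrow> a = b"
proof -
 define r where "r = a / b"
 have r: "0 < r" "a = r * b" using a b by (simp_all add: r_def)
 have "b / a = inverse r" by (simp add: r_def)
 then have i: "(b / a) powr al = r powr (- al)" using r by (simp add: inverse_powr powr_minus less_imp_le)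
 have bp: "b * b powr (p - 1) = b powr p" using b by (simp add: powr_diff)
 have t1: "a * b powr (p - 1) = r * b powr p" unfolding r(2) bp[symmetric] by simp
 have t3: "b * a powr (p - 1) = r powr (p - 1) * b powr p" unfolding bp[symmetric] using r b by (simp add: r(2) powr_mult)
 have "r powr p * r powr (- al) = r powr (p - al)" by (simp flip: powr_add)
 then have t4: "a powr p * (b / a) powr al = r powr (p - al) * b powr p" unfolding i using r b by (simp add: r(2) powr_mult)
 have S: "S = F * b powr p * (r - r powr al + r powr (p - 1) - r powr (p - al))"
  unfolding S_def t1 t3 t4 r_def[symmetric] by (simp add: algebra_simps)
 have "r powr (1 - al) * r powr (p - 1) = r powr (p - al)" "r powr (1 - al) * r powr al = r" using r by (simp_all flip: powr_add)
 then have f: "r - r powr al + r powr (p - 1) - r powr (p - al) = (1 - r powr (1 - al)) * (r powr (p - 1) - r powr al)"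
  by (simp add: algebra_simps)
 have neg: "(1 - r powr (1 - al)) * (r powr (p - 1) - r powr al) < 0" if "r \<noteq> 1"
 proof (cases "1 < r")
  case True
  then have "1 < r powr (1 - al)" "r powr al < r powr (p - 1)" using al by (auto simp: powr_less_mono gr_one_powr)
  then show ?thesis by (simp add: mult_neg_pos)
 next
  case False
  then have "r < 1" using that by simp
  then have "r powr (1 - al) < 1" "r powr (p - 1) < r powr al"
   using al r powr_less_mono2[of "1 - al" r 1] powr_less_mono'[of r al "p - 1"] by auto
  then show ?thesis by (simp add: mult_pos_neg)
 qed
 have Fb: "0 < F * b powr p" using al b by simp
 show "S \<le> 0"
 proof (cases "r = 1")
  case False
  show ?thesis unfolding S f by (rule mult_nonneg_nonpos[OF less_imp_le[OF Fb] less_imp_le[OF neg[OF False]]])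
 qed (simp add: S)
 assume "S = 0"
 then have "r = 1" using neg Fb unfolding S f by force
 then show "a = b" using r by simp
qed

lemma cone_unique_ge_2:
 fixes j :: "'m::finite"
 assumes c1: "cap_ext j \<theta> V1 H1 g1 A1" and c2: "cap_ext j \<theta> V2 H2 g2 A2"
  and F: "continuous_on (cone j \<theta>) F" "\<And>x. x \<in> cone j \<theta> \<Longrightarrow> 0 < F x"
  and pos: "\<And>x. x \<in> cone j \<theta> \<Longrightarrow> 0 < H1 x" "\<And>x. x \<in> cone j \<theta> \<Longrightarrow> 0 < H2 x"
  and k: "2 \<le> k" and p: "1 < p" "p < real k + 1"
  and e1: "\<And>\<nu>. \<nu> \<in> cone j \<theta> \<Longrightarrow> norm \<nu> = 1 \<Longrightarrow> curvature_eq k p F H1 A1 \<nu>"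
  and e2: "\<And>\<nu>. \<nu> \<in> cone j \<theta> \<Longrightarrow> norm \<nu> = 1 \<Longrightarrow> curvature_eq k p F H2 A2 \<nu>"
  and x: "x \<in> cone j \<theta>"
 shows "H1 x = H2 x"
proof (rule cone_eqI[OF c1 c2 _ x])
 fix x :: "real^'m" assume int: "cos \<theta> * norm x < x $ j"
 interpret a: two_cap_ext j \<theta> V1 H1 g1 A1 V2 H2 g2 A2 by (rule cap_ext.swap_two[OF c1 c2])
 interpret b: two_cap_ext j \<theta> V2 H2 g2 A2 V1 H1 g1 A1 by (rule cap_ext.swap_two[OF c2 c1])
 let ?al = "(p - 1) / real k"
 define \<phi> where "\<phi> H H' \<nu> = real k * F \<nu> * (H \<nu> * H' \<nu> powr (p - 1) - H' \<nu> powr p * (H \<nu> / H' \<nu>) powr ?al)" for H H' and \<nu> :: "real^'m"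
 define Q where "Q H H' x = (1 / norm x) ^ (k - 1) * \<phi> H H' (sgn x)" for H H' and x :: "real^'m"
 note sc = sgn_cone
 have cs: "continuous_on (cone j \<theta>) (sgn :: real^'m \<Rightarrow> real^'m)" unfolding sgn_div_norm[abs_def]
  by (intro continuous_intros) (auto simp: cone_def)
 have cphi: "continuous_on (cone j \<theta>) (\<phi> H H')"
  if "continuous_on (cone j \<theta>) H" "continuous_on (cone j \<theta>) H'" "\<And>x. x \<in> cone j \<theta> \<Longrightarrow> 0 < H x" "\<And>x. x \<in> cone j \<theta> \<Longrightarrow> 0 < H' x" for H H'
  unfolding \<phi>_def[abs_def] by (intro continuous_intros F that) (use that(3,4) in force)+
 have cQ: "continuous_on (cone j \<theta>) (Q H H')"
  if "continuous_on (cone j \<theta>) H" "continuous_on (cone j \<theta>) H'" "\<And>x. x \<in> cone j \<theta> \<Longrightarrow> 0 < H x" "\<And>x. x \<in> cone j \<theta> \<Longrightarrow> 0 < H' x" for H H'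
  unfolding Q_def[abs_def]
  by (intro continuous_intros continuous_on_compose2[OF cphi[OF that] cs]) (use sc in \<open>auto simp: cone_def\<close>)
 have cH: "continuous_on (cone j \<theta>) H1" "continuous_on (cone j \<theta>) H2"
  using continuous_on_subset[OF a.one.contH a.one.coneV] continuous_on_subset[OF a.two.contH a.two.coneV] .
 \<comment> \<open>The second inequality is strict because k \<ge> 2; for k = 1 both sides would
   agree.\<close>
 have al: "?al < 1" "?al < p - 1"
 proof -
  show "?al < 1" using p k by (simp add: divide_less_eq)
  have "(p - 1) * 1 < (p - 1) * real k" using p k by (intro mult_strict_left_mono) auto
  then show "?al < p - 1" using k by (simp add: divide_less_eq)
 qed
 have x0: "x \<in> cone j \<theta>" using int by (auto simp: cone_def)
 then have xn: "x \<noteq> 0" by (simp add: cone_def)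
 \<comment> \<open>The norm 5/4 puts \<open>y\<close> into the shell, as 1 < 25/16 < 2; homogeneity
   carries the conclusion back to \<open>x\<close>.\<close>
 define y where "y = (5 / 4) *\<^sub>R sgn x"
 have yn: "norm y = 5 / 4" using sc(2)[OF x0] by (simp add: y_def)
 have ys: "sgn y = sgn x" by (simp add: y_def sgn_scaleR) (simp add: sgn_div_norm[of "sgn x"] sc(2)[OF x0])
 have yj: "cos \<theta> * norm y < y $ j" using int xn unfolding yn by (simp add: y_def sgn_div_norm field_simps)
 have yy: "y \<bullet> y = 25 / 16" unfolding power2_norm_eq_inner[symmetric] yn by (simp add: power2_eq_square)
 have comb: "Q H1 H2 z + Q H2 H1 z = (1 / norm z) ^ (k - 1) * (\<phi> H1 H2 (sgn z) + \<phi> H2 H1 (sgn z))" for z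
  by (simp add: Q_def distrib_left)
 have cmp: "\<phi> H1 H2 \<nu> + \<phi> H2 H1 \<nu> \<le> 0" "\<phi> H1 H2 \<nu> + \<phi> H2 H1 \<nu> = 0 \<Longrightarrow> H1 \<nu> = H2 \<nu>" if "\<nu> \<in> cone j \<theta>" for \<nu>
  using comparison_factor[OF pos(1)[OF that] pos(2)[OF that] al, of "real k * F \<nu>"] F(2)[OF that] k by (simp_all add: \<phi>_def)
 have "Q H1 H2 y + Q H2 H1 y = 0"
 proof (rule flux_pair_zero[OF c1 c2 cQ[OF cH pos] cQ[OF cH(2,1) pos(2,1)], where k = "k - 1"])
  fix z :: "real^'m" assume z: "z \<in> cone j \<theta>"
  note s = sc[OF z]
  have nn: "0 \<le> (1 / norm z) ^ (k - 1)" by simp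
  show "a.flux_density (k - 1) z \<le> Q H1 H2 z" unfolding a.flux_density_hom[OF z] Q_def \<phi>_def
   by (rule mult_left_mono[OF a.flux_density_le[OF s _ F(2)[OF s(1)] pos(1)[OF s(1)] pos(2)[OF s(1)] e1[OF s] e2[OF s]] nn]) (use k in simp)
  show "b.flux_density (k - 1) z \<le> Q H2 H1 z" unfolding b.flux_density_hom[OF z] Q_def \<phi>_def
   by (rule mult_left_mono[OF b.flux_density_le[OF s _ F(2)[OF s(1)] pos(2)[OF s(1)] pos(1)[OF s(1)] e2[OF s] e1[OF s]] nn]) (use k in simp)
  show "Q H1 H2 z + Q H2 H1 z \<le> 0" unfolding comb by (rule mult_nonneg_nonpos[OF nn cmp(1)[OF s(1)]])
 qed (use yj yy in auto)
 then have "\<phi> H1 H2 (sgn x) + \<phi> H2 H1 (sgn x) = 0" unfolding comb ys using yn by simp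
 then have "H1 (sgn x) = H2 (sgn x)" by (rule cmp(2)[OF sc(1)[OF x0]])
 moreover have "norm x *\<^sub>R sgn x = x" using xn by (simp add: sgn_div_norm)
 ultimately show "H1 x = H2 x"
  using a.one.homH[of "sgn x" "norm x"] a.two.homH[of "sgn x" "norm x"] a.one.coneD[OF sc(1)[OF x0]] a.two.coneD[OF sc(1)[OF x0]] xn by auto
qed

section \<open>The Gaussian Poincare inequality\<close>

lemma integrable_exp_neg_square:
 assumes "0 < a"
 shows "integrable lborel (\<lambda>x::real. exp (- a * x\<^sup>2))"
proof -
 define s where "s = 1 / sqrt (2 * a)"
 have s2: "s\<^sup>2 = 1 / (2 * a)" using assms by (simp add: s_def power_divide)
 have "0 < s" using assms by (simp add: s_def)
 then have "integrable lborel (\<lambda>x. sqrt (2 * pi * s\<^sup>2) * normal_density 0 s x)" by simp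
 moreover have "sqrt (2 * pi * s\<^sup>2) * normal_density 0 s x = exp (- a * x\<^sup>2)" for x
  using assms by (simp add: normal_density_def s2)
 ultimately show ?thesis by simp
qed

lemma integrable_exp_neg_inner:
 assumes a: "0 < a"
 shows "integrable lborel (\<lambda>x::'a::euclidean_space. exp (- a * (x \<bullet> x)))"
proof -
 interpret product_sigma_finite "\<lambda>_::'a. lborel :: real measure" ..
 let ?T = "\<lambda>f. \<Sum>b\<in>Basis. f b *\<^sub>R (b::'a)"
 have T: "?T \<in> (\<Pi>\<^sub>M b\<in>Basis. lborel) \<rightarrow>\<^sub>M borel" by measurable
 have "integrable (\<Pi>\<^sub>M b\<in>(Basis::'a set). lborel) (\<lambda>f. \<Prod>b\<in>Basis. exp (- a * (f b)\<^sup>2))"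
  by (rule product_integrable_prod) (use integrable_exp_neg_square[OF a] in auto)
 moreover have "(\<Prod>b\<in>(Basis::'a set). exp (- a * (f b)\<^sup>2)) = exp (- a * (?T f \<bullet> ?T f))" for f
 proof -
  have "?T f \<bullet> ?T f = (\<Sum>b\<in>(Basis::'a set). (f b)\<^sup>2)" by (subst euclidean_inner) (simp add: power2_eq_square)
  then show ?thesis by (simp add: exp_sum sum_distrib_left flip: sum_negf)
 qed
 ultimately have "integrable (\<Pi>\<^sub>M b\<in>(Basis::'a set). lborel) (\<lambda>f. exp (- a * (?T f \<bullet> ?T f)))" by simp
 then show ?thesis unfolding lborel_eq[where 'a = 'a] by (subst integrable_distr_eq[OF T]) (auto simp: comp_def)
qed

text \<open>Squaring 1 + u \<le> 8 exp (u / 8) costs a factor exp (u / 4), so half of the Gaussian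
  exponent is left to dominate.\<close>

lemma one_plus_square_exp:
 fixes u :: real
 assumes "0 \<le> u"
 shows "(1 + u)\<^sup>2 * exp (- u / 2) \<le> 64 * exp (- u / 4)"
proof -
 have "1 + u / 8 \<le> exp (u / 8)" by (rule exp_ge_add_one_self)
 then have "1 + u \<le> 8 * exp (u / 8)" using assms by linarith
 then have "(1 + u)\<^sup>2 \<le> (8 * exp (u / 8))\<^sup>2" using assms by (intro power_mono) auto
 also have "\<dots> = 64 * exp (u / 4)" by (simp add: power_mult_distrib flip: exp_double)
 finally have "(1 + u)\<^sup>2 * exp (- u / 2) \<le> 64 * exp (u / 4) * exp (- u / 2)" by (intro mult_right_mono) auto
 also have "\<dots> = 64 * exp (- u / 4)" by (simp add: mult.assoc flip: exp_add)
 finally show ?thesis .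
qed

lemma integrable_gauss_poly:
 fixes f :: "'a::euclidean_space \<Rightarrow> real"
 assumes "f \<in> borel_measurable borel" "\<And>x. \<bar>f x\<bar> \<le> C * (1 + x \<bullet> x)\<^sup>2"
 shows "integrable lborel (\<lambda>x. exp (- (x \<bullet> x) / 2) * f x)"
proof (rule Bochner_Integration.integrable_bound)
 have "0 \<le> C" using assms(2)[of 0] by simp
 show "integrable lborel (\<lambda>x::'a. C * 64 * exp (- (1 / 4) * (x \<bullet> x)))" by (intro integrable_mult_right integrable_exp_neg_inner) simp
 show "AE x in lborel. norm (exp (- (x \<bullet> x) / 2) * f x) \<le> norm (C * 64 * exp (- (1 / 4) * (x \<bullet> x)))"
 proof (rule AE_I2)
  fix x :: 'a
  have "\<bar>exp (- (x \<bullet> x) / 2) * f x\<bar> \<le> exp (- (x \<bullet> x) / 2) * (C * (1 + x \<bullet> x)\<^sup>2)" using assms(2)[of x] by (simp add: abs_mult)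
  also have "\<dots> = C * ((1 + x \<bullet> x)\<^sup>2 * exp (- (x \<bullet> x) / 2))" by simp
  also have "\<dots> \<le> C * (64 * exp (- (x \<bullet> x) / 4))" using \<open>0 \<le> C\<close> one_plus_square_exp[of "x \<bullet> x"] by (intro mult_left_mono) auto
  finally show "norm (exp (- (x \<bullet> x) / 2) * f x) \<le> norm (C * 64 * exp (- (1 / 4) * (x \<bullet> x)))" using \<open>0 \<le> C\<close> by simp
 qed
 have "(\<lambda>x::'a. exp (- (x \<bullet> x) / 2)) \<in> borel_measurable borel" by (intro borel_measurable_continuous_onI continuous_intros) simp
 then show "(\<lambda>x. exp (- (x \<bullet> x) / 2) * f x) \<in> borel_measurable lborel" using assms(1) by simp
qed

text \<open>The translates by t e with \<open>\<bar>t\<bar> < 1\<close> need a common majorant. It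
  comes from \<open>?z \<bullet> ?z \<ge> (x \<bullet> x) / 2 - e \<bullet> e\<close>, a consequence
  of the nonnegativity of the square of x + 2 t e.\<close>

lemma gauss_directional_deriv:
 fixes F F' :: "'a::euclidean_space \<Rightarrow> real"
 assumes F: "integrable lborel F"
  and der: "AE x in lborel. \<forall>t. DERIV (\<lambda>s. F (x + s *\<^sub>R e)) t :> F' (x + t *\<^sub>R e)"
  and bd: "\<And>x. \<bar>F' x\<bar> \<le> C * ((1 + x \<bullet> x)\<^sup>2 * exp (- (x \<bullet> x) / 2))"
  and meas: "F' \<in> borel_measurable borel"
 shows "(LBINT x. F' x) = 0"
proof (rule integral_directional_deriv_eq_0[where e = e and w = "\<lambda>x. C * 64 * exp ((e \<bullet> e) / 4) * exp (- (1 / 8) * (x \<bullet> x))"])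
 have C: "0 \<le> C" using bd[of 0] by simp
 show "AE x in lborel. \<forall>t. \<bar>t\<bar> < 1 \<longrightarrow> DERIV (\<lambda>s. F (x + s *\<^sub>R e)) t :> F' (x + t *\<^sub>R e)" using der by eventually_elim auto
 show "AE x in lborel. \<forall>t. \<bar>t\<bar> < 1 \<longrightarrow> \<bar>F' (x + t *\<^sub>R e)\<bar> \<le> C * 64 * exp ((e \<bullet> e) / 4) * exp (- (1 / 8) * (x \<bullet> x))"
 proof (intro AE_I2 allI impI)
  fix x and t :: real assume t: "\<bar>t\<bar> < 1"
  let ?z = "x + t *\<^sub>R e"
  have "t\<^sup>2 \<le> 1" using t by (simp add: abs_square_le_1)
  then have te: "t\<^sup>2 * (e \<bullet> e) \<le> 1 * (e \<bullet> e)" by (intro mult_right_mono) auto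
  have "0 \<le> (x + (2 * t) *\<^sub>R e) \<bullet> (x + (2 * t) *\<^sub>R e)" by simp
  then have "0 \<le> x \<bullet> x + 4 * t * (x \<bullet> e) + 4 * (t\<^sup>2 * (e \<bullet> e))"
   by (simp add: inner_add_left inner_add_right inner_commute power2_eq_square algebra_simps)
  moreover have "?z \<bullet> ?z = x \<bullet> x + 2 * t * (x \<bullet> e) + t\<^sup>2 * (e \<bullet> e)"
   by (simp add: inner_add_left inner_add_right inner_commute power2_eq_square algebra_simps)
  ultimately have zz: "x \<bullet> x / 2 - e \<bullet> e \<le> ?z \<bullet> ?z" using te by linarith
  have "\<bar>F' ?z\<bar> \<le> C * ((1 + ?z \<bullet> ?z)\<^sup>2 * exp (- (?z \<bullet> ?z) / 2))" by (rule bd)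
  also have "\<dots> \<le> C * (64 * exp (- (?z \<bullet> ?z) / 4))" using C one_plus_square_exp[of "?z \<bullet> ?z"] by (intro mult_left_mono) auto
  also have "\<dots> \<le> C * (64 * exp ((e \<bullet> e) / 4 + - (1 / 8) * (x \<bullet> x)))" using C zz by (intro mult_left_mono) auto
  also have "\<dots> = C * 64 * exp ((e \<bullet> e) / 4) * exp (- (1 / 8) * (x \<bullet> x))" by (simp only: exp_add mult.assoc)
  finally show "\<bar>F' ?z\<bar> \<le> C * 64 * exp ((e \<bullet> e) / 4) * exp (- (1 / 8) * (x \<bullet> x))" .
 qed
 show "integrable lborel (\<lambda>x. C * 64 * exp ((e \<bullet> e) / 4) * exp (- (1 / 8) * (x \<bullet> x)))"
  by (intro integrable_mult_right integrable_exp_neg_inner) simp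
qed (use F meas in auto)

text \<open>The standard Gaussian density. The normalising constant stays an integral; its
  positivity and the total mass 1 are what the proofs rely on.\<close>

definition gw :: "'a::euclidean_space \<Rightarrow> real" where
 "gw x = exp (- (x \<bullet> x) / 2) / (LBINT y. exp (- ((y::'a) \<bullet> y) / 2))"

lemma gauss_mass_pos: "0 < (LBINT y. exp (- ((y::'a::euclidean_space) \<bullet> y) / 2))"
proof -
 have int: "integrable lborel (\<lambda>y::'a. exp (- (y \<bullet> y) / 2))" using integrable_gauss_poly[of "\<lambda>_::'a. 1" 1] by simp
 have "(LBINT y. exp (- ((y::'a) \<bullet> y) / 2)) \<noteq> 0"
 proof
  assume "(LBINT y. exp (- ((y::'a) \<bullet> y) / 2)) = 0"
  then have "AE y::'a in lborel. exp (- (y \<bullet> y) / 2) = 0" using integral_nonneg_eq_0_iff_AE[OF int] by simp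
  then have "exp (- ((0::'a) \<bullet> 0) / 2) = 0"
   by (intro AE_zero_continuous[of UNIV "\<lambda>y::'a. exp (- (y \<bullet> y) / 2)" 0]) (auto intro!: continuous_intros)
  then show False by simp
 qed
 moreover have "0 \<le> (LBINT y. exp (- ((y::'a) \<bullet> y) / 2))" by simp
 ultimately show ?thesis by (metis order_le_less)
qed

lemma gw_pos: "0 < gw x" unfolding gw_def by (rule divide_pos_pos[OF exp_gt_zero gauss_mass_pos])

lemma integral_gw: "integrable lborel (gw :: 'a::euclidean_space \<Rightarrow> real)" "(LBINT x. gw (x::'a)) = 1"
proof -
 have int: "integrable lborel (\<lambda>y::'a. exp (- (y \<bullet> y) / 2))" using integrable_gauss_poly[of "\<lambda>_::'a. 1" 1] by simp
 show "integrable lborel (gw :: 'a \<Rightarrow> real)" unfolding gw_def[abs_def] using int by simp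
 show "(LBINT x. gw (x::'a)) = 1" unfolding gw_def using gauss_mass_pos[where 'a = 'a] by simp
qed

lemma continuous_gw: "continuous_on S gw"
 unfolding gw_def[abs_def] using gauss_mass_pos by (intro continuous_intros) (auto simp: less_le)

lemma borel_measurable_gw [measurable]: "gw \<in> borel_measurable borel" by (intro borel_measurable_continuous_onI continuous_gw)

lemma integrable_gw_poly:
 fixes f :: "'a::euclidean_space \<Rightarrow> real"
 assumes "f \<in> borel_measurable borel" "\<And>x. \<bar>f x\<bar> \<le> C * (1 + x \<bullet> x)\<^sup>2"
 shows "integrable lborel (\<lambda>x. gw x * f x)" using integrable_gauss_poly[OF assms] by (simp add: gw_def)

definition gw2 :: "'a::euclidean_space \<times> 'a \<Rightarrow> real" where
 "gw2 z = gw (fst z) * gw (snd z)"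

lemma gw2_nonneg: "0 \<le> gw2 z" unfolding gw2_def by (intro mult_nonneg_nonneg less_imp_le gw_pos)

lemma gw2_eq: "gw2 (z :: 'a::euclidean_space \<times> 'a) = exp (- (z \<bullet> z) / 2) / (LBINT y. exp (- ((y::'a) \<bullet> y) / 2))\<^sup>2"
 by (simp add: gw2_def gw_def inner_prod_def power2_eq_square add_divide_distrib flip: exp_add)

lemma integrable_gw2_poly:
 fixes f :: "'a::euclidean_space \<times> 'a \<Rightarrow> real"
 assumes "f \<in> borel_measurable borel" "\<And>x. \<bar>f x\<bar> \<le> C * (1 + x \<bullet> x)\<^sup>2"
 shows "integrable lborel (\<lambda>z. gw2 z * f z)" using integrable_gauss_poly[OF assms] by (simp add: gw2_eq)

lemma integral_gw2_prod:
 fixes f g :: "'a::euclidean_space \<Rightarrow> real"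
 assumes "integrable lborel (\<lambda>z::'a \<times> 'a. gw2 z * (f (fst z) * g (snd z)))"
 shows "(LBINT z. gw2 z * (f (fst z) * g (snd z))) = (LBINT x. gw x * f x) * (LBINT y. gw y * g y)"
proof -
 have "(LBINT z. gw2 z * (f (fst z) * g (snd z))) = (\<integral>z. gw2 z * (f (fst z) * g (snd z)) \<partial>(lborel \<Otimes>\<^sub>M lborel))"
  by (simp add: lborel_prod)
 also have "\<dots> = (LBINT x. LBINT y. gw2 (x, y) * (f x * g y))"
  using assms by (subst lborel_pair.integral_fst'[symmetric]) (auto simp: lborel_prod)
 also have "\<dots> = (LBINT x. (gw x * f x) * (LBINT y. gw y * g y))"
 proof (rule arg_cong[of _ _ "integral\<^sup>L lborel"], rule ext)
  fix x
  have "(LBINT y. gw2 (x, y) * (f x * g y)) = (LBINT y. (gw x * f x) * (gw y * g y))" by (simp add: gw2_def mult_ac)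
  then show "(LBINT y. gw2 (x, y) * (f x * g y)) = (gw x * f x) * (LBINT y. gw y * g y)" by simp
 qed
 finally show ?thesis by simp
qed

section \<open>Rotation invariance of the Gaussian law of a pair\<close>

lemma sets_lborel_pair: "sets (lborel \<Otimes>\<^sub>M lborel :: ('a::euclidean_space \<times> 'a) measure) = sets borel"
 by (simp only: lborel_prod sets_lborel)

text \<open>For each fixed second component the map is a translation, so by Fubini the measure is
  preserved.\<close>

lemma distr_shear_fst: "distr lborel borel (\<lambda>z::'a::euclidean_space \<times> 'a. (fst z + a *\<^sub>R snd z, snd z)) = lborel"
proof (rule measure_eqI)
 let ?T = "\<lambda>z::'a \<times> 'a. (fst z + a *\<^sub>R snd z, snd z)"
 have T: "?T \<in> borel_measurable borel" by (intro borel_measurable_continuous_onI continuous_intros)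
 fix A assume "A \<in> sets (distr lborel borel ?T)"
 then have A: "A \<in> sets borel" by simp
 have TA: "?T -` A \<in> sets borel" using measurable_sets[OF T A] by simp
 have "emeasure (distr lborel borel ?T) A = emeasure (lborel \<Otimes>\<^sub>M lborel) (?T -` A)"
  using A T by (simp add: emeasure_distr lborel_prod)
 also have "\<dots> = (\<integral>\<^sup>+y. emeasure lborel ((\<lambda>x. (x, y)) -` (?T -` A)) \<partial>lborel)"
  by (rule lborel_pair.emeasure_pair_measure_alt2) (use TA in \<open>simp only: sets_lborel_pair\<close>)
 also have "\<dots> = (\<integral>\<^sup>+y. emeasure lborel ((\<lambda>x. (x, y)) -` A) \<partial>lborel)"
 proof (rule arg_cong[of _ _ "nn_integral lborel"], rule ext)
  fix y :: 'a
  have B: "(\<lambda>x. (x, y)) -` A \<in> sets borel"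
   using measurable_sets[of "\<lambda>x. (x, y)" borel borel A] A by (simp add: borel_measurable_continuous_onI continuous_intros)
  have "(\<lambda>x. (x, y)) -` (?T -` A) = (+) (a *\<^sub>R y) -` ((\<lambda>x. (x, y)) -` A)" by (auto simp: add.commute)
  then have "emeasure lborel ((\<lambda>x. (x, y)) -` (?T -` A)) = emeasure (distr lborel borel ((+) (a *\<^sub>R y))) ((\<lambda>x. (x, y)) -` A)"
   using B by (simp add: emeasure_distr)
  then show "emeasure lborel ((\<lambda>x. (x, y)) -` (?T -` A)) = emeasure lborel ((\<lambda>x. (x, y)) -` A)" by (simp add: lborel_distr_plus)
 qed
 also have "\<dots> = emeasure (lborel \<Otimes>\<^sub>M lborel) A"
  by (rule lborel_pair.emeasure_pair_measure_alt2[symmetric]) (use A in \<open>simp only: sets_lborel_pair\<close>)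
 finally show "emeasure (distr lborel borel ?T) A = emeasure lborel A" by (simp add: lborel_prod)
qed simp

lemma distr_swap: "distr lborel borel (\<lambda>z::'a::euclidean_space \<times> 'a. (snd z, fst z)) = lborel"
proof -
 have "distr (lborel \<Otimes>\<^sub>M lborel) (lborel \<Otimes>\<^sub>M lborel) (\<lambda>(x, y). (y, x)) = (lborel \<Otimes>\<^sub>M lborel :: ('a \<times> 'a) measure)"
  by (rule lborel_pair.distr_pair_swap[symmetric])
 then show ?thesis unfolding lborel_prod by (simp add: case_prod_beta' cong: distr_cong)
qed

lemma distr_shear_snd: "distr lborel borel (\<lambda>z::'a::euclidean_space \<times> 'a. (fst z, snd z + a *\<^sub>R fst z)) = lborel"
proof -
 let ?w = "\<lambda>z::'a \<times> 'a. (snd z, fst z)" and ?T = "\<lambda>z::'a \<times> 'a. (fst z + a *\<^sub>R snd z, snd z)"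
 have m: "?w \<in> borel_measurable borel" "?T \<in> borel_measurable borel"
  by (intro borel_measurable_continuous_onI continuous_intros)+
 have "distr (distr (distr lborel borel ?w) borel ?T) borel ?w = lborel" by (simp only: distr_swap distr_shear_fst)
 moreover have "distr (distr (distr lborel borel ?w) borel ?T) borel ?w = distr lborel borel (?w \<circ> (?T \<circ> ?w))"
  using m by (simp add: distr_distr)
 ultimately show ?thesis by (simp add: comp_def)
qed

text \<open>A rotation of the plane is a product of three shears.\<close>
lemma distr_rotation:
 assumes "sin t \<noteq> 0"
 shows "distr lborel borel (\<lambda>z::'a::euclidean_space \<times> 'a. (cos t *\<^sub>R fst z - sin t *\<^sub>R snd z, sin t *\<^sub>R fst z + cos t *\<^sub>R snd z)) = lborel"
proof -
 define \<tau> where "\<tau> = (1 - cos t) / sin t"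
 have 1: "sin t * \<tau> = 1 - cos t" using assms by (simp add: \<tau>_def)
 have "(1 - cos t) * (1 + cos t) = sin t * sin t" using sin_squared_eq[of t] by (simp add: power2_eq_square algebra_simps)
 then have 2: "\<tau> * (1 + cos t) = sin t" using assms by (simp add: \<tau>_def field_simps)
 let ?S = "\<lambda>z::'a \<times> 'a. (fst z + (- \<tau>) *\<^sub>R snd z, snd z)"
 let ?U = "\<lambda>z::'a \<times> 'a. (fst z, snd z + sin t *\<^sub>R fst z)"
 have m: "?S \<in> lborel \<rightarrow>\<^sub>M borel" "?U \<in> lborel \<rightarrow>\<^sub>M borel" by (simp_all add: borel_measurable_continuous_onI continuous_intros)
 have mb: "?S \<in> borel \<rightarrow>\<^sub>M borel" "?U \<in> borel \<rightarrow>\<^sub>M borel" using m by simp_all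
 have "distr (distr (distr lborel borel ?S) borel ?U) borel ?S = distr lborel borel (?S \<circ> (?U \<circ> ?S))"
  using m mb by (simp add: distr_distr)
 moreover have "distr (distr (distr lborel borel ?S) borel ?U) borel ?S = lborel" by (simp only: distr_shear_fst distr_shear_snd)
 moreover have "?S \<circ> (?U \<circ> ?S) = (\<lambda>z. (cos t *\<^sub>R fst z - sin t *\<^sub>R snd z, sin t *\<^sub>R fst z + cos t *\<^sub>R snd z))"
 proof (rule ext, rule prod_eqI)
  fix z :: "'a \<times> 'a"
  have y: "snd ((?S \<circ> (?U \<circ> ?S)) z) = sin t *\<^sub>R fst z + (1 - sin t * \<tau>) *\<^sub>R snd z" by (simp add: algebra_simps)
  then show "snd ((?S \<circ> (?U \<circ> ?S)) z) = snd (cos t *\<^sub>R fst z - sin t *\<^sub>R snd z, sin t *\<^sub>R fst z + cos t *\<^sub>R snd z)"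
   by (simp add: 1)
  have "fst ((?S \<circ> (?U \<circ> ?S)) z) = (1 - sin t * \<tau>) *\<^sub>R fst z - (\<tau> + \<tau> * (1 - sin t * \<tau>)) *\<^sub>R snd z"
   by (simp add: algebra_simps) (simp only: mult_2_right scaleR_add_left)
  then show "fst ((?S \<circ> (?U \<circ> ?S)) z) = fst (cos t *\<^sub>R fst z - sin t *\<^sub>R snd z, sin t *\<^sub>R fst z + cos t *\<^sub>R snd z)"
   using 2 by (simp add: 1 distrib_left)
 qed
 ultimately show ?thesis by metis
qed

lemma integral_rotation:
 fixes f :: "'a::euclidean_space \<times> 'a \<Rightarrow> real"
 assumes t: "sin t \<noteq> 0" and f: "f \<in> borel_measurable borel"
 shows "(LBINT z. gw2 z * f (cos t *\<^sub>R fst z - sin t *\<^sub>R snd z, sin t *\<^sub>R fst z + cos t *\<^sub>R snd z)) = (LBINT z. gw2 z * f z)"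
proof -
 let ?R = "\<lambda>z::'a \<times> 'a. (cos t *\<^sub>R fst z - sin t *\<^sub>R snd z, sin t *\<^sub>R fst z + cos t *\<^sub>R snd z)"
 have R: "?R \<in> lborel \<rightarrow>\<^sub>M borel" by (simp add: borel_measurable_continuous_onI continuous_intros)
 have inv: "?R z \<bullet> ?R z = z \<bullet> z" for z
 proof -
  have "?R z \<bullet> ?R z = ((sin t)\<^sup>2 + (cos t)\<^sup>2) * (fst z \<bullet> fst z) + ((sin t)\<^sup>2 + (cos t)\<^sup>2) * (snd z \<bullet> snd z)"
   unfolding distrib_right
   by (simp add: inner_prod_def inner_diff_left inner_diff_right inner_add_left inner_add_right power2_eq_square inner_commute)
  then show ?thesis by (simp add: inner_prod_def)
 qed
 have gm: "(\<lambda>z. gw2 z * f z) \<in> borel_measurable borel"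
 proof -
  have "(\<lambda>z::'a \<times> 'a. gw2 z) \<in> borel_measurable borel" unfolding gw2_def
   by (intro borel_measurable_continuous_onI continuous_on_mult continuous_on_compose2[OF continuous_gw[of UNIV]]) (auto intro!: continuous_intros)
  then show ?thesis using f by simp
 qed
 have "(LBINT z. gw2 z * f z) = (\<integral>z. gw2 z * f z \<partial>distr lborel borel ?R)" by (simp add: distr_rotation[OF t])
 also have "\<dots> = (LBINT z. gw2 (?R z) * f (?R z))" by (rule integral_distr[OF R gm])
 also have "\<dots> = (LBINT z. gw2 z * f (?R z))" by (simp only: gw2_eq inv)
 finally show ?thesis by simp
qed

text \<open>Along the rotation from \<open>X\<close> to an independent copy, the derivative of the covariance \<open>E F(X) F(X\<^sub>t)\<close> is
 \<open>- sin t E DF(X) \<bullet> DF(X\<^sub>t)\<close> by Gaussian integration by parts, which is at least \<open>- sin t E |DF|\<^sup>2\<close>.\<close>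
lemma gaussian_poincare:
 fixes F :: "'a::euclidean_space \<Rightarrow> real" and DF :: "'a \<Rightarrow> 'a"
 assumes Fm: "F \<in> borel_measurable borel" and DFm: "DF \<in> borel_measurable borel"
  and Fb: "\<And>x. \<bar>F x\<bar> \<le> C * (1 + norm x)" and DFb: "\<And>x. norm (DF x) \<le> C"
  and der: "\<And>x. x \<in> S \<Longrightarrow> (F has_derivative (\<lambda>v. DF x \<bullet> v)) (at x)"
  and ae1: "AE z in lborel. \<forall>t. cos t *\<^sub>R fst z + sin t *\<^sub>R snd z \<in> S"
  and ae2: "\<And>t b. sin t \<noteq> 0 \<Longrightarrow> b \<in> Basis \<Longrightarrow> AE z in lborel. \<forall>s. cos t *\<^sub>R fst z - sin t *\<^sub>R (snd z + s *\<^sub>R b) \<in> S"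
  and mean: "(LBINT x. gw x * F x) = 0"
 shows "(LBINT x. gw x * (F x)\<^sup>2) \<le> (LBINT x. gw x * (DF x \<bullet> DF x))"
proof -
 have C: "0 \<le> C" using DFb[of 0] norm_ge_zero order_trans by blast
 define A where "A = (LBINT x. gw x * (DF x \<bullet> DF x))"
 let ?x = "\<lambda>t z::'a \<times> 'a. cos t *\<^sub>R fst z + sin t *\<^sub>R snd z"
 let ?x' = "\<lambda>t z::'a \<times> 'a. cos t *\<^sub>R snd z - sin t *\<^sub>R fst z"
 let ?w = "\<lambda>t z::'a \<times> 'a. cos t *\<^sub>R fst z - sin t *\<^sub>R snd z"
 have nfs: "norm (fst z) \<le> norm z" "norm (snd z) \<le> norm z" for z :: "'a \<times> 'a" by (simp_all add: norm_prod_def real_le_rsqrt)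
 have cs: "\<bar>cos t\<bar> \<le> 1" "\<bar>sin t\<bar> \<le> 1" for t :: real by simp_all
 have n2: "norm (p *\<^sub>R u + q *\<^sub>R v) \<le> 2 * r" if "\<bar>p\<bar> \<le> 1" "\<bar>q\<bar> \<le> 1" "norm u \<le> r" "norm v \<le> r" for p q r and u v :: 'a
 proof -
  have "norm (p *\<^sub>R u + q *\<^sub>R v) \<le> \<bar>p\<bar> * norm u + \<bar>q\<bar> * norm v" using norm_triangle_ineq[of "p *\<^sub>R u" "q *\<^sub>R v"] by simp
  also have "\<dots> \<le> 1 * r + 1 * r" using that by (intro add_mono mult_mono) auto
  finally show ?thesis by simp
 qed
 have xb: "norm (?x t z) \<le> 2 * norm z" for t z by (rule n2[OF cs nfs])
 have x'b: "norm (?x' t z) \<le> 2 * norm z" for t z using n2[of "cos t" "- sin t" "snd z" "norm z" "fst z"] cs nfs by simp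
 have wb: "norm (?w t z) \<le> 2 * norm z" for t z using n2[of "cos t" "- sin t" "fst z" "norm z" "snd z"] cs nfs by simp
 have poly: "(1 + 2 * r)\<^sup>2 \<le> 9 * (1 + r\<^sup>2)\<^sup>2" if "0 \<le> r" for r :: real
 proof -
  have "0 \<le> (r - 1)\<^sup>2" by simp
  then have "2 * r \<le> 1 + r\<^sup>2" by (simp add: power2_diff)
  moreover have "0 \<le> r\<^sup>2" by simp
  ultimately have "1 + 2 * r \<le> 3 * (1 + r\<^sup>2)" unfolding distrib_left by linarith
  then have "(1 + 2 * r)\<^sup>2 \<le> (3 * (1 + r\<^sup>2))\<^sup>2" using that by (intro power_mono) auto
  then show ?thesis unfolding power_mult_distrib by simp
 qed
 have zn: "z \<bullet> z = (norm z)\<^sup>2" for z :: "'a \<times> 'a" by (simp add: power2_norm_eq_inner)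
 have Fb2: "\<bar>F y\<bar> \<le> C * (1 + 2 * norm z)" if "norm y \<le> 2 * norm z" for y and z :: "'a \<times> 'a"
  using Fb[of y] mult_left_mono[OF _ C, of "1 + norm y" "1 + 2 * norm z"] that by linarith
 have big: "\<bar>a * b\<bar> \<le> 9 * C\<^sup>2 * (1 + z \<bullet> z)\<^sup>2" if "\<bar>a\<bar> \<le> C * (1 + 2 * norm z)" "\<bar>b\<bar> \<le> C * (1 + 2 * norm z)" for a b and z :: "'a \<times> 'a"
 proof -
  have "\<bar>a * b\<bar> \<le> (C * (1 + 2 * norm z)) * (C * (1 + 2 * norm z))" unfolding abs_mult using that C by (intro mult_mono) auto
  also have "\<dots> = C\<^sup>2 * (1 + 2 * norm z)\<^sup>2" by (simp add: power2_eq_square)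
  also have "\<dots> \<le> C\<^sup>2 * (9 * (1 + (norm z)\<^sup>2)\<^sup>2)" using poly[of "norm z"] by (intro mult_left_mono) auto
  finally show ?thesis unfolding zn by simp
 qed
 have mlin: "(\<lambda>z::'a \<times> 'a. p *\<^sub>R fst z + q *\<^sub>R snd z) \<in> borel_measurable borel" for p q :: real
  by (intro borel_measurable_continuous_onI continuous_intros)
 have mx: "?x t \<in> borel_measurable borel" for t by (rule mlin)
 have mw: "?w t \<in> borel_measurable borel" for t using mlin[of "cos t" "- sin t"] by simp
 have mx': "?x' t \<in> borel_measurable borel" for t using mlin[of "- sin t" "cos t"] by (simp add: add.commute)
 have mfs: "(fst :: 'a \<times> 'a \<Rightarrow> 'a) \<in> borel_measurable borel" "(snd :: 'a \<times> 'a \<Rightarrow> 'a) \<in> borel_measurable borel"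
  by (intro borel_measurable_continuous_onI continuous_intros)+
 have cF: "(\<lambda>z. F (f z)) \<in> borel_measurable borel" if "f \<in> borel_measurable borel" for f :: "'a \<times> 'a \<Rightarrow> 'a"
  using measurable_compose[OF that Fm] .
 have cDF: "(\<lambda>z. DF (f z)) \<in> borel_measurable borel" if "f \<in> borel_measurable borel" for f :: "'a \<times> 'a \<Rightarrow> 'a"
  using measurable_compose[OF that DFm] .
 \<comment> \<open>The covariance of F at X and at the rotated point: it equals E F^2 at t = 0 and
   the squared mean, hence 0, at t = pi/2.\<close>
 define \<Phi> where "\<Phi> t = (LBINT z. gw2 z * (F (fst z) * F (?x t z)))" for t
 define D where "D t = (LBINT z. gw2 z * (F (fst z) * (DF (?x t z) \<bullet> ?x' t z)))" for t
 have F1: "\<bar>F (fst z)\<bar> \<le> C * (1 + 2 * norm z)" for z :: "'a \<times> 'a" 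
  by (rule Fb2) (use nfs(1)[of z] norm_ge_zero[of z] in linarith)
 have DFx: "\<bar>DF (?x t z) \<bullet> ?x' t z\<bar> \<le> C * (1 + 2 * norm z)" for t z
 proof -
  have "\<bar>DF (?x t z) \<bullet> ?x' t z\<bar> \<le> norm (DF (?x t z)) * norm (?x' t z)" by (rule Cauchy_Schwarz_ineq2)
  also have "\<dots> \<le> C * (2 * norm z)" using DFb x'b C by (intro mult_mono) auto
  also have "\<dots> \<le> C * (1 + 2 * norm z)" using C by (intro mult_left_mono) auto
  finally show ?thesis .
 qed
 have der\<Phi>: "DERIV \<Phi> t0 :> D t0" for t0 unfolding \<Phi>_def[abs_def] D_def
 proof (rule DERIV_integral[where d = 1 and w = "\<lambda>z. gw2 z * (9 * C\<^sup>2 * (1 + z \<bullet> z)\<^sup>2)"])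
  show "integrable lborel (\<lambda>z. gw2 z * (F (fst z) * F (?x t z)))" for t
   by (rule integrable_gw2_poly[OF _ big[OF F1 Fb2[OF xb]]]) (intro borel_measurable_times cF mfs mx)
  show "AE z in lborel. \<forall>t. \<bar>t - t0\<bar> < 1 \<longrightarrow> DERIV (\<lambda>t. gw2 z * (F (fst z) * F (?x t z))) t :> gw2 z * (F (fst z) * (DF (?x t z) \<bullet> ?x' t z))"
   using ae1
  proof eventually_elim
   case (elim z)
   show ?case
   proof (intro allI impI)
    fix t
    have "((\<lambda>t. ?x t z) has_derivative (\<lambda>s. s *\<^sub>R ?x' t z)) (at t)" by (auto intro!: derivative_eq_intros simp: algebra_simps)
    from has_derivative_compose[OF this der] elim
    have "DERIV (\<lambda>t. F (?x t z)) t :> DF (?x t z) \<bullet> ?x' t z" by (intro has_derivative_mult_imp_DERIV) simp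
    then show "DERIV (\<lambda>t. gw2 z * (F (fst z) * F (?x t z))) t :> gw2 z * (F (fst z) * (DF (?x t z) \<bullet> ?x' t z))"
     by (intro DERIV_cmult)
   qed
  qed
  show "AE z in lborel. \<forall>t. \<bar>t - t0\<bar> < 1 \<longrightarrow> \<bar>gw2 z * (F (fst z) * (DF (?x t z) \<bullet> ?x' t z))\<bar> \<le> gw2 z * (9 * C\<^sup>2 * (1 + z \<bullet> z)\<^sup>2)"
  proof (intro AE_I2 allI impI)
   fix z :: "'a \<times> 'a" and t
   show "\<bar>gw2 z * (F (fst z) * (DF (?x t z) \<bullet> ?x' t z))\<bar> \<le> gw2 z * (9 * C\<^sup>2 * (1 + z \<bullet> z)\<^sup>2)"
    unfolding abs_mult[of "gw2 z"] abs_of_nonneg[OF gw2_nonneg] by (rule mult_left_mono[OF big[OF F1 DFx] gw2_nonneg])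
  qed
  have "integrable lborel (\<lambda>z::'a \<times> 'a. gw2 z * (9 * C\<^sup>2 * (1 + z \<bullet> z)\<^sup>2))"
   by (rule integrable_gw2_poly[of _ "9 * C\<^sup>2"]) (auto intro!: borel_measurable_continuous_onI continuous_intros)
  then show "integrable lborel (\<lambda>z::'a \<times> 'a. gw2 z * (9 * C\<^sup>2 * (1 + z \<bullet> z)\<^sup>2))" .
  have "integrable lborel (\<lambda>z. gw2 z * (F (fst z) * (DF (?x t0 z) \<bullet> ?x' t0 z)))"
   by (rule integrable_gw2_poly[OF _ big[OF F1 DFx]]) (intro borel_measurable_times borel_measurable_inner cF cDF mfs mx mx')
  then show "(\<lambda>z. gw2 z * (F (fst z) * (DF (?x t0 z) \<bullet> ?x' t0 z))) \<in> borel_measurable lborel" by (rule borel_measurable_integrable)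
 qed simp
 have DFi: "\<bar>DF x \<bullet> DF y\<bar> \<le> C\<^sup>2" for x y
 proof -
  have "\<bar>DF x \<bullet> DF y\<bar> \<le> norm (DF x) * norm (DF y)" by (rule Cauchy_Schwarz_ineq2)
  also have "\<dots> \<le> C * C" using DFb C by (intro mult_mono) auto
  finally show ?thesis by (simp add: power2_eq_square)
 qed
 have one_le: "1 \<le> (1 + x \<bullet> x)\<^sup>2" for x :: "'b::real_inner" by (simp add: one_le_power)
 have C2le: "C\<^sup>2 \<le> C\<^sup>2 * (1 + z \<bullet> z)\<^sup>2" for z :: "'b::real_inner" using mult_left_mono[OF one_le[of z], of "C\<^sup>2"] by simp
 have lower: "- sin t * A \<le> D t" if t: "0 < t" "t < pi / 2" for t
 proof -
  have st: "0 < sin t" using t by (intro sin_gt_zero) auto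
  \<comment> \<open>Rotating the pair makes the moving point the first coordinate and its velocity
    the second. \<open>F\<close> is then evaluated at \<open>?w t z\<close>, which depends on
    \<open>snd z\<close> with the factor \<open>- sin t\<close>; this prepares the integration by
    parts in \<open>snd z\<close>.\<close>
  have D1: "D t = (LBINT z. gw2 z * (F (?w t z) * (DF (fst z) \<bullet> snd z)))"
  proof -
   let ?f = "\<lambda>z. F (fst z) * (DF (?x t z) \<bullet> ?x' t z)"
   have fm: "?f \<in> borel_measurable borel" by (intro borel_measurable_times borel_measurable_inner cF cDF mfs mx mx')
   have sc: "sin t * sin t + cos t * cos t = 1" using sin_cos_squared_add[of t] by (simp add: power2_eq_square)
   have e1: "?x t (?w t z, sin t *\<^sub>R fst z + cos t *\<^sub>R snd z) = fst z" for z
   proof -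
    have "?x t (?w t z, sin t *\<^sub>R fst z + cos t *\<^sub>R snd z) = (sin t * sin t + cos t * cos t) *\<^sub>R fst z" unfolding scaleR_add_left by (simp add: scaleR_add_right scaleR_diff_right)
    then show ?thesis by (simp only: sc scaleR_one)
   qed
   have e2: "?x' t (?w t z, sin t *\<^sub>R fst z + cos t *\<^sub>R snd z) = snd z" for z
   proof -
    have "?x' t (?w t z, sin t *\<^sub>R fst z + cos t *\<^sub>R snd z) = (sin t * sin t + cos t * cos t) *\<^sub>R snd z" unfolding scaleR_add_left by (simp add: scaleR_add_right scaleR_diff_right)
    then show ?thesis by (simp only: sc scaleR_one)
   qed
   have "D t = (LBINT z. gw2 z * ?f (?w t z, sin t *\<^sub>R fst z + cos t *\<^sub>R snd z))"
    unfolding D_def using integral_rotation[of t ?f] fm st by simp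
   then show ?thesis unfolding e1 e2 by simp
  qed
  let ?K = "LBINT y. exp (- ((y::'a) \<bullet> y) / 2)"
  have ibp: "(LBINT z. gw2 z * (F (?w t z) * ((DF (fst z) \<bullet> b) * (snd z \<bullet> b)))) =
    (LBINT z. gw2 z * (- sin t * ((DF (?w t z) \<bullet> b) * (DF (fst z) \<bullet> b))))"
   and ibp_int: "integrable lborel (\<lambda>z. gw2 z * (F (?w t z) * ((DF (fst z) \<bullet> b) * (snd z \<bullet> b))))"
    "integrable lborel (\<lambda>z. gw2 z * (- sin t * ((DF (?w t z) \<bullet> b) * (DF (fst z) \<bullet> b))))"
   if b: "b \<in> Basis" for b
  proof -
   let ?s = "\<lambda>z. - sin t * ((DF (?w t z) \<bullet> b) * (DF (fst z) \<bullet> b))" and ?r = "\<lambda>z. F (?w t z) * ((DF (fst z) \<bullet> b) * (snd z \<bullet> b))"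
   have DFbb: "\<bar>DF x \<bullet> b\<bar> \<le> C" for x using Cauchy_Schwarz_ineq2[of "DF x" b] DFb[of x] b by simp
   have s1: "\<bar>(DF (fst z) \<bullet> b) * (snd z \<bullet> b)\<bar> \<le> C * (1 + 2 * norm z)" for z :: "'a \<times> 'a"
   proof -
    have "\<bar>snd z \<bullet> b\<bar> \<le> norm z" using Cauchy_Schwarz_ineq2[of "snd z" b] nfs(2)[of z] b by simp
    then have "\<bar>(DF (fst z) \<bullet> b) * (snd z \<bullet> b)\<bar> \<le> C * norm z" unfolding abs_mult using DFbb C by (intro mult_mono) auto
    also have "\<dots> \<le> C * (1 + 2 * norm z)" using C by (intro mult_left_mono) auto
    finally show ?thesis .
   qed
   have s2: "\<bar>?s z\<bar> \<le> C\<^sup>2 * (1 + z \<bullet> z)\<^sup>2" for z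
   proof -
    have "\<bar>?s z\<bar> \<le> 1 * (C * C)" unfolding abs_mult using DFbb C cs by (intro mult_mono) auto
    then show ?thesis using C2le[of z] by (simp add: power2_eq_square)
   qed
   have s3: "\<bar>DF (fst z) \<bullet> b\<bar> \<le> C * (1 + 2 * norm z)" for z :: "'a \<times> 'a"
    using DFbb[of "fst z"] C mult_left_mono[OF _ C, of 1 "1 + 2 * norm z"] by simp
   have m1: "(\<lambda>z. ?r z) \<in> borel_measurable borel"
    by (intro borel_measurable_times borel_measurable_inner cF cDF mfs mw measurable_const) simp_all
   have m2: "(\<lambda>z. ?s z) \<in> borel_measurable borel"
    by (intro borel_measurable_times borel_measurable_inner cF cDF mfs mw measurable_const) simp_all
   show i1: "integrable lborel (\<lambda>z. gw2 z * ?r z)" by (rule integrable_gw2_poly[OF m1 big[OF Fb2[OF wb] s1]])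
   show i2: "integrable lborel (\<lambda>z. gw2 z * ?s z)" by (rule integrable_gw2_poly[OF m2 s2])
   let ?P = "\<lambda>z. gw2 z * (F (?w t z) * (DF (fst z) \<bullet> b))"
   let ?P' = "\<lambda>z. gw2 z * (?s z - ?r z)"
   have "(LBINT z. ?P' z) = 0"
   proof (rule gauss_directional_deriv[where e = "(0, b)" and F = ?P])
    show "integrable lborel ?P"
     by (rule integrable_gw2_poly[OF _ big[OF Fb2[OF wb] s3]]) (intro borel_measurable_times borel_measurable_inner cF cDF mfs mw measurable_const, simp_all)
    show "AE z in lborel. \<forall>s. DERIV (\<lambda>s. ?P (z + s *\<^sub>R (0, b))) s :> ?P' (z + s *\<^sub>R (0, b))"
     using ae2[OF less_imp_neq[OF st, symmetric] b]
    proof eventually_elim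
     case (elim z)
     show ?case
     proof
      fix s
      let ?y = "\<lambda>s. z + s *\<^sub>R (0::'a, b)"
      have wS: "?w t (?y s) \<in> S" using elim by simp
      have "((\<lambda>s. ?w t (?y s)) has_derivative (\<lambda>u. u *\<^sub>R (- sin t *\<^sub>R b))) (at s)"
       by (auto intro!: derivative_eq_intros simp: algebra_simps)
      from has_derivative_compose[OF this der[OF wS]]
      have d1: "DERIV (\<lambda>s. F (?w t (?y s))) s :> - sin t * (DF (?w t (?y s)) \<bullet> b)"
       by (intro has_derivative_mult_imp_DERIV) (simp add: algebra_simps)
      have bb: "b \<bullet> b = 1" using b by simp
      have q: "DERIV (\<lambda>s. - (?y s \<bullet> ?y s) / 2) s :> - (snd (?y s) \<bullet> b)"
      proof -
       have eq: "- (?y s \<bullet> ?y s) / 2 = - (z \<bullet> z) / 2 - s * (snd z \<bullet> b) - s * s / 2" for s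
       proof -
        have "?y s \<bullet> ?y s = z \<bullet> z + 2 * s * (snd z \<bullet> b) + s * s"
         by (simp add: inner_prod_def inner_add_left inner_add_right bb inner_commute[of b "snd z"] distrib_left)
        then show ?thesis by (simp add: field_simps)
       qed
       show ?thesis unfolding eq by (auto intro!: derivative_eq_intros simp: inner_add_left bb)
      qed
      have d2: "DERIV (\<lambda>s. gw2 (?y s)) s :> - (snd (?y s) \<bullet> b) * gw2 (?y s)"
       unfolding gw2_eq using DERIV_cdivide[OF DERIV_chain2[OF DERIV_exp q], of "?K\<^sup>2"] by (simp add: mult.commute)
      have "DERIV (\<lambda>s. gw2 (?y s) * (F (?w t (?y s)) * (DF (fst z) \<bullet> b))) s :> ?P' (?y s)"
       by (rule DERIV_cong[OF DERIV_mult[OF d2 DERIV_cmult_right[OF d1]]]) (simp add: algebra_simps)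
      then show "DERIV (\<lambda>s. ?P (?y s)) s :> ?P' (?y s)" by simp
     qed
    qed
    show "\<bar>?P' z\<bar> \<le> (10 * C\<^sup>2 / ?K\<^sup>2) * ((1 + z \<bullet> z)\<^sup>2 * exp (- (z \<bullet> z) / 2))" for z
    proof -
     have "\<bar>?s z - ?r z\<bar> \<le> 10 * C\<^sup>2 * (1 + z \<bullet> z)\<^sup>2" using s2[of z] big[OF Fb2[OF wb[of t z]] s1[of z]] by linarith
     then have "\<bar>?P' z\<bar> \<le> gw2 z * (10 * C\<^sup>2 * (1 + z \<bullet> z)\<^sup>2)"
      unfolding abs_mult[of "gw2 z"] abs_of_nonneg[OF gw2_nonneg] by (rule mult_left_mono[OF _ gw2_nonneg])
     then show ?thesis by (simp add: gw2_eq mult_ac)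
    qed
    show "?P' \<in> borel_measurable borel"
    proof -
     have "?P' = (\<lambda>z. gw2 z * ?s z - gw2 z * ?r z)" by (simp add: right_diff_distrib)
     then show ?thesis using borel_measurable_diff[OF borel_measurable_integrable[OF i2] borel_measurable_integrable[OF i1]] by simp
    qed
   qed
   then have "(LBINT z. gw2 z * ?s z - gw2 z * ?r z) = 0" by (simp only: right_diff_distrib)
   then show "(LBINT z. gw2 z * ?r z) =
    (LBINT z. gw2 z * ?s z)" unfolding Bochner_Integration.integral_diff[OF i2 i1] by simp
  qed
  have ib: "(x::'a) \<bullet> y = (\<Sum>b\<in>Basis. (x \<bullet> b) * (y \<bullet> b))" for x y by (rule euclidean_inner)
  have "D t = (LBINT z. (\<Sum>b\<in>Basis. gw2 z * (F (?w t z) * ((DF (fst z) \<bullet> b) * (snd z \<bullet> b)))))"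
   unfolding D1 by (subst ib) (simp only: sum_distrib_left)
  also have "\<dots> = (\<Sum>b\<in>Basis. LBINT z. gw2 z * (F (?w t z) * ((DF (fst z) \<bullet> b) * (snd z \<bullet> b))))"
   by (rule Bochner_Integration.integral_sum) (rule ibp_int(1))
  also have "\<dots> = (\<Sum>b\<in>Basis. LBINT z. gw2 z * (- sin t * ((DF (?w t z) \<bullet> b) * (DF (fst z) \<bullet> b))))"
   by (rule sum.cong[OF refl]) (rule ibp)
  also have "\<dots> = (LBINT z. (\<Sum>b\<in>Basis. gw2 z * (- sin t * ((DF (?w t z) \<bullet> b) * (DF (fst z) \<bullet> b)))))"
   by (rule Bochner_Integration.integral_sum[symmetric]) (rule ibp_int(2))
  also have "\<dots> = (LBINT z. gw2 z * (- sin t * (DF (?w t z) \<bullet> DF (fst z))))" by (subst (2) ib) (simp only: sum_distrib_left)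
  finally have D2: "D t = (LBINT z. gw2 z * (- sin t * (DF (?w t z) \<bullet> DF (fst z))))" .
  let ?h = "\<lambda>x. DF x \<bullet> DF x"
  have hb: "\<bar>?h (f z)\<bar> \<le> C\<^sup>2 * (1 + z \<bullet> z)\<^sup>2" for f and z :: "'a \<times> 'a" using DFi[of "f z" "f z"] C2le[of z] by linarith
  have hi: "integrable lborel (\<lambda>z. gw2 z * ?h (f z))" if "f \<in> borel_measurable borel" for f :: "'a \<times> 'a \<Rightarrow> 'a"
   by (rule integrable_gw2_poly[OF _ hb]) (intro borel_measurable_inner cDF that)
  have h1: "(LBINT z. gw2 z * ?h (fst z)) = A"
   using integral_gw2_prod[of ?h "\<lambda>_. 1"] hi[OF mfs(1)] integral_gw(2)[where 'a = 'a] by (simp add: A_def)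
  have h2: "(LBINT z. gw2 z * ?h (?w t z)) = A"
  proof -
   have "(\<lambda>z::'a \<times> 'a. ?h (fst z)) \<in> borel_measurable borel" by (intro borel_measurable_inner cDF mfs)
   then have "(LBINT z. gw2 z * ?h (?w t z)) = (LBINT z. gw2 z * ?h (fst z))"
    using integral_rotation[of t "\<lambda>z. ?h (fst z)"] st by simp
   then show ?thesis using h1 by simp
  qed
  have "(LBINT z. - (sin t / 2) * (gw2 z * ?h (?w t z)) + - (sin t / 2) * (gw2 z * ?h (fst z))) \<le> D t" unfolding D2
  proof (rule integral_mono)
   show "integrable lborel (\<lambda>z. - (sin t / 2) * (gw2 z * ?h (?w t z)) + - (sin t / 2) * (gw2 z * ?h (fst z)))"
    by (intro Bochner_Integration.integrable_add integrable_mult_right hi mfs mw)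
   have "\<bar>- sin t * (DF (?w t z) \<bullet> DF (fst z))\<bar> \<le> C\<^sup>2 * (1 + z \<bullet> z)\<^sup>2" for z
   proof -
    have "\<bar>- sin t * (DF (?w t z) \<bullet> DF (fst z))\<bar> \<le> 1 * C\<^sup>2" unfolding abs_mult using DFi cs by (intro mult_mono) auto
    then show ?thesis using C2le[of z] by linarith
   qed
   then show "integrable lborel (\<lambda>z. gw2 z * (- sin t * (DF (?w t z) \<bullet> DF (fst z))))"
    by (rule integrable_gw2_poly[rotated]) (intro borel_measurable_times borel_measurable_inner cDF mfs mw measurable_const, simp)
   fix z
   \<comment> \<open>The mixed product is at most half the sum of the squares, and both squares have
     integral \<open>A\<close> by rotation invariance.\<close>
   have "0 \<le> (DF (?w t z) - DF (fst z)) \<bullet> (DF (?w t z) - DF (fst z))" by simp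
   then have "2 * (DF (?w t z) \<bullet> DF (fst z)) \<le> ?h (?w t z) + ?h (fst z)"
    by (simp only: inner_diff_left inner_diff_right inner_commute[of "DF (fst z)" "DF (?w t z)"])
   then have "(gw2 z * sin t / 2) * (2 * (DF (?w t z) \<bullet> DF (fst z))) \<le> (gw2 z * sin t / 2) * (?h (?w t z) + ?h (fst z))"
    using st gw2_nonneg[of z] by (intro mult_left_mono) simp_all
   then show "- (sin t / 2) * (gw2 z * ?h (?w t z)) + - (sin t / 2) * (gw2 z * ?h (fst z)) \<le> gw2 z * (- sin t * (DF (?w t z) \<bullet> DF (fst z)))"
    by (simp add: algebra_simps)
  qed
  also have "(LBINT z. - (sin t / 2) * (gw2 z * ?h (?w t z)) + - (sin t / 2) * (gw2 z * ?h (fst z))) = - sin t * A"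
   by (subst Bochner_Integration.integral_add) (use h1 h2 hi[OF mw] hi[OF mfs(1)] in \<open>auto simp: integral_mult_right_zero\<close>)
  finally show ?thesis .
 qed
 \<comment> \<open>By \<open>lower\<close> the function \<Phi> - A cos is nondecreasing; the mean
   value theorem compares its values at 0 and pi/2.\<close>
 have "\<exists>z>0. z < pi / 2 \<and> (\<Phi> (pi / 2) - A * cos (pi / 2)) - (\<Phi> 0 - A * cos 0) = (pi / 2 - 0) * (D z + A * sin z)"
  by (rule MVT2) (auto intro!: derivative_eq_intros der\<Phi>)
 then obtain z where z: "0 < z" "z < pi / 2" "\<Phi> (pi / 2) - \<Phi> 0 + A = (pi / 2) * (D z + A * sin z)" by auto
 have "0 \<le> (pi / 2) * (D z + A * sin z)" using lower[OF z(1,2)] by (intro mult_nonneg_nonneg) (auto simp: mult.commute)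
 then have "\<Phi> 0 \<le> \<Phi> (pi / 2) + A" using z(3) by linarith
 moreover have "\<Phi> (pi / 2) = 0"
 proof -
  have "integrable lborel (\<lambda>z. gw2 z * (F (fst z) * F (?x (pi / 2) z)))"
   by (rule integrable_gw2_poly[OF _ big[OF F1 Fb2[OF xb]]]) (intro borel_measurable_times cF mfs mx)
  then have "integrable lborel (\<lambda>z. gw2 z * (F (fst z) * F (snd z)))" by simp
  from integral_gw2_prod[OF this] show ?thesis by (simp add: \<Phi>_def mean)
 qed
 moreover have "\<Phi> 0 = (LBINT x. gw x * (F x)\<^sup>2)"
 proof -
  have "integrable lborel (\<lambda>z. gw2 z * (F (fst z) * F (?x 0 z)))"
   by (rule integrable_gw2_poly[OF _ big[OF F1 Fb2[OF xb]]]) (intro borel_measurable_times cF mfs mx)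
  then have "integrable lborel (\<lambda>z::'a \<times> 'a. gw2 z * ((F (fst z))\<^sup>2 * 1))" by (simp add: power2_eq_square)
  from integral_gw2_prod[of "\<lambda>x. (F x)\<^sup>2" "\<lambda>_. 1", OF this] show ?thesis by (simp add: \<Phi>_def integral_gw(2) power2_eq_square)
 qed
 ultimately show ?thesis by (simp add: A_def)
qed

section \<open>Horizontal slices of the cone\<close>

lemma AE_not_hyperplane:
 fixes a :: "'a::euclidean_space"
 assumes "a \<noteq> 0"
 shows "AE x in lborel. a \<bullet> x \<noteq> 0"
proof -
 have "negligible {x. a \<bullet> x = 0}" using assms by (intro negligible_hyperplane) simp
 moreover have s: "{x. a \<bullet> x = 0} \<in> sets lborel" using closed_hyperplane[of a 0] by (simp add: borel_closed)
 ultimately have "{x. a \<bullet> x = 0} \<in> null_sets lborel" by (simp add: negligible_iff_null_sets null_sets_completion_iff)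
 then have "AE x in lborel. x \<notin> {x. a \<bullet> x = 0}" by (rule AE_not_in)
 then show ?thesis by simp
qed

definition hor :: "'m::finite \<Rightarrow> real^'m \<Rightarrow> real^'m" where
 "hor j x = x - (x $ j) *\<^sub>R axis j 1"

lemma hor_nth: "hor j x $ i = (if i = j then 0 else x $ i)" by (simp add: hor_def axis_def)

lemma hor_add: "hor j (x + y) = hor j x + hor j y" by (simp add: vec_eq_iff hor_nth)

lemma hor_scaleR: "hor j (c *\<^sub>R x) = c *\<^sub>R hor j x" by (simp add: vec_eq_iff hor_nth)

lemma hor_0 [simp]: "hor j 0 = 0" by (simp add: vec_eq_iff hor_nth)

lemma hor_axis: "i \<noteq> j \<Longrightarrow> hor j (axis i 1) = axis i 1" by (simp add: vec_eq_iff hor_nth axis_def)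

lemma hor_inner: "hor j x \<bullet> y = x \<bullet> hor j y" "hor j x \<bullet> hor j y = x \<bullet> hor j y"
 unfolding inner_vec_def by (rule sum.cong; simp add: hor_nth)+

lemma norm_hor_le: "norm (hor j x) \<le> norm x" by (rule norm_le_componentwise_cart) (simp add: hor_nth)

lemma bounded_linear_hor: "bounded_linear (hor j)"
 by (rule bounded_linear_intro[where K = 1]) (simp_all add: hor_add hor_scaleR norm_hor_le)

lemma continuous_hor: "continuous_on S (hor j)" by (rule bounded_linear.continuous_on[OF bounded_linear_hor continuous_on_id])

lemma hor_sgn: "sgn (hor j x) $ j = 0" "hor j x \<noteq> 0 \<Longrightarrow> norm (sgn (hor j x)) = 1"
  "hor j (sgn (hor j x)) = sgn (hor j x)" by (simp_all add: sgn_div_norm hor_nth vec_eq_iff)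

lemma hor_nth_nonzero: "l \<noteq> j \<Longrightarrow> x $ l \<noteq> 0 \<Longrightarrow> hor j x \<noteq> 0" by (auto simp: vec_eq_iff hor_nth)

lemma obtain_third_index:
 fixes i j :: "'m::finite"
 assumes "3 \<le> CARD('m)"
 obtains l :: 'm where "l \<noteq> i" "l \<noteq> j"
proof -
 have "card {i, j} \<le> 2" by (simp add: card_insert_if)
 then have "card {i, j} < CARD('m)" using assms by linarith
 then have "UNIV - {i, j} \<noteq> {}" by (metis Diff_eq_empty_iff card_mono finite leD)
 then show ?thesis using that by auto
qed

lemma axis_nth_if: "axis i (1::real) $ l = (if l = i then 1 else 0)" by (simp add: axis_def)

text \<open>A line in direction \<open>axis i 1\<close> meets the axis \<open>hor j x = 0\<close>
  only if the remaining horizontal coordinates of its base point vanish. Three coordinates guarantee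
  such a remaining one, so the exceptional set is null.\<close>

lemma AE_hor_line:
 fixes j :: "'m::finite"
 assumes "3 \<le> CARD('m)"
 shows "AE x in lborel. \<forall>s. hor j (x + s *\<^sub>R axis i 1) \<noteq> 0"
proof -
 obtain l where l: "l \<noteq> j" "l \<noteq> i" using obtain_third_index[OF assms] by metis
 have "AE x in lborel. axis l 1 \<bullet> (x :: real^'m) \<noteq> 0" by (rule AE_not_hyperplane) (simp add: axis_eq_0_iff)
 then show ?thesis
 proof eventually_elim
  case (elim x)
  then show ?case using l by (intro allI hor_nth_nonzero[of l]) (simp_all add: inner_axis' axis_nth_if)
 qed
qed

lemma AE_hor: "3 \<le> CARD('m::finite) \<Longrightarrow> AE x in lborel. hor (j::'m) x \<noteq> 0"
 using AE_hor_line[of j undefined] by (auto elim!: eventually_mono dest: spec[of _ 0])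

lemma AE_hor_rotation_line:
 fixes j :: "'m::finite"
 assumes N: "3 \<le> CARD('m)" and t: "sin t \<noteq> 0" and b: "b \<in> Basis"
 shows "AE z in lborel. \<forall>s. hor j (cos t *\<^sub>R fst z - sin t *\<^sub>R (snd z + s *\<^sub>R b)) \<noteq> 0"
proof -
 obtain i where i: "b = axis i 1" using b by (auto simp: Basis_vec_def)
 obtain l where l: "l \<noteq> j" "l \<noteq> i" using obtain_third_index[OF N] by metis
 have "(cos t *\<^sub>R axis l 1, - sin t *\<^sub>R axis l 1) \<noteq> (0 :: (real^'m) \<times> (real^'m))"
  using t by (simp add: zero_prod_def axis_eq_0_iff)
 from AE_not_hyperplane[OF this] show ?thesis
 proof eventually_elim
  case (elim z)
  then show ?case using l by (intro allI hor_nth_nonzero[of l]) (simp_all add: inner_prod_def inner_axis' i axis_nth_if)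
 qed
qed

text \<open>The rotated point hits the axis for some t only if the horizontal parts of the two
  components are linearly dependent. A nonzero two by two minor excludes this for all t at once, and
  it is nonzero almost everywhere.\<close>

lemma AE_hor_rotation:
 fixes j :: "'m::finite"
 assumes N: "3 \<le> CARD('m)"
 shows "AE z in lborel. \<forall>t. hor j (cos t *\<^sub>R fst z + sin t *\<^sub>R snd z) \<noteq> 0"
proof -
 obtain l where l: "l \<noteq> j" using obtain_third_index[OF N] by metis
 obtain m where m: "m \<noteq> j" "m \<noteq> l" using obtain_third_index[OF N] by metis
 let ?P = "\<lambda>z :: (real^'m) \<times> (real^'m). (fst z $ l *\<^sub>R axis m 1 - fst z $ m *\<^sub>R axis l 1) \<bullet> snd z \<noteq> 0"
 have "open {z. ?P z}" by (intro open_Collect_neq continuous_intros)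
 then have op: "{z \<in> space (lborel \<Otimes>\<^sub>M lborel). ?P z} \<in> sets (lborel \<Otimes>\<^sub>M lborel)"
  unfolding sets_lborel_pair by (intro borel_open) (simp add: space_pair_measure)
 have "AE z in lborel \<Otimes>\<^sub>M lborel. ?P z"
 proof (rule lborel_pair.AE_pair_measure[OF op])
  have "AE x in lborel. axis l 1 \<bullet> (x :: real^'m) \<noteq> 0" by (rule AE_not_hyperplane) (simp add: axis_eq_0_iff)
  then show "AE x in lborel. AE y in lborel. ?P (x, y)"
  proof eventually_elim
   case (elim x)
   have "(x $ l *\<^sub>R axis m 1 - x $ m *\<^sub>R axis l 1 :: real^'m) $ m \<noteq> 0" using elim m by (simp add: inner_axis' axis_nth_if)
   then have "x $ l *\<^sub>R axis m 1 - x $ m *\<^sub>R axis l 1 \<noteq> (0 :: real^'m)" by (metis zero_index)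
   from AE_not_hyperplane[OF this] show ?case by simp
  qed
 qed
 then have "AE z in lborel. ?P z" unfolding lborel_prod .
 then show ?thesis
 proof eventually_elim
  case (elim z)
  show ?case
  proof (rule allI, rule notI)
   fix t assume h: "hor j (cos t *\<^sub>R fst z + sin t *\<^sub>R snd z) = 0"
   have a: "cos t * fst z $ l + sin t * snd z $ l = 0" "cos t * fst z $ m + sin t * snd z $ m = 0"
    using arg_cong[OF h, of "\<lambda>v. v $ l"] arg_cong[OF h, of "\<lambda>v. v $ m"] l m by (simp_all add: hor_nth)
   let ?D = "fst z $ l * snd z $ m - fst z $ m * snd z $ l"
   have D: "?D \<noteq> 0" using elim by (simp add: inner_diff_left inner_axis')
   have "cos t * ?D = 0" "sin t * ?D = 0" using a by algebra+
   then have "cos t = 0 \<and> sin t = 0" using D by simp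
   then show False using sin_cos_squared_add[of t] by simp
  qed
 qed
qed

lemma open_hor: "open {x. hor j x \<noteq> 0}" by (intro open_Collect_neq continuous_hor continuous_on_const)

text \<open>One-homogeneous functions of the horizontal variables, set to zero on the axis; off the
  axis \<open>e x i\<close> is the second derivative in direction i. The bounds by \<open>C\<close>
  express the degrees 0 and -1 of the first and second derivatives.\<close>

locale slice_fun =
 fixes j :: "'m::finite" and G :: "real^'m \<Rightarrow> real" and DG :: "real^'m \<Rightarrow> real^'m"
  and e :: "real^'m \<Rightarrow> 'm \<Rightarrow> real" and C :: real
 assumes N: "3 \<le> CARD('m)"
  and off: "hor j x = 0 \<Longrightarrow> G x = 0" "hor j x = 0 \<Longrightarrow> DG x = 0" "hor j x = 0 \<Longrightarrow> e x i = 0"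
  and cont: "continuous_on {x. hor j x \<noteq> 0} G" "continuous_on {x. hor j x \<noteq> 0} DG" "continuous_on {x. hor j x \<noteq> 0} (\<lambda>x. e x i)"
  and der: "hor j x \<noteq> 0 \<Longrightarrow> (G has_derivative (\<lambda>v. DG x \<bullet> v)) (at x)"
  and der2: "hor j x \<noteq> 0 \<Longrightarrow> i \<noteq> j \<Longrightarrow> DERIV (\<lambda>s. DG (x + s *\<^sub>R axis i 1) $ i) 0 :> e x i"
  and DGj: "DG x $ j = 0"
  and euler: "x \<bullet> DG x = G x"
  and bD: "norm (DG x) \<le> C" and be: "\<bar>e x i\<bar> * norm (hor j x) \<le> C"
begin

lemma C: "0 \<le> C" using bD[of 0] norm_ge_zero order_trans by blast

lemma meas: "G \<in> borel_measurable borel" "DG \<in> borel_measurable borel" "(\<lambda>x. e x i) \<in> borel_measurable borel"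
proof -
 have 0: "f \<in> borel_measurable borel" if "continuous_on {x. hor j x \<noteq> 0} f" "\<And>x. hor j x = 0 \<Longrightarrow> f x = 0"
  for f :: "real^'m \<Rightarrow> 'b::{second_countable_topology,real_normed_vector}"
 proof -
  have "(\<lambda>x. indicator {x. hor j x \<noteq> 0} x *\<^sub>R f x) = f" using that(2) by (auto simp: indicator_def)
  then show ?thesis using borel_measurable_continuous_on_indicator[OF _ that(1)] open_hor[of j] by auto
 qed
 show "G \<in> borel_measurable borel" "DG \<in> borel_measurable borel" "(\<lambda>x. e x i) \<in> borel_measurable borel"
  by (rule 0[OF cont(1) off(1)] 0[OF cont(2) off(2)] 0[OF cont(3) off(3)]; assumption)+
qed

lemma bG: "\<bar>G x\<bar> \<le> C * norm (hor j x)"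
proof -
 have "x \<bullet> DG x = hor j x \<bullet> DG x" using DGj[of x] by (simp add: hor_def inner_diff_left inner_axis')
 then have "\<bar>G x\<bar> \<le> norm (hor j x) * norm (DG x)" unfolding euler[symmetric] using Cauchy_Schwarz_ineq2 by metis
 also have "\<dots> \<le> norm (hor j x) * C" by (intro mult_left_mono bD) simp
 finally show ?thesis by (simp add: mult.commute)
qed

lemma DERIV_lines:
 assumes "hor j x \<noteq> 0" "i \<noteq> j"
 shows "DERIV (\<lambda>s. G (x + s *\<^sub>R axis i 1)) 0 :> DG x $ i"
 using DERIV_along_line[OF der[OF assms(1)], of "axis i 1"] by (simp add: inner_axis)

end

lemma DERIV_gw_line: "DERIV (\<lambda>s. gw (x + s *\<^sub>R axis i 1 :: real^'m)) 0 :> - (x $ i) * gw x"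
proof -
 have "DERIV (\<lambda>s. - ((x + s *\<^sub>R axis i 1) \<bullet> (x + s *\<^sub>R axis i 1)) / 2) 0 :> - (x $ i)"
 proof -
  have eq: "- ((x + s *\<^sub>R axis i 1) \<bullet> (x + s *\<^sub>R axis i 1)) / 2 = - (x \<bullet> x) / 2 - s * x $ i - s * s / 2" for s :: real
   by (simp add: inner_add_left inner_add_right inner_axis inner_axis' field_simps)
  show ?thesis unfolding eq by (auto intro!: derivative_eq_intros)
 qed
 from DERIV_cdivide[OF DERIV_chain2[OF DERIV_exp this]] show ?thesis unfolding gw_def by (simp add: mult.commute)
qed

locale two_slice_fun = one: slice_fun j G1 DG1 e1 C1 + two: slice_fun j G2 DG2 e2 C2
 for j :: "'m::finite" and G1 DG1 e1 C1 G2 DG2 e2 C2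
begin

lemma bounds:
 "\<bar>G1 x * G2 x\<bar> \<le> C1 * C2 * (1 + x \<bullet> x)\<^sup>2" "\<bar>DG1 x \<bullet> DG2 x\<bar> \<le> C1 * C2 * (1 + x \<bullet> x)\<^sup>2"
 "\<bar>G1 x * e2 x i\<bar> \<le> C1 * C2 * (1 + x \<bullet> x)\<^sup>2" "\<bar>DG1 x $ i * DG2 x $ i\<bar> \<le> C1 * C2 * (1 + x \<bullet> x)\<^sup>2"
 "\<bar>x $ i * (G1 x * DG2 x $ i)\<bar> \<le> C1 * C2 * (1 + x \<bullet> x)\<^sup>2" "\<bar>G1 x * DG2 x $ i\<bar> \<le> C1 * C2 * (1 + x \<bullet> x)\<^sup>2"
proof -
 have CC: "0 \<le> C1 * C2" using one.C two.C by simp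
 let ?r = "norm (hor j x)"
 have r: "?r \<le> norm x" "norm x * norm x = x \<bullet> x" by (simp_all add: norm_hor_le flip: power2_norm_eq_inner power2_eq_square)
 have big: "\<bar>y\<bar> \<le> C1 * C2 * (1 + x \<bullet> x)\<^sup>2" if "\<bar>y\<bar> \<le> C1 * C2 * w" "w \<le> 1 + x \<bullet> x" for y w
 proof -
  have "w \<le> (1 + x \<bullet> x)\<^sup>2" using that(2) self_le_power[of "1 + x \<bullet> x" 2] by simp
  then show ?thesis using mult_left_mono[OF _ CC] that(1) order_trans by blast
 qed
 have rr: "?r * ?r \<le> 1 + x \<bullet> x" using mult_mono[OF r(1) r(1)] r(2) by simp
 have xi: "\<bar>x $ i\<bar> \<le> norm x" by (rule component_le_norm_cart)
 have n1: "norm x \<le> 1 + x \<bullet> x"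
 proof -
  have "0 \<le> (norm x - 1)\<^sup>2" by simp
  then have "2 * norm x \<le> 1 + x \<bullet> x" by (simp add: power2_diff power2_norm_eq_inner)
  then show ?thesis by (metis add_nonneg_nonneg inner_ge_zero norm_ge_zero order_trans zero_le_one mult_2 le_add_same_cancel1)
 qed
 have D1: "\<bar>DG1 x $ i\<bar> \<le> C1" and D2: "\<bar>DG2 x $ i\<bar> \<le> C2"
  using component_le_norm_cart[of "DG1 x" i] component_le_norm_cart[of "DG2 x" i] one.bD[of x] two.bD[of x] by linarith+
 show "\<bar>G1 x * G2 x\<bar> \<le> C1 * C2 * (1 + x \<bullet> x)\<^sup>2"
 proof (rule big[OF _ rr])
  have "\<bar>G1 x * G2 x\<bar> \<le> (C1 * ?r) * (C2 * ?r)" unfolding abs_mult using one.bG two.bG one.C by (intro mult_mono) auto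
  then show "\<bar>G1 x * G2 x\<bar> \<le> C1 * C2 * (?r * ?r)" by (simp add: mult_ac)
 qed
 show "\<bar>DG1 x \<bullet> DG2 x\<bar> \<le> C1 * C2 * (1 + x \<bullet> x)\<^sup>2"
 proof (rule big)
  show "\<bar>DG1 x \<bullet> DG2 x\<bar> \<le> C1 * C2 * 1"
   using Cauchy_Schwarz_ineq2[of "DG1 x" "DG2 x"] mult_mono[OF one.bD[of x] two.bD[of x] one.C norm_ge_zero] by linarith
 qed simp
 show "\<bar>G1 x * e2 x i\<bar> \<le> C1 * C2 * (1 + x \<bullet> x)\<^sup>2"
 proof (rule big)
  have "\<bar>G1 x * e2 x i\<bar> \<le> (C1 * ?r) * \<bar>e2 x i\<bar>" unfolding abs_mult using one.bG by (intro mult_right_mono) auto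
  also have "\<dots> = C1 * (\<bar>e2 x i\<bar> * ?r)" by simp
  also have "\<dots> \<le> C1 * C2" by (intro mult_left_mono two.be one.C)
  finally show "\<bar>G1 x * e2 x i\<bar> \<le> C1 * C2 * 1" by simp
 qed simp
 show "\<bar>DG1 x $ i * DG2 x $ i\<bar> \<le> C1 * C2 * (1 + x \<bullet> x)\<^sup>2"
  by (rule big[where w = 1]) (use mult_mono[OF D1 D2 one.C] in \<open>simp_all add: abs_mult\<close>)
 have GD: "\<bar>G1 x * DG2 x $ i\<bar> \<le> C1 * C2 * norm x"
 proof -
  have "\<bar>G1 x * DG2 x $ i\<bar> \<le> (C1 * norm x) * C2"
   unfolding abs_mult using one.bG[of x] D2 one.C mult_left_mono[OF r(1) one.C] by (intro mult_mono) auto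
  then show ?thesis by (simp add: mult_ac)
 qed
 show "\<bar>G1 x * DG2 x $ i\<bar> \<le> C1 * C2 * (1 + x \<bullet> x)\<^sup>2" by (rule big[OF GD n1])
 show "\<bar>x $ i * (G1 x * DG2 x $ i)\<bar> \<le> C1 * C2 * (1 + x \<bullet> x)\<^sup>2"
 proof (rule big)
  have "\<bar>x $ i * (G1 x * DG2 x $ i)\<bar> \<le> norm x * (C1 * C2 * norm x)"
   unfolding abs_mult[of "x $ i"] using xi GD by (intro mult_mono) auto
  also have "\<dots> = C1 * C2 * (x \<bullet> x)" by (simp add: mult_ac flip: r(2))
  finally show "\<bar>x $ i * (G1 x * DG2 x $ i)\<bar> \<le> C1 * C2 * (x \<bullet> x)" .
 qed simp
qed

lemma measDi: "(\<lambda>x. DG1 x $ i) \<in> borel_measurable borel" "(\<lambda>x. DG2 x $ i) \<in> borel_measurable borel"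
 by (rule measurable_compose[OF one.meas(2)] measurable_compose[OF two.meas(2)], rule borel_measurable_continuous_onI, intro continuous_intros)+

lemma ints:
 "integrable lborel (\<lambda>x. gw x * (G1 x * G2 x))" "integrable lborel (\<lambda>x. gw x * (DG1 x \<bullet> DG2 x))"
 "integrable lborel (\<lambda>x. gw x * (G1 x * e2 x i))" "integrable lborel (\<lambda>x. gw x * (DG1 x $ i * DG2 x $ i))"
 "integrable lborel (\<lambda>x. gw x * (x $ i * (G1 x * DG2 x $ i)))" "integrable lborel (\<lambda>x. gw x * (G1 x * DG2 x $ i))"
proof -
 have xi: "(\<lambda>x::real^'m. x $ i) \<in> borel_measurable borel" by (intro borel_measurable_continuous_onI continuous_intros)
 note m = borel_measurable_times borel_measurable_inner one.meas two.meas measDi xi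
 show "integrable lborel (\<lambda>x. gw x * (G1 x * G2 x))" by (rule integrable_gw_poly[OF _ bounds(1)]) (intro m)
 show "integrable lborel (\<lambda>x. gw x * (DG1 x \<bullet> DG2 x))" by (rule integrable_gw_poly[OF _ bounds(2)]) (intro m)
 show "integrable lborel (\<lambda>x. gw x * (G1 x * e2 x i))" by (rule integrable_gw_poly[OF _ bounds(3)]) (intro m)
 show "integrable lborel (\<lambda>x. gw x * (DG1 x $ i * DG2 x $ i))" by (rule integrable_gw_poly[OF _ bounds(4)]) (intro m)
 show "integrable lborel (\<lambda>x. gw x * (x $ i * (G1 x * DG2 x $ i)))" by (rule integrable_gw_poly[OF _ bounds(5)]) (intro m)
 show "integrable lborel (\<lambda>x. gw x * (G1 x * DG2 x $ i))" by (rule integrable_gw_poly[OF _ bounds(6)]) (intro m)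
qed

lemma ibp_direction:
 assumes i: "i \<noteq> j"
 shows "(LBINT x. gw x * (DG1 x $ i * DG2 x $ i)) + (LBINT x. gw x * (G1 x * e2 x i))
  = (LBINT x. gw x * (x $ i * (G1 x * DG2 x $ i)))"
proof -
 let ?F' = "\<lambda>x. gw x * (DG1 x $ i * DG2 x $ i) + gw x * (G1 x * e2 x i) - gw x * (x $ i * (G1 x * DG2 x $ i))"
 let ?K = "LBINT y. exp (- ((y::real^'m) \<bullet> y) / 2)"
 have "(LBINT x. ?F' x) = 0"
 proof (rule gauss_directional_deriv[where e = "axis i 1" and F = "\<lambda>x. gw x * (G1 x * DG2 x $ i)"])
  show "integrable lborel (\<lambda>x. gw x * (G1 x * DG2 x $ i))" by (rule ints)
  show "?F' \<in> borel_measurable borel"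
   using borel_measurable_integrable[OF Bochner_Integration.integrable_diff[OF Bochner_Integration.integrable_add[OF ints(4) ints(3)] ints(5)]] by simp
  show "AE x in lborel. \<forall>t. DERIV (\<lambda>s. gw (x + s *\<^sub>R axis i 1) * (G1 (x + s *\<^sub>R axis i 1) * DG2 (x + s *\<^sub>R axis i 1) $ i)) t :> ?F' (x + t *\<^sub>R axis i 1)"
   using AE_hor_line[OF one.N, of j i]
  proof eventually_elim
   case (elim x)
   show ?case
   proof
    fix t
    let ?y = "x + t *\<^sub>R axis i 1"
    have y: "hor j ?y \<noteq> 0" using elim by blast
    have "DERIV (\<lambda>s. gw (?y + s *\<^sub>R axis i 1) * (G1 (?y + s *\<^sub>R axis i 1) * DG2 (?y + s *\<^sub>R axis i 1) $ i)) 0 :> ?F' ?y"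
     by (rule DERIV_cong[OF DERIV_mult[OF DERIV_gw_line DERIV_mult[OF one.DERIV_lines[OF y i] two.der2[OF y i]]]]) (simp add: algebra_simps)
    then have "DERIV (\<lambda>s. gw (?y + (s + - t) *\<^sub>R axis i 1) * (G1 (?y + (s + - t) *\<^sub>R axis i 1) * DG2 (?y + (s + - t) *\<^sub>R axis i 1) $ i)) t :> ?F' ?y"
     using DERIV_shift[of "\<lambda>s. gw (?y + s *\<^sub>R axis i 1) * (G1 (?y + s *\<^sub>R axis i 1) * DG2 (?y + s *\<^sub>R axis i 1) $ i)" "?F' ?y" t "- t"] by simp
    moreover have "?y + (s + - t) *\<^sub>R axis i 1 = x + s *\<^sub>R axis i 1" for s by (simp add: algebra_simps)
    ultimately show "DERIV (\<lambda>s. gw (x + s *\<^sub>R axis i 1) * (G1 (x + s *\<^sub>R axis i 1) * DG2 (x + s *\<^sub>R axis i 1) $ i)) t :> ?F' ?y" by (simp only:)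
   qed
  qed
  show "\<bar>?F' x\<bar> \<le> (3 * (C1 * C2) / ?K) * ((1 + x \<bullet> x)\<^sup>2 * exp (- (x \<bullet> x) / 2))" for x
  proof -
   have "\<bar>DG1 x $ i * DG2 x $ i + G1 x * e2 x i - x $ i * (G1 x * DG2 x $ i)\<bar> \<le> 3 * (C1 * C2 * (1 + x \<bullet> x)\<^sup>2)"
    using bounds(3,4,5)[where i = i and x = x] by linarith
   then have "gw x * \<bar>DG1 x $ i * DG2 x $ i + G1 x * e2 x i - x $ i * (G1 x * DG2 x $ i)\<bar> \<le> gw x * (3 * (C1 * C2 * (1 + x \<bullet> x)\<^sup>2))"
    by (intro mult_left_mono less_imp_le[OF gw_pos])
   moreover have "\<bar>?F' x\<bar> = gw x * \<bar>DG1 x $ i * DG2 x $ i + G1 x * e2 x i - x $ i * (G1 x * DG2 x $ i)\<bar>"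
    unfolding distrib_left[symmetric] right_diff_distrib[symmetric] abs_mult[of "gw x"] using gw_pos[of x] by simp
   ultimately show ?thesis by (simp add: gw_def mult_ac)
  qed
 qed
 then show ?thesis
  using Bochner_Integration.integral_diff[OF Bochner_Integration.integrable_add[OF ints(4) ints(3)] ints(5), of i]
   Bochner_Integration.integral_add[OF ints(4) ints(3), of i i] by simp
qed

text \<open>Summing the Gaussian integrations by parts over the horizontal directions produces the
  drift term \<open>x \<bullet> DG2 x\<close>, which is \<open>G2 x\<close> by Euler's relation. The
  right side of the second formula is symmetric in the two functions; this becomes the symmetry of B
  on slices.\<close>

lemma slice_ibp:
 "integrable lborel (\<lambda>x. gw x * (G1 x * (\<Sum>i\<in>UNIV - {j}. e2 x i)))"
 "(LBINT x. gw x * (G1 x * (\<Sum>i\<in>UNIV - {j}. e2 x i))) =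
  (LBINT x. gw x * (G1 x * G2 x)) - (LBINT x. gw x * (DG1 x \<bullet> DG2 x))"
proof -
 have s: "gw x * (G1 x * (\<Sum>i\<in>UNIV - {j}. e2 x i)) = (\<Sum>i\<in>UNIV - {j}. gw x * (G1 x * e2 x i))" for x
  by (simp add: sum_distrib_left)
 show "integrable lborel (\<lambda>x. gw x * (G1 x * (\<Sum>i\<in>UNIV - {j}. e2 x i)))"
  unfolding s by (intro Bochner_Integration.integrable_sum ints)
 have split: "sum f UNIV = sum f (UNIV - {j})" if "f j = 0" for f :: "'m \<Rightarrow> real" using sum.remove[of UNIV j f] that by simp
 have d: "gw x * (DG1 x \<bullet> DG2 x) = (\<Sum>i\<in>UNIV - {j}. gw x * (DG1 x $ i * DG2 x $ i))" for x
  unfolding inner_vec_def using split[of "\<lambda>i. DG1 x $ i * DG2 x $ i"] two.DGj[of x] by (simp add: sum_distrib_left)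
 have g: "gw x * (G1 x * G2 x) = (\<Sum>i\<in>UNIV - {j}. gw x * (x $ i * (G1 x * DG2 x $ i)))" for x
 proof -
  have "G2 x = (\<Sum>i\<in>UNIV - {j}. x $ i * DG2 x $ i)"
   unfolding two.euler[symmetric, of x] inner_vec_def using split[of "\<lambda>i. x $ i * DG2 x $ i"] two.DGj[of x] by simp
  then show ?thesis by (simp add: sum_distrib_left mult_ac)
 qed
 have "(\<Sum>i\<in>UNIV - {j}. (LBINT x. gw x * (DG1 x $ i * DG2 x $ i)) + (LBINT x. gw x * (G1 x * e2 x i)))
   = (\<Sum>i\<in>UNIV - {j}. LBINT x. gw x * (x $ i * (G1 x * DG2 x $ i)))" by (rule sum.cong[OF refl]) (simp add: ibp_direction)
 then show "(LBINT x. gw x * (G1 x * (\<Sum>i\<in>UNIV - {j}. e2 x i))) =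
  (LBINT x. gw x * (G1 x * G2 x)) - (LBINT x. gw x * (DG1 x \<bullet> DG2 x))"
  unfolding s d g by (simp add: Bochner_Integration.integral_sum ints sum.distrib)
qed

end

section \<open>The radial function and the Poincare inequality on slices\<close>

lemma has_derivative_norm_hor:
 assumes "hor j x \<noteq> 0"
 shows "((\<lambda>x. norm (hor j x)) has_derivative (\<lambda>v. sgn (hor j x) \<bullet> v)) (at x)"
proof -
 have "(hor j has_derivative hor j) (at x)" by (rule bounded_linear_imp_has_derivative[OF bounded_linear_hor])
 from has_derivative_compose[OF this has_derivative_norm[OF assms]] show ?thesis
  by (simp add: hor_inner(1) hor_sgn(3) inner_commute)
qed

lemma DERIV_norm_hor_line:
 assumes "hor j x \<noteq> 0"
 shows "DERIV (\<lambda>s. norm (hor j (x + s *\<^sub>R axis i 1))) 0 :> sgn (hor j x) $ i"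
 using DERIV_along_line[OF has_derivative_norm_hor[OF assms], of "axis i 1"] by (simp add: inner_axis)

lemma DERIV_sgn_hor_line:
 assumes x: "hor j x \<noteq> 0" and i: "i \<noteq> j"
 shows "DERIV (\<lambda>s. sgn (hor j (x + s *\<^sub>R axis i 1)) $ i) 0 :> (1 - (sgn (hor j x) $ i)\<^sup>2) / norm (hor j x)"
proof -
 have r: "norm (hor j x) \<noteq> 0" using x by simp
 have "DERIV (\<lambda>s. (x $ i + s) / norm (hor j (x + s *\<^sub>R axis i 1))) 0 :> (1 * norm (hor j (x + 0 *\<^sub>R axis i 1)) - (x $ i + 0) * sgn (hor j x) $ i) / (norm (hor j (x + 0 *\<^sub>R axis i 1)) * norm (hor j (x + 0 *\<^sub>R axis i 1)))"
  by (rule DERIV_divide[OF _ DERIV_norm_hor_line[OF x]]) (use r in \<open>auto intro!: derivative_eq_intros\<close>)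
 moreover have "sgn (hor j (x + s *\<^sub>R axis i 1)) $ i = (x $ i + s) / norm (hor j (x + s *\<^sub>R axis i 1))" for s
  using i by (simp add: sgn_div_norm hor_nth axis_nth_if divide_inverse mult.commute)
 moreover have u: "sgn (hor j x) $ i = x $ i / norm (hor j x)" using i by (simp add: sgn_div_norm hor_nth divide_inverse mult.commute)
 ultimately have "DERIV (\<lambda>s. sgn (hor j (x + s *\<^sub>R axis i 1)) $ i) 0 :> (norm (hor j x) - x $ i * (x $ i / norm (hor j x))) / (norm (hor j x) * norm (hor j x))" by simp
 moreover have "(norm (hor j x) - x $ i * (x $ i / norm (hor j x))) / (norm (hor j x) * norm (hor j x)) = (1 - (x $ i / norm (hor j x))\<^sup>2) / norm (hor j x)"
  using r by (simp add: field_simps power2_eq_square)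
 ultimately show ?thesis unfolding u by simp
qed

lemma hor_hor: "hor j (hor j x) = hor j x" by (simp add: vec_eq_iff hor_nth)

lemma inner_sgn_hor: "x \<bullet> sgn (hor j x) = norm (hor j x)"
proof (cases "hor j x = 0")
 case False
 have "x \<bullet> sgn (hor j x) = hor j x \<bullet> hor j x / norm (hor j x)"
  by (simp add: sgn_div_norm hor_inner(1)[of j x "hor j x"] hor_hor divide_inverse mult.commute)
 then show ?thesis using False by (simp flip: power2_norm_eq_inner add: power2_eq_square)
qed simp

lemma continuous_sgn_hor: "continuous_on {x. hor j x \<noteq> 0} (\<lambda>x. sgn (hor j x))" by (intro continuous_on_sgn continuous_hor) simp

abbreviation rad_e :: "'m::finite \<Rightarrow> real^'m \<Rightarrow> 'm \<Rightarrow> real" where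
 "rad_e j \<equiv> \<lambda>x i. if hor j x = 0 then 0 else (1 - (sgn (hor j x) $ i)\<^sup>2) / norm (hor j x)"

text \<open>The radius is the one-homogeneous extension of the constant 1 on the horizontal sphere,
  the function that is subtracted later to make a mean vanish.\<close>

lemma rad_slice:
 assumes "3 \<le> CARD('m::finite)"
 shows "slice_fun (j::'m) (\<lambda>x. norm (hor j x)) (\<lambda>x. sgn (hor j x))
  (rad_e j) 1"
proof
 show "continuous_on {x. hor j x \<noteq> 0} (\<lambda>x. if hor j x = 0 then 0 else (1 - (sgn (hor j x) $ i)\<^sup>2) / norm (hor j x))" for i
  by (rule continuous_on_eq[where f = "\<lambda>x. (1 - (sgn (hor j x) $ i)\<^sup>2) / norm (hor j x)"])
    (auto intro!: continuous_intros continuous_sgn_hor continuous_hor)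
 show "\<bar>if hor j x = 0 then 0 else (1 - (sgn (hor j x) $ i)\<^sup>2) / norm (hor j x)\<bar> * norm (hor j x) \<le> 1" for x i
 proof (cases "hor j x = 0")
  case False
  have "\<bar>sgn (hor j x) $ i\<bar> \<le> 1" using component_le_norm_cart[of "sgn (hor j x)" i] hor_sgn(2)[OF False] by simp
  then have "(sgn (hor j x) $ i)\<^sup>2 \<le> 1" by (simp add: abs_square_le_1)
  moreover have "0 \<le> (sgn (hor j x) $ i)\<^sup>2" by simp
  ultimately have "\<bar>1 - (sgn (hor j x) $ i)\<^sup>2\<bar> \<le> 1" by linarith
  then show ?thesis using False by simp
 qed simp
 show "continuous_on {x. hor j x \<noteq> 0} (\<lambda>x. norm (hor j x))" by (intro continuous_intros continuous_hor)
 show "DERIV (\<lambda>s. sgn (hor j (x + s *\<^sub>R axis i 1)) $ i) 0 :> (if hor j x = 0 then 0 else (1 - (sgn (hor j x) $ i)\<^sup>2) / norm (hor j x))"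
  if "hor j x \<noteq> 0" "i \<noteq> j" for x i using DERIV_sgn_hor_line[OF that] that by simp
qed (use assms in \<open>simp_all add: hor_sgn inner_sgn_hor norm_sgn continuous_sgn_hor has_derivative_norm_hor\<close>)

lemma sum_sgn_hor:
 assumes "hor (j::'m::finite) x \<noteq> 0"
 shows "(\<Sum>i\<in>UNIV - {j}. (sgn (hor j x) $ i)\<^sup>2) = 1"
proof -
 have "(\<Sum>i\<in>UNIV. (sgn (hor j x) $ i)\<^sup>2) = (norm (sgn (hor j x)))\<^sup>2" by (simp add: norm_vec_def L2_set_def sum_nonneg)
 also have "\<dots> = 1" using hor_sgn(2)[OF assms] by simp
 finally show ?thesis using sum.remove[of UNIV j "\<lambda>i. (sgn (hor j x) $ i)\<^sup>2"] by (simp add: hor_sgn)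
qed

context slice_fun
begin

text \<open>Pair \<open>G\<close> with the radius r, whose horizontal Laplacian is (N - 2) / r with
  N = \<open>CARD('m)\<close>; Euler's relation turns the product of the gradients into G / r. The
  mixed moments in the Poincare inequality thus reduce to the mean of G / r.\<close>

lemma with_rad:
 shows "(LBINT x. gw x * (G x * norm (hor j x))) = (real CARD('m) - 1) * (LBINT x. gw x * (G x / norm (hor j x)))"
  and "integrable lborel (\<lambda>x. gw x * (G x * norm (hor j x)))"
  and "(LBINT x. gw x * (DG x \<bullet> sgn (hor j x))) = (LBINT x. gw x * (G x / norm (hor j x)))"
  and "integrable lborel (\<lambda>x. gw x * (DG x \<bullet> sgn (hor j x)))"
proof -
 interpret r: slice_fun j "\<lambda>x. norm (hor j x)" "\<lambda>x. sgn (hor j x)" "rad_e j" 1 by (rule rad_slice[OF N])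
 interpret t: two_slice_fun j G DG e C "\<lambda>x. norm (hor j x)" "\<lambda>x. sgn (hor j x)" "rad_e j" 1 ..
 show i: "integrable lborel (\<lambda>x. gw x * (G x * norm (hor j x)))" "integrable lborel (\<lambda>x. gw x * (DG x \<bullet> sgn (hor j x)))"
  using t.ints(1,2) .
 have "DG x \<bullet> sgn (hor j x) = G x / norm (hor j x)" for x
 proof -
  have "hor j x \<bullet> DG x = x \<bullet> DG x" using DGj[of x] by (simp add: hor_def inner_diff_left inner_axis')
  then show ?thesis using euler[of x] by (simp add: sgn_div_norm inner_commute divide_inverse mult.commute)
 qed
 then show d: "(LBINT x. gw x * (DG x \<bullet> sgn (hor j x))) = (LBINT x. gw x * (G x / norm (hor j x)))" by simp
 have "G x * (\<Sum>i\<in>UNIV - {j}. if hor j x = 0 then 0 else (1 - (sgn (hor j x) $ i)\<^sup>2) / norm (hor j x)) = (real CARD('m) - 2) * (G x / norm (hor j x))" for x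
 proof (cases "hor j x = 0")
  case False
  have "(\<Sum>i\<in>UNIV - {j}. (1 - (sgn (hor j x) $ i)\<^sup>2) / norm (hor j x)) = (real (CARD('m) - 1) - 1) / norm (hor j x)"
   unfolding sum_divide_distrib[symmetric] sum_subtractf sum_sgn_hor[OF False] by simp
  moreover have "real (CARD('m) - 1) - 1 = real CARD('m) - 2" using N by simp
  ultimately show ?thesis using False by simp
 qed (simp add: off)
 then have "(LBINT x. gw x * ((real CARD('m) - 2) * (G x / norm (hor j x)))) = (LBINT x. gw x * (G x * norm (hor j x))) - (LBINT x. gw x * (G x / norm (hor j x)))"
  using t.slice_ibp(2) d by simp
 moreover have "(LBINT x. gw x * ((real CARD('m) - 2) * (G x / norm (hor j x)))) = (real CARD('m) - 2) * (LBINT x. gw x * (G x / norm (hor j x)))"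
  unfolding mult.left_commute[of "gw _"] by (rule integral_mult_right_zero)
 ultimately show "(LBINT x. gw x * (G x * norm (hor j x))) = (real CARD('m) - 1) * (LBINT x. gw x * (G x / norm (hor j x)))"
  by (simp add: algebra_simps)
qed

text \<open>Poincare's inequality is applied to \<open>G - \<mu> r\<close>, where \<open>\<mu>\<close> makes the mean vanish.\<close>
lemma slice_poincare:
 "(LBINT x. gw x * (G x * (\<Sum>i\<in>UNIV - {j}. e x i))) \<le> (real CARD('m) - 2) * (LBINT x. gw x * (G x / norm (hor j x)))\<^sup>2"
proof -
 interpret r: slice_fun j "\<lambda>x. norm (hor j x)" "\<lambda>x. sgn (hor j x)" "rad_e j" 1 by (rule rad_slice[OF N])
 interpret rr: two_slice_fun j "\<lambda>x. norm (hor j x)" "\<lambda>x. sgn (hor j x)" "rad_e j" 1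
   "\<lambda>x. norm (hor j x)" "\<lambda>x. sgn (hor j x)" "rad_e j" 1 ..
 interpret s: two_slice_fun j G DG e C G DG e C ..
 let ?r = "\<lambda>x. norm (hor j x)" and ?u = "\<lambda>x. sgn (hor j x)" and ?n = "real CARD('m) - 1"
 let ?m = "LBINT x. gw x * (G x / ?r x)"
 have one: "(LBINT x. gw x * (?r x / ?r x)) = 1"
 proof -
  have "(LBINT x. gw x * (?r x / ?r x)) = (LBINT x. gw (x::real^'m))"
  proof (rule integral_cong_AE)
   show "(\<lambda>x. gw x * (?r x / ?r x)) \<in> borel_measurable lborel"
    unfolding measurable_lborel2 by (intro borel_measurable_times borel_measurable_divide borel_measurable_gw r.meas(1))
   show "AE x in lborel. gw x * (?r x / ?r x) = gw x" using AE_hor[OF N, of j] by eventually_elim simp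
  qed simp
  then show ?thesis by (simp add: integral_gw)
 qed
 have Er2: "(LBINT x. gw x * (?r x * ?r x)) = ?n" "(LBINT x. gw x * (?u x \<bullet> ?u x)) = 1" using r.with_rad(1,3) one by simp_all
 have b1: "\<bar>y\<bar> \<le> K * (1 + x \<bullet> x)\<^sup>2" if "\<bar>y\<bar> \<le> K * norm (hor j x)" "0 \<le> K" for y K and x :: "real^'m"
 proof -
  have "0 \<le> (norm x - 1)\<^sup>2" by simp
  then have "2 * norm x \<le> 1 + x \<bullet> x" by (simp add: power2_diff power2_norm_eq_inner)
  then have "norm (hor j x) \<le> 1 + x \<bullet> x" using norm_hor_le[of j x] norm_ge_zero[of x] by linarith
  also have "\<dots> \<le> (1 + x \<bullet> x)\<^sup>2" using self_le_power[of "1 + x \<bullet> x" 2] by simp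
  finally show ?thesis using that mult_left_mono order_trans by blast
 qed
 have iG: "integrable lborel (\<lambda>x. gw x * G x)" by (rule integrable_gw_poly[OF meas(1) b1[OF bG C]])
 have ir: "integrable lborel (\<lambda>x. gw x * ?r x)" by (rule integrable_gw_poly[OF r.meas(1) b1[OF r.bG]]) simp
 have r_pos: "(LBINT x. gw x * ?r x) \<noteq> 0"
 proof
  assume "(LBINT x. gw x * ?r x) = 0"
  moreover have "AE x in lborel. 0 \<le> gw x * ?r x" by (intro AE_I2 mult_nonneg_nonneg less_imp_le[OF gw_pos] norm_ge_zero)
  ultimately have "AE x in lborel. gw x * ?r x = 0" using integral_nonneg_eq_0_iff_AE[OF ir] by blast
  then have ae: "AE x in lborel. x \<in> UNIV \<longrightarrow> gw x * ?r x = 0" by simp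
  obtain l where l: "l \<noteq> j" using obtain_third_index[OF N] by metis
  have "gw (axis l 1 :: real^'m) * ?r (axis l 1) = 0"
   using AE_zero_continuous[OF open_UNIV _ ae, of "axis l 1"] by (simp add: continuous_intros continuous_gw continuous_hor)
  then show False using gw_pos[of "axis l 1 :: real^'m"] l by (simp add: hor_axis norm_axis_1)
 qed
 define \<mu> where "\<mu> = (LBINT x. gw x * G x) / (LBINT x. gw x * ?r x)"
 let ?F = "\<lambda>x. G x - \<mu> * ?r x" and ?DF = "\<lambda>x. DG x - \<mu> *\<^sub>R ?u x"
 have "(LBINT x. gw x * (?F x)\<^sup>2) \<le> (LBINT x. gw x * (?DF x \<bullet> ?DF x))"
 proof (rule gaussian_poincare[where S = "{x. hor j x \<noteq> 0}" and C = "C + \<bar>\<mu>\<bar>"])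
  show "?F \<in> borel_measurable borel" using meas(1) r.meas(1) by simp
  show "?DF \<in> borel_measurable borel" using meas(2) r.meas(2) by simp
  show "\<bar>?F x\<bar> \<le> (C + \<bar>\<mu>\<bar>) * (1 + norm x)" for x
  proof -
   have "\<bar>?F x\<bar> \<le> (C + \<bar>\<mu>\<bar>) * norm (hor j x)" using bG[of x] abs_triangle_ineq4[of "G x" "\<mu> * ?r x"] by (simp add: abs_mult distrib_right)
   also have "\<dots> \<le> (C + \<bar>\<mu>\<bar>) * (1 + norm x)" using C norm_hor_le[of j x] by (intro mult_left_mono) auto
   finally show ?thesis .
  qed
  show "norm (?DF x) \<le> C + \<bar>\<mu>\<bar>" for x
  proof -
   have "norm (\<mu> *\<^sub>R ?u x) \<le> \<bar>\<mu>\<bar>" by (simp add: norm_sgn)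
   then show ?thesis using norm_triangle_ineq4[of "DG x" "\<mu> *\<^sub>R ?u x"] bD[of x] by linarith
  qed
  show "(?F has_derivative (\<lambda>v. ?DF x \<bullet> v)) (at x)" if "x \<in> {x. hor j x \<noteq> 0}" for x
   using has_derivative_diff[OF der has_derivative_mult_right[OF has_derivative_norm_hor, of j x \<mu>]] that
   by (simp add: inner_diff_left)
  show "AE z in lborel. \<forall>t. cos t *\<^sub>R fst z + sin t *\<^sub>R snd z \<in> {x. hor j x \<noteq> 0}" using AE_hor_rotation[OF N, of j] by simp
  show "AE z in lborel. \<forall>s. cos t *\<^sub>R fst z - sin t *\<^sub>R (snd z + s *\<^sub>R b) \<in> {x. hor j x \<noteq> 0}"
   if "sin t \<noteq> 0" "b \<in> Basis" for t and b :: "real^'m" using AE_hor_rotation_line[OF N that, of j] by simp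
  have "(LBINT x. gw x * ?F x) = (LBINT x. gw x * G x - \<mu> * (gw x * ?r x))" by (simp add: right_diff_distrib mult_ac)
  also have "\<dots> = (LBINT x. gw x * G x) - \<mu> * (LBINT x. gw x * ?r x)"
   using iG ir by (subst Bochner_Integration.integral_diff) auto
  finally show "(LBINT x. gw x * ?F x) = 0" using r_pos by (simp add: \<mu>_def)
 qed
 moreover have "(LBINT x. gw x * (?F x)\<^sup>2) = (LBINT x. gw x * (G x * G x)) - 2 * \<mu> * (?n * ?m) + \<mu>\<^sup>2 * ?n"
 proof -
  have "gw x * (?F x)\<^sup>2 = gw x * (G x * G x) - (2 * \<mu>) * (gw x * (G x * ?r x)) + \<mu>\<^sup>2 * (gw x * (?r x * ?r x))" for x
   by (simp add: power2_eq_square algebra_simps)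
  then show ?thesis using s.ints(1) with_rad(1,2) rr.ints(1) Er2(1) by simp
 qed
 moreover have "(LBINT x. gw x * (?DF x \<bullet> ?DF x)) = (LBINT x. gw x * (DG x \<bullet> DG x)) - 2 * \<mu> * ?m + \<mu>\<^sup>2"
 proof -
  have "gw x * (?DF x \<bullet> ?DF x) = gw x * (DG x \<bullet> DG x) - (2 * \<mu>) * (gw x * (DG x \<bullet> ?u x)) + \<mu>\<^sup>2 * (gw x * (?u x \<bullet> ?u x))" for x
   by (simp add: inner_diff_left inner_diff_right inner_commute[of "?u x" "DG x"] power2_eq_square algebra_simps)
  then show ?thesis using s.ints(2) with_rad(3,4) rr.ints(2) Er2(2) by simp
 qed
 \<comment> \<open>The coefficients combine because r^2 has mean N - 1 and the squared gradient of r
   has mean 1. Whatever \<mu> is, 2 \<mu> m - \<mu>^2 is at most m^2.\<close>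
 ultimately have "(LBINT x. gw x * (G x * G x)) - (LBINT x. gw x * (DG x \<bullet> DG x)) \<le> (real CARD('m) - 2) * (2 * \<mu> * ?m - \<mu>\<^sup>2)"
  by (simp add: algebra_simps)
 also have "\<dots> \<le> (real CARD('m) - 2) * ?m\<^sup>2"
 proof (intro mult_left_mono)
  have "0 \<le> (\<mu> - ?m)\<^sup>2" by simp
  then show "2 * \<mu> * ?m - \<mu>\<^sup>2 \<le> ?m\<^sup>2" unfolding power2_diff by linarith
 qed (use N in simp)
 finally show ?thesis using s.slice_ibp(2) by simp
qed

end

text \<open>Points of slope c over a horizontal unit vector have norm sqrt (1 + c^2), so the
  conclusion is the cone condition for them. The proof squares, which requires distinguishing the
  signs of cos \<theta> and c.\<close>

lemma slice_angle:
 fixes \<theta> c :: real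
 assumes "0 < \<theta>" "\<theta> < pi" "cot \<theta> \<le> c"
 shows "cos \<theta> * sqrt (1 + c\<^sup>2) \<le> c"
proof -
 have s: "0 < sin \<theta>" by (rule sin_gt_zero[OF assms(1,2)])
 have cs: "cos \<theta> \<le> c * sin \<theta>" using assms(3) s by (simp add: cot_def divide_le_eq)
 have sc: "(sin \<theta>)\<^sup>2 = 1 - (cos \<theta>)\<^sup>2" by (rule sin_squared_eq)
 have e: "(cos \<theta>)\<^sup>2 * (1 + c\<^sup>2) - c\<^sup>2 = (cos \<theta>)\<^sup>2 - (c * sin \<theta>)\<^sup>2" by (simp add: power_mult_distrib sc algebra_simps)
 show ?thesis
 proof (cases "0 \<le> cos \<theta>")
  case True
  then have c: "0 \<le> c" using cs s by (metis order_trans zero_le_mult_iff not_less)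
  have "(cos \<theta> * sqrt (1 + c\<^sup>2))\<^sup>2 \<le> c\<^sup>2" using e power_mono[OF cs True, of 2] by (simp add: power_mult_distrib)
  then show ?thesis using c by (rule power2_le_imp_le)
 next
  case False
  show ?thesis
  proof (cases "0 \<le> c")
   case True
   have "cos \<theta> * sqrt (1 + c\<^sup>2) \<le> 0" using False by (intro mult_nonpos_nonneg) auto
   then show ?thesis using True by simp
  next
   case c: False
   have "c * sin \<theta> \<le> 0" using c s by (intro mult_nonpos_nonneg) auto
   then have "(- (c * sin \<theta>))\<^sup>2 \<le> (- cos \<theta>)\<^sup>2" using cs by (intro power_mono) auto
   then have "(- c)\<^sup>2 \<le> (- cos \<theta> * sqrt (1 + c\<^sup>2))\<^sup>2" using e by (simp add: power_mult_distrib)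
   moreover have "0 \<le> - cos \<theta> * sqrt (1 + c\<^sup>2)" using False by (intro mult_nonneg_nonneg) auto
   ultimately have "- c \<le> - cos \<theta> * sqrt (1 + c\<^sup>2)" by (rule power2_le_imp_le)
   then show ?thesis by simp
  qed
 qed
qed

section \<open>Restriction of a homogeneous function to slices of fixed slope\<close>

definition hsph :: "'m::finite \<Rightarrow> (real^'m) set" where
 "hsph j = {u. u $ j = 0 \<and> norm u = 1}"

lemma norm_slice: "u \<in> hsph j \<Longrightarrow> norm (u + c *\<^sub>R axis j 1) = sqrt (1 + c\<^sup>2)" unfolding norm_eq_sqrt_inner hsph_def
 by (auto simp: inner_add_left inner_add_right inner_axis inner_axis' power2_eq_square norm_eq_1)

lemma slice_nth: "u \<in> hsph j \<Longrightarrow> (u + c *\<^sub>R axis j 1) $ j = c" by (simp add: hsph_def)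

lemma slice_cone:
 assumes "0 < \<theta>" "\<theta> < pi" "cot \<theta> \<le> c" "u \<in> hsph j"
 shows "u + c *\<^sub>R axis j 1 \<in> cone j \<theta>"
proof -
 have n: "norm (u + c *\<^sub>R axis j 1) = sqrt (1 + c\<^sup>2)" by (rule norm_slice[OF assms(4)])
 moreover have "0 < 1 + c\<^sup>2" by (rule add_pos_nonneg) auto
 ultimately have "u + c *\<^sub>R axis j 1 \<noteq> 0" by (metis norm_zero real_sqrt_gt_zero less_irrefl)
 then show ?thesis unfolding cone_def using slice_angle[OF assms(1-3)] n slice_nth[OF assms(4), of c] by simp
qed

lemma slice_boundary:
 assumes "0 < \<theta>" "\<theta> < pi" "u \<in> hsph j"
 shows "(u + cot \<theta> *\<^sub>R axis j 1) $ j = cos \<theta> * norm (u + cot \<theta> *\<^sub>R axis j 1)"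
proof -
 have s: "0 < sin \<theta>" by (rule sin_gt_zero[OF assms(1,2)])
 have "1 + (cot \<theta>)\<^sup>2 = (1 / sin \<theta>)\<^sup>2" using s sin_cos_squared_add[of \<theta>] by (simp add: cot_def power_divide field_simps)
 then have "sqrt (1 + (cot \<theta>)\<^sup>2) = 1 / sin \<theta>" using s by simp
 then show ?thesis unfolding norm_slice[OF assms(3)] slice_nth[OF assms(3)] by (simp add: cot_def)
qed

lemma hsph_sgn: "hor j x \<noteq> 0 \<Longrightarrow> sgn (hor j x) \<in> hsph j" by (simp add: hsph_def hor_sgn)

context cap_ext
begin

text \<open>Parametrises the slice of slope c by its horizontal part. Composing \<open>H\<close>
  with it gives a one-homogeneous function of the horizontal variables, an instance of
  \<open>slice_fun\<close>.\<close>

definition sl_q :: "real \<Rightarrow> real^'m \<Rightarrow> real^'m" where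
 "sl_q c x = hor j x + (c * norm (hor j x)) *\<^sub>R axis j 1"

definition sl_G :: "real \<Rightarrow> real^'m \<Rightarrow> real" where
 "sl_G c x = (if hor j x = 0 then 0 else H (sl_q c x))"

definition sl_DG :: "real \<Rightarrow> real^'m \<Rightarrow> real^'m" where
 "sl_DG c x = (if hor j x = 0 then 0 else hor j (g (sl_q c x)) + (c * g (sl_q c x) $ j) *\<^sub>R sgn (hor j x))"

definition sl_e :: "real \<Rightarrow> real^'m \<Rightarrow> 'm \<Rightarrow> real" where
 "sl_e c x i = (if hor j x = 0 then 0 else
   A (sl_q c x) $ i $ i + 2 * c * sgn (hor j x) $ i * A (sl_q c x) $ i $ j
   + (c * sgn (hor j x) $ i)\<^sup>2 * A (sl_q c x) $ j $ j
   + c * ((1 - (sgn (hor j x) $ i)\<^sup>2) / norm (hor j x)) * g (sl_q c x) $ j)"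

text \<open>The horizontal Laplacian of the slice function at a horizontal unit vector u. The chain
  rule also produces mixed entries of the Hessian; since the Hessian annihilates its base point
  \<open>u + c *\<^sub>R axis j 1\<close>, these are expressed by the entry at j, j.\<close>

definition lap :: "real \<Rightarrow> real^'m \<Rightarrow> real" where
 "lap c u = trace (A (u + c *\<^sub>R axis j 1)) - (1 + c\<^sup>2) * A (u + c *\<^sub>R axis j 1) $ j $ j
   + (real CARD('m) - 2) * c * g (u + c *\<^sub>R axis j 1) $ j"

lemma sl_q_scale:
 assumes "hor j x \<noteq> 0"
 shows "sl_q c x = norm (hor j x) *\<^sub>R (sgn (hor j x) + c *\<^sub>R axis j 1)"
 using assms by (simp add: sl_q_def sgn_div_norm scaleR_add_right mult.commute)

lemma cone_scale: "x \<in> cone j \<theta> \<Longrightarrow> 0 < t \<Longrightarrow> t *\<^sub>R x \<in> cone j \<theta>" by (simp add: cone_def)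

lemma sl_V:
 assumes c: "cot \<theta> \<le> c" and x: "hor j x \<noteq> 0"
 shows "sl_q c x \<in> cone j \<theta>" "sl_q c x \<in> V" "sgn (hor j x) + c *\<^sub>R axis j 1 \<in> V"
proof -
 have y: "sgn (hor j x) + c *\<^sub>R axis j 1 \<in> cone j \<theta>" by (rule slice_cone[OF \<theta> c hsph_sgn[OF x]])
 show "sl_q c x \<in> cone j \<theta>" unfolding sl_q_scale[OF x] by (rule cone_scale[OF y]) (use x in simp)
 then show "sl_q c x \<in> V" using coneD by simp
 show "sgn (hor j x) + c *\<^sub>R axis j 1 \<in> V" using y coneD by simp
qed

lemma sl_hom:
 assumes c: "cot \<theta> \<le> c" and x: "hor j x \<noteq> 0"
 shows "H (sl_q c x) = norm (hor j x) * H (sgn (hor j x) + c *\<^sub>R axis j 1)"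
  "g (sl_q c x) = g (sgn (hor j x) + c *\<^sub>R axis j 1)"
  "A (sl_q c x) = (1 / norm (hor j x)) *\<^sub>R A (sgn (hor j x) + c *\<^sub>R axis j 1)"
 unfolding sl_q_scale[OF x] using x homH[OF sl_V(3)[OF c x]] homg[OF sl_V(3)[OF c x]] homA[OF sl_V(3)[OF c x]] by simp_all

text \<open>\<open>g\<close> has degree 0 and \<open>A\<close> degree -1, so bounds on the compact
  set of unit vectors in the cone suffice.\<close>

lemma cone_bound: "\<exists>B\<ge>0. \<forall>x\<in>cone j \<theta>. norm (g x) \<le> B \<and> (\<forall>i l. \<bar>A x $ i $ l\<bar> * norm x \<le> B)"
proof -
 let ?K = "sphere 0 1 \<inter> {x. cos \<theta> * norm x \<le> x $ j}"
 have "closed {x::real^'m. cos \<theta> * norm x \<le> x $ j}" by (intro closed_Collect_le continuous_intros)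
 then have K: "compact ?K" by (intro compact_Int_closed) auto
 have KV: "?K \<subseteq> V" using coneV by (force simp: cone_def)
 obtain B1 where B1: "0 \<le> B1" "\<And>x. x \<in> ?K \<Longrightarrow> norm (g x) \<le> B1"
  using compact_image_bound[OF K continuous_on_subset[OF contg KV]] by blast
 obtain B2 where B2: "\<And>x. x \<in> ?K \<Longrightarrow> norm (A x) \<le> B2" using compact_image_bound[OF K continuous_on_subset[OF A KV]] by blast
 show ?thesis
 proof (intro exI[of _ "max B1 B2"] conjI ballI allI)
  fix x i l assume x: "x \<in> cone j \<theta>"
  have x0: "0 < norm x" using x by (simp add: cone_def)
  have s: "sgn x \<in> ?K" using x x0 by (auto simp: cone_def norm_sgn sgn_div_norm field_simps)
  then have sV: "sgn x \<in> V" using KV by blast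
  have xs: "x = norm x *\<^sub>R sgn x" using x0 by (simp add: sgn_div_norm)
  have "g x = g (sgn x)" by (subst xs) (rule homg[OF sV x0])
  then show "norm (g x) \<le> max B1 B2" using B1(2)[OF s] by simp
  have "A x = (1 / norm x) *\<^sub>R A (sgn x)" by (subst xs) (rule homA[OF sV x0])
  then have "\<bar>A x $ i $ l\<bar> * norm x = \<bar>A (sgn x) $ i $ l\<bar>" using x0 by (simp add: abs_mult)
  also have "\<dots> \<le> norm (A (sgn x) $ i)" by (rule component_le_norm_cart)
  also have "\<dots> \<le> norm (A (sgn x))" by (rule Finite_Cartesian_Product.norm_nth_le)
  finally show "\<bar>A x $ i $ l\<bar> * norm x \<le> max B1 B2" using B2[OF s] by simp
 qed (use B1 in simp)
qed

lemma sl_q_deriv: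
 assumes "hor j x \<noteq> 0"
 shows "(sl_q c has_derivative (\<lambda>v. hor j v + (c * (sgn (hor j x) \<bullet> v)) *\<^sub>R axis j 1)) (at x)"
proof -
 have "(hor j has_derivative hor j) (at x)" by (rule bounded_linear_imp_has_derivative[OF bounded_linear_hor])
 from has_derivative_add[OF this has_derivative_scaleR_left[OF has_derivative_mult_right[OF has_derivative_norm_hor[OF assms], of c], of "axis j 1"]]
 show ?thesis unfolding sl_q_def[abs_def] .
qed

lemma continuous_sl_q: "continuous_on S (sl_q c)" unfolding sl_q_def[abs_def] by (intro continuous_intros continuous_hor)

lemma sl_q_line:
 assumes "hor j x \<noteq> 0" "i \<noteq> j"
 shows "((\<lambda>s. sl_q c (x + s *\<^sub>R axis i 1)) has_derivative (\<lambda>s. s *\<^sub>R (axis i 1 + (c * sgn (hor j x) $ i) *\<^sub>R axis j 1))) (at 0)"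
proof -
 have "((\<lambda>s. x + s *\<^sub>R axis i 1) has_derivative (\<lambda>s. s *\<^sub>R axis i (1::real))) (at 0)" by (auto intro!: derivative_eq_intros)
 from has_derivative_compose[OF this, of "sl_q c" "\<lambda>v. hor j v + (c * (sgn (hor j x) \<bullet> v)) *\<^sub>R axis j 1"] sl_q_deriv[OF assms(1)] assms(2)
 show ?thesis by (simp add: hor_scaleR hor_axis inner_axis scaleR_add_right mult_ac)
qed

lemma DERIV_g_sl:
 assumes c: "cot \<theta> \<le> c" and x: "hor j x \<noteq> 0" and i: "i \<noteq> j"
 shows "DERIV (\<lambda>s. g (sl_q c (x + s *\<^sub>R axis i 1)) $ l) 0 :> A (sl_q c x) $ l $ i + c * sgn (hor j x) $ i * A (sl_q c x) $ l $ j"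
proof -
 have "(g has_derivative (\<lambda>v. A (sl_q c (x + 0 *\<^sub>R axis i 1)) *v v)) (at (sl_q c (x + 0 *\<^sub>R axis i 1)))"
  using g[OF sl_V(2)[OF c x]] by simp
 from bounded_linear.has_derivative[OF bounded_linear_vec_nth has_derivative_compose[OF sl_q_line[OF x i, of c] this], of l]
 show ?thesis by (intro has_derivative_mult_imp_DERIV)
    (simp add: matrix_vector_mult_scaleR matrix_vector_mult_basis column_def matrix_vector_right_distrib mult_ac)
qed

lemma sym_nth: "x \<in> V \<Longrightarrow> A x $ i $ l = A x $ l $ i" using arg_cong[OF sym[of x], of "\<lambda>M. M $ l $ i"] by (simp add: transpose_def)

lemma sl_slice:
 assumes c: "cot \<theta> \<le> c" and N: "3 \<le> CARD('m)"
 shows "\<exists>C. slice_fun j (sl_G c) (sl_DG c) (sl_e c) C"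
proof -
 obtain B where B: "0 \<le> B" "\<And>x. x \<in> cone j \<theta> \<Longrightarrow> norm (g x) \<le> B" "\<And>x i l. x \<in> cone j \<theta> \<Longrightarrow> \<bar>A x $ i $ l\<bar> * norm x \<le> B"
  using cone_bound by blast
 let ?C = "B * (1 + 3 * \<bar>c\<bar> + c\<^sup>2)" and ?S = "{x. hor j x \<noteq> 0}"
 have gj: "\<bar>g x $ l\<bar> \<le> B" if "x \<in> cone j \<theta>" for x l using component_le_norm_cart[of "g x" l] B(2)[OF that] by linarith
 have qV: "sl_q c ` ?S \<subseteq> V" using sl_V(2)[OF c] by blast
 have cq: "continuous_on ?S (\<lambda>x. f (sl_q c x))" if "continuous_on V f" for f :: "real^'m \<Rightarrow> 'b::topological_space"
  by (rule continuous_on_compose2[OF that continuous_sl_q qV])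
 have "slice_fun j (sl_G c) (sl_DG c) (sl_e c) ?C"
 proof
  show "continuous_on ?S (sl_G c)" by (rule continuous_on_eq[OF cq[OF contH]]) (simp add: sl_G_def)
  show "continuous_on ?S (sl_DG c)"
   by (rule continuous_on_eq[where f = "\<lambda>x. hor j (g (sl_q c x)) + (c * g (sl_q c x) $ j) *\<^sub>R sgn (hor j x)"])
     (auto intro!: continuous_intros cq[OF contg] continuous_sgn_hor continuous_on_compose2[OF continuous_hor[of UNIV]] simp: sl_DG_def)
  show "continuous_on ?S (\<lambda>x. sl_e c x i)" for i
   by (rule continuous_on_eq[where f = "\<lambda>x. A (sl_q c x) $ i $ i + 2 * c * sgn (hor j x) $ i * A (sl_q c x) $ i $ j
   + (c * sgn (hor j x) $ i)\<^sup>2 * A (sl_q c x) $ j $ j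
   + c * ((1 - (sgn (hor j x) $ i)\<^sup>2) / norm (hor j x)) * g (sl_q c x) $ j"])
    (auto intro!: continuous_intros cq[OF contg] cq[OF A] continuous_sgn_hor continuous_hor simp: sl_e_def)
  show "(sl_G c has_derivative (\<lambda>v. sl_DG c x \<bullet> v)) (at x)" if x: "hor j x \<noteq> 0" for x
  proof (rule has_derivative_transform_within_open[OF _ open_hor[of j]])
   show "((\<lambda>x. H (sl_q c x)) has_derivative (\<lambda>v. sl_DG c x \<bullet> v)) (at x)"
    using has_derivative_compose[OF sl_q_deriv[OF x, of c] H[OF sl_V(2)[OF c x]]] x
    by (simp add: sl_DG_def inner_add_left inner_add_right inner_axis hor_inner(1) mult_ac)
  qed (use x in \<open>auto simp: sl_G_def\<close>)
  show "DERIV (\<lambda>s. sl_DG c (x + s *\<^sub>R axis i 1) $ i) 0 :> sl_e c x i" if x: "hor j x \<noteq> 0" and i: "i \<noteq> j" for x i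
  proof (rule has_field_derivative_transform_within_open)
   let ?l = "\<lambda>s. x + s *\<^sub>R axis i 1"
   show "DERIV (\<lambda>s. g (sl_q c (?l s)) $ i + c * (g (sl_q c (?l s)) $ j * sgn (hor j (?l s)) $ i)) 0 :> sl_e c x i"
    by (rule DERIV_cong[OF DERIV_add[OF DERIV_g_sl[OF c x i, of i] DERIV_cmult[OF DERIV_mult[OF DERIV_g_sl[OF c x i, of j] DERIV_sgn_hor_line[OF x i]]]]])
      (use x in \<open>simp add: sl_e_def sym_nth[OF sl_V(2)[OF c x], of j i] power2_eq_square algebra_simps\<close>)
   show "open {s. hor j (?l s) \<noteq> 0}"
    by (intro open_Collect_neq continuous_on_compose2[OF continuous_hor[of UNIV]]) (auto intro!: continuous_intros)
  qed (use x i in \<open>auto simp: sl_DG_def hor_nth\<close>)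
  show "sl_DG c x $ j = 0" for x by (simp add: sl_DG_def hor_nth hor_sgn)
  show "x \<bullet> sl_DG c x = sl_G c x" for x
  proof (cases "hor j x = 0")
   case False
   have "g (sl_q c x) \<bullet> sl_q c x = H (sl_q c x)" by (rule euler(1)[OF sl_V(2)[OF c False]])
   moreover have "w \<bullet> sl_q c x = x \<bullet> hor j w + c * norm (hor j x) * w $ j" for w
    by (simp add: sl_q_def inner_add_right inner_axis inner_commute[of w] hor_inner(1))
   ultimately show ?thesis using False by (simp add: sl_DG_def sl_G_def inner_add_right inner_sgn_hor mult_ac)
  qed (simp add: sl_DG_def sl_G_def)
  show "norm (sl_DG c x) \<le> ?C" for x
  proof (cases "hor j x = 0")
   case False
   note q = sl_V(1)[OF c False]
   have "norm (sl_DG c x) \<le> norm (hor j (g (sl_q c x))) + norm ((c * g (sl_q c x) $ j) *\<^sub>R sgn (hor j x))"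
    using False norm_triangle_ineq[of "hor j (g (sl_q c x))" "(c * g (sl_q c x) $ j) *\<^sub>R sgn (hor j x)"] by (simp add: sl_DG_def)
   also have "\<dots> \<le> B + \<bar>c\<bar> * B"
    using norm_hor_le[of j "g (sl_q c x)"] B(2)[OF q] mult_left_mono[OF gj[OF q, of j], of "\<bar>c\<bar>"] False by (simp add: abs_mult norm_sgn)
   also have "\<dots> \<le> ?C" using B(1) by (simp add: algebra_simps)
   finally show ?thesis .
  qed (use B(1) in \<open>simp add: sl_DG_def\<close>)
  show "\<bar>sl_e c x i\<bar> * norm (hor j x) \<le> ?C" for x i
  proof (cases "hor j x = 0")
   case False
   note q = sl_V(1)[OF c False]
   let ?u = "sgn (hor j x) $ i" and ?r = "norm (hor j x)" and ?q = "sl_q c x"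
   have u: "\<bar>?u\<bar> \<le> 1" using component_le_norm_cart[of "sgn (hor j x)" i] hor_sgn(2)[OF False] by simp
   have u2: "\<bar>1 - ?u\<^sup>2\<bar> \<le> 1" "?u\<^sup>2 \<le> 1"
   proof -
    show 1: "?u\<^sup>2 \<le> 1" using u by (simp add: abs_square_le_1)
    have "0 \<le> ?u\<^sup>2" by simp
    then show "\<bar>1 - ?u\<^sup>2\<bar> \<le> 1" using 1 by linarith
   qed
   have rq: "?r \<le> norm ?q" using norm_hor_le[of j ?q] by (simp add: sl_q_def hor_add hor_scaleR hor_hor) (simp add: hor_def)
   have a: "\<bar>A ?q $ i' $ l * ?r\<bar> \<le> B" for i' l
    using mult_left_mono[OF rq, of "\<bar>A ?q $ i' $ l\<bar>"] B(3)[OF q, of i' l] by (simp add: abs_mult)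
   have e: "sl_e c x i * ?r = A ?q $ i $ i * ?r + (2 * c * ?u) * (A ?q $ i $ j * ?r) + (c\<^sup>2 * ?u\<^sup>2) * (A ?q $ j $ j * ?r) + (c * (1 - ?u\<^sup>2)) * g ?q $ j"
    using False by (simp add: sl_e_def field_simps power2_eq_square)
   have "\<bar>(2 * c * ?u) * (A ?q $ i $ j * ?r)\<bar> \<le> (2 * \<bar>c\<bar>) * B" unfolding abs_mult[of "2 * c * ?u"]
    using u a by (intro mult_mono) (auto simp: abs_mult intro: mult_left_le)
   moreover have "\<bar>(c\<^sup>2 * ?u\<^sup>2) * (A ?q $ j $ j * ?r)\<bar> \<le> c\<^sup>2 * B" unfolding abs_mult[of "c\<^sup>2 * ?u\<^sup>2"]
    using u2 a by (intro mult_mono) (auto simp: abs_mult intro: mult_left_le)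
   moreover have "\<bar>(c * (1 - ?u\<^sup>2)) * g ?q $ j\<bar> \<le> \<bar>c\<bar> * B" unfolding abs_mult[of "c * (1 - ?u\<^sup>2)"]
    using u2 gj[OF q, of j] by (intro mult_mono) (auto simp: abs_mult intro: mult_left_le)
   ultimately have "\<bar>sl_e c x i * ?r\<bar> \<le> B + (2 * \<bar>c\<bar>) * B + c\<^sup>2 * B + \<bar>c\<bar> * B" using a[of i i] unfolding e by linarith
   also have "\<dots> = ?C" by (simp add: algebra_simps)
   finally show ?thesis by (simp add: abs_mult)
  qed (use B(1) in \<open>simp add: sl_e_def\<close>)
 qed (use N in \<open>simp_all add: sl_G_def sl_DG_def sl_e_def\<close>)
 then show ?thesis ..
qed

lemma sum_sl_e:
 assumes c: "cot \<theta> \<le> c" and x: "hor j x \<noteq> 0"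
 shows "(\<Sum>i\<in>UNIV - {j}. sl_e c x i) = lap c (sgn (hor j x)) / norm (hor j x)"
proof -
 let ?u = "sgn (hor j x)" and ?r = "norm (hor j x)" and ?q = "sl_q c x"
 let ?y = "?u + c *\<^sub>R axis j 1"
 have r: "?r \<noteq> 0" using x by simp
 have gq: "g ?q = g ?y" and Aq: "A ?q $ i $ l = A ?y $ i $ l / ?r" for i l using sl_hom(2,3)[OF c x] by simp_all
 have rem: "sum f UNIV = f j + sum f (UNIV - {j})" for f :: "'m \<Rightarrow> real" by (simp add: sum.remove)
 have "(A ?y *v ?y) $ j = 0" by (simp add: euler(2)[OF sl_V(3)[OF c x]])
 then have "(\<Sum>i\<in>UNIV. A ?y $ j $ i * ?y $ i) = 0" by (simp add: matrix_vector_mult_def)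
 then have "A ?y $ j $ j * c + (\<Sum>i\<in>UNIV - {j}. A ?y $ j $ i * ?u $ i) = 0" unfolding rem by (simp add: hor_sgn(1) axis_nth_if)
 then have 1: "(\<Sum>i\<in>UNIV - {j}. ?u $ i * A ?y $ i $ j) = - c * A ?y $ j $ j"
 proof -
  assume "A ?y $ j $ j * c + (\<Sum>i\<in>UNIV - {j}. A ?y $ j $ i * ?u $ i) = 0"
  moreover have "(\<Sum>i\<in>UNIV - {j}. A ?y $ j $ i * ?u $ i) = (\<Sum>i\<in>UNIV - {j}. ?u $ i * A ?y $ i $ j)"
   by (rule sum.cong[OF refl]) (use sym_nth[OF sl_V(3)[OF c x]] in simp)
  ultimately show ?thesis by (simp add: mult.commute)
 qed
 have 2: "(\<Sum>i\<in>UNIV - {j}. A ?y $ i $ i) = trace (A ?y) - A ?y $ j $ j" unfolding trace_def rem by simp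
 have "(\<Sum>i\<in>UNIV - {j}. sl_e c x i) = (\<Sum>i\<in>UNIV - {j}. (A ?y $ i $ i + 2 * c * (?u $ i * A ?y $ i $ j)
   + c\<^sup>2 * A ?y $ j $ j * (?u $ i)\<^sup>2 + c * g ?y $ j * (1 - (?u $ i)\<^sup>2)) / ?r)"
  using x by (intro sum.cong refl) (simp add: sl_e_def gq Aq field_simps power2_eq_square)
 also have "\<dots> = ((\<Sum>i\<in>UNIV - {j}. A ?y $ i $ i) + 2 * c * (\<Sum>i\<in>UNIV - {j}. ?u $ i * A ?y $ i $ j)
   + c\<^sup>2 * A ?y $ j $ j * (\<Sum>i\<in>UNIV - {j}. (?u $ i)\<^sup>2) + c * g ?y $ j * (real (card (UNIV - {j})) - (\<Sum>i\<in>UNIV - {j}. (?u $ i)\<^sup>2))) / ?r"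
  unfolding sum_divide_distrib[symmetric] sum.distrib sum_distrib_left[symmetric] sum_subtractf by simp
 also have "\<dots> = lap c ?u / ?r"
 proof -
  have 3: "real (card (UNIV - {j})) = real CARD('m) - 1" by (simp add: of_nat_diff Suc_leI)
  have 4: "t - a + 2 * c * (- c * a) + c\<^sup>2 * a * 1 + c * G * (N - 1 - 1) = t - (1 + c\<^sup>2) * a + (N - 2) * c * G" for t a G N :: real
   by (simp add: algebra_simps power2_eq_square)
  show ?thesis unfolding 1 2 sum_sgn_hor[OF x] lap_def by (simp only: 3 4)
 qed
 finally show ?thesis .
qed

end

text \<open>The law of the direction of the horizontal part of a Gaussian vector, that is, the
  uniform measure on the horizontal unit sphere. As an image measure it makes averages of functions
  of degree 0 into Gaussian integrals.\<close>

definition hmeas :: "'m::finite \<Rightarrow> (real^'m) measure" where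
 "hmeas j = distr (restrict_space (density lborel gw) {x. hor j x \<noteq> 0}) (restrict_space borel (hsph j)) (\<lambda>x. sgn (hor j x))"

lemma space_hmeas: "space (hmeas j) = hsph j" by (simp add: hmeas_def space_restrict_space)

lemma sets_hmeas: "sets (hmeas j) = sets (restrict_space borel (hsph j))" by (simp add: hmeas_def)

lemma measurable_sgn_hor:
 "(\<lambda>x. sgn (hor j x)) \<in> restrict_space (density lborel gw) {x. hor j x \<noteq> 0} \<rightarrow>\<^sub>M restrict_space borel (hsph j)"
proof (rule measurable_restrict_space2)
 show "(\<lambda>x. sgn (hor j x)) \<in> space (restrict_space (density lborel gw) {x. hor j x \<noteq> 0}) \<rightarrow> hsph j"
  by (auto simp: space_restrict_space hsph_sgn)
 have "(\<lambda>x. sgn (hor j x)) \<in> borel_measurable (restrict_space borel {x. hor j x \<noteq> 0})"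
  by (rule borel_measurable_continuous_on_restrict[OF continuous_sgn_hor])
 then show "(\<lambda>x. sgn (hor j x)) \<in> borel_measurable (restrict_space (density lborel gw) {x. hor j x \<noteq> 0})"
  by (subst measurable_cong_sets[of _ "restrict_space borel {x. hor j x \<noteq> 0}" borel borel]) (auto intro!: sets_restrict_space_cong)
qed

lemma compact_hsph: "compact (hsph j)"
proof -
 have "closed {u::real^'a. u $ j = 0}" by (intro closed_Collect_eq continuous_intros)
 then have "compact (sphere 0 1 \<inter> {u::real^'a. u $ j = 0})" by (intro compact_Int_closed) auto
 moreover have "sphere 0 1 \<inter> {u::real^'a. u $ j = 0} = hsph j" by (auto simp: hsph_def)
 ultimately show ?thesis by simp
qed

lemma prob_space_hmeas:
 assumes "3 \<le> CARD('m::finite)"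
 shows "prob_space (hmeas (j::'m))" unfolding hmeas_def
proof (rule prob_space.prob_space_distr[OF prob_space_restrict_space measurable_sgn_hor])
 show S: "{x. hor j x \<noteq> 0} \<in> sets (density lborel gw)" using borel_open[OF open_hor[of j]] by simp
 have "emeasure (density lborel gw) {x. hor j x \<noteq> 0} = (\<integral>\<^sup>+x. ennreal (gw x) * indicator {x. hor j x \<noteq> 0} x \<partial>lborel)"
  using S by (subst emeasure_density) auto
 also have "\<dots> = (\<integral>\<^sup>+x. ennreal (gw (x::real^'m)) \<partial>lborel)"
  by (rule nn_integral_cong_AE) (use AE_hor[OF assms, of j] in \<open>auto elim!: eventually_mono\<close>)
 also have "\<dots> = ennreal (LBINT x. gw (x::real^'m))"
  by (rule nn_integral_eq_integral[OF integral_gw(1)]) (simp add: less_imp_le[OF gw_pos])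
 finally show "emeasure (density lborel gw) {x. hor j x \<noteq> 0} = 1" by (simp add: integral_gw)
qed

lemma integral_hmeas:
 assumes f: "f \<in> borel_measurable (restrict_space borel (hsph j))"
 shows "(\<integral>u. f u \<partial>hmeas j) = (LBINT x. gw x * (indicator {x. hor j x \<noteq> 0} x * f (sgn (hor j x))))"
proof -
 let ?S = "{x. hor j x \<noteq> 0}"
 have S: "?S \<in> sets borel" by (rule borel_open[OF open_hor])
 have m: "(\<lambda>x. f (sgn (hor j x))) \<in> borel_measurable (restrict_space (density lborel gw) ?S)"
  by (rule measurable_compose[OF measurable_sgn_hor f])
 have "(\<lambda>x. indicator ?S x *\<^sub>R f (sgn (hor j x))) \<in> borel_measurable lborel"
  using m S by (subst (asm) borel_measurable_restrict_space_iff) auto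
 note integral_density[OF this borel_measurable_gw[folded measurable_lborel2] AE_I2[OF less_imp_le[OF gw_pos]]]
 moreover have "(\<integral>u. f u \<partial>hmeas j) = (\<integral>x. f (sgn (hor j x)) \<partial>restrict_space (density lborel gw) ?S)"
  unfolding hmeas_def by (rule integral_distr[OF measurable_sgn_hor f])
 moreover have "\<dots> = (\<integral>x. indicator ?S x *\<^sub>R f (sgn (hor j x)) \<partial>density lborel gw)"
  by (rule integral_restrict_space) (use S in simp)
 ultimately show ?thesis by simp
qed

lemma measurable_hmeas: "continuous_on (hsph j) f \<Longrightarrow> f \<in> borel_measurable (restrict_space borel (hsph j))"
 by (rule borel_measurable_continuous_on_restrict)

lemma integrable_hmeas:
 fixes f :: "real^'m \<Rightarrow> real"
 assumes "3 \<le> CARD('m::finite)" "continuous_on (hsph j) f"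
 shows "integrable (hmeas j) f"
proof -
 interpret prob_space "hmeas j" by (rule prob_space_hmeas[OF assms(1)])
 obtain B where "\<And>u. u \<in> hsph j \<Longrightarrow> norm (f u) \<le> B" using compact_image_bound[OF compact_hsph assms(2)] by blast
 then show ?thesis using measurable_hmeas[OF assms(2)]
  by (intro integrable_const_bound[where B = B] AE_I2) (auto simp: space_hmeas measurable_cong_sets[OF sets_hmeas refl])
qed

text \<open>Pulled back along the direction map, \<open>f\<close> is integrated against a positive
  density on an open set, so the integral sees every point.\<close>

lemma hmeas_full_support:
 fixes f :: "real^'m \<Rightarrow> real"
 assumes N: "3 \<le> CARD('m::finite)" and f: "continuous_on (hsph j) f" "\<And>u. u \<in> hsph j \<Longrightarrow> 0 \<le> f u"
  and z: "(\<integral>u. f u \<partial>hmeas (j::'m)) = 0" and u: "u \<in> hsph j"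
 shows "f u = 0"
proof -
 have hu: "hor j u = u" "u \<noteq> 0" "sgn u = u" using u by (auto simp: hsph_def hor_def sgn_div_norm)
 let ?F = "\<lambda>x. gw x * (indicator {x. hor j x \<noteq> 0} x * f (sgn (hor j x)))"
 have ge: "0 \<le> ?F x" for x using f(2)[OF hsph_sgn, of x] gw_pos[of x] by (simp add: indicator_def)
 have 0: "(LBINT x. ?F x) = 0" using z integral_hmeas[OF measurable_hmeas[OF f(1)]] by simp
 have m: "(\<lambda>x. indicator {x. hor j x \<noteq> 0} x *\<^sub>R f (sgn (hor j x))) \<in> borel_measurable borel"
  by (rule borel_measurable_continuous_on_indicator[OF borel_open[OF open_hor]])
    (rule continuous_on_compose2[OF f(1) continuous_sgn_hor], auto simp: hsph_sgn)
 obtain B where B0: "0 \<le> B" and B: "\<And>u. u \<in> hsph j \<Longrightarrow> \<bar>f u\<bar> \<le> B"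
  using compact_image_bound[OF compact_hsph f(1)] unfolding real_norm_def by blast
 have "integrable lborel ?F"
 proof (rule integrable_gw_poly[where C = B])
  show "(\<lambda>x. indicator {x. hor j x \<noteq> 0} x * f (sgn (hor j x))) \<in> borel_measurable borel" using m by simp
  show "\<bar>indicator {x. hor j x \<noteq> 0} x * f (sgn (hor j x))\<bar> \<le> B * (1 + x \<bullet> x)\<^sup>2" for x
  proof -
   have "\<bar>indicator {x. hor j x \<noteq> 0} x * f (sgn (hor j x))\<bar> \<le> B * 1" using B[OF hsph_sgn, of x] B0 by (simp add: indicator_def)
   also have "\<dots> \<le> B * (1 + x \<bullet> x)\<^sup>2" using B0 by (intro mult_left_mono one_le_power) auto
   finally show ?thesis .
  qed
 qed
 then have "AE x in lborel. ?F x = 0" using integral_nonneg_eq_0_iff_AE[of lborel ?F] ge 0 by simp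
 then have ae: "AE x in lborel. x \<in> {x. hor j x \<noteq> 0} \<longrightarrow> f (sgn (hor j x)) = 0"
  by eventually_elim (use gw_pos in \<open>auto simp: less_le\<close>)
 have "continuous_on {x. hor j x \<noteq> 0} (\<lambda>x. f (sgn (hor j x)))"
  by (rule continuous_on_compose2[OF f(1) continuous_sgn_hor]) (auto simp: hsph_sgn)
 from AE_zero_continuous[OF open_hor this ae, of u] have "f (sgn (hor j u)) = 0" using hu by simp
 then show ?thesis using hu by simp
qed

context cap_ext
begin

lemma continuous_slice:
 assumes "cot \<theta> \<le> c" "continuous_on V f"
 shows "continuous_on (hsph j) (\<lambda>u. f (u + c *\<^sub>R axis j 1))"
proof (rule continuous_on_compose2[OF assms(2)])
 show "(\<lambda>u. u + c *\<^sub>R axis j 1) ` hsph j \<subseteq> V" using slice_cone[OF \<theta> assms(1)] coneD by blast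
qed (intro continuous_intros)

lemma continuous_lap:
 assumes "cot \<theta> \<le> c"
 shows "continuous_on (hsph j) (lap c)"
proof -
 have "continuous_on (hsph j) (\<lambda>u. g (u + c *\<^sub>R axis j 1))" "continuous_on (hsph j) (\<lambda>u. A (u + c *\<^sub>R axis j 1))"
  by (rule continuous_slice[OF assms contg] continuous_slice[OF assms A])+
 then show ?thesis unfolding lap_def[abs_def] trace_def by (intro continuous_intros)
qed

text \<open>The product of a function of degree 1 and a Laplacian of degree -1 has degree 0, so its
  spherical average is a Gaussian integral. There \<open>slice_ibp\<close> gives an expression
  symmetric in the two functions.\<close>

lemma lap_symmetric:
 assumes b: "cap_ext j \<theta> V2 H2 g2 A2" and c: "cot \<theta> \<le> c" and N: "3 \<le> CARD('m)"
 shows "(\<integral>u. H (u + c *\<^sub>R axis j 1) * cap_ext.lap j g2 A2 c u \<partial>hmeas j) =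
  (\<integral>u. H2 (u + c *\<^sub>R axis j 1) * lap c u \<partial>hmeas j)"
proof -
 interpret b: cap_ext j \<theta> V2 H2 g2 A2 by (rule b)
 obtain C1 where "slice_fun j (sl_G c) (sl_DG c) (sl_e c) C1" using sl_slice[OF c N] ..
 then interpret s1: slice_fun j "sl_G c" "sl_DG c" "sl_e c" C1 .
 obtain C2 where "slice_fun j (b.sl_G c) (b.sl_DG c) (b.sl_e c) C2" using b.sl_slice[OF c N] ..
 then interpret s2: slice_fun j "b.sl_G c" "b.sl_DG c" "b.sl_e c" C2 .
 interpret t12: two_slice_fun j "sl_G c" "sl_DG c" "sl_e c" C1 "b.sl_G c" "b.sl_DG c" "b.sl_e c" C2 ..
 interpret t21: two_slice_fun j "b.sl_G c" "b.sl_DG c" "b.sl_e c" C2 "sl_G c" "sl_DG c" "sl_e c" C1 ..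
 have 1: "indicator {x. hor j x \<noteq> 0} x * (H (sgn (hor j x) + c *\<^sub>R axis j 1) * b.lap c (sgn (hor j x))) = sl_G c x * (\<Sum>i\<in>UNIV - {j}. b.sl_e c x i)" for x
  using b.sum_sl_e[OF c, of x] sl_hom(1)[OF c, of x] by (cases "hor j x = 0") (auto simp: sl_G_def)
 have 2: "indicator {x. hor j x \<noteq> 0} x * (H2 (sgn (hor j x) + c *\<^sub>R axis j 1) * lap c (sgn (hor j x))) = b.sl_G c x * (\<Sum>i\<in>UNIV - {j}. sl_e c x i)" for x
  using sum_sl_e[OF c, of x] b.sl_hom(1)[OF c, of x] by (cases "hor j x = 0") (auto simp: b.sl_G_def)
 have m1: "(\<lambda>u. H (u + c *\<^sub>R axis j 1) * b.lap c u) \<in> borel_measurable (restrict_space borel (hsph j))"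
  by (intro measurable_hmeas continuous_intros continuous_slice[OF c contH] b.continuous_lap[OF c])
 have m2: "(\<lambda>u. H2 (u + c *\<^sub>R axis j 1) * lap c u) \<in> borel_measurable (restrict_space borel (hsph j))"
  by (intro measurable_hmeas continuous_intros b.continuous_slice[OF c b.contH] continuous_lap[OF c])
 show ?thesis unfolding integral_hmeas[OF m1] integral_hmeas[OF m2] 1 2 t12.slice_ibp(2) t21.slice_ibp(2)
  by (simp add: mult.commute inner_commute)
qed

text \<open>The averages of \<open>H * lap\<close> and of \<open>H\<close> are the Gaussian
  integrals of \<open>sl_G\<close> times its Laplacian and of \<open>sl_G\<close> divided by the
  radius, which are the two sides of \<open>slice_poincare\<close>.\<close>

lemma lap_poincare:
 assumes c: "cot \<theta> \<le> c" and N: "3 \<le> CARD('m)"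
 shows "(\<integral>u. H (u + c *\<^sub>R axis j 1) * lap c u \<partial>hmeas j) \<le> (real CARD('m) - 2) * (\<integral>u. H (u + c *\<^sub>R axis j 1) \<partial>hmeas j)\<^sup>2"
proof -
 obtain C1 where "slice_fun j (sl_G c) (sl_DG c) (sl_e c) C1" using sl_slice[OF c N] ..
 then interpret s: slice_fun j "sl_G c" "sl_DG c" "sl_e c" C1 .
 have 1: "indicator {x. hor j x \<noteq> 0} x * (H (sgn (hor j x) + c *\<^sub>R axis j 1) * lap c (sgn (hor j x))) = sl_G c x * (\<Sum>i\<in>UNIV - {j}. sl_e c x i)" for x
  using sum_sl_e[OF c, of x] sl_hom(1)[OF c, of x] by (cases "hor j x = 0") (auto simp: sl_G_def)
 have 2: "indicator {x. hor j x \<noteq> 0} x * H (sgn (hor j x) + c *\<^sub>R axis j 1) = sl_G c x / norm (hor j x)" for x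
  using sl_hom(1)[OF c, of x] by (cases "hor j x = 0") (auto simp: sl_G_def)
 have m1: "(\<lambda>u. H (u + c *\<^sub>R axis j 1) * lap c u) \<in> borel_measurable (restrict_space borel (hsph j))"
  by (intro measurable_hmeas continuous_intros continuous_slice[OF c contH] continuous_lap[OF c])
 have m2: "(\<lambda>u. H (u + c *\<^sub>R axis j 1)) \<in> borel_measurable (restrict_space borel (hsph j))"
  by (intro measurable_hmeas continuous_slice[OF c contH])
 show ?thesis unfolding integral_hmeas[OF m1] integral_hmeas[OF m2] 1 2 by (rule s.slice_poincare)
qed

end

section \<open>The dependence on the slope\<close>

abbreviation pt :: "'m::finite \<Rightarrow> real \<Rightarrow> real^'m \<Rightarrow> real^'m" where
 "pt j c u \<equiv> u + c *\<^sub>R axis j 1"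

abbreviation avg :: "'m::finite \<Rightarrow> (real^'m \<Rightarrow> real) \<Rightarrow> real" where
 "avg j f \<equiv> \<integral>u. f u \<partial>hmeas j"

text \<open>With N the ambient dimension, P = \<open>wP\<close> satisfies P' = - (N - 2) c P / (1 +
  c^2). It is the integrating factor that turns the part (1 + c^2) m'' - (N - 2) c m' of the trace
  into an exact derivative.\<close>

definition wP :: "nat \<Rightarrow> real \<Rightarrow> real" where
 "wP N c = (1 + c\<^sup>2) powr (- (real N - 2) / 2)"

text \<open>This is (1 + c^2) powr (- N / 2): up to a constant factor, \<open>wO\<close> dc times
  \<open>hmeas\<close> is the surface measure of the unit sphere in the coordinates slope and
  horizontal direction. Integrating the weighted averages below over c therefore gives B.\<close>

definition wO :: "nat \<Rightarrow> real \<Rightarrow> real" where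
 "wO N c = wP N c / (1 + c\<^sup>2)"

lemma one_plus_sq_pos: "0 < 1 + (c::real)\<^sup>2" by (rule add_pos_nonneg) auto

lemma wP_pos: "0 < wP N c" and wO_pos: "0 < wO N c" using one_plus_sq_pos[of c] by (simp_all add: wP_def wO_def)

lemma DERIV_wP: "DERIV (wP N) c :> - (real N - 2) * c * wO N c"
proof -
 have "DERIV (\<lambda>c. 1 + c\<^sup>2) c :> 2 * c" by (auto intro!: derivative_eq_intros)
 from DERIV_chain2[OF has_real_derivative_powr[OF one_plus_sq_pos] this, of "- (real N - 2) / 2"]
 have "DERIV (wP N) c :> - (real N - 2) / 2 * (1 + c\<^sup>2) powr (- (real N - 2) / 2 - 1) * (2 * c)" unfolding wP_def[abs_def] .
 moreover have "(1 + c\<^sup>2) powr (- (real N - 2) / 2 - 1) = wO N c"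
  using one_plus_sq_pos[of c] by (subst powr_diff) (simp add: wO_def wP_def)
 ultimately show ?thesis by (simp add: mult_ac)
qed

lemma continuous_wP: "continuous_on S (wP N)" by (rule DERIV_continuous_on[OF DERIV_subset[OF DERIV_wP]]) simp

lemma continuous_wO: "continuous_on S (wO N)"
 unfolding wO_def[abs_def] using one_plus_sq_pos by (intro continuous_intros continuous_wP) (auto simp: less_le)

lemma wO_le:
 assumes "2 \<le> N"
 shows "wO N c \<le> 1 / (1 + c\<^sup>2)"
proof -
 have "wP N c \<le> (1 + c\<^sup>2) powr 0" unfolding wP_def using assms by (intro powr_mono) auto
 then show ?thesis using one_plus_sq_pos[of c] by (simp add: wO_def divide_right_mono)
qed

lemma wP_tendsto:
 assumes "3 \<le> N"
 shows "(\<lambda>n. wP N (a + real n)) \<longlonglongrightarrow> 0" unfolding wP_def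
proof (rule tendsto_neg_powr)
 have "filterlim (\<lambda>n. a + real n) at_top sequentially"
  by (rule filterlim_tendsto_add_at_top[OF tendsto_const filterlim_real_sequentially])
 then have "filterlim (\<lambda>n. (a + real n)\<^sup>2) at_top sequentially" by (intro filterlim_pow_at_top) auto
 then show "filterlim (\<lambda>n. 1 + (a + real n)\<^sup>2) at_top sequentially" by (rule filterlim_tendsto_add_at_top[OF tendsto_const])
qed (use assms in simp)

lemma param_slice:
 fixes f :: "real \<Rightarrow> real^'m::finite \<Rightarrow> real"
 assumes "continuous_on (hsph j \<times> {a..}) (\<lambda>z. f (snd z) (fst z))" "a \<le> c"
 shows "continuous_on (hsph j) (f c)"
proof -
 have "continuous_on (hsph j) (\<lambda>u. (\<lambda>z. f (snd z) (fst z)) (u, c))"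
  by (rule continuous_on_compose2[OF assms(1)]) (use assms(2) in \<open>auto intro: continuous_intros\<close>)
 then show ?thesis by simp
qed

lemma param_bound:
 fixes f :: "real \<Rightarrow> real^'m::finite \<Rightarrow> real"
 assumes "continuous_on (hsph j \<times> {a..}) (\<lambda>z. f (snd z) (fst z))"
 obtains B where "\<And>c u. u \<in> hsph j \<Longrightarrow> a \<le> c \<Longrightarrow> c \<le> b \<Longrightarrow> \<bar>f c u\<bar> \<le> B"
proof -
 have "continuous_on (hsph j \<times> {a..b}) (\<lambda>z. f (snd z) (fst z))" by (rule continuous_on_subset[OF assms]) auto
 from compact_image_bound[OF compact_Times[OF compact_hsph compact_Icc] this]
 obtain B where B: "\<And>z. z \<in> hsph j \<times> {a..b} \<Longrightarrow> norm (f (snd z) (fst z)) \<le> B" by blast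
 have "\<bar>f c u\<bar> \<le> B" if "u \<in> hsph j" "a \<le> c" "c \<le> b" for c u using B[of "(u, c)"] that by simp
 then show ?thesis by (rule that)
qed

lemma measure_hmeas: "3 \<le> CARD('m::finite) \<Longrightarrow> measure (hmeas (j::'m)) (space (hmeas j)) = 1"
 by (rule prob_space.prob_space[OF prob_space_hmeas])

lemma avg_mono:
 fixes f h :: "real^'m::finite \<Rightarrow> real"
 assumes "3 \<le> CARD('m)" "continuous_on (hsph j) f" "continuous_on (hsph j) h" "\<And>u. u \<in> hsph j \<Longrightarrow> f u \<le> h u"
 shows "avg j f \<le> avg j h"
 by (rule integral_mono[OF integrable_hmeas[OF assms(1,2)] integrable_hmeas[OF assms(1,3)]]) (simp add: space_hmeas assms(4))

lemma avg_abs_le: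
 fixes f :: "real^'m::finite \<Rightarrow> real"
 assumes "3 \<le> CARD('m)" "continuous_on (hsph j) f" "\<And>u. u \<in> hsph j \<Longrightarrow> \<bar>f u\<bar> \<le> B"
 shows "\<bar>avg j f\<bar> \<le> B"
proof -
 have f: "f u \<le> B" "- B \<le> f u" if "u \<in> hsph j" for u using assms(3)[OF that] by linarith+
 have "avg j f \<le> avg j (\<lambda>_. B)" by (rule avg_mono[OF assms(1,2) continuous_on_const f(1)])
 moreover have "avg j (\<lambda>_. - B) \<le> avg j f" by (rule avg_mono[OF assms(1) continuous_on_const assms(2) f(2)])
 ultimately show ?thesis by (simp add: measure_hmeas[OF assms(1)])
qed

lemma avg_square_le:
 fixes f :: "real^'m::finite \<Rightarrow> real"
 assumes "3 \<le> CARD('m)" "continuous_on (hsph j) f"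
 shows "(avg j f)\<^sup>2 \<le> avg j (\<lambda>u. (f u)\<^sup>2)"
proof -
 let ?m = "avg j f"
 have "avg j (\<lambda>u. 2 * ?m * f u - ?m\<^sup>2) \<le> avg j (\<lambda>u. (f u)\<^sup>2)"
 proof (rule avg_mono[OF assms(1)])
  fix u
  have "0 \<le> (f u - ?m)\<^sup>2" by simp
  then show "2 * ?m * f u - ?m\<^sup>2 \<le> (f u)\<^sup>2" unfolding power2_diff by (simp add: mult_ac)
 qed (intro continuous_intros assms)+
 moreover have "avg j (\<lambda>u. 2 * ?m * f u - ?m\<^sup>2) = 2 * ?m * ?m - ?m\<^sup>2"
  using integrable_hmeas[OF assms] integrable_hmeas[OF assms(1) continuous_on_const] by (simp add: measure_hmeas[OF assms(1)])
 ultimately show ?thesis by (simp add: power2_eq_square)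
qed

lemma avg_continuous:
 fixes f :: "real \<Rightarrow> real^'m::finite \<Rightarrow> real"
 assumes N: "3 \<le> CARD('m)" and f: "continuous_on (hsph j \<times> {a..}) (\<lambda>z. f (snd z) (fst z))"
 shows "continuous_on {a..} (\<lambda>c. avg j (f c))"
proof (rule continuous_on_sequentiallyI)
 interpret prob_space "hmeas j" by (rule prob_space_hmeas[OF N])
 fix X c assume X: "\<forall>n. X n \<in> {a..}" and c: "c \<in> {a..}" and l: "X \<longlonglongrightarrow> c"
 obtain b where b: "\<And>n. X n \<le> b" using convergent_imp_Bseq[OF convergentI[OF l]] by (auto simp: Bseq_def abs_le_iff)
 obtain B where B: "\<And>c u. u \<in> hsph j \<Longrightarrow> a \<le> c \<Longrightarrow> c \<le> b \<Longrightarrow> \<bar>f c u\<bar> \<le> B" using param_bound[OF f, of b] by blast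
 show "(\<lambda>n. avg j (f (X n))) \<longlonglongrightarrow> avg j (f c)"
 proof (rule integral_dominated_convergence[where w = "\<lambda>_. B"])
  show "f c \<in> borel_measurable (hmeas j)" "f (X n) \<in> borel_measurable (hmeas j)" for n
   using param_slice[OF f] X c by (auto intro!: borel_measurable_integrable integrable_hmeas[OF N])
  show "AE u in hmeas j. (\<lambda>n. f (X n) u) \<longlonglongrightarrow> f c u"
  proof (rule AE_I2)
   fix u assume "u \<in> space (hmeas j)"
   then have u: "u \<in> hsph j" by (simp add: space_hmeas)
   have "(\<lambda>n. (u, X n)) \<longlonglongrightarrow> (u, c)" by (intro tendsto_intros l)
   then show "(\<lambda>n. f (X n) u) \<longlonglongrightarrow> f c u" using continuous_on_tendsto_compose[OF f, of "\<lambda>n. (u, X n)" "(u, c)"] u X c by auto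
  qed
  show "AE u in hmeas j. norm (f (X n) u) \<le> B" for n using B X b by (intro AE_I2) (auto simp: space_hmeas)
 qed simp
qed

lemma avg_DERIV:
 fixes f f' :: "real \<Rightarrow> real^'m::finite \<Rightarrow> real"
 assumes N: "3 \<le> CARD('m)" and f: "continuous_on (hsph j \<times> {a..}) (\<lambda>z. f (snd z) (fst z))"
  and f': "continuous_on (hsph j \<times> {a..}) (\<lambda>z. f' (snd z) (fst z))"
  and der: "\<And>c u. u \<in> hsph j \<Longrightarrow> a < c \<Longrightarrow> DERIV (\<lambda>c. f c u) c :> f' c u" and c: "a < c"
 shows "DERIV (\<lambda>c. avg j (f c)) c :> avg j (f' c)"
proof -
 obtain B where B: "\<And>t u. u \<in> hsph j \<Longrightarrow> a \<le> t \<Longrightarrow> t \<le> 2 * c - a \<Longrightarrow> \<bar>f' t u\<bar> \<le> B" using param_bound[OF f', of "2 * c - a"] by blast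
 show ?thesis
 proof (rule DERIV_integral[where d = "c - a" and w = "\<lambda>_. B"])
  show "integrable (hmeas j) (f t)" if "\<bar>t - c\<bar> < c - a" for t
   by (rule integrable_hmeas[OF N param_slice[OF f]]) (use that in linarith)
  show "AE u in hmeas j. \<forall>t. \<bar>t - c\<bar> < c - a \<longrightarrow> DERIV (\<lambda>s. f s u) t :> f' t u"
   using der by (intro AE_I2) (auto simp: space_hmeas)
  show "AE u in hmeas j. \<forall>t. \<bar>t - c\<bar> < c - a \<longrightarrow> \<bar>f' t u\<bar> \<le> B" using B by (intro AE_I2) (auto simp: space_hmeas abs_less_iff)
  show "integrable (hmeas j) (\<lambda>_. B)" by (rule integrable_hmeas[OF N continuous_on_const])
  show "f' c \<in> borel_measurable (hmeas j)"
   by (rule borel_measurable_integrable[OF integrable_hmeas[OF N param_slice[OF f']]]) (use c in simp)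
 qed (use c in simp)
qed

definition prim :: "real \<Rightarrow> (real \<Rightarrow> real) \<Rightarrow> real \<Rightarrow> real" where
 "prim a w C = integral {a..C} w"

lemma prim:
 assumes "continuous_on {a..} w"
 shows "prim a w a = 0" "continuous_on {a..b} (prim a w)" "a < c \<Longrightarrow> DERIV (prim a w) c :> w c"
proof -
 show "prim a w a = 0" by (simp add: prim_def)
 have d: "(prim a w has_real_derivative w t) (at t within {a..b})" if "t \<in> {a..b}" for t b
  unfolding prim_def by (rule integral_has_real_derivative[OF continuous_on_subset[OF assms] that]) auto
 show "continuous_on {a..b} (prim a w)" by (rule DERIV_continuous_on[OF d])
 show "DERIV (prim a w) c :> w c" if "a < c" using d[of c "c + 1"] at_within_interior[of c "{a..c + 1}"] that by simp
qed

text \<open>One exceptional point z is allowed because the comparison function m^2 / c used later is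
  not differentiated at c = 0, where the quotient rule fails.\<close>

lemma DERIV_nonneg_except:
 fixes f :: "real \<Rightarrow> real"
 assumes "a \<le> b" and cont: "continuous_on {a..b} f"
  and der: "\<And>x. a < x \<Longrightarrow> x < b \<Longrightarrow> x \<noteq> z \<Longrightarrow> \<exists>y\<ge>0. DERIV f x :> y"
 shows "f a \<le> f b"
proof -
 have 1: "f s \<le> f t" if "a \<le> s" "s \<le> t" "t \<le> b" "z \<notin> {s<..<t}" for s t
 proof (rule DERIV_nonneg_imp_increasing_open[OF that(2)])
  show "continuous_on {s..t} f" by (rule continuous_on_subset[OF cont]) (use that in auto)
  show "\<exists>y. DERIV f x :> y \<and> 0 \<le> y" if x: "s < x" "x < t" for x
  proof -
   have "x \<noteq> z" using x \<open>z \<notin> {s<..<t}\<close> by auto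
   then show ?thesis using der[of x] x \<open>a \<le> s\<close> \<open>t \<le> b\<close> by auto
  qed
 qed
 show ?thesis
 proof (cases "z \<in> {a<..<b}")
  case True
  then show ?thesis using 1[of a z] 1[of z b] by auto
 next
  case False
  then show ?thesis using 1[of a b] assms(1) by auto
 qed
qed

context cap_ext
begin

lemma continuous_pt:
 assumes "continuous_on V f"
 shows "continuous_on (hsph j \<times> {cot \<theta>..}) (\<lambda>z. f (pt j (snd z) (fst z)))"
proof (rule continuous_on_compose2[OF assms])
 have "pt j c u \<in> V" if "u \<in> hsph j" "cot \<theta> \<le> c" for u c using slice_cone[OF \<theta> that(2,1)] coneD by simp
 then show "(\<lambda>z. pt j (snd z) (fst z)) ` (hsph j \<times> {cot \<theta>..}) \<subseteq> V" by auto
qed (intro continuous_intros)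

lemma cpt: "continuous_on (hsph j \<times> {cot \<theta>..}) (\<lambda>z. H (pt j (snd z) (fst z)))"
 "continuous_on (hsph j \<times> {cot \<theta>..}) (\<lambda>z. g (pt j (snd z) (fst z)) $ j)"
 "continuous_on (hsph j \<times> {cot \<theta>..}) (\<lambda>z. A (pt j (snd z) (fst z)) $ j $ j)"
 "continuous_on (hsph j \<times> {cot \<theta>..}) (\<lambda>z. trace (A (pt j (snd z) (fst z))))"
 unfolding trace_def by (intro continuous_intros continuous_pt contH contg A)+

lemma DERIV_pt:
 assumes "u \<in> hsph j" "cot \<theta> \<le> c"
 shows "DERIV (\<lambda>c. H (pt j c u)) c :> g (pt j c u) $ j"
  "DERIV (\<lambda>c. g (pt j c u) $ j) c :> A (pt j c u) $ j $ j"
proof -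
 have V: "pt j c u \<in> V" using slice_cone[OF \<theta> assms(2,1)] coneD by simp
 have d: "((\<lambda>c. pt j c u) has_derivative (\<lambda>s. s *\<^sub>R axis j (1::real))) (at c)" by (auto intro!: derivative_eq_intros)
 show "DERIV (\<lambda>c. H (pt j c u)) c :> g (pt j c u) $ j"
  using has_derivative_compose[OF d H[OF V]] by (intro has_derivative_mult_imp_DERIV) (simp add: inner_axis)
 from bounded_linear.has_derivative[OF bounded_linear_vec_nth has_derivative_compose[OF d g[OF V]], of j]
 show "DERIV (\<lambda>c. g (pt j c u) $ j) c :> A (pt j c u) $ j $ j"
  by (intro has_derivative_mult_imp_DERIV) (simp add: matrix_vector_mult_scaleR matrix_vector_mult_basis column_def)
qed

lemma pt_euler:
 assumes "u \<in> hsph j" "cot \<theta> \<le> c"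
 shows "H (pt j c u) = g (pt j c u) \<bullet> u + c * g (pt j c u) $ j"
proof -
 have V: "pt j c u \<in> V" using slice_cone[OF \<theta> assms(2,1)] coneD by simp
 show ?thesis using euler(1)[OF V] by (simp add: inner_add_right inner_axis)
qed

lemma pt_bdry: "u \<in> hsph j \<Longrightarrow> g (pt j (cot \<theta>) u) $ j = 0" by (rule bdry[OF slice_cone[OF \<theta> order_refl] slice_boundary[OF \<theta>]])

end

context two_cap_ext
begin

abbreviation pairing :: "real \<Rightarrow> real" where
 "pairing c \<equiv> wO CARD('m) c * avg j (\<lambda>u. H1 (pt j c u) * trace (A2 (pt j c u)))"

text \<open>The boundary term of Green's formula at slope c: its derivative contains the pairing,
  the horizontal Laplacian and the product of the vertical derivatives.\<close>

definition vflux :: "real \<Rightarrow> real" where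
 "vflux c = wP CARD('m) c * avg j (\<lambda>u. H1 (pt j c u) * g2 (pt j c u) $ j)"

lemma continuous_vflux: "3 \<le> CARD('m) \<Longrightarrow> continuous_on {cot \<theta>..} vflux"
 unfolding vflux_def[abs_def] by (intro continuous_intros continuous_wP avg_continuous one.cpt two.cpt)

lemma continuous_pairing: "3 \<le> CARD('m) \<Longrightarrow> continuous_on {cot \<theta>..} pairing"
 by (intro continuous_intros continuous_wO avg_continuous one.cpt two.cpt)

text \<open>Solve the definition of \<open>lap\<close> for the trace; the first-order term is then
  absorbed by the derivative of \<open>wP\<close>, and wO (1 + c^2) = wP matches the second-order
  terms.\<close>

lemma DERIV_vflux:
 assumes N: "3 \<le> CARD('m)" and c: "cot \<theta> < c"
 shows "DERIV vflux c :> pairing c - wO CARD('m) c * avg j (\<lambda>u. H1 (pt j c u) * two.lap c u)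
   + wP CARD('m) c * avg j (\<lambda>u. g1 (pt j c u) $ j * g2 (pt j c u) $ j)"
proof -
 let ?N = "CARD('m)"
 have c': "cot \<theta> \<le> c" using c by simp
 have "DERIV (\<lambda>c. avg j (\<lambda>u. H1 (pt j c u) * g2 (pt j c u) $ j)) c :> avg j (\<lambda>u. g1 (pt j c u) $ j * g2 (pt j c u) $ j + A2 (pt j c u) $ j $ j * H1 (pt j c u))"
  by (rule avg_DERIV[OF N _ _ _ c]) (intro continuous_intros one.cpt two.cpt DERIV_mult one.DERIV_pt two.DERIV_pt; simp)+
 from DERIV_mult[OF DERIV_wP[of ?N] this]
 have d: "DERIV vflux c :> (- (real ?N - 2) * c * wO ?N c) * avg j (\<lambda>u. H1 (pt j c u) * g2 (pt j c u) $ j)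
   + avg j (\<lambda>u. g1 (pt j c u) $ j * g2 (pt j c u) $ j + A2 (pt j c u) $ j $ j * H1 (pt j c u)) * wP ?N c"
  unfolding vflux_def[abs_def] .
 have i: "integrable (hmeas j) (\<lambda>u. H1 (pt j c u) * g2 (pt j c u) $ j)"
  "integrable (hmeas j) (\<lambda>u. H1 (pt j c u) * trace (A2 (pt j c u)))"
  "integrable (hmeas j) (\<lambda>u. H1 (pt j c u) * A2 (pt j c u) $ j $ j)"
  "integrable (hmeas j) (\<lambda>u. g1 (pt j c u) $ j * g2 (pt j c u) $ j)"
  by (rule integrable_hmeas[OF N param_slice[OF _ c']]; intro continuous_intros one.cpt two.cpt)+
 have "avg j (\<lambda>u. H1 (pt j c u) * two.lap c u) = avg j (\<lambda>u. H1 (pt j c u) * trace (A2 (pt j c u))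
   - (1 + c\<^sup>2) * (H1 (pt j c u) * A2 (pt j c u) $ j $ j) + (real ?N - 2) * c * (H1 (pt j c u) * g2 (pt j c u) $ j))"
  by (simp add: two.lap_def algebra_simps)
 also have "\<dots> = avg j (\<lambda>u. H1 (pt j c u) * trace (A2 (pt j c u)))
   - (1 + c\<^sup>2) * avg j (\<lambda>u. H1 (pt j c u) * A2 (pt j c u) $ j $ j) + (real ?N - 2) * c * avg j (\<lambda>u. H1 (pt j c u) * g2 (pt j c u) $ j)"
  using i by simp
 finally have l: "avg j (\<lambda>u. H1 (pt j c u) * trace (A2 (pt j c u))) = avg j (\<lambda>u. H1 (pt j c u) * two.lap c u)
   + (1 + c\<^sup>2) * avg j (\<lambda>u. H1 (pt j c u) * A2 (pt j c u) $ j $ j) - (real ?N - 2) * c * avg j (\<lambda>u. H1 (pt j c u) * g2 (pt j c u) $ j)"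
  by simp
 have s: "avg j (\<lambda>u. g1 (pt j c u) $ j * g2 (pt j c u) $ j + A2 (pt j c u) $ j $ j * H1 (pt j c u)) =
   avg j (\<lambda>u. g1 (pt j c u) $ j * g2 (pt j c u) $ j) + avg j (\<lambda>u. H1 (pt j c u) * A2 (pt j c u) $ j $ j)"
  using i by (simp add: mult.commute)
 have w: "wO ?N c * (1 + c\<^sup>2) = wP ?N c" using one_plus_sq_pos[of c] by (simp add: wO_def)
 show ?thesis by (rule DERIV_cong[OF d]) (unfold l s w[symmetric], simp add: algebra_simps)
qed

end

section \<open>Green's formula over all slopes\<close>

lemma prim_le:
 assumes w: "continuous_on {a..} w" and ab: "a \<le> b" and F: "continuous_on {a..b} F"
  and der: "\<And>c. a < c \<Longrightarrow> c < b \<Longrightarrow> c \<noteq> z \<Longrightarrow> \<exists>y\<ge>w c. DERIV F c :> y"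
 shows "prim a w b \<le> F b - F a"
proof -
 have "F a - prim a w a \<le> F b - prim a w b"
 proof (rule DERIV_nonneg_except[OF ab])
  show "continuous_on {a..b} (\<lambda>x. F x - prim a w x)" by (intro continuous_intros F prim(2)[OF w])
  fix c assume c: "a < c" "c < b" "c \<noteq> z"
  obtain y where "w c \<le> y" "DERIV F c :> y" using der[OF c] by blast
  then show "\<exists>y\<ge>0. DERIV (\<lambda>x. F x - prim a w x) c :> y" using DERIV_diff prim(3)[OF w c(1)] by (metis diff_ge_0_iff_ge)
 qed
 then show ?thesis by (simp add: prim(1)[OF w])
qed

lemma prim_eqI:
 assumes w: "continuous_on {a..} w" and ab: "a \<le> b" and F: "continuous_on {a..b} F"
  and der: "\<And>c. a < c \<Longrightarrow> c < b \<Longrightarrow> DERIV F c :> w c"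
 shows "prim a w b = F b - F a"
proof (rule antisym)
 show "prim a w b \<le> F b - F a" by (rule prim_le[OF w ab F, where z = a]) (use der in blast)
 have "F b - prim a w b \<le> F a - prim a w a"
 proof -
  have "prim a w a - F a \<le> prim a w b - F b"
  proof (rule DERIV_nonneg_except[OF ab, where z = a])
   show "continuous_on {a..b} (\<lambda>x. prim a w x - F x)" by (intro continuous_intros F prim(2)[OF w])
   show "\<exists>y\<ge>0. DERIV (\<lambda>x. prim a w x - F x) c :> y" if "a < c" "c < b" for c
    using DERIV_diff[OF prim(3)[OF w that(1)] der[OF that]] by auto
  qed
  then show ?thesis by simp
 qed
 then show "F b - F a \<le> prim a w b" by (simp add: prim(1)[OF w])
qed

context cap_ext
begin

lemma H_le:
 assumes "x \<in> cone j \<theta>" "norm (g x) \<le> B"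
 shows "\<bar>H x\<bar> \<le> B * norm x"
proof -
 have "\<bar>H x\<bar> \<le> norm (g x) * norm x" using Cauchy_Schwarz_ineq2[of "g x" x] euler(1) coneD[OF assms(1)] by simp
 also have "\<dots> \<le> B * norm x" by (intro mult_right_mono assms) simp
 finally show ?thesis .
qed

text \<open>For c > 0 the disc of horizontal vectors of norm at most 1 at height c lies in the cone
  and is convex, so the gradient bound applies along a segment of length at most 2. The resulting
  bound does not grow with c, although \<open>H\<close> itself may.\<close>

lemma pt_oscillation:
 assumes B: "\<And>x. x \<in> cone j \<theta> \<Longrightarrow> norm (g x) \<le> B" and c: "cot \<theta> \<le> c" "0 < c" and u: "u \<in> hsph j" "v \<in> hsph j"
 shows "\<bar>H (pt j c u) - H (pt j c v)\<bar> \<le> 2 * B"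
proof -
 let ?S = "(\<lambda>w. pt j c w) ` {w. w $ j = 0 \<and> norm w \<le> 1}"
 have S: "?S \<subseteq> cone j \<theta>"
 proof
  fix x assume "x \<in> ?S"
  then obtain w where w: "x = pt j c w" "w $ j = 0" "norm w \<le> 1" by auto
  have "w \<bullet> w \<le> 1" using w(3) by (simp flip: power2_norm_eq_inner add: power_le_one)
  moreover have "x \<bullet> x = w \<bullet> w + c\<^sup>2" using w by (simp add: inner_add_left inner_add_right inner_axis inner_axis' power2_eq_square)
  ultimately have n: "norm x \<le> sqrt (1 + c\<^sup>2)" by (simp add: norm_eq_sqrt_inner)
  have xj: "x $ j = c" using w by simp
  have "cos \<theta> * norm x \<le> c"
  proof (cases "0 \<le> cos \<theta>")
   case True
   then show ?thesis using mult_left_mono[OF n True] slice_angle[OF \<theta> c(1)] by linarith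
  next
   case False
   then have "cos \<theta> * norm x \<le> 0" by (intro mult_nonpos_nonneg) auto
   then show ?thesis using c by linarith
  qed
  then show "x \<in> cone j \<theta>" using xj c by (auto simp: cone_def)
 qed
 have cv: "convex ?S"
 proof -
  have "convex {w::real^'m. w $ j = 0 \<and> norm w \<le> 1}" unfolding convex_def
  proof (intro ballI allI impI)
   fix x y :: "real^'m" and a b :: real
   assume h: "x \<in> {w. w $ j = 0 \<and> norm w \<le> 1}" "y \<in> {w. w $ j = 0 \<and> norm w \<le> 1}" "0 \<le> a" "0 \<le> b" "a + b = 1"
   have "norm (a *\<^sub>R x + b *\<^sub>R y) \<le> a * norm x + b * norm y" using norm_triangle_ineq[of "a *\<^sub>R x" "b *\<^sub>R y"] h by simp
   also have "\<dots> \<le> a * 1 + b * 1" using h by (intro add_mono mult_left_mono) auto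
   finally show "a *\<^sub>R x + b *\<^sub>R y \<in> {w. w $ j = 0 \<and> norm w \<le> 1}" using h by simp
  qed
  then show ?thesis using convex_translation[of _ "c *\<^sub>R axis j 1"] by (simp add: add.commute)
 qed
 have B0: "0 \<le> B" using B[OF slice_cone[OF \<theta> c(1) u(1)]] norm_ge_zero order_trans by blast
 have "norm (H (pt j c u) - H (pt j c v)) \<le> B * norm (pt j c u - pt j c v)"
 proof (rule differentiable_bound[OF cv])
  show "(H has_derivative (\<lambda>w. g x \<bullet> w)) (at x within ?S)" if "x \<in> ?S" for x
   using H S that coneD has_derivative_at_withinI by blast
  show "onorm (\<lambda>w. g x \<bullet> w) \<le> B" if x: "x \<in> ?S" for x
  proof (rule onorm_le)
   fix w
   have "norm (g x \<bullet> w) \<le> norm (g x) * norm w" using Cauchy_Schwarz_ineq2 by simp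
   also have "\<dots> \<le> B * norm w" using B S x by (intro mult_right_mono) auto
   finally show "norm (g x \<bullet> w) \<le> B * norm w" .
  qed
 qed (use u in \<open>auto simp: hsph_def\<close>)
 also have "\<dots> \<le> B * 2" using norm_triangle_ineq4[of u v] u B0 by (intro mult_left_mono) (auto simp: hsph_def)
 finally show ?thesis by simp
qed

end

context two_cap_ext
begin

text \<open>\<open>H1\<close> times the trace of \<open>A2\<close> has degree 0 and is bounded, and
  the weight is at most 1 / (1 + c^2), whose primitive arctan is bounded.\<close>

lemma pairing_bound:
 assumes N: "3 \<le> CARD('m)"
 obtains K where "\<And>C. cot \<theta> \<le> C \<Longrightarrow> prim (cot \<theta>) pairing C \<le> K"
proof -
 obtain B1 where B1: "0 \<le> B1" "\<And>x. x \<in> cone j \<theta> \<Longrightarrow> norm (g1 x) \<le> B1" using one.cone_bound by blast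
 obtain B2 where B2: "0 \<le> B2" "\<And>x i l. x \<in> cone j \<theta> \<Longrightarrow> \<bar>A2 x $ i $ l\<bar> * norm x \<le> B2" using two.cone_bound by blast
 let ?K = "B1 * (real CARD('m) * B2)"
 have p: "pairing c \<le> ?K * (1 / (1 + c\<^sup>2))" if c: "cot \<theta> \<le> c" for c
 proof -
  have "\<bar>avg j (\<lambda>u. H1 (pt j c u) * trace (A2 (pt j c u)))\<bar> \<le> ?K"
  proof (rule avg_abs_le[OF N])
   show "continuous_on (hsph j) (\<lambda>u. H1 (pt j c u) * trace (A2 (pt j c u)))"
    by (rule param_slice[OF _ c]) (intro continuous_intros one.cpt two.cpt)
   fix u assume u: "u \<in> hsph j"
   let ?y = "pt j c u"
   have y: "?y \<in> cone j \<theta>" by (rule slice_cone[OF one.\<theta> c u])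
   have "\<bar>trace (A2 ?y)\<bar> * norm ?y \<le> (\<Sum>i\<in>UNIV. \<bar>A2 ?y $ i $ i\<bar>) * norm ?y"
    unfolding trace_def by (intro mult_right_mono sum_abs) simp
   also have "\<dots> \<le> (\<Sum>i\<in>(UNIV::'m set). B2)" unfolding sum_distrib_right by (intro sum_mono B2(2)[OF y])
   finally have t: "\<bar>trace (A2 ?y)\<bar> * norm ?y \<le> real CARD('m) * B2" by simp
   have "\<bar>H1 ?y * trace (A2 ?y)\<bar> \<le> (B1 * norm ?y) * \<bar>trace (A2 ?y)\<bar>"
    unfolding abs_mult using one.H_le[OF y B1(2)[OF y]] by (intro mult_right_mono) auto
   also have "\<dots> = B1 * (\<bar>trace (A2 ?y)\<bar> * norm ?y)" by simp
   also have "\<dots> \<le> ?K" by (intro mult_left_mono t B1)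
   finally show "\<bar>H1 ?y * trace (A2 ?y)\<bar> \<le> ?K" .
  qed
  then have "pairing c \<le> wO CARD('m) c * ?K" by (intro mult_left_mono less_imp_le[OF wO_pos]) auto
  also have "\<dots> \<le> (1 / (1 + c\<^sup>2)) * ?K" using N B1 B2 by (intro mult_right_mono wO_le) auto
  finally show ?thesis by (simp add: mult.commute)
 qed
 have "prim (cot \<theta>) pairing C \<le> ?K * pi" if C: "cot \<theta> \<le> C" for C
 proof -
  have "prim (cot \<theta>) pairing C \<le> ?K * arctan C - ?K * arctan (cot \<theta>)"
  proof (rule prim_le[OF continuous_pairing[OF N] C, where z = 0])
   show "continuous_on {cot \<theta>..C} (\<lambda>x. ?K * arctan x)" by (intro continuous_intros)
   fix c assume c: "cot \<theta> < c"
   have "DERIV (\<lambda>x. ?K * arctan x) c :> ?K * (1 / (1 + c\<^sup>2))"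
    using DERIV_cmult[OF DERIV_arctan, of ?K c] by (simp add: divide_inverse)
   then show "\<exists>y\<ge>pairing c. DERIV (\<lambda>x. ?K * arctan x) c :> y" using p[of c] c by auto
  qed
  also have "\<dots> = ?K * (arctan C - arctan (cot \<theta>))" by (simp add: right_diff_distrib)
  also have "\<dots> \<le> ?K * pi" using arctan_bounded[of C] arctan_bounded[of "cot \<theta>"] B1 B2 by (intro mult_left_mono) auto
  finally show ?thesis .
 qed
 then show ?thesis using that by blast
qed

lemma vflux_start: "3 \<le> CARD('m) \<Longrightarrow> vflux (cot \<theta>) = 0"
proof -
 assume N: "3 \<le> CARD('m)"
 have "\<bar>avg j (\<lambda>u. H1 (pt j (cot \<theta>) u) * g2 (pt j (cot \<theta>) u) $ j)\<bar> \<le> 0"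
 proof (rule avg_abs_le[OF N])
  show "continuous_on (hsph j) (\<lambda>u. H1 (pt j (cot \<theta>) u) * g2 (pt j (cot \<theta>) u) $ j)"
   by (rule param_slice[where a = "cot \<theta>"]) (intro continuous_intros one.cpt two.cpt, simp)
 qed (simp add: two.pt_bdry)
 then show ?thesis by (simp add: vflux_def)
qed

end

text \<open>The difference is that of the two boundary terms at slope C. Each may be as large as C
  times \<open>wP\<close>, which does not tend to 0 in ambient dimension 3, but Euler's relation
  cancels the products of the two vertical derivatives and leaves a bounded factor.\<close>

lemma pairing_asym:
 fixes j :: "'m::finite"
 assumes a: "two_cap_ext j \<theta> V1 H1 g1 A1 V2 H2 g2 A2" and N: "3 \<le> CARD('m)"
 obtains K where "\<And>C. cot \<theta> \<le> C \<Longrightarrow>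
  \<bar>prim (cot \<theta>) (\<lambda>c. wO CARD('m) c * avg j (\<lambda>u. H1 (pt j c u) * trace (A2 (pt j c u)))) C
  - prim (cot \<theta>) (\<lambda>c. wO CARD('m) c * avg j (\<lambda>u. H2 (pt j c u) * trace (A1 (pt j c u)))) C\<bar> \<le> K * wP CARD('m) C"
proof -
 interpret a: two_cap_ext j \<theta> V1 H1 g1 A1 V2 H2 g2 A2 by (rule a)
 interpret b: two_cap_ext j \<theta> V2 H2 g2 A2 V1 H1 g1 A1 ..
 obtain B1 where B1: "0 \<le> B1" "\<And>x. x \<in> cone j \<theta> \<Longrightarrow> norm (g1 x) \<le> B1" using a.one.cone_bound by blast
 obtain B2 where B2: "0 \<le> B2" "\<And>x. x \<in> cone j \<theta> \<Longrightarrow> norm (g2 x) \<le> B2" using a.two.cone_bound by blast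
 show ?thesis
 proof (rule that[of "2 * (B1 * B2)"])
  fix C assume C: "cot \<theta> \<le> C"
  have "prim (cot \<theta>) (\<lambda>c. a.pairing c - b.pairing c) C = prim (cot \<theta>) a.pairing C - prim (cot \<theta>) b.pairing C - (prim (cot \<theta>) a.pairing (cot \<theta>) - prim (cot \<theta>) b.pairing (cot \<theta>))"
   by (rule prim_eqI[OF _ C]) (intro continuous_intros a.continuous_pairing[OF N] b.continuous_pairing[OF N] prim(2) DERIV_diff prim(3); assumption)+
  also have "\<dots> = prim (cot \<theta>) a.pairing C - prim (cot \<theta>) b.pairing C"
   using prim(1)[OF a.continuous_pairing[OF N]] prim(1)[OF b.continuous_pairing[OF N]] by simp
  finally have 1: "prim (cot \<theta>) (\<lambda>c. a.pairing c - b.pairing c) C = prim (cot \<theta>) a.pairing C - prim (cot \<theta>) b.pairing C" .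
  have "prim (cot \<theta>) (\<lambda>c. a.pairing c - b.pairing c) C = a.vflux C - b.vflux C - (a.vflux (cot \<theta>) - b.vflux (cot \<theta>))"
  proof (rule prim_eqI[OF _ C])
   show "continuous_on {cot \<theta>..} (\<lambda>c. a.pairing c - b.pairing c)"
    by (intro continuous_intros a.continuous_pairing[OF N] b.continuous_pairing[OF N])
   show "continuous_on {cot \<theta>..C} (\<lambda>c. a.vflux c - b.vflux c)"
    by (intro continuous_intros continuous_on_subset[OF a.continuous_vflux[OF N]] continuous_on_subset[OF b.continuous_vflux[OF N]]) auto
   fix c assume c: "cot \<theta> < c"
   show "DERIV (\<lambda>c. a.vflux c - b.vflux c) c :> a.pairing c - b.pairing c"
    by (rule DERIV_cong[OF DERIV_diff[OF a.DERIV_vflux[OF N c] b.DERIV_vflux[OF N c]]])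
      (use a.one.lap_symmetric[OF a.two.cap_ext_axioms less_imp_le[OF c] N] in \<open>simp add: mult.commute\<close>)
  qed
  then have 2: "prim (cot \<theta>) a.pairing C - prim (cot \<theta>) b.pairing C = a.vflux C - b.vflux C"
   using 1 a.vflux_start[OF N] b.vflux_start[OF N] by simp
  have i: "continuous_on (hsph j) (\<lambda>u. H1 (pt j C u) * g2 (pt j C u) $ j)" "continuous_on (hsph j) (\<lambda>u. H2 (pt j C u) * g1 (pt j C u) $ j)"
   by (rule param_slice[OF _ C]; intro continuous_intros a.one.cpt a.two.cpt)+
  have "a.vflux C - b.vflux C = wP CARD('m) C * avg j (\<lambda>u. H1 (pt j C u) * g2 (pt j C u) $ j - H2 (pt j C u) * g1 (pt j C u) $ j)"
   using integrable_hmeas[OF N i(1)] integrable_hmeas[OF N i(2)] by (simp add: a.vflux_def b.vflux_def right_diff_distrib)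
  moreover have "\<bar>avg j (\<lambda>u. H1 (pt j C u) * g2 (pt j C u) $ j - H2 (pt j C u) * g1 (pt j C u) $ j)\<bar> \<le> 2 * (B1 * B2)"
  proof (rule avg_abs_le[OF N continuous_on_diff[OF i]])
   fix u assume u: "u \<in> hsph j"
   let ?y = "pt j C u"
   have y: "?y \<in> cone j \<theta>" by (rule slice_cone[OF a.one.\<theta> C u])
   have c1: "\<bar>g1 ?y $ j\<bar> \<le> B1" "\<bar>g2 ?y $ j\<bar> \<le> B2"
    using component_le_norm_cart[of "g1 ?y" j] component_le_norm_cart[of "g2 ?y" j] B1(2)[OF y] B2(2)[OF y] by linarith+
   have c2: "\<bar>g1 ?y \<bullet> u\<bar> \<le> B1" "\<bar>g2 ?y \<bullet> u\<bar> \<le> B2"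
    using Cauchy_Schwarz_ineq2[of "g1 ?y" u] Cauchy_Schwarz_ineq2[of "g2 ?y" u] B1(2)[OF y] B2(2)[OF y] u by (auto simp: hsph_def)
   have "H1 ?y * g2 ?y $ j - H2 ?y * g1 ?y $ j = (g1 ?y \<bullet> u) * g2 ?y $ j - (g2 ?y \<bullet> u) * g1 ?y $ j"
    unfolding a.one.pt_euler[OF u C] a.two.pt_euler[OF u C] by (simp add: algebra_simps)
   moreover have "\<bar>(g1 ?y \<bullet> u) * g2 ?y $ j\<bar> \<le> B1 * B2" "\<bar>(g2 ?y \<bullet> u) * g1 ?y $ j\<bar> \<le> B2 * B1"
    unfolding abs_mult using c1 c2 B1(1) B2(1) by (auto intro!: mult_mono)
   ultimately show "\<bar>H1 ?y * g2 ?y $ j - H2 ?y * g1 ?y $ j\<bar> \<le> 2 * (B1 * B2)" by (simp add: mult.commute)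
  qed
  ultimately have "\<bar>a.vflux C - b.vflux C\<bar> \<le> wP CARD('m) C * (2 * (B1 * B2))"
   using wP_pos[of "CARD('m)" C] by (simp add: abs_mult)
  then show "\<bar>prim (cot \<theta>) a.pairing C - prim (cot \<theta>) b.pairing C\<bar> \<le> 2 * (B1 * B2) * wP CARD('m) C"
   unfolding 2 by (simp add: mult.commute)
 qed
qed

context cap_ext
begin

text \<open>The only obstruction to \<open>(n - 1) \<omega> m\<^sup>2 \<le> P m'\<^sup>2\<close> modulo an exact derivative is the zero mode \<open>m = c\<close> of the
 linear function \<open>x $ j\<close>, whence the comparison function \<open>P m\<^sup>2 / c\<close>.\<close>
lemma pairing_self:
 assumes N: "3 \<le> CARD('m)" and zero: "avg j (\<lambda>u. H (pt j (max (cot \<theta>) 0) u)) = 0"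
 obtains K where "\<And>C. max 1 (cot \<theta>) \<le> C \<Longrightarrow>
  prim (cot \<theta>) (\<lambda>c. wO CARD('m) c * avg j (\<lambda>u. H (pt j c u) * trace (A (pt j c u)))) C \<le> K * wP CARD('m) C"
proof -
 interpret s: two_cap_ext j \<theta> V H g A V H g A ..
 let ?N = "CARD('m)" and ?c0 = "cot \<theta>"
 obtain B where B: "0 \<le> B" "\<And>x. x \<in> cone j \<theta> \<Longrightarrow> norm (g x) \<le> B" using cone_bound by blast
 define m where "m c = avg j (\<lambda>u. H (pt j c u))" for c
 define d where "d c = avg j (\<lambda>u. g (pt j c u) $ j)" for c
 have cm: "continuous_on {?c0..} m" unfolding m_def by (rule avg_continuous[OF N]) (intro cpt)
 have dm: "DERIV m c :> d c" if "?c0 < c" for c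
  unfolding m_def d_def by (rule avg_DERIV[OF N _ _ _ that]) (intro cpt DERIV_pt; simp)+
 have gj: "\<bar>g (pt j c u) $ j\<bar> \<le> B" if "u \<in> hsph j" "?c0 \<le> c" for u c
  using component_le_norm_cart[of "g (pt j c u)" j] B(2)[OF slice_cone[OF \<theta> that(2,1)]] by linarith
 have cd: "continuous_on (hsph j) (\<lambda>u. g (pt j c u) $ j)" if "?c0 \<le> c" for c by (rule param_slice[OF _ that]) (intro cpt)
 have db: "\<bar>d c\<bar> \<le> B" if "?c0 \<le> c" for c unfolding d_def by (rule avg_abs_le[OF N cd[OF that]]) (use gj that in blast)
 have lip: "\<bar>m b - m a\<bar> \<le> B * (b - a)" if ab: "?c0 \<le> a" "a \<le> b" for a b
 proof (cases "a = b")
  case False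
  have "\<exists>l z. a < z \<and> z < b \<and> DERIV m z :> l \<and> m b - m a = (b - a) * l"
  proof (rule MVT)
   show "continuous_on {a..b} m" by (rule continuous_on_subset[OF cm]) (use ab in auto)
   show "m differentiable (at x)" if "a < x" for x using dm[of x] that ab unfolding real_differentiable_def by auto
  qed (use False ab in simp)
  then obtain z l where z: "a < z" "z < b" "DERIV m z :> l" "m b - m a = (b - a) * l" by blast
  have "?c0 < z" using z(1) ab(1) by linarith
  then have "l = d z" using DERIV_unique[OF z(3) dm] by simp
  then have "\<bar>l\<bar> \<le> B" using db[of z] \<open>?c0 < z\<close> by simp
  then show ?thesis unfolding z(4) abs_mult using ab mult_left_mono[of "\<bar>l\<bar>" B "b - a"] by (simp add: mult.commute)
 qed simp
 have mz: "m (max ?c0 0) = 0" using zero by (simp add: m_def)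
 \<comment> \<open>If cot \<theta> \<le> 0, the mean vanishes at slope 0 and the Lipschitz bound
   removes the pole of \<open>q\<close>; if cot \<theta> > 0, it vanishes at the left end instead.
   In both cases \<open>q\<close> is at most 0 at the left end.\<close>
 define q where "q c = (m c)\<^sup>2 / c" for c
 have cq: "continuous_on {?c0..} q" unfolding continuous_on_eq_continuous_within
 proof
  fix x assume x: "x \<in> {?c0..}"
  show "continuous (at x within {?c0..}) q"
  proof (cases "x = 0")
   case False
   then show ?thesis using cm x unfolding q_def[abs_def] continuous_on_eq_continuous_within by (intro continuous_intros) auto
  next
   case True
   then have m0: "m 0 = 0" and c0: "?c0 \<le> 0" using mz x by auto
   have mb: "\<bar>m c\<bar> \<le> B * \<bar>c\<bar>" if "?c0 \<le> c" for c using lip[of c 0] lip[of 0 c] that c0 m0 by (cases "0 \<le> c") auto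
   have qb: "\<bar>q c\<bar> \<le> B\<^sup>2 * \<bar>c\<bar>" if "?c0 \<le> c" for c
   proof (cases "c = 0")
    case False
    have "\<bar>m c\<bar>\<^sup>2 \<le> (B * \<bar>c\<bar>)\<^sup>2" by (rule power_mono[OF mb[OF that]]) simp
    moreover have "(B * \<bar>c\<bar>)\<^sup>2 = B\<^sup>2 * \<bar>c\<bar> * \<bar>c\<bar>" by (simp add: power2_eq_square)
    ultimately have "(m c)\<^sup>2 \<le> B\<^sup>2 * \<bar>c\<bar> * \<bar>c\<bar>" by simp
    then have "(m c)\<^sup>2 / \<bar>c\<bar> \<le> B\<^sup>2 * \<bar>c\<bar>" using False by (simp add: divide_le_eq)
    then show ?thesis by (simp add: q_def abs_divide)
   qed (simp add: q_def)
   have "(q \<longlongrightarrow> 0) (at 0 within {?c0..})"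
   proof (rule Lim_null_comparison)
    show "\<forall>\<^sub>F c in at 0 within {?c0..}. norm (q c) \<le> B\<^sup>2 * \<bar>c\<bar>" using qb by (auto simp: eventually_at_filter)
    have "((\<lambda>c. B\<^sup>2 * \<bar>c\<bar>) \<longlongrightarrow> B\<^sup>2 * \<bar>0\<bar>) (at 0 within {?c0..})" by (intro tendsto_intros)
    then show "((\<lambda>c. B\<^sup>2 * \<bar>c\<bar>) \<longlongrightarrow> 0) (at 0 within {?c0..})" by simp
   qed
   then show ?thesis unfolding True continuous_within by (simp add: q_def m0)
  qed
 qed
 let ?\<Psi> = "\<lambda>c. s.vflux c - wP ?N c * q c"
 have "prim ?c0 s.pairing C \<le> 6 * B\<^sup>2 * wP ?N C" if C1: "max 1 ?c0 \<le> C" for C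
 proof -
  have C: "?c0 \<le> C" "1 \<le> C" using C1 by auto
  have "prim ?c0 s.pairing C \<le> ?\<Psi> C - ?\<Psi> ?c0"
  proof (rule prim_le[OF s.continuous_pairing[OF N] C(1), where z = 0])
   show "continuous_on {?c0..C} ?\<Psi>"
    by (intro continuous_intros continuous_wP continuous_on_subset[OF s.continuous_vflux[OF N]] continuous_on_subset[OF cq]) auto
   fix c assume c: "?c0 < c" "c < C" "c \<noteq> 0"
   have c': "?c0 \<le> c" using c by simp
   have w: "wP ?N c = wO ?N c * (1 + c\<^sup>2)" using one_plus_sq_pos[of c] by (simp add: wO_def)
   have dq: "DERIV q c :> (2 * m c * d c * c - (m c)\<^sup>2) / (c * c)"
    unfolding q_def[abs_def] using dm[OF c(1)] c by (auto intro!: derivative_eq_intros)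
   note D = DERIV_diff[OF s.DERIV_vflux[OF N c(1)] DERIV_mult[OF DERIV_wP dq]]
   have 1: "avg j (\<lambda>u. H (pt j c u) * lap c u) \<le> (real ?N - 2) * (m c)\<^sup>2" unfolding m_def by (rule lap_poincare[OF c' N])
   have 2: "(d c)\<^sup>2 \<le> avg j (\<lambda>u. g (pt j c u) $ j * g (pt j c u) $ j)"
    using avg_square_le[OF N cd[OF c']] by (simp add: d_def power2_eq_square)
   have comb: "p \<le> p - b + e - (t1 + t2)" if "b \<le> a" "f \<le> e" "0 \<le> f - t2" "t1 = - a" for p a b e f t1 t2 :: real
    using that by linarith
   have "s.pairing c \<le> s.pairing c - wO ?N c * avg j (\<lambda>u. H (pt j c u) * lap c u)
     + wP ?N c * avg j (\<lambda>u. g (pt j c u) $ j * g (pt j c u) $ j)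
     - (- (real ?N - 2) * c * wO ?N c * q c + (2 * m c * d c * c - (m c)\<^sup>2) / (c * c) * wP ?N c)"
   proof (rule comb[where a = "wO ?N c * ((real ?N - 2) * (m c)\<^sup>2)" and f = "wP ?N c * (d c)\<^sup>2"])
    show "wO ?N c * avg j (\<lambda>u. H (pt j c u) * lap c u) \<le> wO ?N c * ((real ?N - 2) * (m c)\<^sup>2)"
     by (rule mult_left_mono[OF 1 less_imp_le[OF wO_pos]])
    show "wP ?N c * (d c)\<^sup>2 \<le> wP ?N c * avg j (\<lambda>u. g (pt j c u) $ j * g (pt j c u) $ j)"
     by (rule mult_left_mono[OF 2 less_imp_le[OF wP_pos]])
    \<comment> \<open>Completing the square: the derivative of \<open>q\<close> contributes exactly
      the terms that complete the squared vertical derivative of the mean.\<close>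
    have "wP ?N c * (d c - m c / c)\<^sup>2 = wP ?N c * (d c)\<^sup>2 - (2 * m c * d c * c - (m c)\<^sup>2) / (c * c) * wP ?N c"
     using c(3) by (simp add: power2_eq_square field_simps)
    moreover have "0 \<le> wP ?N c * (d c - m c / c)\<^sup>2" using wP_pos[of ?N c] by simp
    ultimately show "0 \<le> wP ?N c * (d c)\<^sup>2 - (2 * m c * d c * c - (m c)\<^sup>2) / (c * c) * wP ?N c" by simp
    show "- (real ?N - 2) * c * wO ?N c * q c = - (wO ?N c * ((real ?N - 2) * (m c)\<^sup>2))"
     using c(3) by (simp add: q_def) (simp add: algebra_simps)
   qed
   then show "\<exists>y\<ge>s.pairing c. DERIV ?\<Psi> c :> y" using D by blast
  qed
  also have "\<dots> \<le> ?\<Psi> C"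
  proof -
   have "q ?c0 \<le> 0"
   proof (cases "0 \<le> ?c0")
    case True
    then show ?thesis using mz by (simp add: q_def max_def)
   next
    case False
    then show ?thesis by (simp add: q_def divide_nonneg_neg)
   qed
   then have "wP ?N ?c0 * q ?c0 \<le> 0" using wP_pos[of ?N ?c0] by (simp add: mult_nonneg_nonpos)
   then show ?thesis using s.vflux_start[OF N] by simp
  qed
  also have "\<dots> \<le> 6 * B\<^sup>2 * wP ?N C"
  proof -
   obtain l where l: "l \<noteq> j" using obtain_third_index[OF N] by metis
   \<comment> \<open>\<open>a\<close> is the value at one point of the slice. As \<open>H\<close>
     varies there by at most 2 B, its square is at most 4 B^2 + 2 a H - a^2. After averaging,
     subtracting m^2 / C leaves 4 B^2 - (m - a)^2 over C, and C \<ge> 1; together with the 2 B^2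
     from the horizontal gradient this gives the 6.\<close>
   define a where "a = H (pt j C (axis l 1))"
   have e: "axis l 1 \<in> hsph j" using l by (simp add: hsph_def axis_nth_if norm_axis_1)
   have cH: "continuous_on (hsph j) (\<lambda>u. H (pt j C u))" by (rule param_slice[OF _ C(1)]) (intro cpt)
   have pw: "H (pt j C u) * g (pt j C u) $ j \<le> 2 * B\<^sup>2 + ((2 * B)\<^sup>2 + 2 * a * H (pt j C u) - a\<^sup>2) / C" if u: "u \<in> hsph j" for u
   proof -
    let ?y = "pt j C u"
    have y: "?y \<in> cone j \<theta>" by (rule slice_cone[OF \<theta> C(1) u])
    have gu: "\<bar>g ?y \<bullet> u\<bar> \<le> B" using Cauchy_Schwarz_ineq2[of "g ?y" u] B(2)[OF y] u by (simp add: hsph_def)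
    have "\<bar>H ?y\<bar> \<le> B * (2 * C)" unfolding pt_euler[OF u C(1)]
    proof -
     have "\<bar>C * g ?y $ j\<bar> \<le> C * B" unfolding abs_mult using C gj[OF u C(1)] by (intro mult_mono) auto
     moreover have "B \<le> C * B" using C B(1) by (simp add: mult_le_cancel_right1)
     ultimately show "\<bar>g ?y \<bullet> u + C * g ?y $ j\<bar> \<le> B * (2 * C)" using gu by (simp add: mult.commute)
    qed
    then have "\<bar>H ?y * (g ?y \<bullet> u)\<bar> \<le> (B * (2 * C)) * B" unfolding abs_mult using gu C B by (intro mult_mono) auto
    then have h1: "- (H ?y * (g ?y \<bullet> u)) \<le> 2 * B\<^sup>2 * C" by (simp add: power2_eq_square mult_ac abs_le_iff)
    have "\<bar>H ?y - a\<bar> \<le> 2 * B" unfolding a_def using pt_oscillation[OF B(2) C(1) _ u e] C by simp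
    then have "\<bar>H ?y - a\<bar>\<^sup>2 \<le> (2 * B)\<^sup>2" by (intro power_mono) auto
    then have h2: "H ?y * H ?y \<le> (2 * B)\<^sup>2 + 2 * a * H ?y - a\<^sup>2" by (simp add: power2_diff power2_eq_square algebra_simps)
    have "H ?y * H ?y = H ?y * (g ?y \<bullet> u + C * g ?y $ j)" using pt_euler[OF u C(1)] by simp
    then have "C * (H ?y * g ?y $ j) = H ?y * H ?y - H ?y * (g ?y \<bullet> u)" by (simp add: algebra_simps)
    then have "C * (H ?y * g ?y $ j) \<le> (2 * B\<^sup>2) * C + ((2 * B)\<^sup>2 + 2 * a * H ?y - a\<^sup>2)" using h1 h2 by linarith
    then have "H ?y * g ?y $ j \<le> ((2 * B\<^sup>2) * C + ((2 * B)\<^sup>2 + 2 * a * H ?y - a\<^sup>2)) / C" using C by (simp add: le_divide_eq mult.commute)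
    then show ?thesis using C by (simp add: add_divide_distrib)
   qed
   have "avg j (\<lambda>u. H (pt j C u) * g (pt j C u) $ j) \<le> avg j (\<lambda>u. 2 * B\<^sup>2 + ((2 * B)\<^sup>2 + 2 * a * H (pt j C u) - a\<^sup>2) / C)"
    by (rule avg_mono[OF N _ _ pw]) (use C in \<open>auto intro!: continuous_intros cH cd\<close>)
   also have "\<dots> = 2 * B\<^sup>2 + ((2 * B)\<^sup>2 + 2 * a * m C - a\<^sup>2) / C"
    using integrable_hmeas[OF N cH] integrable_hmeas[OF N continuous_on_const, of j] by (simp add: m_def measure_hmeas[OF N])
   finally have "avg j (\<lambda>u. H (pt j C u) * g (pt j C u) $ j) - q C \<le> 2 * B\<^sup>2 + ((2 * B)\<^sup>2 - (m C - a)\<^sup>2) / C"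
    unfolding q_def power2_diff using C by (simp add: field_simps)
   also have "\<dots> \<le> 2 * B\<^sup>2 + (2 * B)\<^sup>2 / C" using C by (intro add_left_mono divide_right_mono) auto
   also have "\<dots> \<le> 2 * B\<^sup>2 + (2 * B)\<^sup>2" using C by (simp add: divide_le_eq mult_le_cancel_left1)
   also have "\<dots> = 6 * B\<^sup>2" by (simp add: power2_eq_square)
   finally show ?thesis using wP_pos[of ?N C] unfolding s.vflux_def right_diff_distrib[symmetric] by (simp add: mult.commute)
  qed
  finally show ?thesis .
 qed
 then show ?thesis by (rule that)
qed

end

section \<open>Uniqueness\<close>

text \<open>\<open>pairing_self\<close> will be applied to H1 - s H2, which solves no equation of
  its own; all conditions of the locale on the function are linear.\<close>

lemma cap_ext_combine:
 assumes "cap_ext j \<theta> V1 H1 g1 A1" "cap_ext j \<theta> V2 H2 g2 A2"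
 shows "cap_ext j \<theta> (V1 \<inter> V2) (\<lambda>x. H1 x - s * H2 x) (\<lambda>x. g1 x - s *\<^sub>R g2 x) (\<lambda>x. A1 x - s *\<^sub>R A2 x)"
proof -
 interpret a: cap_ext j \<theta> V1 H1 g1 A1 by (rule assms)
 interpret b: cap_ext j \<theta> V2 H2 g2 A2 by (rule assms)
 have mv: "(M - s *\<^sub>R M') *v v = M *v v - s *\<^sub>R (M' *v v)" for M M' :: "real^'a^'a" and v
  by (simp add: matrix_vector_mult_diff_rdistrib scaleR_matrix_vector_assoc)
 show ?thesis
 proof
  show "0 < \<theta>" "\<theta> < pi" by (rule a.\<theta>)+
  show "open (V1 \<inter> V2)" "cone j \<theta> \<subseteq> V1 \<inter> V2" "0 \<notin> V1 \<inter> V2" using a.openV b.openV a.coneV b.coneV a.V0 by auto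
  show "continuous_on (V1 \<inter> V2) (\<lambda>x. A1 x - s *\<^sub>R A2 x)"
   by (intro continuous_intros continuous_on_subset[OF a.A] continuous_on_subset[OF b.A]) auto
  fix x assume x: "x \<in> V1 \<inter> V2"
  then have V: "x \<in> V1" "x \<in> V2" by auto
  show "((\<lambda>x. H1 x - s * H2 x) has_derivative (\<lambda>v. (g1 x - s *\<^sub>R g2 x) \<bullet> v)) (at x)"
   using has_derivative_diff[OF a.H[OF V(1)] has_derivative_mult_right[OF b.H[OF V(2)], of s]] by (simp add: inner_diff_left)
  show "((\<lambda>x. g1 x - s *\<^sub>R g2 x) has_derivative (\<lambda>v. (A1 x - s *\<^sub>R A2 x) *v v)) (at x)"
   using has_derivative_diff[OF a.g[OF V(1)] has_derivative_scaleR_right[OF b.g[OF V(2)], of s]] by (simp add: mv)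
  show "transpose (A1 x - s *\<^sub>R A2 x) = A1 x - s *\<^sub>R A2 x"
   using a.sym[OF V(1)] b.sym[OF V(2)] by (simp add: transpose_def vec_eq_iff)
  show "(g1 x - s *\<^sub>R g2 x) \<bullet> x = H1 x - s * H2 x" using a.euler(1)[OF V(1)] b.euler(1)[OF V(2)] by (simp add: inner_diff_left)
  show "(A1 x - s *\<^sub>R A2 x) *v x = 0" using a.euler(2)[OF V(1)] b.euler(2)[OF V(2)] by (simp add: mv)
  fix t :: real assume t: "0 < t"
  show "t *\<^sub>R x \<in> V1 \<inter> V2" using a.homV b.homV V t by simp
  show "H1 (t *\<^sub>R x) - s * H2 (t *\<^sub>R x) = t * (H1 x - s * H2 x)" using a.homH[OF V(1) t] b.homH[OF V(2) t] by (simp add: algebra_simps)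
  show "g1 (t *\<^sub>R x) - s *\<^sub>R g2 (t *\<^sub>R x) = g1 x - s *\<^sub>R g2 x" using a.homg[OF V(1) t] b.homg[OF V(2) t] by simp
  show "A1 (t *\<^sub>R x) - s *\<^sub>R A2 (t *\<^sub>R x) = (1 / t) *\<^sub>R (A1 x - s *\<^sub>R A2 x)"
   using a.homA[OF V(1) t] b.homA[OF V(2) t] by (simp add: scaleR_diff_right mult.commute)
 next
  fix x assume "x \<in> cone j \<theta>" "x $ j = cos \<theta> * norm x"
  then show "(g1 x - s *\<^sub>R g2 x) $ j = 0" using a.bdry b.bdry by simp
 qed
qed

lemma powr_monotone_product:
 fixes a b q :: real
 assumes "0 < a" "0 < b" "0 < q"
 shows "0 \<le> (a - b) * (a powr q - b powr q)" "(a - b) * (a powr q - b powr q) = 0 \<Longrightarrow> a = b"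
proof -
 consider "a < b" | "a = b" | "b < a" by linarith
 then have "0 \<le> (a - b) * (a powr q - b powr q) \<and> ((a - b) * (a powr q - b powr q) = 0 \<longrightarrow> a = b)"
 proof cases
  case 1
  then show ?thesis using powr_less_mono2[of q a b] assms by (simp add: mult_nonpos_nonpos)
 next
  case 3
  then show ?thesis using powr_less_mono2[of q b a] assms by simp
 qed simp
 then show "0 \<le> (a - b) * (a powr q - b powr q)" "(a - b) * (a powr q - b powr q) = 0 \<Longrightarrow> a = b" by auto
qed

text \<open>Reflecting the last coordinate replaces \<theta> by pi - \<theta> and the slope by its
  negative, so \<open>slice_angle\<close> yields the reverse inequality for points outside the open
  cone.\<close>

lemma interior_slice:
 assumes \<theta>: "0 < \<theta>" "\<theta> < pi" and x: "cos \<theta> * norm x < x $ j" and h: "hor j x \<noteq> 0"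
 shows "cot \<theta> < x $ j / norm (hor j x)"
proof (rule ccontr)
 let ?r = "norm (hor j x)" and ?c = "x $ j / norm (hor j x)"
 assume "\<not> cot \<theta> < ?c"
 then have "cot (pi - \<theta>) \<le> - ?c" by (simp add: cot_def)
 from slice_angle[OF _ _ this] have a: "?c \<le> cos \<theta> * sqrt (1 + ?c\<^sup>2)" using \<theta> by simp
 have xe: "x = ?r *\<^sub>R (pt j ?c (sgn (hor j x)))" using h by (simp add: scaleR_add_right sgn_div_norm hor_def)
 have "norm x = norm (?r *\<^sub>R (pt j ?c (sgn (hor j x))))" using xe by simp
 also have "\<dots> = ?r * sqrt (1 + ?c\<^sup>2)" unfolding norm_scaleR norm_slice[OF hsph_sgn[OF h]] by simp
 finally have "cos \<theta> * norm x = ?r * (cos \<theta> * sqrt (1 + ?c\<^sup>2))" by simp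
 moreover have "?r * ?c \<le> ?r * (cos \<theta> * sqrt (1 + ?c\<^sup>2))" by (intro mult_left_mono a) simp
 moreover have "?r * ?c = x $ j" using h by simp
 ultimately show False using x by linarith
qed

lemma (in cap_ext) trace_curvature:
 assumes e: "\<And>\<nu>. \<nu> \<in> cone j \<theta> \<Longrightarrow> norm \<nu> = 1 \<Longrightarrow> curvature_eq 1 p F H A \<nu>"
  and x: "x \<in> cone j \<theta>" and pos: "0 < H x"
 shows "trace (A x) = (1 / norm x) * F (sgn x) * (1 / norm x) powr (p - 1) * H x powr (p - 1)"
proof -
 have x0: "0 < norm x" using x by (simp add: cone_def)
 note s = sgn_cone[OF x]
 have sV: "sgn x \<in> V" using coneD[OF s(1)] by simp
 have xs: "norm x *\<^sub>R sgn x = x" using x0 by (simp add: sgn_div_norm)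
 obtain v lam where "eigframe (CARD('m) - 1) (sgn x) v lam (A (sgn x))" "esym {..<CARD('m) - 1} 1 lam = F (sgn x) * H (sgn x) powr (p - 1)"
  using e[OF s] by (auto simp: curvature_eq_def)
 then have t: "trace (A (sgn x)) = F (sgn x) * H (sgn x) powr (p - 1)" using trace_newton_self[of _ _ v lam "A (sgn x)" 1] by simp
 have "H (sgn x) = (1 / norm x) * H x" using homH[OF sV x0] xs x0 by simp
 then have "H (sgn x) powr (p - 1) = (1 / norm x) powr (p - 1) * H x powr (p - 1)"
  using powr_mult[of "1 / norm x" "H x" "p - 1"] x0 pos by simp
 moreover have "A x = (1 / norm x) *\<^sub>R A (sgn x)" using homA[OF sV x0] xs by simp
 ultimately show ?thesis by (simp add: trace_scaleR t)
qed

lemma cone_unique_1: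
 fixes j :: "'m::finite"
 assumes c1: "cap_ext j \<theta> V1 H1 g1 A1" and c2: "cap_ext j \<theta> V2 H2 g2 A2" and N: "3 \<le> CARD('m)"
  and F: "\<And>x. x \<in> cone j \<theta> \<Longrightarrow> 0 < F x"
  and pos: "\<And>x. x \<in> cone j \<theta> \<Longrightarrow> 0 < H1 x" "\<And>x. x \<in> cone j \<theta> \<Longrightarrow> 0 < H2 x"
  and p: "1 < p" "p < 2"
  and e1: "\<And>\<nu>. \<nu> \<in> cone j \<theta> \<Longrightarrow> norm \<nu> = 1 \<Longrightarrow> curvature_eq 1 p F H1 A1 \<nu>"
  and e2: "\<And>\<nu>. \<nu> \<in> cone j \<theta> \<Longrightarrow> norm \<nu> = 1 \<Longrightarrow> curvature_eq 1 p F H2 A2 \<nu>"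
  and x: "x \<in> cone j \<theta>"
 shows "H1 x = H2 x"
proof -
 interpret a: two_cap_ext j \<theta> V1 H1 g1 A1 V2 H2 g2 A2 by (rule cap_ext.swap_two[OF c1 c2])
 interpret b: two_cap_ext j \<theta> V2 H2 g2 A2 V1 H1 g1 A1 by (rule cap_ext.swap_two[OF c2 c1])
 interpret s1: two_cap_ext j \<theta> V1 H1 g1 A1 V1 H1 g1 A1 ..
 interpret s2: two_cap_ext j \<theta> V2 H2 g2 A2 V2 H2 g2 A2 ..
 let ?N = "CARD('m)" and ?c0 = "cot \<theta>"
 define q where "q = p - 1"
 have q: "0 < q" "q < 1" using p by (simp_all add: q_def)
 note \<theta> = a.one.\<theta>
 let ?T = "\<lambda>A c u. trace (A (pt j c u))"
 let ?w = "\<lambda>H A c. wO ?N c * avg j (\<lambda>u. H (pt j c u) * ?T A c u)"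
 let ?J = "\<lambda>H A. prim ?c0 (?w H A)"
 have K: "pt j c u \<in> cone j \<theta>" if "u \<in> hsph j" "?c0 \<le> c" for u c by (rule slice_cone[OF \<theta> that(2,1)])
 \<comment> \<open>For k = 1 the equation at every point of the cone reads tr A = \<phi> H^q with
   the same factor \<phi> for both solutions; \<phi> collects the powers of the norm.\<close>
 define \<phi> where "\<phi> y = (1 / norm y) * F (sgn y) * (1 / norm y) powr q" for y
 have \<phi>: "0 < \<phi> y" if "y \<in> cone j \<theta>" for y
 proof -
  have "0 < norm y" using that by (simp add: cone_def)
  then show ?thesis using F[OF sgn_cone(1)[OF that]] by (simp add: \<phi>_def)
 qed
 have T: "trace (A1 y) = \<phi> y * H1 y powr q" "trace (A2 y) = \<phi> y * H2 y powr q" if "y \<in> cone j \<theta>" for y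
  using a.one.trace_curvature[OF e1 that pos(1)[OF that]] a.two.trace_curvature[OF e2 that pos(2)[OF that]]
  unfolding \<phi>_def q_def by simp_all
 have Tpos: "0 < trace (A1 y)" "0 < trace (A2 y)" if "y \<in> cone j \<theta>" for y
  unfolding T[OF that] using \<phi>[OF that] pos(1)[OF that] pos(2)[OF that] by (auto intro: mult_pos_pos)
 have cw: "continuous_on {?c0..} (?w H1 A1)" "continuous_on {?c0..} (?w H1 A2)" "continuous_on {?c0..} (?w H2 A1)" "continuous_on {?c0..} (?w H2 A2)"
  by (rule s1.continuous_pairing[OF N] a.continuous_pairing[OF N] b.continuous_pairing[OF N] s2.continuous_pairing[OF N])+
 have ci: "continuous_on (hsph j) (\<lambda>u. H1 (pt j c u) * ?T A1 c u)" "continuous_on (hsph j) (\<lambda>u. H1 (pt j c u) * ?T A2 c u)"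
  "continuous_on (hsph j) (\<lambda>u. H2 (pt j c u) * ?T A1 c u)" "continuous_on (hsph j) (\<lambda>u. H2 (pt j c u) * ?T A2 c u)" if "?c0 \<le> c" for c
  by (rule param_slice[OF _ that]; intro continuous_intros a.one.cpt a.two.cpt)+
 obtain l where l: "l \<noteq> j" using obtain_third_index[OF N] by metis
 have ne: "axis l 1 \<in> hsph j" using l by (simp add: hsph_def axis_nth_if norm_axis_1)
 have avg_pos: "0 < avg j f" if f: "continuous_on (hsph j) f" "\<And>u. u \<in> hsph j \<Longrightarrow> 0 < f u" for f
 proof -
  have "0 \<le> avg j f" by (rule integral_nonneg_AE) (use f(2) in \<open>auto intro!: AE_I2 simp: space_hmeas less_imp_le\<close>)
  moreover have "avg j f \<noteq> 0" using hmeas_full_support[OF N f(1) less_imp_le[OF f(2)] _ ne] f(2)[OF ne] by auto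
  ultimately show ?thesis by simp
 qed
 have wpos: "0 < ?w H1 A1 c" "0 < ?w H1 A2 c" "0 < ?w H2 A1 c" "0 < ?w H2 A2 c" if c: "?c0 \<le> c" for c
  by (intro mult_pos_pos wO_pos avg_pos ci[OF c] pos Tpos K[OF _ c]; assumption)+
 have Jless: "prim ?c0 w s < prim ?c0 w t" if w: "continuous_on {?c0..} w" "\<And>c. ?c0 \<le> c \<Longrightarrow> 0 < w c" and st: "?c0 \<le> s" "s < t" for w s t
 proof (rule DERIV_pos_imp_increasing_open[OF st(2)])
  show "continuous_on {s..t} (prim ?c0 w)" by (rule continuous_on_subset[OF prim(2)[OF w(1), of t]]) (use st in auto)
  show "\<exists>y. DERIV (prim ?c0 w) x :> y \<and> 0 < y" if "s < x" for x using prim(3)[OF w(1), of x] w(2)[of x] that st by auto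
 qed
 \<comment> \<open>The limits along \<open>?X n\<close> serve as the four values of B; starting at
   \<open>max 1 (cot \<theta>)\<close> meets the requirement of \<open>pairing_self\<close>.\<close>
 let ?C = "max 1 ?c0"
 let ?X = "\<lambda>n. ?C + real n"
 have X: "?c0 \<le> ?X n" "?C \<le> ?X n" "?X n < ?X (Suc n)" for n by simp_all
 have lim: "\<exists>L>0. (\<lambda>n. prim ?c0 w (?X n)) \<longlonglongrightarrow> L" if w: "continuous_on {?c0..} w" "\<And>c. ?c0 \<le> c \<Longrightarrow> 0 < w c"
  and bd: "\<And>C. ?c0 \<le> C \<Longrightarrow> prim ?c0 w C \<le> M" for w M
 proof -
  have inc: "incseq (\<lambda>n. prim ?c0 w (?X n))" by (rule incseq_SucI) (rule less_imp_le[OF Jless[OF w(1,2) X(1) X(3)]])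
  obtain L where L: "(\<lambda>n. prim ?c0 w (?X n)) \<longlonglongrightarrow> L" "\<And>i. prim ?c0 w (?X i) \<le> L"
   using incseq_convergent[OF inc, of M] bd[OF X(1)] by blast
  have "0 \<le> prim ?c0 w (?X 0)"
   using Jless[OF w order_refl, of "?X 0"] prim(1)[OF w(1)] by (cases "?c0 = ?X 0") (auto simp: less_imp_le)
  also have "\<dots> < prim ?c0 w (?X (Suc 0))" by (rule Jless[OF w(1,2) X(1) X(3)])
  also have "\<dots> \<le> L" by (rule L(2))
  finally show ?thesis using L(1) by blast
 qed
 obtain M11 where "\<And>C. ?c0 \<le> C \<Longrightarrow> ?J H1 A1 C \<le> M11" using s1.pairing_bound[OF N] by blast
 from lim[OF cw(1) wpos(1) this] obtain l11 where l11: "0 < l11" "(\<lambda>n. ?J H1 A1 (?X n)) \<longlonglongrightarrow> l11" by blast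
 obtain M12 where "\<And>C. ?c0 \<le> C \<Longrightarrow> ?J H1 A2 C \<le> M12" using a.pairing_bound[OF N] by blast
 from lim[OF cw(2) wpos(2) this] obtain l12 where l12: "0 < l12" "(\<lambda>n. ?J H1 A2 (?X n)) \<longlonglongrightarrow> l12" by blast
 obtain M21 where "\<And>C. ?c0 \<le> C \<Longrightarrow> ?J H2 A1 C \<le> M21" using b.pairing_bound[OF N] by blast
 from lim[OF cw(3) wpos(3) this] obtain l21 where l21: "0 < l21" "(\<lambda>n. ?J H2 A1 (?X n)) \<longlonglongrightarrow> l21" by blast
 obtain M22 where "\<And>C. ?c0 \<le> C \<Longrightarrow> ?J H2 A2 C \<le> M22" using s2.pairing_bound[OF N] by blast
 from lim[OF cw(4) wpos(4) this] obtain l22 where l22: "0 < l22" "(\<lambda>n. ?J H2 A2 (?X n)) \<longlonglongrightarrow> l22" by blast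
 have wP0: "(\<lambda>n. k * wP ?N (?X n)) \<longlonglongrightarrow> 0" for k using tendsto_mult[OF tendsto_const[of k] wP_tendsto[OF N, of ?C]] by simp
 have sym: "l21 = l12"
 proof -
  obtain k where k: "\<And>C. ?c0 \<le> C \<Longrightarrow> \<bar>?J H1 A2 C - ?J H2 A1 C\<bar> \<le> k * wP ?N C"
   using pairing_asym[OF a.two_cap_ext_axioms N] by blast
  have "(\<lambda>n. ?J H1 A2 (?X n) - ?J H2 A1 (?X n)) \<longlonglongrightarrow> 0" by (rule Lim_null_comparison[OF _ wP0[of k]]) (use k[OF X(1)] in simp)
  moreover have "(\<lambda>n. ?J H1 A2 (?X n) - ?J H2 A1 (?X n)) \<longlonglongrightarrow> l12 - l21" by (intro tendsto_diff l12 l21)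
  ultimately show ?thesis using LIMSEQ_unique by fastforce
 qed
 have lin: "prim ?c0 (\<lambda>c. k1 * ?w H1 A1 c + k2 * ?w H1 A2 c + k3 * ?w H2 A1 c + k4 * ?w H2 A2 c) C
   = k1 * ?J H1 A1 C + k2 * ?J H1 A2 C + k3 * ?J H2 A1 C + k4 * ?J H2 A2 C" if C: "?c0 \<le> C" for k1 k2 k3 k4 C
 proof -
  have "prim ?c0 (\<lambda>c. k1 * ?w H1 A1 c + k2 * ?w H1 A2 c + k3 * ?w H2 A1 c + k4 * ?w H2 A2 c) C
   = (\<lambda>C. k1 * ?J H1 A1 C + k2 * ?J H1 A2 C + k3 * ?J H2 A1 C + k4 * ?J H2 A2 C) C
   - (\<lambda>C. k1 * ?J H1 A1 C + k2 * ?J H1 A2 C + k3 * ?J H2 A1 C + k4 * ?J H2 A2 C) ?c0"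
   by (rule prim_eqI[OF _ C]) (intro continuous_on_add continuous_on_mult continuous_on_const cw prim(2) DERIV_add DERIV_cmult prim(3); assumption)+
  then show ?thesis using prim(1)[OF cw(1)] prim(1)[OF cw(2)] prim(1)[OF cw(3)] prim(1)[OF cw(4)] by simp
 qed
 have expand: "?w (\<lambda>x. H1 x - r * H2 x) (\<lambda>x. A1 x - t *\<^sub>R A2 x) c = 1 * ?w H1 A1 c + (- t) * ?w H1 A2 c + (- r) * ?w H2 A1 c + (r * t) * ?w H2 A2 c"
  if c: "?c0 \<le> c" for r t c
 proof -
  note i = integrable_hmeas[OF N ci(1)[OF c]] integrable_hmeas[OF N ci(2)[OF c]] integrable_hmeas[OF N ci(3)[OF c]] integrable_hmeas[OF N ci(4)[OF c]]
  have "(H1 (pt j c u) - r * H2 (pt j c u)) * trace (A1 (pt j c u) - t *\<^sub>R A2 (pt j c u)) =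
    H1 (pt j c u) * ?T A1 c u - t * (H1 (pt j c u) * ?T A2 c u) - r * (H2 (pt j c u) * ?T A1 c u) + r * t * (H2 (pt j c u) * ?T A2 c u)" for u
   by (simp add: trace_sub trace_scaleR algebra_simps)
  then have eq: "avg j (\<lambda>u. (H1 (pt j c u) - r * H2 (pt j c u)) * trace (A1 (pt j c u) - t *\<^sub>R A2 (pt j c u))) =
    avg j (\<lambda>u. H1 (pt j c u) * ?T A1 c u) - t * avg j (\<lambda>u. H1 (pt j c u) * ?T A2 c u)
    - r * avg j (\<lambda>u. H2 (pt j c u) * ?T A1 c u) + r * t * avg j (\<lambda>u. H2 (pt j c u) * ?T A2 c u)" using i by simp
  show ?thesis unfolding eq by (simp add: algebra_simps)
 qed
 have prim_cong: "prim ?c0 v C = prim ?c0 w C" if "\<And>c. ?c0 \<le> c \<Longrightarrow> v c = w c" for v w C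
  unfolding prim_def by (rule integral_cong) (use that in auto)
 have pexp: "?J (\<lambda>x. H1 x - r * H2 x) (\<lambda>x. A1 x - t *\<^sub>R A2 x) C
   = 1 * ?J H1 A1 C + (- t) * ?J H1 A2 C + (- r) * ?J H2 A1 C + (r * t) * ?J H2 A2 C" if C: "?c0 \<le> C" for r t C
  unfolding lin[OF C, symmetric] by (rule prim_cong) (rule expand)
 obtain s where s: "0 < s" "l11 - 2 * s * l12 + s\<^sup>2 * l22 \<le> 0"
 proof -
  let ?cs = "max ?c0 0"
  have cH: "continuous_on (hsph j) (\<lambda>u. H1 (pt j ?cs u))" "continuous_on (hsph j) (\<lambda>u. H2 (pt j ?cs u))"
   by (rule param_slice[where a = ?c0]; (intro a.one.cpt a.two.cpt)?; simp)+
  have m: "0 < avg j (\<lambda>u. H1 (pt j ?cs u))" "0 < avg j (\<lambda>u. H2 (pt j ?cs u))" by (intro avg_pos cH pos K; simp)+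
  \<comment> \<open>This quotient makes the horizontal mean of \<open>H1 - s * H2\<close> vanish at
    slope \<open>max (cot \<theta>) 0\<close>, as \<open>pairing_self\<close> demands.\<close>
  define s where "s = avg j (\<lambda>u. H1 (pt j ?cs u)) / avg j (\<lambda>u. H2 (pt j ?cs u))"
  have s: "0 < s" using m by (simp add: s_def)
  interpret h: cap_ext j \<theta> "V1 \<inter> V2" "\<lambda>x. H1 x - s * H2 x" "\<lambda>x. g1 x - s *\<^sub>R g2 x" "\<lambda>x. A1 x - s *\<^sub>R A2 x"
   by (rule cap_ext_combine[OF c1 c2])
  have "avg j (\<lambda>u. H1 (pt j ?cs u) - s * H2 (pt j ?cs u)) = 0"
   using integrable_hmeas[OF N cH(1)] integrable_hmeas[OF N cH(2)] m by (simp add: s_def)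
  from h.pairing_self[OF N this] obtain k where k: "\<And>C. ?C \<le> C \<Longrightarrow> ?J (\<lambda>x. H1 x - s * H2 x) (\<lambda>x. A1 x - s *\<^sub>R A2 x) C \<le> k * wP ?N C" by blast
  have "1 * ?J H1 A1 (?X n) + (- s) * ?J H1 A2 (?X n) + (- s) * ?J H2 A1 (?X n) + (s * s) * ?J H2 A2 (?X n) \<le> k * wP ?N (?X n)" for n
   using k[OF X(2)[of n]] unfolding pexp[OF X(1)] .
  moreover have "(\<lambda>n. 1 * ?J H1 A1 (?X n) + (- s) * ?J H1 A2 (?X n) + (- s) * ?J H2 A1 (?X n) + (s * s) * ?J H2 A2 (?X n))
    \<longlonglongrightarrow> 1 * l11 + (- s) * l12 + (- s) * l21 + (s * s) * l22" by (intro tendsto_intros l11 l12 l21 l22)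
  ultimately have "1 * l11 + (- s) * l12 + (- s) * l21 + (s * s) * l22 \<le> 0" using LIMSEQ_le[OF _ wP0[of k]] by blast
  then show ?thesis using that[OF s] by (simp add: sym power2_eq_square algebra_simps)
 qed
 define \<alpha> \<beta> where "\<alpha> = sqrt l11" and "\<beta> = sqrt l22"
 have ab: "0 < \<alpha>" "0 < \<beta>" "l11 = \<alpha> * \<alpha>" "l22 = \<beta> * \<beta>" using l11 l22 by (simp_all add: \<alpha>_def \<beta>_def)
 \<comment> \<open>A single s > 0 with B(H1 - s H2, H1 - s H2) \<le> 0 suffices: the
   arithmetic-geometric mean inequality converts it into the reversed Cauchy-Schwarz
   inequality.\<close>
 have lor: "\<alpha> * \<beta> \<le> l12"
 proof -
  have "0 \<le> (\<alpha> - s * \<beta>)\<^sup>2" by simp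
  then have "2 * s * (\<alpha> * \<beta>) \<le> l11 + s\<^sup>2 * l22" unfolding ab(3,4) power2_diff by (simp add: power2_eq_square mult_ac)
  then have "(2 * s) * (\<alpha> * \<beta>) \<le> (2 * s) * l12" using s(2) by linarith
  then show ?thesis using s(1) by (simp add: mult_le_cancel_left)
 qed
 define \<rho> where "\<rho> = \<alpha> / \<beta>"
 \<comment> \<open>Substituting \<rho> H2 into the right side of the equation gives \<phi> (\<rho>
   H2)^q = \<tau> tr A2. Pairing with \<open>A1 - \<tau> *\<^sub>R A2\<close>, and not with \<rho>
   in place of \<tau>, therefore produces a monotone product.\<close>
 define \<tau> where "\<tau> = \<rho> powr q"
 have \<rho>: "0 < \<rho>" "0 < \<tau>" "\<alpha> = \<rho> * \<beta>" using ab by (simp_all add: \<rho>_def \<tau>_def)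
 let ?e = "\<lambda>c u. (H1 (pt j c u) - \<rho> * H2 (pt j c u)) * trace (A1 (pt j c u) - \<tau> *\<^sub>R A2 (pt j c u))"
 let ?we = "?w (\<lambda>x. H1 x - \<rho> * H2 x) (\<lambda>x. A1 x - \<tau> *\<^sub>R A2 x)"
 have e: "?e c u = \<phi> (pt j c u) * ((H1 (pt j c u) - \<rho> * H2 (pt j c u)) * (H1 (pt j c u) powr q - (\<rho> * H2 (pt j c u)) powr q))"
  if "u \<in> hsph j" "?c0 \<le> c" for c u
  using T[OF K[OF that]] pos(2)[OF K[OF that]] \<rho> by (simp add: trace_sub trace_scaleR powr_mult \<tau>_def less_imp_le algebra_simps)
 have e0: "0 \<le> ?e c u" "?e c u = 0 \<Longrightarrow> H1 (pt j c u) = \<rho> * H2 (pt j c u)" if uc: "u \<in> hsph j" "?c0 \<le> c" for c u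
  using powr_monotone_product[of "H1 (pt j c u)" "\<rho> * H2 (pt j c u)" q] pos(1)[OF K[OF uc]] pos(2)[OF K[OF uc]] \<rho>(1) q \<phi>[OF K[OF uc]]
  unfolding e[OF uc] by (auto simp: zero_le_mult_iff)
 have cwe: "continuous_on {?c0..} ?we"
  by (rule continuous_on_eq[where f = "\<lambda>c. 1 * ?w H1 A1 c + (- \<tau>) * ?w H1 A2 c + (- \<rho>) * ?w H2 A1 c + (\<rho> * \<tau>) * ?w H2 A2 c"])
    (intro continuous_on_add continuous_on_mult continuous_on_const cw, use expand in simp)
 have we0: "0 \<le> ?we c" if "?c0 \<le> c" for c
  by (intro mult_nonneg_nonneg less_imp_le[OF wO_pos] integral_nonneg_AE AE_I2 e0(1)[OF _ that]) (simp add: space_hmeas)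
 have Je_mono: "prim ?c0 ?we s \<le> prim ?c0 ?we t" if "?c0 \<le> s" "s \<le> t" for s t
 proof (rule DERIV_nonneg_except[OF that(2), where z = s])
  show "continuous_on {s..t} (prim ?c0 ?we)" by (rule continuous_on_subset[OF prim(2)[OF cwe, of t]]) (use that in auto)
  show "\<exists>y\<ge>0. DERIV (prim ?c0 ?we) c :> y" if "s < c" for c using prim(3)[OF cwe, of c] we0[of c] that \<open>?c0 \<le> s\<close> by auto
 qed
 have Je_lim: "prim ?c0 ?we (?X n) \<le> 0" for n
 proof -
  have eq: "prim ?c0 ?we (?X n) = 1 * ?J H1 A1 (?X n) + (- \<tau>) * ?J H1 A2 (?X n) + (- \<rho>) * ?J H2 A1 (?X n) + (\<rho> * \<tau>) * ?J H2 A2 (?X n)" for n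
   by (rule pexp[OF X(1)])
  have "(\<lambda>n. prim ?c0 ?we (?X n)) \<longlonglongrightarrow> 1 * l11 + (- \<tau>) * l12 + (- \<rho>) * l21 + (\<rho> * \<tau>) * l22"
   unfolding eq by (intro tendsto_intros l11 l12 l21 l22)
  moreover have "incseq (\<lambda>n. prim ?c0 ?we (?X n))" by (intro incseq_SucI Je_mono X less_imp_le)
  ultimately have "prim ?c0 ?we (?X n) \<le> 1 * l11 + (- \<tau>) * l12 + (- \<rho>) * l21 + (\<rho> * \<tau>) * l22" by (rule incseq_le[rotated])
  also have "\<dots> = l11 - (\<tau> + \<rho>) * l12 + \<rho> * \<tau> * l22" by (simp add: sym algebra_simps)
  also have "\<dots> \<le> l11 - (\<tau> + \<rho>) * (\<alpha> * \<beta>) + \<rho> * \<tau> * l22" using mult_left_mono[OF lor, of "\<tau> + \<rho>"] \<rho> by simp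
  \<comment> \<open>The expression factors as (\<alpha> - \<rho> \<beta>) (\<alpha> - \<tau>
    \<beta>), and \<rho> is \<alpha> / \<beta>.\<close>
  also have "\<dots> = 0" unfolding ab(3,4) \<rho>(3) by (simp add: algebra_simps)
  finally show ?thesis .
 qed
 \<comment> \<open>The primitive starts at 0, is nondecreasing and never exceeds 0, so it is
   constant; its derivative, a nonnegative weighted average, must then vanish.\<close>
 have Je0: "prim ?c0 ?we C = 0" if C: "?c0 \<le> C" for C
 proof -
  obtain n where "C \<le> real n" using real_arch_simple by blast
  then have "C \<le> ?X n" by simp
  then have "prim ?c0 ?we C \<le> 0" using Je_mono[OF C] Je_lim[of n] order_trans by blast
  moreover have "prim ?c0 ?we ?c0 \<le> prim ?c0 ?we C" by (rule Je_mono[OF order_refl C])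
  ultimately show ?thesis by (simp add: prim(1)[OF cwe])
 qed
 have H12: "H1 (pt j c u) = \<rho> * H2 (pt j c u)" if c: "?c0 < c" and u: "u \<in> hsph j" for c u
 proof -
  have c': "?c0 \<le> c" using c by simp
  have "?we c = 0"
  proof (rule DERIV_local_const[OF prim(3)[OF cwe c]])
   show "0 < c - ?c0" using c by simp
   show "\<forall>y. \<bar>c - y\<bar> < c - ?c0 \<longrightarrow> prim ?c0 ?we c = prim ?c0 ?we y" using Je0 c by (auto simp: abs_less_iff)
  qed
  then have z: "avg j (?e c) = 0" using wO_pos[of ?N c] by simp
  have ce: "continuous_on (hsph j) (?e c)"
   unfolding trace_sub trace_scaleR by (rule param_slice[OF _ c']) (intro continuous_intros a.one.cpt a.two.cpt)
  show ?thesis by (rule e0(2)[OF u c' hmeas_full_support[OF N ce e0(1)[OF _ c'] z u]])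
 qed
 \<comment> \<open>Since H1 = \<rho> H2 at every slope above cot \<theta>, the limit of the pairing
   is \<rho> B(H2, H2) in one order of the arguments and \<tau> B(H2, H2) in the other.\<close>
 have "\<rho> = \<tau>"
 proof -
  have w12: "?w H1 A2 c = \<rho> * ?w H2 A2 c" "?w H2 A1 c = \<tau> * ?w H2 A2 c" if c: "?c0 < c" for c
  proof -
   have c': "?c0 \<le> c" using c by simp
   have "avg j (\<lambda>u. H1 (pt j c u) * ?T A2 c u) = avg j (\<lambda>u. \<rho> * (H2 (pt j c u) * ?T A2 c u))"
    by (rule Bochner_Integration.integral_cong[OF refl]) (simp add: space_hmeas H12[OF c])
   then show "?w H1 A2 c = \<rho> * ?w H2 A2 c" by simp
   have "avg j (\<lambda>u. H2 (pt j c u) * ?T A1 c u) = avg j (\<lambda>u. \<tau> * (H2 (pt j c u) * ?T A2 c u))"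
   proof (rule Bochner_Integration.integral_cong[OF refl])
    fix u assume "u \<in> space (hmeas j)"
    then have u: "u \<in> hsph j" by (simp add: space_hmeas)
    show "H2 (pt j c u) * ?T A1 c u = \<tau> * (H2 (pt j c u) * ?T A2 c u)"
     using T[OF K[OF u c']] H12[OF c u] pos(2)[OF K[OF u c']] \<rho>(1) by (simp add: powr_mult \<tau>_def less_imp_le)
   qed
   then show "?w H2 A1 c = \<tau> * ?w H2 A2 c" by simp
  qed
  have "?J H1 A2 (?X n) = \<rho> * ?J H2 A2 (?X n) - \<rho> * ?J H2 A2 ?c0" "?J H2 A1 (?X n) = \<tau> * ?J H2 A2 (?X n) - \<tau> * ?J H2 A2 ?c0" for n
   by (rule prim_eqI[OF cw(2) X(1)] prim_eqI[OF cw(3) X(1)], intro continuous_intros prim(2)[OF cw(4)],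
     subst w12, assumption, intro DERIV_cmult prim(3)[OF cw(4)], assumption)+
  then have J: "?J H1 A2 (?X n) = \<rho> * ?J H2 A2 (?X n)" "?J H2 A1 (?X n) = \<tau> * ?J H2 A2 (?X n)" for n by (simp_all add: prim(1)[OF cw(4)])
  have "l12 = \<rho> * l22" using LIMSEQ_unique[OF l12(2)[unfolded J] tendsto_mult[OF tendsto_const l22(2)]] .
  moreover have "l21 = \<tau> * l22" using LIMSEQ_unique[OF l21(2)[unfolded J] tendsto_mult[OF tendsto_const l22(2)]] .
  ultimately show ?thesis using sym l22(1) by simp
 qed
 then have "ln \<rho> = q * ln \<rho>" using \<rho>(1) by (metis \<tau>_def ln_powr)
 then have "(1 - q) * ln \<rho> = 0" by (simp add: algebra_simps)
 then have r1: "\<rho> = 1" using q \<rho>(1) by simp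
 \<comment> \<open>Slopes only reach points off the vertical axis; the axis is a null set, and
   equality on it is recovered by continuity below.\<close>
 have hz: "H1 y = H2 y" if y: "cos \<theta> * norm y < y $ j" "hor j y \<noteq> 0" for y
 proof -
  let ?u = "sgn (hor j y)" and ?r = "norm (hor j y)" and ?z = "y $ j / norm (hor j y)"
  have c: "?c0 < ?z" by (rule interior_slice[OF \<theta> y])
  have ye: "?r *\<^sub>R (pt j ?z ?u) = y" using y(2) by (simp add: scaleR_add_right sgn_div_norm hor_def)
  have z: "pt j ?z ?u \<in> cone j \<theta>" by (rule K[OF hsph_sgn[OF y(2)] less_imp_le[OF c]])
  have "0 < ?r" using y(2) by simp
  then show ?thesis using a.one.homH[of "pt j ?z ?u" ?r] a.two.homH[of "pt j ?z ?u" ?r] a.one.coneD[OF z] a.two.coneD[OF z]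
    H12[OF c hsph_sgn[OF y(2)]] r1 unfolding ye by simp
 qed
 show ?thesis
 proof (rule cone_eqI[OF c1 c2 _ x])
  fix y :: "real^'m" assume y: "cos \<theta> * norm y < y $ j"
  let ?I = "{y::real^'m. cos \<theta> * norm y < y $ j}"
  have I: "open ?I" by (intro open_Collect_less continuous_intros)
  have IK: "?I \<subseteq> cone j \<theta>" by (auto simp: cone_def)
  have "continuous_on ?I (\<lambda>y. H1 y - H2 y)"
   by (intro continuous_intros continuous_on_subset[OF a.one.contH] continuous_on_subset[OF a.two.contH] subset_trans[OF IK] a.one.coneV a.two.coneV)
  moreover have "AE y in lborel. y \<in> ?I \<longrightarrow> H1 y - H2 y = 0" using AE_hor[OF N, of j] by eventually_elim (use hz in auto)
  ultimately have "H1 y - H2 y = 0" using AE_zero_continuous[OF I] y by blast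
  then show "H1 y = H2 y" by simp
 qed
qed

lemma smooth_set_continuous:
 assumes "smooth_set S f"
 shows "continuous_on S f"
proof -
 obtain U where U: "S \<subseteq> U" "smooth_on U f" using assms by (auto simp: smooth_set_def)
 have "Ck_on 0 U f" using U(2) unfolding smooth_on_def by blast
 then show ?thesis using U(1) continuous_on_subset by auto
qed

text \<open>\<open>admissible\<close> and \<open>solves\<close> provide their eigenvalue lists
  independently. Both lists compute the same \<open>msig\<close> of the Hessian, so one list
  satisfies the cone condition and the equation together.\<close>

lemma curvature_eq_of_solution:
 fixes h :: "real^'m \<Rightarrow> real"
 assumes ext: "cap_ext j \<theta> V (\<lambda>x. norm x * h (sgn x + cap_center j \<theta>)) g A"
  and W: "\<And>\<xi> X. \<xi> \<in> cap j \<theta> \<Longrightarrow> X \<bullet> sph_normal j \<theta> \<xi> = 0 \<Longrightarrow> W_quad j \<theta> h \<xi> X = X \<bullet> (A (sph_normal j \<theta> \<xi>) *v X)"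
  and adm: "admissible k j \<theta> h" and sol: "solves k p j \<theta> f h"
  and \<nu>: "\<nu> \<in> cone j \<theta>" "norm \<nu> = 1"
 shows "curvature_eq k p (\<lambda>x. f (sgn x + cap_center j \<theta>)) (\<lambda>x. norm x * h (sgn x + cap_center j \<theta>)) A \<nu>"
proof -
 interpret cap_ext j \<theta> V "\<lambda>x. norm x * h (sgn x + cap_center j \<theta>)" g A by (rule ext)
 let ?\<xi> = "\<nu> + cap_center j \<theta>"
 have s: "sgn \<nu> = \<nu>" using \<nu>(2) by (simp add: sgn_div_norm)
 have \<xi>: "?\<xi> \<in> cap j \<theta>" using cone_cap[OF \<nu>(1)] by (simp add: s)
 have n: "sph_normal j \<theta> ?\<xi> = \<nu>" by (simp add: sph_normal_def)
 have T: "tangent_space j \<theta> ?\<xi> = {X. X \<bullet> \<nu> = 0}" by (simp add: tangent_space_def n)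
 have \<nu>V: "\<nu> \<in> V" using coneD[OF \<nu>(1)] by simp
 obtain lam where lam: "eigenvalues_of (CARD('m) - 1) {X. X \<bullet> \<nu> = 0} (W_quad j \<theta> h ?\<xi>) lam" "lam \<in> Gamma (CARD('m) - 1) k"
  using adm \<xi> unfolding admissible_def T[symmetric] by blast
 obtain mu where mu: "eigenvalues_of (CARD('m) - 1) {X. X \<bullet> \<nu> = 0} (W_quad j \<theta> h ?\<xi>) mu" "sigma (CARD('m) - 1) k mu = f ?\<xi> * h ?\<xi> powr (p - 1)"
  using sol \<xi> unfolding solves_def T[symmetric] by blast
 have Q: "W_quad j \<theta> h ?\<xi> X = X \<bullet> (A \<nu> *v X)" if "X \<bullet> \<nu> = 0" for X using W[OF \<xi>, of X] that by (simp add: n)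
 obtain v where v: "eigframe (CARD('m) - 1) \<nu> v lam (A \<nu>)"
  using eigenvalues_of_eigframe[OF lam(1) \<nu>(2) sym[OF \<nu>V] euler(2)[OF \<nu>V] Q] by blast
 obtain u where u: "eigframe (CARD('m) - 1) \<nu> u mu (A \<nu>)"
  using eigenvalues_of_eigframe[OF mu(1) \<nu>(2) sym[OF \<nu>V] euler(2)[OF \<nu>V] Q] by blast
 have "esym {..<CARD('m) - 1} k lam = f ?\<xi> * h ?\<xi> powr (p - 1)"
  using eigframe_esym_unique[OF v u, of k] mu(2) by (simp add: sigma_eq_esym)
 then show ?thesis using v lam(2) unfolding curvature_eq_def by (auto simp: s \<nu>(2) Gamma_eq_gam)
qed

theorem theorem5p4:
  fixes j :: "'m::finite" and \<theta> p :: real and k :: nat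
    and f h1 h2 :: "real^'m \<Rightarrow> real"
  defines "n \<equiv> CARD('m) - 1"
  assumes "n \<ge> 2" and "1 \<le> k" and "k \<le> n"
    and "0 < \<theta>" and "\<theta> < pi"
    and "1 < p" and "p < real k + 1"
    and "smooth_set (cap j \<theta>) f" and "\<forall>\<xi>\<in>cap j \<theta>. f \<xi> > 0"
    and "\<forall>\<xi>\<in>cap j \<theta>. h1 \<xi> > 0" and "admissible k j \<theta> h1" and "solves k p j \<theta> f h1"
    and "\<forall>\<xi>\<in>cap j \<theta>. h2 \<xi> > 0" and "admissible k j \<theta> h2" and "solves k p j \<theta> f h2"
  shows "\<forall>\<xi>\<in>cap j \<theta>. h1 \<xi> = h2 \<xi>"
proof
 fix \<xi> assume \<xi>: "\<xi> \<in> cap j \<theta>"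
 note \<theta> = assms(5,6)
 have N: "3 \<le> CARD('m)" using assms(2) unfolding n_def by simp
 have C: "Ck_set 2 (cap j \<theta>) h1" "Ck_set 2 (cap j \<theta>) h2"
  and R: "\<forall>\<xi>\<in>cap_boundary j \<theta>. frechet_derivative h1 (at \<xi>) (conormal j \<theta> \<xi>) = cot \<theta> * h1 \<xi>"
   "\<forall>\<xi>\<in>cap_boundary j \<theta>. frechet_derivative h2 (at \<xi>) (conormal j \<theta> \<xi>) = cot \<theta> * h2 \<xi>"
  using assms(12,13,15,16) by (simp_all add: admissible_def solves_def)
 let ?e = "\<lambda>x. sgn x + cap_center j \<theta>"
 let ?H = "\<lambda>h x. norm x * h (?e x)" and ?F = "\<lambda>x. f (?e x)"
 obtain V1 g1 A1 where 1: "cap_ext j \<theta> V1 (?H h1) g1 A1"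
  "\<And>\<xi> X. \<xi> \<in> cap j \<theta> \<Longrightarrow> X \<bullet> sph_normal j \<theta> \<xi> = 0 \<Longrightarrow> W_quad j \<theta> h1 \<xi> X = X \<bullet> (A1 (sph_normal j \<theta> \<xi>) *v X)"
  using cap_ext_exists[OF \<theta> C(1) R(1)] by blast
 obtain V2 g2 A2 where 2: "cap_ext j \<theta> V2 (?H h2) g2 A2"
  "\<And>\<xi> X. \<xi> \<in> cap j \<theta> \<Longrightarrow> X \<bullet> sph_normal j \<theta> \<xi> = 0 \<Longrightarrow> W_quad j \<theta> h2 \<xi> X = X \<bullet> (A2 (sph_normal j \<theta> \<xi>) *v X)"
  using cap_ext_exists[OF \<theta> C(2) R(2)] by blast
 have F: "0 < ?F x" and pos: "0 < ?H h1 x" "0 < ?H h2 x" if "x \<in> cone j \<theta>" for x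
  using cone_cap[OF that] assms(10,11,14) that by (auto simp: cone_def)
 have cF: "continuous_on (cone j \<theta>) ?F"
 proof (rule continuous_on_compose2[OF smooth_set_continuous[OF assms(9)]])
  show "continuous_on (cone j \<theta>) ?e" by (intro continuous_intros) (simp add: cone_def)
 qed (use cone_cap in blast)
 have e: "curvature_eq k p ?F (?H h1) A1 \<nu>" "curvature_eq k p ?F (?H h2) A2 \<nu>" if "\<nu> \<in> cone j \<theta>" "norm \<nu> = 1" for \<nu>
  using curvature_eq_of_solution[OF 1 assms(12,13) that] curvature_eq_of_solution[OF 2 assms(15,16) that] by simp_all
 have eq: "?H h1 x = ?H h2 x" if x: "x \<in> cone j \<theta>" for x
 proof (cases "k = 1")
  case True
  have "p < 2" using assms(8) unfolding True by simp
  then show ?thesis by (intro cone_unique_1[OF 1(1) 2(1) N F pos assms(7) _ e[unfolded True] x])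
 next
  case False
  then have "2 \<le> k" using assms(3) by simp
  then show ?thesis by (intro cone_unique_ge_2[OF 1(1) 2(1) cF F pos _ assms(7,8) e x])
 qed
 show "h1 \<xi> = h2 \<xi>"
  using eq[OF cap_normal(2)[OF \<xi>]] by (simp add: cap_normal(1,3)[OF \<xi>]) (simp add: sph_normal_def)
qed

end
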